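(* Let $q=p^m$ with $p$ prime and $m\geq 1$, let $n$ be a nonnegative integer, and let $K$ be a field of characteristic different from $p$. Then for any pair $V,W$ of $KM_n(\mathbb F_q)$-modules, inflated to $K\mathrm{Aff}(n,q)$-modules via the projection $\mathrm{Aff}(n,q)\to M_n(\mathbb F_q)$, we have $\mathrm{Ext}^i_{K\mathrm{Aff}(n,q)}(V,W)\cong \mathrm{Ext}^i_{KM_n(\mathbb F_q)}(V,W)$ for all $i\ge 0$. In particular, if the characteristic of $K$ does not divide $|\mathrm{GL}_n(\mathbb F_q)|$, then $\mathrm{Ext}^i_{K\mathrm{Aff}(n,q)}(V,W)=0$ for all $i\geq 1$.
   Context: $\mathrm{Aff}(n,q)$ is the monoid, under composition, of all affine transformations $x\mapsto Ax+b$ of $\mathbb F_q^n$ with $A\in M_n(\mathbb F_q)$ and $b\in\mathbb F_q^n$; the projection to $M_n(\mathbb F_q)$ (a monoid under multiplication) sends $x\mapsto Ax+b$ to $A$. For a monoid $M$, $KM$ denotes the monoid algebra (so $KM_n(\mathbb F_q)$ is the monoid algebra of the multiplicative monoid of $n\times n$ matrices). *)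

theory Defs
  imports
    "Jordan_Normal_Form.VS_Connect"
    "HOL-Algebra.AbelCoset"
    "HOL-Library.Cardinality"
begin

hide_const (open) Modules.module_hom

section \<open>Left modules over a possibly noncommutative ring\<close>

text \<open>The locale \<^locale>\<open>module\<close> of \<^theory>\<open>HOL-Algebra.Module\<close> requires a commutative ring of
  scalars; its record type is reused here. The fields for multiplication and unit of a module
  record are irrelevant throughout. Homomorphisms are the library's
  \<^const>\<open>LinearCombinations.module_hom\<close>, whose definition makes sense over any ring.\<close>

locale left_module = R?: ring R + M?: abelian_group M
    for R :: "('r, 'q) ring_scheme" (structure) and M :: "('r, 'a) module" (structure) +
  assumes smult_closed [simp, intro]:
      "\<lbrakk> a \<in> carrier R; x \<in> carrier M \<rbrakk> \<Longrightarrow> a \<odot>\<^bsub>M\<^esub> x \<in> carrier M"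
    and smult_l_distr:
      "\<lbrakk> a \<in> carrier R; b \<in> carrier R; x \<in> carrier M \<rbrakk> \<Longrightarrow>
        (a \<oplus> b) \<odot>\<^bsub>M\<^esub> x = a \<odot>\<^bsub>M\<^esub> x \<oplus>\<^bsub>M\<^esub> b \<odot>\<^bsub>M\<^esub> x"
    and smult_r_distr:
      "\<lbrakk> a \<in> carrier R; x \<in> carrier M; y \<in> carrier M \<rbrakk> \<Longrightarrow>
        a \<odot>\<^bsub>M\<^esub> (x \<oplus>\<^bsub>M\<^esub> y) = a \<odot>\<^bsub>M\<^esub> x \<oplus>\<^bsub>M\<^esub> a \<odot>\<^bsub>M\<^esub> y"
    and smult_assoc:
      "\<lbrakk> a \<in> carrier R; b \<in> carrier R; x \<in> carrier M \<rbrakk> \<Longrightarrow>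
        (a \<otimes> b) \<odot>\<^bsub>M\<^esub> x = a \<odot>\<^bsub>M\<^esub> (b \<odot>\<^bsub>M\<^esub> x)"
    and smult_one [simp]: "x \<in> carrier M \<Longrightarrow> \<one> \<odot>\<^bsub>M\<^esub> x = x"

definition module_isomorphic ::
    "('r, 'q) ring_scheme \<Rightarrow> ('r, 'a) module \<Rightarrow> ('r, 'b) module \<Rightarrow> bool" where
  "module_isomorphic R M N \<longleftrightarrow>
    (\<exists>h \<in> LinearCombinations.module_hom R M N. bij_betw h (carrier M) (carrier N))"

definition restrict_scalars :: "('r \<Rightarrow> 's) \<Rightarrow> ('s, 'a) module \<Rightarrow> ('r, 'a) module" where
  "restrict_scalars \<phi> M =
    \<lparr>carrier = carrier M, mult = mult M, one = one M, zero = zero M, add = add M,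
     smult = (\<lambda>r x. \<phi> r \<odot>\<^bsub>M\<^esub> x)\<rparr>"

definition quotient_module :: "('r, 'a) module \<Rightarrow> 'a set \<Rightarrow> ('r, 'a set) module" where
  "quotient_module M N =
    \<lparr>carrier = a_rcosets\<^bsub>M\<^esub> N, mult = undefined, one = undefined, zero = N, add = set_add M,
     smult = (\<lambda>r X. \<Union>x\<in>X. N +>\<^bsub>M\<^esub> (r \<odot>\<^bsub>M\<^esub> x))\<rparr>"

definition free_module :: "('r, 'q) ring_scheme \<Rightarrow> 'b set \<Rightarrow> ('r, 'b \<Rightarrow> 'r) module" where
  "free_module R B =
    \<lparr>carrier = {f. range f \<subseteq> carrier R \<and> finite {b. f b \<noteq> \<zero>\<^bsub>R\<^esub>} \<and> {b. f b \<noteq> \<zero>\<^bsub>R\<^esub>} \<subseteq> B},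
     mult = undefined, one = undefined,
     zero = (\<lambda>_. \<zero>\<^bsub>R\<^esub>), add = (\<lambda>f g b. f b \<oplus>\<^bsub>R\<^esub> g b),
     smult = (\<lambda>r f b. r \<otimes>\<^bsub>R\<^esub> f b)\<rparr>"

text \<open>A module is projective if it is a direct summand of a free module. Taking the basis inside
  the type of elements of \<open>P\<close> is no restriction, since \<open>P\<close> generates itself.\<close>

definition projective_module :: "('r, 'q) ring_scheme \<Rightarrow> ('r, 'p) module \<Rightarrow> bool" where
  "projective_module R P \<longleftrightarrow> left_module R P \<and>
    (\<exists>B :: 'p set.
      \<exists>s \<in> LinearCombinations.module_hom R P (free_module R B).
      \<exists>r \<in> LinearCombinations.module_hom R (free_module R B) P.
        \<forall>x \<in> carrier P. r (s x) = x)"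


section \<open>Ext over an algebra\<close>

text \<open>A projective resolution
  \<open>\<dots> \<rightarrow> P 2 \<rightarrow> P 1 \<rightarrow> P 0 \<rightarrow> V \<rightarrow> 0\<close> with differentials \<open>d i : P (i + 1) \<rightarrow> P i\<close> and augmentation
  \<open>\<epsilon> : P 0 \<rightarrow> V\<close>. All \<open>P i\<close> have elements of the same type, but their carriers may differ.\<close>

definition projective_resolution ::
    "('r, 'q) ring_scheme \<Rightarrow> ('r, 'v) module \<Rightarrow> (nat \<Rightarrow> ('r, 'p) module) \<Rightarrow> (nat \<Rightarrow> 'p \<Rightarrow> 'p)
      \<Rightarrow> ('p \<Rightarrow> 'v) \<Rightarrow> bool" where
  "projective_resolution R V P d \<epsilon> \<longleftrightarrow>
    (\<forall>i. projective_module R (P i)) \<and>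
    (\<forall>i. d i \<in> LinearCombinations.module_hom R (P (Suc i)) (P i)) \<and>
    \<epsilon> \<in> LinearCombinations.module_hom R (P 0) V \<and>
    \<epsilon> ` carrier (P 0) = carrier V \<and>
    {x \<in> carrier (P 0). \<epsilon> x = \<zero>\<^bsub>V\<^esub>} = d 0 ` carrier (P (Suc 0)) \<and>
    (\<forall>i. {x \<in> carrier (P (Suc i)). d i x = \<zero>\<^bsub>P i\<^esub>} = d (Suc i) ` carrier (P (Suc (Suc i))))"

text \<open>Every \<open>R\<close>-module with elements in \<open>'v\<close> has a free resolution all of whose terms have bases in
  the following type: \<open>Base_Elem\<close> serves for the elements of the module itself, and \<open>Base_Syz\<close> for
  finitely supported functions (elements of the previous free module), listed by their values.
  See \<open>ex_projective_resolution\<close> below.\<close>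

datatype ('r, 'v) res_basis = Base_Elem 'v | Base_Syz "('r \<times> ('r, 'v) res_basis) list"

definition chosen_resolution ::
    "('r, 'q) ring_scheme \<Rightarrow> ('r, 'v) module \<Rightarrow>
      (nat \<Rightarrow> ('r, ('r, 'v) res_basis \<Rightarrow> 'r) module) \<times>
      (nat \<Rightarrow> (('r, 'v) res_basis \<Rightarrow> 'r) \<Rightarrow> (('r, 'v) res_basis \<Rightarrow> 'r))" where
  "chosen_resolution R V = (SOME (P, d). \<exists>\<epsilon>. projective_resolution R V P d \<epsilon>)"

text \<open>In the following \<open>R\<close> is an algebra over a field with structure map \<open>\<iota>\<close>, a ring homomorphism
  from the field to the centre of \<open>R\<close>. Homomorphisms are made extensional so that they are determined
  by their values on the carrier.\<close>

definition hom_space ::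
    "('r, 'q) ring_scheme \<Rightarrow> ('k \<Rightarrow> 'r) \<Rightarrow> ('r, 'p) module \<Rightarrow> ('r, 'w) module \<Rightarrow>
      ('k, 'p \<Rightarrow> 'w) module" where
  "hom_space R \<iota> P W =
    \<lparr>carrier = LinearCombinations.module_hom R P W \<inter> extensional (carrier P),
     mult = undefined, one = undefined,
     zero = (\<lambda>x\<in>carrier P. \<zero>\<^bsub>W\<^esub>),
     add = (\<lambda>f g. \<lambda>x\<in>carrier P. f x \<oplus>\<^bsub>W\<^esub> g x),
     smult = (\<lambda>c f. \<lambda>x\<in>carrier P. \<iota> c \<odot>\<^bsub>W\<^esub> f x)\<rparr>"

definition cocycles ::
    "('r, 'q) ring_scheme \<Rightarrow> ('k \<Rightarrow> 'r) \<Rightarrow> (nat \<Rightarrow> ('r, 'p) module) \<Rightarrow> (nat \<Rightarrow> 'p \<Rightarrow> 'p) \<Rightarrow>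
      ('r, 'w) module \<Rightarrow> nat \<Rightarrow> ('k, 'p \<Rightarrow> 'w) module" where
  "cocycles R \<iota> P d W i =
    (hom_space R \<iota> (P i) W)
      \<lparr>carrier := {f \<in> carrier (hom_space R \<iota> (P i) W).
        compose (carrier (P (Suc i))) f (d i) = \<zero>\<^bsub>hom_space R \<iota> (P (Suc i)) W\<^esub>}\<rparr>"

fun coboundaries ::
    "('r, 'q) ring_scheme \<Rightarrow> ('k \<Rightarrow> 'r) \<Rightarrow> (nat \<Rightarrow> ('r, 'p) module) \<Rightarrow> (nat \<Rightarrow> 'p \<Rightarrow> 'p) \<Rightarrow>
      ('r, 'w) module \<Rightarrow> nat \<Rightarrow> ('p \<Rightarrow> 'w) set" where
  "coboundaries R \<iota> P d W 0 = {\<zero>\<^bsub>hom_space R \<iota> (P 0) W\<^esub>}"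
| "coboundaries R \<iota> P d W (Suc i) =
    (\<lambda>g. compose (carrier (P (Suc i))) g (d i)) ` carrier (hom_space R \<iota> (P i) W)"

definition hom_cohomology ::
    "('r, 'q) ring_scheme \<Rightarrow> ('k \<Rightarrow> 'r) \<Rightarrow> (nat \<Rightarrow> ('r, 'p) module) \<Rightarrow> (nat \<Rightarrow> 'p \<Rightarrow> 'p) \<Rightarrow>
      ('r, 'w) module \<Rightarrow> nat \<Rightarrow> ('k, ('p \<Rightarrow> 'w) set) module" where
  "hom_cohomology R \<iota> P d W i =
    quotient_module (cocycles R \<iota> P d W i) (coboundaries R \<iota> P d W i)"

definition Ext ::
    "('r, 'q) ring_scheme \<Rightarrow> ('k \<Rightarrow> 'r) \<Rightarrow> nat \<Rightarrow> ('r, 'v) module \<Rightarrow> ('r, 'w) module \<Rightarrow>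
      ('k, ((('r, 'v) res_basis \<Rightarrow> 'r) \<Rightarrow> 'w) set) module" where
  "Ext R \<iota> i V W = (case chosen_resolution R V of (P, d) \<Rightarrow> hom_cohomology R \<iota> P d W i)"


section \<open>Monoid algebras\<close>

definition monoid_algebra :: "('m, 'q) monoid_scheme \<Rightarrow> ('m \<Rightarrow> 'k::field) ring" where
  "monoid_algebra M =
    \<lparr>carrier = {a. finite {x. a x \<noteq> 0} \<and> {x. a x \<noteq> 0} \<subseteq> carrier M},
     mult = (\<lambda>a b z. \<Sum>(x, y) \<in> {(x, y). a x \<noteq> 0 \<and> b y \<noteq> 0 \<and> x \<otimes>\<^bsub>M\<^esub> y = z}. a x * b y),
     one = (\<lambda>x. if x = \<one>\<^bsub>M\<^esub> then 1 else 0),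
     zero = (\<lambda>_. 0),
     add = (\<lambda>a b x. a x + b x)\<rparr>"

definition scalar_embedding :: "('m, 'q) monoid_scheme \<Rightarrow> 'k \<Rightarrow> ('m \<Rightarrow> 'k::field)" where
  "scalar_embedding M c = (\<lambda>x. if x = \<one>\<^bsub>M\<^esub> then c else 0)"

definition monoid_algebra_map :: "('m \<Rightarrow> 'n) \<Rightarrow> ('m \<Rightarrow> 'k::field) \<Rightarrow> ('n \<Rightarrow> 'k)" where
  "monoid_algebra_map \<phi> a = (\<lambda>y. \<Sum>x \<in> {x. a x \<noteq> 0 \<and> \<phi> x = y}. a x)"

abbreviation inflate ::
    "('m \<Rightarrow> 'n) \<Rightarrow> ('n \<Rightarrow> 'k::field, 'v) module \<Rightarrow> ('m \<Rightarrow> 'k, 'v) module" where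
  "inflate \<phi> V \<equiv> restrict_scalars (monoid_algebra_map \<phi>) V"

abbreviation Ext_monoid ::
    "('m, 'q) monoid_scheme \<Rightarrow> nat \<Rightarrow> ('m \<Rightarrow> 'k::field, 'v) module \<Rightarrow> ('m \<Rightarrow> 'k, 'w) module \<Rightarrow>
      ('k, ((('m \<Rightarrow> 'k, 'v) res_basis \<Rightarrow> 'm \<Rightarrow> 'k) \<Rightarrow> 'w) set) module" where
  "Ext_monoid M i V W \<equiv> Ext (monoid_algebra M) (scalar_embedding M) i V W"


section \<open>Matrices and affine transformations\<close>

text \<open>The multiplicative monoid \<open>M\<^sub>n\<close> is the monoid part of the library's matrix ring.\<close>

abbreviation matrix_monoid :: "nat \<Rightarrow> 'f::field mat ring" where
  "matrix_monoid n \<equiv> ring_mat TYPE('f) n ()"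

abbreviation GL :: "nat \<Rightarrow> 'f::field mat set" where
  "GL n \<equiv> Units (matrix_monoid n)"

definition affine_transformation :: "nat \<Rightarrow> 'f::field mat \<Rightarrow> 'f vec \<Rightarrow> 'f vec \<Rightarrow> 'f vec" where
  "affine_transformation n A b = (\<lambda>x\<in>carrier_vec n. A *\<^sub>v x + b)"

definition affine_monoid :: "nat \<Rightarrow> ('f::field vec \<Rightarrow> 'f vec) monoid" where
  "affine_monoid n =
    \<lparr>carrier = {affine_transformation n A b | A b. A \<in> carrier_mat n n \<and> b \<in> carrier_vec n},
     mult = compose (carrier_vec n),
     one = (\<lambda>x\<in>carrier_vec n. x)\<rparr>"

definition linear_part :: "nat \<Rightarrow> ('f::field vec \<Rightarrow> 'f vec) \<Rightarrow> 'f mat" where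
  "linear_part n f =
    (THE A. A \<in> carrier_mat n n \<and> (\<exists>b\<in>carrier_vec n. f = affine_transformation n A b))"


section \<open>Existence of projective resolutions\<close>

text \<open>This shows that \<open>chosen_resolution\<close> is a projective resolution for every left module.\<close>

context left_module begin

lemma smult_l_null [simp]: "x \<in> carrier M \<Longrightarrow> \<zero> \<odot>\<^bsub>M\<^esub> x = \<zero>\<^bsub>M\<^esub>"
  by (metis M.add.l_cancel_one' M.add.m_closed R.l_zero R.zero_closed smult_closed smult_l_distr)

lemma smult_r_null [simp]: "a \<in> carrier R \<Longrightarrow> a \<odot>\<^bsub>M\<^esub> \<zero>\<^bsub>M\<^esub> = \<zero>\<^bsub>M\<^esub>"
  by (metis M.add.l_cancel_one' M.l_zero M.zero_closed smult_closed smult_r_distr)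

lemma smult_finsum:
  "\<lbrakk>finite A; r \<in> carrier R; g \<in> A \<rightarrow> carrier M\<rbrakk> \<Longrightarrow>
    r \<odot>\<^bsub>M\<^esub> (\<Oplus>\<^bsub>M\<^esub>b\<in>A. g b) = (\<Oplus>\<^bsub>M\<^esub>b\<in>A. r \<odot>\<^bsub>M\<^esub> g b)"
proof (induction A rule: finite_induct)
  case (insert x F)
  then have "g \<in> F \<rightarrow> carrier M" "g x \<in> carrier M" by auto
  moreover from this have "(\<lambda>b. r \<odot>\<^bsub>M\<^esub> g b) \<in> F \<rightarrow> carrier M" "r \<odot>\<^bsub>M\<^esub> g x \<in> carrier M"
    using insert.prems by auto
  ultimately show ?case using insert by (simp add: smult_r_distr)
qed simp

lemma submodule_left_module:
  assumes "K \<subseteq> carrier M" "\<zero>\<^bsub>M\<^esub> \<in> K" "\<And>x y. x \<in> K \<Longrightarrow> y \<in> K \<Longrightarrow> x \<oplus>\<^bsub>M\<^esub> y \<in> K"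
    and "\<And>r x. r \<in> carrier R \<Longrightarrow> x \<in> K \<Longrightarrow> r \<odot>\<^bsub>M\<^esub> x \<in> K"
  shows "left_module R (M\<lparr>carrier := K\<rparr>)"
proof -
  have neg: "\<exists>y\<in>K. y \<oplus>\<^bsub>M\<^esub> x = \<zero>\<^bsub>M\<^esub>" if "x \<in> K" for x
  proof
    have x: "x \<in> carrier M" using that assms by auto
    show "(\<ominus> \<one>) \<odot>\<^bsub>M\<^esub> x \<in> K" using assms(4) that by auto
    have "(\<ominus> \<one>) \<odot>\<^bsub>M\<^esub> x \<oplus>\<^bsub>M\<^esub> x = (\<ominus> \<one> \<oplus> \<one>) \<odot>\<^bsub>M\<^esub> x"
      using x by (simp add: smult_l_distr)
    then show "(\<ominus> \<one>) \<odot>\<^bsub>M\<^esub> x \<oplus>\<^bsub>M\<^esub> x = \<zero>\<^bsub>M\<^esub>" using x by (simp add: R.l_neg)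
  qed
  have "abelian_group (M\<lparr>carrier := K\<rparr>)"
    by (rule abelian_groupI) (use assms neg in \<open>auto simp: subset_iff M.a_ac\<close>)
  then show ?thesis
    by (intro left_module.intro left_module_axioms.intro)
      (use assms in \<open>auto simp: subset_iff R.ring_axioms smult_l_distr smult_r_distr smult_assoc\<close>)
qed

lemma hom_zero:
  assumes "left_module R N" "h \<in> LinearCombinations.module_hom R M N"
  shows "h \<zero>\<^bsub>M\<^esub> = \<zero>\<^bsub>N\<^esub>"
proof -
  interpret N: left_module R N by fact
  have "h (\<zero> \<odot>\<^bsub>M\<^esub> \<zero>\<^bsub>M\<^esub>) = \<zero> \<odot>\<^bsub>N\<^esub> h \<zero>\<^bsub>M\<^esub>" "h \<zero>\<^bsub>M\<^esub> \<in> carrier N"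
    using assms(2) M.zero_closed R.zero_closed unfolding LinearCombinations.module_hom_def by blast+
  then show ?thesis by simp
qed

lemma kernel_left_module:
  assumes "left_module R N" "h \<in> LinearCombinations.module_hom R M N"
  shows "left_module R (M\<lparr>carrier := {x \<in> carrier M. h x = \<zero>\<^bsub>N\<^esub>}\<rparr>)"
proof -
  interpret N: left_module R N by fact
  show ?thesis
    by (rule submodule_left_module)
      (use hom_zero[OF assms] assms(2) in \<open>auto simp: LinearCombinations.module_hom_def\<close>)
qed

end

lemma free_left_module:
  fixes R :: "('a, 'q) ring_scheme" and B :: "'b set"
  assumes "ring R"
  shows "left_module R (free_module R B)"
proof -
  interpret ring R by fact
  have fin: "finite {b. f b \<oplus>\<^bsub>R\<^esub> g b \<noteq> \<zero>\<^bsub>R\<^esub>}" 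
    if "finite {b. f b \<noteq> \<zero>\<^bsub>R\<^esub>}" "finite {b. g b \<noteq> \<zero>\<^bsub>R\<^esub>}" for f g :: "'b \<Rightarrow> 'a"
    by (rule finite_subset[OF _ finite_UnI[OF that]]) auto
  have fin': "finite {b. r \<otimes>\<^bsub>R\<^esub> f b \<noteq> \<zero>\<^bsub>R\<^esub>}"
    if "finite {b. f b \<noteq> \<zero>\<^bsub>R\<^esub>}" "r \<in> carrier R" for f :: "'b \<Rightarrow> 'a" and r
    by (rule finite_subset[OF _ that(1)]) (use that in auto)
  have mem: "f \<in> carrier (free_module R B) \<longleftrightarrow>
      (\<forall>b. f b \<in> carrier R) \<and> finite {b. f b \<noteq> \<zero>\<^bsub>R\<^esub>} \<and> (\<forall>b. b \<notin> B \<longrightarrow> f b = \<zero>\<^bsub>R\<^esub>)" for f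
    by (auto simp: free_module_def)
  have ops: "\<zero>\<^bsub>free_module R B\<^esub> = (\<lambda>_. \<zero>\<^bsub>R\<^esub>)" "f \<oplus>\<^bsub>free_module R B\<^esub> g = (\<lambda>b. f b \<oplus>\<^bsub>R\<^esub> g b)"
    "r \<odot>\<^bsub>free_module R B\<^esub> f = (\<lambda>b. r \<otimes>\<^bsub>R\<^esub> f b)" for f g r
    by (simp_all add: free_module_def)
  have "abelian_group (free_module R B)"
  proof (rule abelian_groupI)
    fix x assume x: "x \<in> carrier (free_module R B)"
    then have "{b. \<ominus>\<^bsub>R\<^esub> x b \<noteq> \<zero>\<^bsub>R\<^esub>} \<subseteq> {b. x b \<noteq> \<zero>\<^bsub>R\<^esub>}" by auto
    then have "(\<lambda>b. \<ominus>\<^bsub>R\<^esub> x b) \<in> carrier (free_module R B)"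
      using x finite_subset by (auto simp: mem)
    moreover have "(\<lambda>b. \<ominus>\<^bsub>R\<^esub> x b) \<oplus>\<^bsub>free_module R B\<^esub> x = \<zero>\<^bsub>free_module R B\<^esub>"
      using x by (simp add: mem ops l_neg)
    ultimately show "\<exists>y\<in>carrier (free_module R B). y \<oplus>\<^bsub>free_module R B\<^esub> x = \<zero>\<^bsub>free_module R B\<^esub>"
      by blast
  next
    fix x y assume "x \<in> carrier (free_module R B)" "y \<in> carrier (free_module R B)"
    then have xy: "\<forall>b. x b \<in> carrier R" "\<forall>b. y b \<in> carrier R" "finite {b. x b \<noteq> \<zero>\<^bsub>R\<^esub>}"
      "finite {b. y b \<noteq> \<zero>\<^bsub>R\<^esub>}" "\<forall>b. b \<notin> B \<longrightarrow> x b = \<zero>\<^bsub>R\<^esub> \<and> y b = \<zero>\<^bsub>R\<^esub>"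
      by (auto simp: mem)
    show "x \<oplus>\<^bsub>free_module R B\<^esub> y \<in> carrier (free_module R B)"
      unfolding mem ops using xy fin[OF xy(3,4)] by auto
    show "x \<oplus>\<^bsub>free_module R B\<^esub> y = y \<oplus>\<^bsub>free_module R B\<^esub> x"
      using xy by (simp add: ops a_comm)
  qed (simp_all add: mem ops a_assoc)
  then show ?thesis
    by (intro left_module.intro left_module_axioms.intro)
      (simp_all add: mem ops ring_axioms fin' l_distr r_distr m_assoc)
qed

definition free_basis :: "('r, 'q) ring_scheme \<Rightarrow> 'b \<Rightarrow> 'b \<Rightarrow> 'r" where
  "free_basis R b = (\<lambda>x. if x = b then \<one>\<^bsub>R\<^esub> else \<zero>\<^bsub>R\<^esub>)"

definition lin_ext where
  "lin_ext R N g f = (\<Oplus>\<^bsub>N\<^esub>b\<in>{b. f b \<noteq> \<zero>\<^bsub>R\<^esub>}. f b \<odot>\<^bsub>N\<^esub> g b)"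

lemma (in left_module) lin_ext_superset:
  assumes "f \<in> carrier (free_module R B)" "g \<in> B \<rightarrow> carrier M" "finite A" "{b. f b \<noteq> \<zero>} \<subseteq> A" "A \<subseteq> B"
  shows "lin_ext R M g f = (\<Oplus>\<^bsub>M\<^esub>b\<in>A. f b \<odot>\<^bsub>M\<^esub> g b)"
  unfolding lin_ext_def
  by (rule M.add.finprod_mono_neutral_cong_left)
    (use assms in \<open>auto simp: free_module_def subset_iff Pi_iff\<close>)

lemma (in left_module) lin_ext_hom:
  assumes g: "g \<in> B \<rightarrow> carrier M"
  shows "lin_ext R M g \<in> LinearCombinations.module_hom R (free_module R B) M"
  unfolding LinearCombinations.module_hom_def
proof (intro CollectI conjI allI impI)
  let ?F = "free_module R B"
  interpret F: left_module R ?F by (rule free_left_module[OF R.ring_axioms])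
  have D: "finite {b. f b \<noteq> \<zero>}" "{b. f b \<noteq> \<zero>} \<subseteq> B" "\<And>b. f b \<in> carrier R" if "f \<in> carrier ?F" for f
    using that by (auto simp: free_module_def)
  show "lin_ext R M g \<in> carrier ?F \<rightarrow> carrier M"
  proof
    fix f assume f: "f \<in> carrier ?F"
    have "g b \<in> carrier M" if "f b \<noteq> \<zero>" for b using D(2)[OF f] g that by auto
    then show "lin_ext R M g f \<in> carrier M"
      unfolding lin_ext_def using D(3)[OF f] by (intro M.finsum_closed) auto
  qed
  fix f h assume "f \<in> carrier ?F \<and> h \<in> carrier ?F"
  then have fh: "f \<in> carrier ?F" "h \<in> carrier ?F" "f \<oplus>\<^bsub>?F\<^esub> h \<in> carrier ?F" by auto
  let ?A = "{b. f b \<noteq> \<zero>} \<union> {b. h b \<noteq> \<zero>}"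
  have A: "finite ?A" "?A \<subseteq> B" using D fh by auto
  have s: "{b. (f \<oplus>\<^bsub>?F\<^esub> h) b \<noteq> \<zero>} \<subseteq> ?A" by (auto simp: free_module_def)
  have gA: "g b \<in> carrier M" if "b \<in> ?A" for b using A(2) g that by blast
  have c: "f b \<in> carrier R" "h b \<in> carrier R" for b using D(3) fh by auto
  have e: "(f \<oplus>\<^bsub>?F\<^esub> h) b = f b \<oplus> h b" for b by (simp add: free_module_def)
  have "lin_ext R M g (f \<oplus>\<^bsub>?F\<^esub> h) = (\<Oplus>\<^bsub>M\<^esub>b\<in>?A. (f \<oplus>\<^bsub>?F\<^esub> h) b \<odot>\<^bsub>M\<^esub> g b)"
    by (rule lin_ext_superset[OF fh(3) g A(1) s A(2)])
  also have "\<dots> = (\<Oplus>\<^bsub>M\<^esub>b\<in>?A. f b \<odot>\<^bsub>M\<^esub> g b \<oplus>\<^bsub>M\<^esub> h b \<odot>\<^bsub>M\<^esub> g b)"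
    by (rule M.add.finprod_cong') (simp_all add: e gA c smult_l_distr Pi_iff del: Un_iff)
  also have "\<dots> = (\<Oplus>\<^bsub>M\<^esub>b\<in>?A. f b \<odot>\<^bsub>M\<^esub> g b) \<oplus>\<^bsub>M\<^esub> (\<Oplus>\<^bsub>M\<^esub>b\<in>?A. h b \<odot>\<^bsub>M\<^esub> g b)"
    by (rule M.finsum_addf) (simp_all add: gA c Pi_iff del: Un_iff)
  also have "\<dots> = lin_ext R M g f \<oplus>\<^bsub>M\<^esub> lin_ext R M g h"
    using lin_ext_superset[OF fh(1) g A(1) _ A(2)] lin_ext_superset[OF fh(2) g A(1) _ A(2)] by simp
  finally show "lin_ext R M g (f \<oplus>\<^bsub>?F\<^esub> h) = lin_ext R M g f \<oplus>\<^bsub>M\<^esub> lin_ext R M g h" .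
next
  let ?F = "free_module R B"
  interpret F: left_module R ?F by (rule free_left_module[OF R.ring_axioms])
  fix r f assume "r \<in> carrier R \<and> f \<in> carrier ?F"
  then have rf: "r \<in> carrier R" "f \<in> carrier ?F" "r \<odot>\<^bsub>?F\<^esub> f \<in> carrier ?F" by auto
  let ?A = "{b. f b \<noteq> \<zero>}"
  have A: "finite ?A" "?A \<subseteq> B" "\<And>b. f b \<in> carrier R" using rf by (auto simp: free_module_def)
  have s: "{b. (r \<odot>\<^bsub>?F\<^esub> f) b \<noteq> \<zero>} \<subseteq> ?A" using rf by (auto simp: free_module_def)
  have gA: "g b \<in> carrier M" if "b \<in> ?A" for b using A(2) g that by blast
  have e: "(r \<odot>\<^bsub>?F\<^esub> f) b = r \<otimes> f b" for b by (simp add: free_module_def)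
  have "lin_ext R M g (r \<odot>\<^bsub>?F\<^esub> f) = (\<Oplus>\<^bsub>M\<^esub>b\<in>?A. (r \<odot>\<^bsub>?F\<^esub> f) b \<odot>\<^bsub>M\<^esub> g b)"
    by (rule lin_ext_superset[OF rf(3) g A(1) s A(2)])
  also have "\<dots> = (\<Oplus>\<^bsub>M\<^esub>b\<in>?A. r \<odot>\<^bsub>M\<^esub> (f b \<odot>\<^bsub>M\<^esub> g b))"
    by (rule M.add.finprod_cong') (auto simp: e gA A(3) rf(1) smult_assoc simp del: mem_Collect_eq)
  also have "\<dots> = r \<odot>\<^bsub>M\<^esub> lin_ext R M g f"
    unfolding lin_ext_def by (rule smult_finsum[symmetric]) (auto simp: gA A(1,3) rf(1) simp del: mem_Collect_eq)
  finally show "lin_ext R M g (r \<odot>\<^bsub>?F\<^esub> f) = r \<odot>\<^bsub>M\<^esub> lin_ext R M g f" .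
qed

lemma free_basis_carrier: "ring R \<Longrightarrow> b \<in> B \<Longrightarrow> free_basis R b \<in> carrier (free_module R B)"
  by (auto simp: free_module_def free_basis_def intro!: ring.ring_simprules(6) ring.ring_simprules(2))

lemma (in left_module) lin_ext_basis:
  assumes "g \<in> B \<rightarrow> carrier M" "b \<in> B"
  shows "lin_ext R M g (free_basis R b) = g b"
proof -
  have "g b \<in> carrier M" using assms by auto
  moreover have "{x. free_basis R b x \<noteq> \<zero>} \<subseteq> {b}" by (auto simp: free_basis_def)
  ultimately show ?thesis
    using lin_ext_superset[OF free_basis_carrier[OF R.ring_axioms assms(2)] assms(1), of "{b}"] assms(2)
    by (simp add: free_basis_def)
qed

lemma (in left_module) ex_free_cover:
  fixes enc :: "_ \<Rightarrow> 'b"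
  assumes "inj_on enc (carrier M)"
  shows "\<exists>(B :: 'b set) h. h \<in> LinearCombinations.module_hom R (free_module R B) M \<and>
    h ` carrier (free_module R B) = carrier M"
proof -
  let ?g = "the_inv_into (carrier M) enc" and ?B = "enc ` carrier M"
  let ?h = "lin_ext R M ?g"
  have g: "?g \<in> ?B \<rightarrow> carrier M" using assms by (auto simp: the_inv_into_f_f)
  have h: "?h \<in> LinearCombinations.module_hom R (free_module R ?B) M" by (rule lin_ext_hom[OF g])
  have "x \<in> ?h ` carrier (free_module R ?B)" if "x \<in> carrier M" for x
    using lin_ext_basis[OF g, of "enc x"] the_inv_into_f_f[OF assms that] that
      free_basis_carrier[OF R.ring_axioms, of "enc x" ?B] by (metis imageI)
  with h show ?thesis by (intro exI[of _ ?B] exI[of _ ?h]) (auto simp: LinearCombinations.module_hom_def)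
qed

lemma free_module_projective:
  assumes "ring R"
  shows "projective_module R (free_module R B)"
proof -
  let ?F = "free_module R B"
  interpret F: left_module R ?F by (rule free_left_module[OF assms])
  let ?B = "free_basis R ` B"
  let ?r = "lin_ext R ?F (\<lambda>x. x)"
  have r: "?r \<in> LinearCombinations.module_hom R (free_module R ?B) ?F"
    by (rule F.lin_ext_hom) (auto intro!: free_basis_carrier assms)
  interpret G: left_module R "free_module R ?B" by (rule free_left_module[OF assms])
  let ?s = "lin_ext R (free_module R ?B) (\<lambda>b. free_basis R (free_basis R b))"
  have gs: "(\<lambda>b. free_basis R (free_basis R b)) \<in> B \<rightarrow> carrier (free_module R ?B)"
    by (auto intro!: free_basis_carrier assms)
  have s: "?s \<in> LinearCombinations.module_hom R ?F (free_module R ?B)"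
    by (rule G.lin_ext_hom[OF gs])
  have rs: "?r (?s f) = f" if f: "f \<in> carrier ?F" for f
  proof -
    let ?A = "{b. f b \<noteq> \<zero>\<^bsub>R\<^esub>}"
    have A: "finite ?A" "?A \<subseteq> B" "\<And>b. f b \<in> carrier R" using f by (auto simp: free_module_def)
    have add: "?r (\<Oplus>\<^bsub>free_module R ?B\<^esub>b\<in>C. u b) = (\<Oplus>\<^bsub>?F\<^esub>b\<in>C. ?r (u b))"
      if "finite C" "u \<in> C \<rightarrow> carrier (free_module R ?B)" for C and u
      using that
    proof (induction C rule: finite_induct)
      case empty then show ?case using G.hom_zero[OF F.left_module_axioms r] by simp
    next
      case (insert x C)
      then have "u \<in> C \<rightarrow> carrier (free_module R ?B)" "u x \<in> carrier (free_module R ?B)" by auto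
      moreover have "(\<lambda>b. ?r (u b)) \<in> C \<rightarrow> carrier ?F" "?r (u x) \<in> carrier ?F"
        using r calculation by (auto simp: LinearCombinations.module_hom_def)
      moreover have "(\<Oplus>\<^bsub>free_module R ?B\<^esub>b\<in>C. u b) \<in> carrier (free_module R ?B)"
        using calculation by (intro G.M.finsum_closed) 
      ultimately show ?case using insert r by (simp add: LinearCombinations.module_hom_def)
    qed
    have "?r (?s f) = (\<Oplus>\<^bsub>?F\<^esub>b\<in>?A. ?r (f b \<odot>\<^bsub>free_module R ?B\<^esub> free_basis R (free_basis R b)))"
      unfolding lin_ext_def[of R "free_module R ?B" _ f]
      by (rule add) (use A gs in \<open>auto intro!: G.smult_closed\<close>)
    also have "\<dots> = (\<Oplus>\<^bsub>?F\<^esub>b\<in>?A. f b \<odot>\<^bsub>?F\<^esub> free_basis R b)"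
    proof (rule F.M.add.finprod_cong')
      fix b assume b: "b \<in> ?A"
      then have "free_basis R b \<in> ?B" using A by auto
      then have "?r (free_basis R (free_basis R b)) = free_basis R b"
        by (intro F.lin_ext_basis) (auto intro!: free_basis_carrier assms)
      then show "?r (f b \<odot>\<^bsub>free_module R ?B\<^esub> free_basis R (free_basis R b)) = f b \<odot>\<^bsub>?F\<^esub> free_basis R b"
        using LinearCombinations.module_hom_smult[OF r A(3), of "free_basis R (free_basis R b)" b]
          funcset_mem[OF gs, of b] A(2) b by auto
    qed (use A in \<open>auto intro!: F.smult_closed free_basis_carrier assms\<close>)
    also have "\<dots> = f"
    proof
      fix x
      have "(\<Oplus>\<^bsub>?F\<^esub>b\<in>C. f b \<odot>\<^bsub>?F\<^esub> free_basis R b) x = (if x \<in> C then f x else \<zero>\<^bsub>R\<^esub>)"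
        if "finite C" "C \<subseteq> B" for C using that
      proof (induction C rule: finite_induct)
        case empty then show ?case by simp (simp add: free_module_def)
      next
        case (insert y C)
        then have "(\<lambda>b. f b \<odot>\<^bsub>?F\<^esub> free_basis R b) \<in> C \<rightarrow> carrier ?F" 
          "f y \<odot>\<^bsub>?F\<^esub> free_basis R y \<in> carrier ?F"
          using A by (auto intro!: F.smult_closed free_basis_carrier assms)
        then have "(\<Oplus>\<^bsub>?F\<^esub>b\<in>insert y C. f b \<odot>\<^bsub>?F\<^esub> free_basis R b) =
           f y \<odot>\<^bsub>?F\<^esub> free_basis R y \<oplus>\<^bsub>?F\<^esub> (\<Oplus>\<^bsub>?F\<^esub>b\<in>C. f b \<odot>\<^bsub>?F\<^esub> free_basis R b)"
          using insert.hyps by simp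
        then have "(\<Oplus>\<^bsub>?F\<^esub>b\<in>insert y C. f b \<odot>\<^bsub>?F\<^esub> free_basis R b) x =
           f y \<otimes>\<^bsub>R\<^esub> free_basis R y x \<oplus>\<^bsub>R\<^esub> (\<Oplus>\<^bsub>?F\<^esub>b\<in>C. f b \<odot>\<^bsub>?F\<^esub> free_basis R b) x"
          by (simp add: free_module_def)
        then show ?case using insert A by (auto simp: free_basis_def)
      qed
      from this[OF A(1,2)] show "(\<Oplus>\<^bsub>?F\<^esub>b\<in>?A. f b \<odot>\<^bsub>?F\<^esub> free_basis R b) x = f x" by auto
    qed
    finally show ?thesis .
  qed
  show ?thesis
    unfolding projective_module_def
    by (intro conjI F.left_module_axioms exI[of _ ?B] bexI[OF _ s] bexI[OF _ r] ballI rs)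
qed

lemma ex_projective_resolution:
  fixes V :: "('r, 'v) module"
  assumes "left_module R V"
  shows "\<exists>(P :: nat \<Rightarrow> ('r, ('r, 'v) res_basis \<Rightarrow> 'r) module) d \<epsilon>. projective_resolution R V P d \<epsilon>"
proof -
  interpret V: left_module R V by fact
  let ?F = "free_module R :: ('r, 'v) res_basis set \<Rightarrow> _"
  let ?hom = "LinearCombinations.module_hom R"
  have F: "left_module R (?F B)" for B by (rule free_left_module[OF V.R.ring_axioms])
  have "\<forall>f :: ('r, 'v) res_basis \<Rightarrow> 'r. \<exists>xs. finite {b. f b \<noteq> \<zero>\<^bsub>R\<^esub>} \<longrightarrow>
    set xs = (\<lambda>b. (f b, b)) ` {b. f b \<noteq> \<zero>\<^bsub>R\<^esub>}" (is "\<forall>f. \<exists>xs. ?Q f xs")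
  proof
    fix f :: "('r, 'v) res_basis \<Rightarrow> 'r"
    show "\<exists>xs. ?Q f xs"
      by (cases "finite {b. f b \<noteq> \<zero>\<^bsub>R\<^esub>}") (simp_all add: finite_list)
  qed
  from choice[OF this] obtain l where l: "\<forall>f. ?Q f (l f)" ..
  obtain enc :: "(('r, 'v) res_basis \<Rightarrow> 'r) \<Rightarrow> ('r, 'v) res_basis"
    where enc: "inj_on enc {f. finite {b. f b \<noteq> \<zero>\<^bsub>R\<^esub>}}"
  proof
    show "inj_on (\<lambda>f. Base_Syz (l f)) {f. finite {b. f b \<noteq> \<zero>\<^bsub>R\<^esub>}}"
    proof (rule inj_onI, clarsimp)
      fix f g :: "('r, 'v) res_basis \<Rightarrow> 'r"
      assume fin: "finite {b. f b \<noteq> \<zero>\<^bsub>R\<^esub>}" "finite {b. g b \<noteq> \<zero>\<^bsub>R\<^esub>}" and eq: "l f = l g"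
      have e: "(\<lambda>b. (f b, b)) ` {b. f b \<noteq> \<zero>\<^bsub>R\<^esub>} = (\<lambda>b. (g b, b)) ` {b. g b \<noteq> \<zero>\<^bsub>R\<^esub>}"
        using l[THEN spec, of f, THEN mp, OF fin(1)] l[THEN spec, of g, THEN mp, OF fin(2)]
          arg_cong[OF eq, of set] by metis
      show "f = g"
      proof
        fix b
        have 1: "f b = g b" if "f b \<noteq> \<zero>\<^bsub>R\<^esub>"
        proof -
          have "(f b, b) \<in> (\<lambda>b. (f b, b)) ` {b. f b \<noteq> \<zero>\<^bsub>R\<^esub>}" using that by simp
          then show ?thesis unfolding e by auto
        qed
        have 2: "f b = g b" if "g b \<noteq> \<zero>\<^bsub>R\<^esub>"
        proof -
          have "(g b, b) \<in> (\<lambda>b. (g b, b)) ` {b. g b \<noteq> \<zero>\<^bsub>R\<^esub>}" using that by simp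
          then show ?thesis unfolding e[symmetric] by auto
        qed
        show "f b = g b"
        proof (cases "f b = \<zero>\<^bsub>R\<^esub> \<and> g b = \<zero>\<^bsub>R\<^esub>")
          case False
          then show ?thesis using 1 2 by blast
        qed simp
      qed
    qed
  qed
  have "inj_on (Base_Elem :: 'v \<Rightarrow> ('r, 'v) res_basis) (carrier V)"
    by (auto intro: inj_onI)
  from V.ex_free_cover[OF this] obtain B0 \<epsilon>
    where B0: "\<epsilon> \<in> ?hom (?F B0) V" "\<epsilon> ` carrier (?F B0) = carrier V"
    by (elim exE conjE)
  define good where "good = (\<lambda>(B, K). K \<subseteq> carrier (?F B) \<and> left_module R ((?F B)\<lparr>carrier := K\<rparr>))"
  define ker where "ker = (\<lambda>B B' (h :: (('r, 'v) res_basis \<Rightarrow> 'r) \<Rightarrow> (('r, 'v) res_basis \<Rightarrow> 'r)).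
    {x \<in> carrier (?F B'). h x = \<zero>\<^bsub>?F B\<^esub>})"
  define step where "step = (\<lambda>(B, K) (B', K'). \<exists>h. h \<in> ?hom (?F B') (?F B) \<and>
    h ` carrier (?F B') = K \<and> K' = ker B B' h)"
  have "\<exists>y. good y \<and> step x y" if "good x" for x
  proof -
    obtain B K where x: "x = (B, K)" by (cases x)
    let ?N = "(?F B)\<lparr>carrier := K\<rparr>"
    interpret N: left_module R ?N using that x by (simp add: good_def)
    have K: "K \<subseteq> carrier (?F B)" using that x by (simp add: good_def)
    have "inj_on enc (carrier ?N)"
      by (rule inj_on_subset[OF enc]) (use K in \<open>auto simp: free_module_def\<close>)
    from N.ex_free_cover[OF this] obtain B' h where
      h: "h \<in> ?hom (?F B') ?N" "h ` carrier (?F B') = carrier ?N" by (elim exE conjE)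
    have h': "h \<in> ?hom (?F B') (?F B)"
      using h(1) K by (auto simp: LinearCombinations.module_hom_def)
    have "good (B', ker B B' h)"
      using left_module.kernel_left_module[OF F F h'] by (auto simp: good_def ker_def)
    moreover have "step x (B', ker B B' h)" using h' h(2) x by (auto simp: step_def)
    ultimately show ?thesis by blast
  qed
  moreover have "good (B0, {x \<in> carrier (?F B0). \<epsilon> x = \<zero>\<^bsub>V\<^esub>})" (is "good ?s0")
    using left_module.kernel_left_module[OF F V.left_module_axioms B0(1)] by (auto simp: good_def)
  ultimately obtain s where s: "s 0 = ?s0" "\<And>n. good (s n)" "\<And>n. step (s n) (s (Suc n))"
    using dependent_nat_choice[of "\<lambda>n x. good x \<and> (n = 0 \<longrightarrow> x = ?s0)" "\<lambda>_. step"] by auto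
  define P where "P = (\<lambda>n. ?F (fst (s n)))"
  have "\<forall>n. \<exists>h. h \<in> ?hom (P (Suc n)) (P n) \<and> h ` carrier (P (Suc n)) = snd (s n) \<and>
    snd (s (Suc n)) = {x \<in> carrier (P (Suc n)). h x = \<zero>\<^bsub>P n\<^esub>}" (is "\<forall>n. \<exists>h. ?Q n h")
  proof
    fix n
    show "\<exists>h. ?Q n h"
      using s(3)[of n] by (simp add: step_def ker_def P_def split_beta)
  qed
  from choice[OF this] obtain d where d: "\<forall>n. ?Q n (d n)" ..
  have "projective_resolution R V P d \<epsilon>"
    unfolding projective_resolution_def
  proof (intro conjI allI)
    show "projective_module R (P i)" for i
      unfolding P_def by (rule free_module_projective[OF V.R.ring_axioms])
    show "d i \<in> ?hom (P (Suc i)) (P i)" for i using d by simp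
    show "\<epsilon> \<in> ?hom (P 0) V" "\<epsilon> ` carrier (P 0) = carrier V" using B0 s(1) by (simp_all add: P_def)
    show "{x \<in> carrier (P 0). \<epsilon> x = \<zero>\<^bsub>V\<^esub>} = d 0 ` carrier (P (Suc 0))"
      using d[THEN spec, of 0] s(1) by (simp add: P_def)
    show "{x \<in> carrier (P (Suc i)). d i x = \<zero>\<^bsub>P i\<^esub>} = d (Suc i) ` carrier (P (Suc (Suc i)))" for i
      using d[THEN spec, of i] d[THEN spec, of "Suc i"] by simp
  qed
  then show ?thesis by blast
qed

lemma chosen_resolution:
  fixes V :: "('r, 'v) module"
  assumes "left_module R V" "chosen_resolution R V = (P, d)"
  shows "\<exists>\<epsilon>. projective_resolution R V P d \<epsilon>"
proof -
  obtain P' :: "nat \<Rightarrow> ('r, ('r, 'v) res_basis \<Rightarrow> 'r) module" and d' \<epsilon> where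
    "projective_resolution R V P' d' \<epsilon>" using ex_projective_resolution[OF assms(1)] by blast
  then have "case (P', d') of (P, d) \<Rightarrow> \<exists>\<epsilon>. projective_resolution R V P d \<epsilon>" by auto
  from someI[of "\<lambda>x. case x of (P, d) \<Rightarrow> \<exists>\<epsilon>. projective_resolution R V P d \<epsilon>", OF this] assms(2)
  show ?thesis unfolding chosen_resolution_def by simp
qed


section \<open>The monoid algebra is a ring, and the linear part is a monoid homomorphism\<close>

lemma monoid_algebra_mult:
  assumes "finite A" "finite B" "{x. a x \<noteq> 0} \<subseteq> A" "{y. b y \<noteq> 0} \<subseteq> B"
  shows "(a \<otimes>\<^bsub>monoid_algebra M\<^esub> b) z = (\<Sum>x\<in>A. \<Sum>y\<in>B. if x \<otimes>\<^bsub>M\<^esub> y = z then a x * b y else 0)"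
proof -
  have "(\<Sum>x\<in>A. \<Sum>y\<in>B. if x \<otimes>\<^bsub>M\<^esub> y = z then a x * b y else 0)
     = (\<Sum>(x, y) \<in> A \<times> B. if x \<otimes>\<^bsub>M\<^esub> y = z then a x * b y else 0)"
    by (simp add: sum.cartesian_product)
  also have "\<dots> = (\<Sum>(x, y) \<in> {(x, y). a x \<noteq> 0 \<and> b y \<noteq> 0 \<and> x \<otimes>\<^bsub>M\<^esub> y = z}. a x * b y)"
    by (rule sum.mono_neutral_cong_right) (use assms in \<open>auto split: if_splits\<close>)
  finally show ?thesis by (simp add: monoid_algebra_def)
qed

lemma sum_swap4:
  "(\<Sum>u\<in>U. \<Sum>w\<in>C. \<Sum>x\<in>A. \<Sum>y\<in>B. F u w x y) = (\<Sum>x\<in>A. \<Sum>y\<in>B. \<Sum>w\<in>C. \<Sum>u\<in>U. F u w x y)"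
proof -
  have "(\<Sum>u\<in>U. \<Sum>w\<in>C. \<Sum>x\<in>A. \<Sum>y\<in>B. F u w x y) = (\<Sum>w\<in>C. \<Sum>u\<in>U. \<Sum>x\<in>A. \<Sum>y\<in>B. F u w x y)"
    by (rule sum.swap)
  also have "\<dots> = (\<Sum>w\<in>C. \<Sum>x\<in>A. \<Sum>u\<in>U. \<Sum>y\<in>B. F u w x y)" by (intro sum.cong refl sum.swap)
  also have "\<dots> = (\<Sum>x\<in>A. \<Sum>w\<in>C. \<Sum>u\<in>U. \<Sum>y\<in>B. F u w x y)" by (rule sum.swap)
  also have "\<dots> = (\<Sum>x\<in>A. \<Sum>w\<in>C. \<Sum>y\<in>B. \<Sum>u\<in>U. F u w x y)" by (intro sum.cong refl sum.swap)
  also have "\<dots> = (\<Sum>x\<in>A. \<Sum>y\<in>B. \<Sum>w\<in>C. \<Sum>u\<in>U. F u w x y)" by (intro sum.cong refl sum.swap)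
  finally show ?thesis .
qed

lemma sum_swap3:
  "(\<Sum>y\<in>B. \<Sum>w\<in>C. \<Sum>v\<in>D. F y w v) = (\<Sum>v\<in>D. \<Sum>y\<in>B. \<Sum>w\<in>C. F y w v)"
proof -
  have "(\<Sum>y\<in>B. \<Sum>w\<in>C. \<Sum>v\<in>D. F y w v) = (\<Sum>y\<in>B. \<Sum>v\<in>D. \<Sum>w\<in>C. F y w v)"
    by (intro sum.cong refl sum.swap)
  also have "\<dots> = (\<Sum>v\<in>D. \<Sum>y\<in>B. \<Sum>w\<in>C. F y w v)" by (rule sum.swap)
  finally show ?thesis .
qed

lemma monoid_algebra_ring:
  fixes M :: "('m, 'q) monoid_scheme"
  assumes "Group.monoid M"
  shows "ring (monoid_algebra M :: ('m \<Rightarrow> 'k::field) ring)"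
proof -
  interpret monoid M by fact
  let ?R = "monoid_algebra M :: ('m \<Rightarrow> 'k) ring"
  have mem: "a \<in> carrier ?R \<longleftrightarrow> finite {x. a x \<noteq> 0} \<and> {x. a x \<noteq> 0} \<subseteq> carrier M" for a
    by (simp add: monoid_algebra_def)
  have add: "a \<oplus>\<^bsub>?R\<^esub> b = (\<lambda>x. a x + b x)" "\<zero>\<^bsub>?R\<^esub> = (\<lambda>_. 0)"
    "\<one>\<^bsub>?R\<^esub> = (\<lambda>x. if x = \<one>\<^bsub>M\<^esub> then 1 else 0)" for a b by (simp_all add: monoid_algebra_def)
  have addc: "a \<oplus>\<^bsub>?R\<^esub> b \<in> carrier ?R" if "a \<in> carrier ?R" "b \<in> carrier ?R" for a b
  proof -
    have "{x. a x + b x \<noteq> 0} \<subseteq> {x. a x \<noteq> 0} \<union> {x. b x \<noteq> 0}" by auto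
    moreover have "finite ({x. a x \<noteq> 0} \<union> {x. b x \<noteq> 0})" "{x. a x \<noteq> 0} \<union> {x. b x \<noteq> 0} \<subseteq> carrier M"
      using that by (auto simp: mem)
    ultimately show ?thesis unfolding mem add using finite_subset by (meson subset_trans)
  qed
  have supp: "{z. (a \<otimes>\<^bsub>?R\<^esub> b) z \<noteq> 0} \<subseteq> (\<lambda>(x, y). x \<otimes>\<^bsub>M\<^esub> y) ` ({x. a x \<noteq> 0} \<times> {y. b y \<noteq> 0})" for a b
  proof
    fix z assume "z \<in> {z. (a \<otimes>\<^bsub>?R\<^esub> b) z \<noteq> 0}"
    then have "(\<Sum>(x, y) \<in> {(x, y). a x \<noteq> 0 \<and> b y \<noteq> 0 \<and> x \<otimes>\<^bsub>M\<^esub> y = z}. a x * b y) \<noteq> 0"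
      by (simp add: monoid_algebra_def)
    then have "{(x, y). a x \<noteq> 0 \<and> b y \<noteq> 0 \<and> x \<otimes>\<^bsub>M\<^esub> y = z} \<noteq> {}"
      by (intro notI) simp
    then obtain p where "p \<in> {(x, y). a x \<noteq> 0 \<and> b y \<noteq> 0 \<and> x \<otimes>\<^bsub>M\<^esub> y = z}" by blast
    then show "z \<in> (\<lambda>(x, y). x \<otimes>\<^bsub>M\<^esub> y) ` ({x. a x \<noteq> 0} \<times> {y. b y \<noteq> 0})" by auto
  qed
  have multc: "a \<otimes>\<^bsub>?R\<^esub> b \<in> carrier ?R" if "a \<in> carrier ?R" "b \<in> carrier ?R" for a b
    unfolding mem
  proof
    show "finite {x. (a \<otimes>\<^bsub>?R\<^esub> b) x \<noteq> 0}"
      by (rule finite_subset[OF supp]) (use that in \<open>auto simp: mem\<close>)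
    show "{x. (a \<otimes>\<^bsub>?R\<^esub> b) x \<noteq> 0} \<subseteq> carrier M"
      by (rule subset_trans[OF supp]) (use that in \<open>auto simp: mem subset_iff\<close>)
  qed
  have onec: "\<one>\<^bsub>?R\<^esub> \<in> carrier ?R" by (auto simp: mem add)
  show ?thesis
  proof (rule ringI)
    show "abelian_group ?R"
    proof (rule abelian_groupI)
      fix x assume x: "x \<in> carrier ?R"
      show "\<exists>y\<in>carrier ?R. y \<oplus>\<^bsub>?R\<^esub> x = \<zero>\<^bsub>?R\<^esub>"
        by (rule bexI[of _ "\<lambda>z. - x z"]) (use x in \<open>auto simp: mem add\<close>)
    qed (simp_all add: addc, auto simp: add mem)
    show "Group.monoid ?R"
    proof (rule monoidI)
      fix a b c assume abc: "a \<in> carrier ?R" "b \<in> carrier ?R" "c \<in> carrier ?R"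
      let ?A = "{x. a x \<noteq> 0}" and ?B = "{x. b x \<noteq> 0}" and ?C = "{x. c x \<noteq> 0}"
      let ?AB = "(\<lambda>(x, y). x \<otimes>\<^bsub>M\<^esub> y) ` (?A \<times> ?B)" and ?BC = "(\<lambda>(x, y). x \<otimes>\<^bsub>M\<^esub> y) ` (?B \<times> ?C)"
      have fin: "finite ?A" "finite ?B" "finite ?C" "finite ?AB" "finite ?BC" using abc by (auto simp: mem)
      have sub: "x \<in> carrier M" if "x \<in> ?A \<union> ?B \<union> ?C" for x using that abc by (auto simp: mem)
      show "a \<otimes>\<^bsub>?R\<^esub> b \<otimes>\<^bsub>?R\<^esub> c = a \<otimes>\<^bsub>?R\<^esub> (b \<otimes>\<^bsub>?R\<^esub> c)"
      proof
        fix z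
        have "(a \<otimes>\<^bsub>?R\<^esub> b \<otimes>\<^bsub>?R\<^esub> c) z = (\<Sum>u\<in>?AB. \<Sum>w\<in>?C. if u \<otimes>\<^bsub>M\<^esub> w = z then (a \<otimes>\<^bsub>?R\<^esub> b) u * c w else 0)"
          by (rule monoid_algebra_mult[OF fin(4) fin(3) supp order_refl])
        also have "\<dots> = (\<Sum>u\<in>?AB. \<Sum>w\<in>?C. \<Sum>x\<in>?A. \<Sum>y\<in>?B. if u = x \<otimes>\<^bsub>M\<^esub> y then (if u \<otimes>\<^bsub>M\<^esub> w = z then a x * b y * c w else 0) else 0)"
        proof (intro sum.cong refl)
          fix u w
          show "(if u \<otimes>\<^bsub>M\<^esub> w = z then (a \<otimes>\<^bsub>?R\<^esub> b) u * c w else 0) =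
            (\<Sum>x\<in>?A. \<Sum>y\<in>?B. if u = x \<otimes>\<^bsub>M\<^esub> y then (if u \<otimes>\<^bsub>M\<^esub> w = z then a x * b y * c w else 0) else 0)"
          proof (cases "u \<otimes>\<^bsub>M\<^esub> w = z")
            case True
            then show ?thesis unfolding monoid_algebra_mult[OF fin(1,2) order_refl order_refl] sum_distrib_right if_P[OF True]
              by (intro sum.cong refl) simp
          next
            case False
            show ?thesis unfolding if_not_P[OF False] by simp
          qed
        qed
        also have "\<dots> = (\<Sum>x\<in>?A. \<Sum>y\<in>?B. \<Sum>w\<in>?C. \<Sum>u\<in>?AB. if u = x \<otimes>\<^bsub>M\<^esub> y then (if u \<otimes>\<^bsub>M\<^esub> w = z then a x * b y * c w else 0) else 0)"
          by (rule sum_swap4)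
        also have "\<dots> = (\<Sum>x\<in>?A. \<Sum>y\<in>?B. \<Sum>w\<in>?C. if x \<otimes>\<^bsub>M\<^esub> y \<otimes>\<^bsub>M\<^esub> w = z then a x * b y * c w else 0)"
          by (intro sum.cong refl) (subst sum.delta[OF fin(4)], auto)
        also have "\<dots> = (\<Sum>x\<in>?A. \<Sum>y\<in>?B. \<Sum>w\<in>?C. \<Sum>v\<in>?BC. if v = y \<otimes>\<^bsub>M\<^esub> w then (if x \<otimes>\<^bsub>M\<^esub> v = z then a x * (b y * c w) else 0) else 0)"
          by (intro sum.cong refl) (subst sum.delta[OF fin(5)], use sub in \<open>auto simp: m_assoc mult.assoc\<close>)
        also have "\<dots> = (\<Sum>x\<in>?A. \<Sum>v\<in>?BC. \<Sum>y\<in>?B. \<Sum>w\<in>?C. if v = y \<otimes>\<^bsub>M\<^esub> w then (if x \<otimes>\<^bsub>M\<^esub> v = z then a x * (b y * c w) else 0) else 0)"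
          by (intro sum.cong refl sum_swap3)
        also have "\<dots> = (\<Sum>x\<in>?A. \<Sum>v\<in>?BC. if x \<otimes>\<^bsub>M\<^esub> v = z then a x * (b \<otimes>\<^bsub>?R\<^esub> c) v else 0)"
        proof (intro sum.cong refl)
          fix x v
          show "(\<Sum>y\<in>?B. \<Sum>w\<in>?C. if v = y \<otimes>\<^bsub>M\<^esub> w then (if x \<otimes>\<^bsub>M\<^esub> v = z then a x * (b y * c w) else 0) else 0) =
            (if x \<otimes>\<^bsub>M\<^esub> v = z then a x * (b \<otimes>\<^bsub>?R\<^esub> c) v else 0)"
          proof (cases "x \<otimes>\<^bsub>M\<^esub> v = z")
            case True
            then show ?thesis unfolding monoid_algebra_mult[OF fin(2,3) order_refl order_refl] sum_distrib_left if_P[OF True]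
              by (intro sum.cong refl) simp
          next
            case False
            show ?thesis unfolding if_not_P[OF False] by simp
          qed
        qed
        also have "\<dots> = (a \<otimes>\<^bsub>?R\<^esub> (b \<otimes>\<^bsub>?R\<^esub> c)) z"
          by (rule monoid_algebra_mult[OF fin(1) fin(5) order_refl supp, symmetric])
        finally show "(a \<otimes>\<^bsub>?R\<^esub> b \<otimes>\<^bsub>?R\<^esub> c) z = (a \<otimes>\<^bsub>?R\<^esub> (b \<otimes>\<^bsub>?R\<^esub> c)) z" .
      qed
    next
      fix a assume a: "a \<in> carrier ?R"
      let ?A = "{x. a x \<noteq> 0}"
      have A: "finite ?A" "\<And>x. a x \<noteq> 0 \<Longrightarrow> x \<in> carrier M" using a by (auto simp: mem)
      have o: "{x. \<one>\<^bsub>?R\<^esub> x \<noteq> 0} \<subseteq> {\<one>\<^bsub>M\<^esub>}" "\<one>\<^bsub>?R\<^esub> \<one>\<^bsub>M\<^esub> = 1" by (auto simp: add)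
      show "\<one>\<^bsub>?R\<^esub> \<otimes>\<^bsub>?R\<^esub> a = a"
      proof
        fix z
        have "(\<one>\<^bsub>?R\<^esub> \<otimes>\<^bsub>?R\<^esub> a) z = (\<Sum>y\<in>?A. if \<one>\<^bsub>M\<^esub> \<otimes>\<^bsub>M\<^esub> y = z then a y else 0)"
          by (subst monoid_algebra_mult[OF _ A(1) o(1) order_refl]) (auto simp: o cong: if_cong)
        also have "\<dots> = (\<Sum>y\<in>?A. if y = z then a y else 0)" by (intro sum.cong) (auto simp: A)
        also have "\<dots> = a z" using A(1) by (simp add: sum.delta')
        finally show "(\<one>\<^bsub>?R\<^esub> \<otimes>\<^bsub>?R\<^esub> a) z = a z" .
      qed
      show "a \<otimes>\<^bsub>?R\<^esub> \<one>\<^bsub>?R\<^esub> = a"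
      proof
        fix z
        have "(a \<otimes>\<^bsub>?R\<^esub> \<one>\<^bsub>?R\<^esub>) z = (\<Sum>y\<in>?A. if y \<otimes>\<^bsub>M\<^esub> \<one>\<^bsub>M\<^esub> = z then a y else 0)"
          by (subst monoid_algebra_mult[OF A(1) _ order_refl o(1)]) (auto simp: o cong: if_cong)
        also have "\<dots> = (\<Sum>y\<in>?A. if y = z then a y else 0)" by (intro sum.cong) (auto simp: A)
        also have "\<dots> = a z" using A(1) by (simp add: sum.delta')
        finally show "(a \<otimes>\<^bsub>?R\<^esub> \<one>\<^bsub>?R\<^esub>) z = a z" .
      qed
    qed (simp_all add: multc onec)
    fix a b c assume abc: "a \<in> carrier ?R" "b \<in> carrier ?R" "c \<in> carrier ?R"
    let ?A = "{x. a x \<noteq> 0} \<union> {x. b x \<noteq> 0}" and ?C = "{x. c x \<noteq> 0}"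
    have fin: "finite ?A" "finite ?C" using abc by (auto simp: mem)
    have sub: "{x. a x \<noteq> 0} \<subseteq> ?A" "{x. b x \<noteq> 0} \<subseteq> ?A" "{x. (a \<oplus>\<^bsub>?R\<^esub> b) x \<noteq> 0} \<subseteq> ?A" by (auto simp: add)
    note m = monoid_algebra_mult[OF fin(1,2) _ order_refl] monoid_algebra_mult[OF fin(2,1) order_refl]
    show "(a \<oplus>\<^bsub>?R\<^esub> b) \<otimes>\<^bsub>?R\<^esub> c = a \<otimes>\<^bsub>?R\<^esub> c \<oplus>\<^bsub>?R\<^esub> b \<otimes>\<^bsub>?R\<^esub> c"
      unfolding add(1)[of "a \<otimes>\<^bsub>?R\<^esub> c"]
    proof
      fix z
      show "((a \<oplus>\<^bsub>?R\<^esub> b) \<otimes>\<^bsub>?R\<^esub> c) z = (a \<otimes>\<^bsub>?R\<^esub> c) z + (b \<otimes>\<^bsub>?R\<^esub> c) z"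
        unfolding m(1)[OF sub(1)] m(1)[OF sub(2)] m(1)[OF sub(3)] sum.distrib[symmetric]
        by (intro sum.cong refl) (simp add: add distrib_right)
    qed
    show "c \<otimes>\<^bsub>?R\<^esub> (a \<oplus>\<^bsub>?R\<^esub> b) = c \<otimes>\<^bsub>?R\<^esub> a \<oplus>\<^bsub>?R\<^esub> c \<otimes>\<^bsub>?R\<^esub> b"
      unfolding add(1)[of "c \<otimes>\<^bsub>?R\<^esub> a"]
    proof
      fix z
      show "(c \<otimes>\<^bsub>?R\<^esub> (a \<oplus>\<^bsub>?R\<^esub> b)) z = (c \<otimes>\<^bsub>?R\<^esub> a) z + (c \<otimes>\<^bsub>?R\<^esub> b) z"
        unfolding m(2)[OF sub(1)] m(2)[OF sub(2)] m(2)[OF sub(3)] sum.distrib[symmetric]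
        by (intro sum.cong refl) (simp add: add distrib_left)
    qed
  qed
qed

lemma matrix_monoid: "Group.monoid (matrix_monoid n :: 'f::field mat ring)"
  using ring.axioms(2)[OF ring_mat[where 'a = 'f]] .

lemma compose_affine_transformation:
  assumes "A \<in> carrier_mat n n" "A' \<in> carrier_mat n n" "b \<in> carrier_vec n" "b' \<in> carrier_vec n"
  shows "compose (carrier_vec n) (affine_transformation n A b) (affine_transformation n A' b') =
    affine_transformation n (A * A') (A *\<^sub>v b' + b)"
proof
  fix x
  show "compose (carrier_vec n) (affine_transformation n A b) (affine_transformation n A' b') x =
    affine_transformation n (A * A') (A *\<^sub>v b' + b) x"
  proof (cases "x \<in> carrier_vec n")
    case True
    then have "A' *\<^sub>v x \<in> carrier_vec n" using assms by auto
    then show ?thesis using assms True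
      by (auto simp: compose_def affine_transformation_def mult_add_distrib_mat_vec[of A n n]
          assoc_mult_mat_vec[of A n n] assoc_add_vec[of _ n])
  qed (auto simp: compose_def affine_transformation_def)
qed

lemma affine_transformation_one: "affine_transformation n (1\<^sub>m n) (0\<^sub>v n) = (\<lambda>x\<in>carrier_vec n. x)"
  by (auto simp: affine_transformation_def)

lemma affine_monoid: "Group.monoid (affine_monoid n :: ('f::field vec \<Rightarrow> 'f vec) monoid)"
proof (rule monoidI)
  let ?M = "affine_monoid n :: ('f vec \<Rightarrow> 'f vec) monoid"
  fix x y assume "x \<in> carrier ?M" "y \<in> carrier ?M"
  then obtain A b A' b' where *: "x = affine_transformation n A b" "y = affine_transformation n A' b'"
    "A \<in> carrier_mat n n" "A' \<in> carrier_mat n n" "b \<in> carrier_vec n" "b' \<in> carrier_vec n"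
    by (auto simp: affine_monoid_def)
  then show "x \<otimes>\<^bsub>?M\<^esub> y \<in> carrier ?M"
    by (simp add: affine_monoid_def compose_affine_transformation)
      (intro exI conjI, rule refl, auto)
next
  let ?M = "affine_monoid n :: ('f vec \<Rightarrow> 'f vec) monoid"
  show "\<one>\<^bsub>?M\<^esub> \<in> carrier ?M"
    using affine_transformation_one[of n, symmetric]
    by (auto simp: affine_monoid_def intro!: exI[of _ "1\<^sub>m n"] exI[of _ "0\<^sub>v n"])
  fix x y z :: "'f vec \<Rightarrow> 'f vec"
  assume "x \<in> carrier ?M" "y \<in> carrier ?M" "z \<in> carrier ?M"
  then have f: "x \<in> carrier_vec n \<rightarrow>\<^sub>E carrier_vec n" "y \<in> carrier_vec n \<rightarrow>\<^sub>E carrier_vec n"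
     "z \<in> carrier_vec n \<rightarrow>\<^sub>E carrier_vec n"
    by (auto simp: affine_monoid_def affine_transformation_def)
  then show "x \<otimes>\<^bsub>?M\<^esub> y \<otimes>\<^bsub>?M\<^esub> z = x \<otimes>\<^bsub>?M\<^esub> (y \<otimes>\<^bsub>?M\<^esub> z)"
    unfolding affine_monoid_def by (auto intro!: compose_assoc[symmetric])
next
  let ?M = "affine_monoid n :: ('f vec \<Rightarrow> 'f vec) monoid"
  fix x :: "'f vec \<Rightarrow> 'f vec" assume "x \<in> carrier ?M"
  then have f: "x \<in> carrier_vec n \<rightarrow>\<^sub>E carrier_vec n"
    by (auto simp: affine_monoid_def affine_transformation_def)
  then show "\<one>\<^bsub>?M\<^esub> \<otimes>\<^bsub>?M\<^esub> x = x" "x \<otimes>\<^bsub>?M\<^esub> \<one>\<^bsub>?M\<^esub> = x"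
    by (auto simp: affine_monoid_def compose_def fun_eq_iff PiE_iff extensional_def)
qed

lemma linear_part_affine_transformation:
  assumes "A \<in> carrier_mat n n" "b \<in> carrier_vec n"
  shows "linear_part n (affine_transformation n A b) = A"
  unfolding linear_part_def
proof (rule the_equality)
  show "A \<in> carrier_mat n n \<and> (\<exists>c\<in>carrier_vec n. affine_transformation n A b = affine_transformation n A c)"
    using assms by auto
  fix A' assume "A' \<in> carrier_mat n n \<and> (\<exists>c\<in>carrier_vec n. affine_transformation n A b = affine_transformation n A' c)"
  then obtain c where A': "A' \<in> carrier_mat n n" and c: "c \<in> carrier_vec n"
    and eq: "affine_transformation n A b = affine_transformation n A' c" by auto
  have *: "A *\<^sub>v x + b = A' *\<^sub>v x + c" if "x \<in> carrier_vec n" for x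
    using fun_cong[OF eq, of x] that by (simp add: affine_transformation_def)
  have "A *\<^sub>v 0\<^sub>v n = 0\<^sub>v n" "A' *\<^sub>v 0\<^sub>v n = 0\<^sub>v n" using assms A' by auto
  then have "b = c" using *[of "0\<^sub>v n"] assms c by auto
  show "A' = A"
  proof (rule eq_matI)
    fix i j assume "i < dim_row A" "j < dim_col A"
    then have ij: "i < n" "j < n" "i < dim_row A" "i < dim_row A'" "i < dim_vec c" using A' assms c by auto
    have "(A *\<^sub>v unit_vec n j + c) $ i = (A' *\<^sub>v unit_vec n j + c) $ i"
      using *[of "unit_vec n j"] \<open>b = c\<close> by simp
    then have "row A i \<bullet> unit_vec n j = row A' i \<bullet> unit_vec n j"
      using ij by simp
    then show "A' $$ (i, j) = A $$ (i, j)"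
      using ij assms A' by (simp add: scalar_prod_right_unit)
  qed (use assms A' in auto)
qed

lemma linear_part_hom: "linear_part n \<in> hom (affine_monoid n) (matrix_monoid n)"
  "linear_part n \<one>\<^bsub>affine_monoid n\<^esub> = 1\<^sub>m n"
  using linear_part_affine_transformation[of "1\<^sub>m n" n "0\<^sub>v n"]
  by (auto simp: affine_monoid_def affine_transformation_one intro!: homI)
    (auto simp: ring_mat_simps compose_affine_transformation linear_part_affine_transformation)

end

theory Submission
  imports Defs
begin

text \<open>The projection \<open>\<pi> : K Aff(n, q) \<rightarrow> K M\<^sub>n\<close> has a section \<open>s\<close>, and the average \<open>e\<close> of all translations
  exists because \<open>q\<close> is invertible in \<open>K\<close>. It is an idempotent with \<open>e s(\<pi> a) = e a\<close>, hence
  \<open>P \<mapsto> e P\<close> is exact, sends projective \<open>K Aff(n, q)\<close>-modules to projective \<open>K M\<^sub>n\<close>-modules and is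
  left adjoint to inflation, so it turns a projective resolution of an inflated module \<open>V\<close> into one
  of \<open>V\<close> with the same cochain complex into \<open>W\<close>.

  The vanishing follows from semisimplicity of \<open>K M\<^sub>n\<close>. By Kovacs's theorem the ideal spanned by
  the singular matrices has an identity \<open>\<epsilon>\<close>; it is obtained here from an alternating sum over
  chains of subspaces, with a sign-reversing involution on chains. The ideal is
  generated by the idempotent \<open>f\<close> of rank \<open>n - 1\<close>, and \<open>f K M\<^sub>n f = K M\<^bsub>n-1\<^esub>\<close>, so splittings over
  \<open>K M\<^bsub>n-1\<^esub>\<close> are transported to \<open>\<epsilon> K M\<^sub>n\<close>, while Maschke's averaging applies on
  the complement \<open>(1 - \<epsilon>) K M\<^sub>n\<close>, where the singular matrices act as zero.\<close>

section \<open>Chains of subspaces and the singular matrices\<close>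

text \<open>Invertibility of q in K serves twice. There are q^n translations, and x \<mapsto> Ax + b
  is translation by b after A, so the average e absorbs b. The endomorphisms allowed by a chain form
  a coset of an additive group of matrices, so their number divides q^(n*n), and 1 - \<epsilon> can
  be defined as the alternating sum of the averages over these cosets. The chain with the whole
  space as its only member contributes the identity matrix, every other chain only singular ones. If
  a is singular, its image lies in a hyperplane U and x a depends only on the restriction of x to U;
  two chains that allow the same restrictions to U cancel. This kills singular matrices from one
  side, transposition gives an element for the other side, and the two elements coincide.

  \<open>Ext\<close> is built from one chosen resolution whose elements have a type that depends on
  the ring and on the module. The resolutions over the two algebras have different types, so
  independence of the resolution is needed across types before e P can be compared with the chosen
  resolution of V.\<close>

text \<open>A chain \<open>C\<close> of subspaces prescribes where an endomorphism may send \<open>v\<close>: vectors of the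
  smallest member are fixed, and every other vector drops into a strictly smaller member.\<close>

definition flag_ok :: "'a set set \<Rightarrow> 'a \<Rightarrow> 'a \<Rightarrow> bool" where
  "flag_ok C v y \<longleftrightarrow> (if v \<in> \<Inter>C then y = v else \<exists>H\<in>C. v \<notin> H \<and> y \<in> H)"

definition vec_subspace :: "nat \<Rightarrow> 'f::field vec set \<Rightarrow> bool" where
  "vec_subspace n S \<longleftrightarrow> S \<subseteq> carrier_vec n \<and> 0\<^sub>v n \<in> S \<and>
    (\<forall>x\<in>S. \<forall>y\<in>S. x + y \<in> S) \<and> (\<forall>c. \<forall>x\<in>S. c \<cdot>\<^sub>v x \<in> S)"

definition subspace_chains :: "nat \<Rightarrow> 'f::field vec set set set" where
  "subspace_chains n = {C. carrier_vec n \<in> C \<and> (\<forall>S\<in>C. vec_subspace n S) \<and>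
    (\<forall>S\<in>C. \<forall>T\<in>C. S \<subseteq> T \<or> T \<subseteq> S)}"

definition flag_mats :: "nat \<Rightarrow> 'f::field vec set set \<Rightarrow> 'f mat set" where
  "flag_mats n C = {x \<in> carrier_mat n n. \<forall>v\<in>carrier_vec n. flag_ok C v (x *\<^sub>v v)}"

section \<open>Linear algebra of the conditions imposed by a chain\<close>

lemma vec_subspace_cancel:
  fixes u w :: "'f::field vec"
  assumes S: "vec_subspace n S" and u: "u \<in> carrier_vec n" and w: "w \<in> carrier_vec n" and "w \<in> S \<or> c = 0"
  shows "u + c \<cdot>\<^sub>v w \<in> S \<longleftrightarrow> u \<in> S"
proof
  have cw: "c \<cdot>\<^sub>v w \<in> S"
  proof (cases "c = 0")
    case True
    then have "c \<cdot>\<^sub>v w = 0\<^sub>v n" using w by auto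
    then show ?thesis using S by (simp add: vec_subspace_def)
  qed (use assms(4) S in \<open>auto simp: vec_subspace_def\<close>)
  then show "u \<in> S \<Longrightarrow> u + c \<cdot>\<^sub>v w \<in> S" using S by (auto simp: vec_subspace_def)
  assume "u + c \<cdot>\<^sub>v w \<in> S"
  then have "(u + c \<cdot>\<^sub>v w) + (-1) \<cdot>\<^sub>v (c \<cdot>\<^sub>v w) \<in> S" using cw S by (auto simp: vec_subspace_def)
  also have "(u + c \<cdot>\<^sub>v w) + (-1) \<cdot>\<^sub>v (c \<cdot>\<^sub>v w) = u" using u w by auto
  finally show "u \<in> S" .
qed

lemma vec_subspace_cancel':
  fixes u w :: "'f::field vec"
  assumes S: "vec_subspace n S" and u: "u \<in> S" and w: "w \<in> carrier_vec n" and "c \<noteq> 0"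
  shows "u + c \<cdot>\<^sub>v w \<in> S \<longleftrightarrow> w \<in> S"
proof
  show "w \<in> S \<Longrightarrow> u + c \<cdot>\<^sub>v w \<in> S" using S u by (auto simp: vec_subspace_def)
  have u': "u \<in> carrier_vec n" using S u by (auto simp: vec_subspace_def)
  assume "u + c \<cdot>\<^sub>v w \<in> S"
  then have "inverse c \<cdot>\<^sub>v ((u + c \<cdot>\<^sub>v w) + (-1) \<cdot>\<^sub>v u) \<in> S" using u S by (auto simp: vec_subspace_def)
  also have "inverse c \<cdot>\<^sub>v ((u + c \<cdot>\<^sub>v w) + (-1) \<cdot>\<^sub>v u) = w" using u' w \<open>c \<noteq> 0\<close> by auto
  finally show "w \<in> S" .
qed


lemma flag_ok_carrier:
  assumes "C \<in> subspace_chains n" "v \<in> carrier_vec n" "flag_ok C v y"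
  shows "y \<in> carrier_vec n"
  using assms by (auto simp: flag_ok_def subspace_chains_def vec_subspace_def split: if_splits)

text \<open>The three members of the chain that witness the premises avoid v, and the largest of
  them contains a, b and c, so it is a witness for the combination. The coefficients of the
  combination add up to 1, which keeps the vectors of the smallest member fixed.\<close>

lemma flag_ok_affine:
  fixes v :: "'f::field vec"
  assumes C: "C \<in> subspace_chains n" and v: "v \<in> carrier_vec n"
    and "flag_ok C v a" "flag_ok C v b" "flag_ok C v c"
  shows "flag_ok C v (a + b - c)"
proof (cases "v \<in> \<Inter>C")
  case True
  then show ?thesis using assms by (auto simp: flag_ok_def)
next
  case False
  have ch: "\<forall>S\<in>C. \<forall>T\<in>C. S \<subseteq> T \<or> T \<subseteq> S" using C by (simp add: subspace_chains_def)
  from False assms(3-5) obtain H1 H2 H3 where H: "H1 \<in> C" "v \<notin> H1" "a \<in> H1" "H2 \<in> C" "v \<notin> H2" "b \<in> H2"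
    "H3 \<in> C" "v \<notin> H3" "c \<in> H3" unfolding flag_ok_def if_not_P[OF False] by blast
  obtain H' where "H' \<in> C" "v \<notin> H'" "H1 \<subseteq> H'" "H2 \<subseteq> H'" using ch H by (metis order_refl)
  moreover from this obtain H where "H \<in> C" "v \<notin> H" "H' \<subseteq> H" "H3 \<subseteq> H" using ch H by (metis order_refl)
  ultimately have "H \<in> C" "v \<notin> H" "a \<in> H" "b \<in> H" "c \<in> H" using H by auto
  then have S: "vec_subspace n H" and abc: "a \<in> H" "b \<in> H" "c \<in> H" using C by (auto simp: subspace_chains_def)
  then have "a + b + (-1) \<cdot>\<^sub>v c \<in> H" by (auto simp: vec_subspace_def)
  also have "a + b + (-1) \<cdot>\<^sub>v c = a + b - c" using S abc by (intro eq_vecI) (auto simp: vec_subspace_def subset_iff)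
  finally show ?thesis using \<open>H \<in> C\<close> \<open>v \<notin> H\<close> False by (auto simp: flag_ok_def)
qed

text \<open>Every vector has an admissible image, because zero lies in all members of the
  chain.\<close>

lemma flag_ok_ex:
  assumes "C \<in> subspace_chains n" "v \<in> carrier_vec n"
  shows "flag_ok C v (if v \<in> \<Inter>C then v else 0\<^sub>v n)"
  using assms by (auto simp: flag_ok_def subspace_chains_def vec_subspace_def)

text \<open>Values on a hyperplane \<open>U\<close> and on a vector \<open>w\<close> that lies in every member not contained in
  \<open>U\<close> can be chosen independently.\<close>

lemma flag_ok_mix:
  fixes u w :: "'f::field vec"
  assumes C: "C \<in> subspace_chains n" and U: "vec_subspace n U" and w: "w \<in> carrier_vec n" "w \<notin> U"
    and wC: "\<And>H. H \<in> C \<Longrightarrow> \<not> H \<subseteq> U \<Longrightarrow> w \<in> H"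
    and u: "u \<in> U" and a: "flag_ok C u a" and b: "flag_ok C w b"
  shows "flag_ok C (u + c \<cdot>\<^sub>v w) (a + c \<cdot>\<^sub>v b)"
proof (cases "c = 0")
  case True
  have "u \<in> carrier_vec n" using U u by (auto simp: vec_subspace_def)
  moreover have "a \<in> carrier_vec n" "b \<in> carrier_vec n"
    using flag_ok_carrier[OF C calculation a] flag_ok_carrier[OF C w(1) b] .
  ultimately have "u + c \<cdot>\<^sub>v w = u" "a + c \<cdot>\<^sub>v b = a" using True w by auto
  then show ?thesis using a by simp
next
  case c: False
  have ch: "\<forall>S\<in>C. \<forall>T\<in>C. S \<subseteq> T \<or> T \<subseteq> S" using C by (simp add: subspace_chains_def)
  have sub: "vec_subspace n H" if "H \<in> C" for H using C that by (simp add: subspace_chains_def)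
  have uc: "u \<in> carrier_vec n" using U u by (auto simp: vec_subspace_def)
  have ac: "a \<in> carrier_vec n" and bc: "b \<in> carrier_vec n"
    using flag_ok_carrier[OF C uc a] flag_ok_carrier[OF C w(1) b] .
  let ?v = "u + c \<cdot>\<^sub>v w"
  have vU: "?v \<notin> U" using vec_subspace_cancel'[OF U u w(1) c] w(2) by simp
  \<comment> \<open>For nonzero c the vector has left U, so members inside U avoid it. The other
    members contain w and cannot distinguish it from u.\<close>
  have vH: "?v \<notin> H" if "H \<in> C" "u \<notin> H" for H
  proof (cases "H \<subseteq> U")
    case False
    then show ?thesis using wC[OF that(1)] that vec_subspace_cancel[OF sub[OF that(1)] uc w(1)] by simp
  qed (use vU in blast)
  \<comment> \<open>If w must be fixed, adding multiples of w changes no membership. Otherwise w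
    drops into a member H2, which lies inside U, and the larger of H2 and the member that u drops
    into serves for the sum.\<close>
  show ?thesis
  proof (cases "w \<in> \<Inter>C")
    case wI: True
    then have bw: "b = w" using b by (simp add: flag_ok_def)
    have iff: "?v \<in> H \<longleftrightarrow> u \<in> H" "a + c \<cdot>\<^sub>v w \<in> H \<longleftrightarrow> a \<in> H" if "H \<in> C" for H
      using vec_subspace_cancel[OF sub[OF that] uc w(1)] vec_subspace_cancel[OF sub[OF that] ac w(1)] wI that by blast+
    have "?v \<in> \<Inter>C \<longleftrightarrow> u \<in> \<Inter>C" using iff(1) by simp
    then show ?thesis using a iff unfolding bw flag_ok_def by (cases "u \<in> \<Inter>C") auto
  next
    case False
    with b obtain H2 where H2: "H2 \<in> C" "w \<notin> H2" "b \<in> H2"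
      unfolding flag_ok_def if_not_P[OF False] by blast
    then have "H2 \<subseteq> U" using wC by blast
    then have v2: "?v \<notin> H2" using vU by blast
    have "\<exists>H\<in>C. ?v \<notin> H \<and> a \<in> H \<and> b \<in> H"
    proof (cases "u \<in> \<Inter>C")
      case True
      then have "a = u" "u \<in> H2" using a H2(1) unfolding flag_ok_def if_P[OF True] by blast+
      then show ?thesis using H2 v2 by blast
    next
      case False
      with a obtain H where H: "H \<in> C" "u \<notin> H" "a \<in> H"
        unfolding flag_ok_def if_not_P[OF False] by blast
      have "H \<subseteq> H2 \<or> H2 \<subseteq> H" using ch H(1) H2(1) by blast
      then show ?thesis using H vH[OF H(1,2)] H2 v2 by blast
    qed
    then obtain H where H: "H \<in> C" "?v \<notin> H" "a \<in> H" "b \<in> H" by blast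
    then have "a + c \<cdot>\<^sub>v b \<in> H" using sub[OF H(1)] unfolding vec_subspace_def by blast
    moreover have "?v \<notin> \<Inter>C" using H by blast
    ultimately show ?thesis using H unfolding flag_ok_def by auto
  qed
qed

text \<open>A vector of U lies in F \<inter> U exactly when it lies in F, so a witness F \<inter> U
  can be replaced by F, which is in the chain already.\<close>

lemma flag_ok_toggle:
  assumes "F \<in> C" "u \<in> U"
  shows "flag_ok (insert (F \<inter> U) C) u y \<longleftrightarrow> flag_ok C u y"
proof -
  have "u \<in> \<Inter>(insert (F \<inter> U) C) \<longleftrightarrow> u \<in> \<Inter>C" using assms by auto
  moreover have "(\<exists>H\<in>insert (F \<inter> U) C. u \<notin> H \<and> y \<in> H) \<longleftrightarrow> (\<exists>H\<in>C. u \<notin> H \<and> y \<in> H)" using assms by auto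
  ultimately show ?thesis by (auto simp: flag_ok_def)
qed

text \<open>The sign-reversing involution toggles \<open>F \<inter> U\<close>, where \<open>F\<close> is the smallest member of the chain
  not contained in the hyperplane \<open>U\<close>.\<close>

definition pivot_space :: "'a set \<Rightarrow> 'a set set \<Rightarrow> 'a set" where
  "pivot_space U C = \<Inter>{H \<in> C. \<not> H \<subseteq> U}"

definition toggle :: "'a set \<Rightarrow> 'a set set \<Rightarrow> 'a set set" where
  "toggle U C = (let T = pivot_space U C \<inter> U in if T \<in> C then C - {T} else insert T C)"

section \<open>The involution on chains over a finite field\<close>

lemma chain_Inter_mem:
  "finite D \<Longrightarrow> D \<noteq> {} \<Longrightarrow> \<forall>S\<in>D. \<forall>T\<in>D. S \<subseteq> T \<or> T \<subseteq> S \<Longrightarrow> \<Inter>D \<in> D"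
proof (induction D rule: finite_ne_induct)
  case (insert x F)
  then have "\<Inter>F \<in> F" by blast
  then have "x \<subseteq> \<Inter>F \<or> \<Inter>F \<subseteq> x" using insert.prems by blast
  then have "x \<inter> \<Inter>F = x \<or> x \<inter> \<Inter>F = \<Inter>F" by blast
  then show ?case using \<open>\<Inter>F \<in> F\<close> by auto
qed auto

lemma finite_carrier_vec: "finite (carrier_vec n :: 'f::{finite} vec set)"
proof -
  have "carrier_vec n \<subseteq> vec_of_list ` {xs :: 'f list. set xs \<subseteq> UNIV \<and> length xs = n}"
  proof
    fix v :: "'f vec" assume "v \<in> carrier_vec n"
    then have "v = vec_of_list (list_of_vec v)" "length (list_of_vec v) = n" by (auto simp: vec_list)
    then show "v \<in> vec_of_list ` {xs. set xs \<subseteq> UNIV \<and> length xs = n}" by auto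
  qed
  then show ?thesis by (rule finite_subset) (intro finite_imageI finite_lists_length_eq finite)
qed

lemma finite_subspace_chains: "finite (subspace_chains n :: 'f::{field,finite} vec set set set)"
proof -
  have "(subspace_chains n :: 'f vec set set set) \<subseteq> Pow (Pow (carrier_vec n))"
    by (auto simp: subspace_chains_def vec_subspace_def)
  then show ?thesis by (rule finite_subset) (simp add: finite_carrier_vec)
qed

lemma finite_chain:
  assumes "C \<in> subspace_chains n" shows "finite (C :: 'f::{field,finite} vec set set)"
proof -
  have "C \<subseteq> Pow (carrier_vec n)" using assms by (auto simp: subspace_chains_def vec_subspace_def)
  then show ?thesis by (rule finite_subset) (simp add: finite_carrier_vec)
qed

text \<open>Over a finite field chains are finite, so the intersection of the members not inside U
  is itself one of them. The whole space is such a member, hence there is at least one.\<close>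

lemma pivot_space:
  fixes C :: "'f::{field,finite} vec set set"
  assumes C: "C \<in> subspace_chains n" and U: "vec_subspace n U" "U \<noteq> carrier_vec n"
  shows "pivot_space U C \<in> C" "\<not> pivot_space U C \<subseteq> U"
    "\<And>H. H \<in> C \<Longrightarrow> \<not> H \<subseteq> U \<Longrightarrow> pivot_space U C \<subseteq> H"
proof -
  let ?D = "{H \<in> C. \<not> H \<subseteq> U}"
  have "carrier_vec n \<in> ?D" using C U by (auto simp: subspace_chains_def vec_subspace_def)
  moreover have "finite ?D" using finite_chain[OF C] by simp
  ultimately have "\<Inter>?D \<in> ?D"
    using C by (intro chain_Inter_mem) (auto simp: subspace_chains_def)
  then show "pivot_space U C \<in> C" "\<not> pivot_space U C \<subseteq> U" by (auto simp: pivot_space_def)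
  show "\<And>H. H \<in> C \<Longrightarrow> \<not> H \<subseteq> U \<Longrightarrow> pivot_space U C \<subseteq> H" by (auto simp: pivot_space_def)
qed

text \<open>The toggled member lies inside U, so the members not inside U remain the same. This is
  why toggling twice restores the chain.\<close>

lemma pivot_space_toggle:
  fixes C :: "'f::{field,finite} vec set set"
  shows "pivot_space U (toggle U C) = pivot_space U C"
proof -
  have "{H \<in> toggle U C. \<not> H \<subseteq> U} = {H \<in> C. \<not> H \<subseteq> U}" by (auto simp: toggle_def Let_def)
  then show ?thesis by (simp add: pivot_space_def)
qed

lemma toggle_toggle: "toggle U (toggle U C) = (C :: 'f::{field,finite} vec set set)"
  using pivot_space_toggle[of U C] by (auto simp: toggle_def Let_def)

text \<open>Members inside U lie in the pivot by nestedness and the other members contain it, so the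
  intersection of the pivot with U fits into the chain. This intersection is a proper subspace,
  hence the whole space is never removed.\<close>

lemma toggle_chain:
  fixes C :: "'f::{field,finite} vec set set"
  assumes C: "C \<in> subspace_chains n" and U: "vec_subspace n U" "U \<noteq> carrier_vec n"
  shows "toggle U C \<in> subspace_chains n"
proof -
  let ?F = "pivot_space U C"
  note F = pivot_space[OF C U]
  have FU: "?F \<inter> U \<noteq> carrier_vec n" using U by (auto simp: vec_subspace_def)
  have "vec_subspace n (?F \<inter> U)" using F(1) C U by (auto simp: subspace_chains_def vec_subspace_def)
  moreover have "H \<subseteq> ?F \<inter> U \<or> ?F \<inter> U \<subseteq> H" if "H \<in> C" for H
  proof (cases "H \<subseteq> U")
    case True
    then have "H \<subseteq> ?F" using F C that unfolding subspace_chains_def by blast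
    then show ?thesis using True by blast
  qed (use F(3)[OF that] in blast)
  ultimately show ?thesis using C FU by (auto simp: toggle_def Let_def subspace_chains_def)
qed

lemma card_toggle:
  fixes C :: "'f::{field,finite} vec set set"
  assumes C: "C \<in> subspace_chains n"
  shows "(-1 :: 'k::ring_1) ^ card (toggle U C) = - ((-1) ^ card C)"
proof -
  note f = finite_chain[OF C]
  show ?thesis
  proof (cases "pivot_space U C \<inter> U \<in> C")
    case True
    then have "card C = Suc (card (toggle U C))"
      using card.remove[OF f True] by (simp add: toggle_def)
    then show ?thesis by simp
  qed (use f in \<open>simp add: toggle_def\<close>)
qed

lemma flag_ok_toggle':
  fixes C :: "'f::{field,finite} vec set set"
  assumes C: "C \<in> subspace_chains n" and U: "vec_subspace n U" "U \<noteq> carrier_vec n" and u: "u \<in> U"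
  shows "flag_ok (toggle U C) u y \<longleftrightarrow> flag_ok C u y"
proof -
  let ?F = "pivot_space U C"
  note F = pivot_space[OF C U]
  show ?thesis
  proof (cases "?F \<inter> U \<in> C")
    case True
    have "insert (?F \<inter> U) (toggle U C) = C" "?F \<in> toggle U C" using True F by (auto simp: toggle_def)
    then show ?thesis using flag_ok_toggle[of ?F "toggle U C" u U y] u by simp
  qed (use flag_ok_toggle[OF F(1) u] in \<open>simp add: toggle_def\<close>)
qed

section \<open>Counting the matrices adapted to a chain\<close>

lemma finite_carrier_mat: "finite (carrier_mat n m :: 'f::finite mat set)"
  and card_carrier_mat: "card (carrier_mat n m :: 'f::finite mat set) = CARD('f) ^ (n * m)"
proof -
  let ?I = "{..<n} \<times> {..<m}" and ?h = "\<lambda>f. mat n m f :: 'f mat"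
  have img: "carrier_mat n m = ?h ` (?I \<rightarrow>\<^sub>E UNIV)"
  proof (intro equalityI subsetI)
    fix A :: "'f mat" assume A: "A \<in> carrier_mat n m"
    then have "A = ?h (restrict (\<lambda>ij. A $$ ij) ?I)" by (intro eq_matI) auto
    moreover have "restrict (\<lambda>ij. A $$ ij) ?I \<in> ?I \<rightarrow>\<^sub>E UNIV" by simp
    ultimately show "A \<in> ?h ` (?I \<rightarrow>\<^sub>E UNIV)" by blast
  qed auto
  have inj: "inj_on ?h (?I \<rightarrow>\<^sub>E UNIV)"
  proof (rule inj_onI)
    fix f g assume fg: "f \<in> ?I \<rightarrow>\<^sub>E UNIV" "g \<in> ?I \<rightarrow>\<^sub>E UNIV" and eq: "?h f = ?h g"
    show "f = g"
    proof (rule PiE_ext[OF fg])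
      fix ij assume "ij \<in> ?I"
      then show "f ij = g ij" using arg_cong[OF eq, of "\<lambda>A. A $$ ij"] by auto
    qed
  qed
  have fin: "finite (?I \<rightarrow>\<^sub>E (UNIV :: 'f set))" by (intro finite_PiE) auto
  then show "finite (carrier_mat n m :: 'f mat set)" unfolding img by simp
  show "card (carrier_mat n m :: 'f mat set) = CARD('f) ^ (n * m)"
    unfolding img card_image[OF inj] by (subst card_PiE) (auto simp: card_cartesian_product)
qed

lemma mat_eqI_vec:
  fixes A B :: "'f::field mat"
  assumes A: "A \<in> carrier_mat n m" and B: "B \<in> carrier_mat n m"
    and eq: "\<And>v. v \<in> carrier_vec m \<Longrightarrow> A *\<^sub>v v = B *\<^sub>v v"
  shows "A = B"
proof (rule eq_matI)
  fix i j assume ij: "i < dim_row B" "j < dim_col B"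
  then have "j < m" "i < n" using B by auto
  then have "(A *\<^sub>v unit_vec m j) $ i = (B *\<^sub>v unit_vec m j) $ i" using eq by simp
  then show "A $$ (i, j) = B $$ (i, j)" using A B \<open>j < m\<close> \<open>i < n\<close> by (simp add: scalar_prod_right_unit)
qed (use A B in auto)

lemma flag_mats_affine:
  fixes C :: "'f::field vec set set"
  assumes C: "C \<in> subspace_chains n" and x: "x \<in> flag_mats n C" "y \<in> flag_mats n C" "z \<in> flag_mats n C"
  shows "x + y - z \<in> flag_mats n C"
  unfolding flag_mats_def
proof (intro CollectI conjI ballI)
  have xyz: "x \<in> carrier_mat n n" "y \<in> carrier_mat n n" "z \<in> carrier_mat n n"
    using x by (auto simp: flag_mats_def)
  then show "x + y - z \<in> carrier_mat n n" by (intro minus_carrier_mat)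
  fix v :: "'f vec" assume v: "v \<in> carrier_vec n"
  have "(x + y - z) *\<^sub>v v = x *\<^sub>v v + y *\<^sub>v v - z *\<^sub>v v"
    using xyz v by (simp add: minus_mult_distrib_mat_vec[of _ n n] add_mult_distrib_mat_vec[of _ n n])
  then show "flag_ok C v ((x + y - z) *\<^sub>v v)"
    using flag_ok_affine[OF C v] x v by (simp add: flag_mats_def)
qed

text \<open>Translation by one element x0 turns the set into a subgroup of the additive group of
  matrices, whose order is a power of q. Averages over the set therefore make sense in every field
  in which q is invertible.\<close>

lemma card_flag_mats_dvd:
  fixes C :: "'f::{field,finite} vec set set"
  assumes C: "C \<in> subspace_chains n" and ne: "flag_mats n C \<noteq> {}"
  shows "card (flag_mats n C) dvd CARD('f) ^ (n * n)"
proof -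
  let ?R = "matrix_monoid n :: 'f mat ring" and ?S = "flag_mats n C"
  interpret ring ?R by (rule ring_mat)
  obtain x0 where x0: "x0 \<in> ?S" using ne by blast
  have sub: "?S \<subseteq> carrier_mat n n" by (auto simp: flag_mats_def)
  have x0c: "x0 \<in> carrier_mat n n" using sub x0 by blast
  let ?H = "(\<lambda>x. x - x0) ` ?S"
  have Hc: "?H \<subseteq> carrier_mat n n" using sub x0c by (auto intro: minus_carrier_mat)
  have "subgroup ?H (add_monoid ?R)"
  proof (rule add.subgroupI)
    show "?H \<subseteq> carrier ?R" using Hc by (simp add: ring_mat_simps)
    show "?H \<noteq> {}" using x0 by blast
    fix a assume a: "a \<in> ?H"
    then obtain x where x: "x \<in> ?S" "a = x - x0" by blast
    then have xc: "x \<in> carrier_mat n n" using sub by blast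
    have "\<ominus>\<^bsub>?R\<^esub> a = (x0 + x0 - x) - x0"
    proof (rule minus_equality)
      show "(x0 + x0 - x) - x0 \<oplus>\<^bsub>?R\<^esub> a = \<zero>\<^bsub>?R\<^esub>" using x x0c xc
        by (simp add: ring_mat_simps, intro eq_matI) auto
    qed (use x x0c xc in \<open>auto simp: ring_mat_simps intro!: minus_carrier_mat\<close>)
    then show "\<ominus>\<^bsub>?R\<^esub> a \<in> ?H" using flag_mats_affine[OF C x0 x0 x(1)] by blast
    fix b assume "b \<in> ?H"
    then obtain y where y: "y \<in> ?S" "b = y - x0" by blast
    then have yc: "y \<in> carrier_mat n n" using sub by blast
    have "a \<oplus>\<^bsub>?R\<^esub> b = (x + y - x0) - x0" using x y x0c xc yc
      by (simp add: ring_mat_simps, intro eq_matI) auto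
    then show "a \<oplus>\<^bsub>?R\<^esub> b \<in> ?H" using flag_mats_affine[OF C x(1) y(1) x0] by blast
  qed
  from add.lagrange[OF this] have "card ?H dvd Coset.order (add_monoid ?R)" by (metis dvd_triv_right)
  also have "Coset.order (add_monoid ?R) = CARD('f) ^ (n * n)"
    by (simp add: Coset.order_def ring_mat_simps card_carrier_mat)
  also have "card ?H = card ?S"
  proof (rule card_image, rule inj_onI)
    fix x y assume xy: "x \<in> ?S" "y \<in> ?S" "x - x0 = y - x0"
    then have c: "x \<in> carrier_mat n n" "y \<in> carrier_mat n n" using sub by auto
    have "x = (x - x0) + x0" using c x0c by (intro eq_matI) auto
    also have "\<dots> = (y - x0) + x0" using xy by simp
    also have "\<dots> = y" using c x0c by (intro eq_matI) auto
    finally show "x = y" .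
  qed
  finally show ?thesis .
qed

text \<open>\<open>hmix w \<phi> x y\<close> agrees with \<open>x\<close> on the hyperplane \<open>\<phi> = 0\<close> and with \<open>y\<close> on \<open>w\<close>.\<close>

definition hmix :: "'f::field vec \<Rightarrow> 'f vec \<Rightarrow> 'f mat \<Rightarrow> 'f mat \<Rightarrow> 'f mat" where
  "hmix w \<phi> x y = x + (y - x) * mat (dim_vec w) (dim_vec \<phi>) (\<lambda>(i, j). w $ i * \<phi> $ j)"

context
  fixes w \<phi> :: "'f::field vec" and n
  assumes w: "w \<in> carrier_vec n" and \<phi>: "\<phi> \<in> carrier_vec n" and \<phi>w: "\<phi> \<bullet> w = 1"
begin

lemma hmix_carrier: "x \<in> carrier_mat n n \<Longrightarrow> y \<in> carrier_mat n n \<Longrightarrow> hmix w \<phi> x y \<in> carrier_mat n n"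
  using w \<phi> by (auto simp: hmix_def)

lemma outer_vec: "v \<in> carrier_vec n \<Longrightarrow>
    mat (dim_vec w) (dim_vec \<phi>) (\<lambda>(i, j). w $ i * \<phi> $ j) *\<^sub>v v = (\<phi> \<bullet> v) \<cdot>\<^sub>v w"
  using w \<phi> by (intro eq_vecI) (auto simp: scalar_prod_def sum_distrib_left sum_distrib_right ac_simps)

lemma hyperplane_split:
  assumes v: "v \<in> carrier_vec n"
  shows "v - (\<phi> \<bullet> v) \<cdot>\<^sub>v w \<in> carrier_vec n" "\<phi> \<bullet> (v - (\<phi> \<bullet> v) \<cdot>\<^sub>v w) = 0"
    "v = (v - (\<phi> \<bullet> v) \<cdot>\<^sub>v w) + (\<phi> \<bullet> v) \<cdot>\<^sub>v w"
  using v w \<phi> \<phi>w by (auto simp: scalar_prod_minus_distrib[of _ n])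

lemma hmix_vec:
  assumes x: "x \<in> carrier_mat n n" and y: "y \<in> carrier_mat n n" and v: "v \<in> carrier_vec n"
  shows "hmix w \<phi> x y *\<^sub>v v = x *\<^sub>v (v - (\<phi> \<bullet> v) \<cdot>\<^sub>v w) + (\<phi> \<bullet> v) \<cdot>\<^sub>v (y *\<^sub>v w)"
proof -
  let ?q = "mat (dim_vec w) (dim_vec \<phi>) (\<lambda>(i, j). w $ i * \<phi> $ j)"
  have q: "?q \<in> carrier_mat n n" using w \<phi> by auto
  have yx: "y - x \<in> carrier_mat n n" using x y by auto
  have "hmix w \<phi> x y *\<^sub>v v = x *\<^sub>v v + (y - x) *\<^sub>v ((\<phi> \<bullet> v) \<cdot>\<^sub>v w)"
    unfolding hmix_def using x yx q v outer_vec[OF v]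
    by (simp add: add_mult_distrib_mat_vec[of _ n n] assoc_mult_mat_vec[of _ n n])
  also have "(y - x) *\<^sub>v ((\<phi> \<bullet> v) \<cdot>\<^sub>v w) = (\<phi> \<bullet> v) \<cdot>\<^sub>v (y *\<^sub>v w) - (\<phi> \<bullet> v) \<cdot>\<^sub>v (x *\<^sub>v w)"
    using x y w by (simp add: minus_mult_distrib_mat_vec[of _ n n] mult_mat_vec[of _ n n])
  also have "x *\<^sub>v v + \<dots> = x *\<^sub>v (v - (\<phi> \<bullet> v) \<cdot>\<^sub>v w) + (\<phi> \<bullet> v) \<cdot>\<^sub>v (y *\<^sub>v w)"
    using x y w v by (simp add: mult_minus_distrib_mat_vec[of _ n n] mult_mat_vec[of _ n n], intro eq_vecI) auto
  finally show ?thesis .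
qed

text \<open>A mixture takes its values on the hyperplane from the first matrix and its value on w
  from the second, so mixing the two mixtures restores x. Exchanging values on w is thereby an
  involution on pairs.\<close>

lemma hmix_hmix:
  assumes x: "x \<in> carrier_mat n n" and y: "y \<in> carrier_mat n n"
  shows "hmix w \<phi> (hmix w \<phi> x y) (hmix w \<phi> y x) = x"
proof (rule mat_eqI_vec[of _ n n])
  note c = hmix_carrier[OF x y] hmix_carrier[OF y x]
  show "hmix w \<phi> (hmix w \<phi> x y) (hmix w \<phi> y x) \<in> carrier_mat n n" by (rule hmix_carrier[OF c])
  fix v :: "'f vec" assume v: "v \<in> carrier_vec n"
  note s = hyperplane_split[OF v]
  let ?u = "v - (\<phi> \<bullet> v) \<cdot>\<^sub>v w"
  have z: "w - (\<phi> \<bullet> w) \<cdot>\<^sub>v w = 0\<^sub>v n" using w \<phi>w by auto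
  have u0: "?u - 0 \<cdot>\<^sub>v w = ?u" using s(1) w by auto
  have "hmix w \<phi> (hmix w \<phi> x y) (hmix w \<phi> y x) *\<^sub>v v = x *\<^sub>v ?u + (\<phi> \<bullet> v) \<cdot>\<^sub>v (x *\<^sub>v w)"
    unfolding hmix_vec[OF c v] hmix_vec[OF x y s(1)] hmix_vec[OF y x w] s(2) u0 z \<phi>w
    using x y w s(1) by auto
  also have "\<dots> = x *\<^sub>v (?u + (\<phi> \<bullet> v) \<cdot>\<^sub>v w)"
    using x w s(1) by (simp add: mult_add_distrib_mat_vec[of _ n n] mult_mat_vec[of _ n n])
  finally show "hmix w \<phi> (hmix w \<phi> x y) (hmix w \<phi> y x) *\<^sub>v v = x *\<^sub>v v" using s(3) by simp
qed (rule x)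

text \<open>The image of a lies in the hyperplane, where the mixture agrees with x.\<close>

lemma hmix_mult:
  assumes x: "x \<in> carrier_mat n n" and y: "y \<in> carrier_mat n n" and a: "a \<in> carrier_mat n n"
    and \<phi>a: "\<And>v. v \<in> carrier_vec n \<Longrightarrow> \<phi> \<bullet> (a *\<^sub>v v) = 0"
  shows "hmix w \<phi> x y * a = x * a"
proof (rule mat_eqI_vec[of _ n n])
  note c = hmix_carrier[OF x y]
  show "hmix w \<phi> x y * a \<in> carrier_mat n n" "x * a \<in> carrier_mat n n" using c x a by auto
  fix v :: "'f vec" assume v: "v \<in> carrier_vec n"
  then have av: "a *\<^sub>v v \<in> carrier_vec n" using a by auto
  have "hmix w \<phi> x y *\<^sub>v (a *\<^sub>v v) = x *\<^sub>v (a *\<^sub>v v)"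
  proof -
    have "b - 0 \<cdot>\<^sub>v w = b" if "b \<in> carrier_vec n" for b
      using that w by (intro eq_vecI) auto
    from this[OF av] have "a *\<^sub>v v - 0 \<cdot>\<^sub>v w = a *\<^sub>v v" .
    moreover have "x *\<^sub>v (a *\<^sub>v v) + 0 \<cdot>\<^sub>v (y *\<^sub>v w) = x *\<^sub>v (a *\<^sub>v v)"
      using x y by (intro eq_vecI) auto
    ultimately show ?thesis unfolding hmix_vec[OF x y av] \<phi>a[OF v] by simp
  qed
  then show "hmix w \<phi> x y * a *\<^sub>v v = x * a *\<^sub>v v"
    using c x a v by (simp add: assoc_mult_mat_vec[of _ n n])
qed

lemma vec_subspace_hyperplane:
  "vec_subspace n {v \<in> carrier_vec n. \<phi> \<bullet> v = 0}" "w \<notin> {v \<in> carrier_vec n. \<phi> \<bullet> v = 0}"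
  using \<phi> \<phi>w by (auto simp: vec_subspace_def scalar_prod_add_distrib[of _ n])

text \<open>Only the values of x on the hyperplane and the value of y on w are constrained, so x and
  y may be adapted to different chains.\<close>

lemma hmix_flag_mats:
  assumes C: "C \<in> subspace_chains n" and x: "x \<in> carrier_mat n n" and y: "y \<in> carrier_mat n n"
    and wC: "\<And>H. H \<in> C \<Longrightarrow> \<not> H \<subseteq> {v \<in> carrier_vec n. \<phi> \<bullet> v = 0} \<Longrightarrow> w \<in> H"
    and xU: "\<And>u. u \<in> carrier_vec n \<Longrightarrow> \<phi> \<bullet> u = 0 \<Longrightarrow> flag_ok C u (x *\<^sub>v u)"
    and yw: "flag_ok C w (y *\<^sub>v w)"
  shows "hmix w \<phi> x y \<in> flag_mats n C"
  unfolding flag_mats_def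
proof (intro CollectI conjI ballI hmix_carrier x y)
  fix v :: "'f vec" assume v: "v \<in> carrier_vec n"
  note s = hyperplane_split[OF v]
  let ?u = "v - (\<phi> \<bullet> v) \<cdot>\<^sub>v w"
  have "?u \<in> {v \<in> carrier_vec n. \<phi> \<bullet> v = 0}" using s by simp
  from flag_ok_mix[OF C vec_subspace_hyperplane(1) w vec_subspace_hyperplane(2) wC this xU[OF s(1,2)] yw]
  have "flag_ok C (?u + (\<phi> \<bullet> v) \<cdot>\<^sub>v w) (x *\<^sub>v ?u + (\<phi> \<bullet> v) \<cdot>\<^sub>v (y *\<^sub>v w))" .
  then show "flag_ok C v (hmix w \<phi> x y *\<^sub>v v)" unfolding hmix_vec[OF x y v] s(3)[symmetric] .
qed

end

lemma card_involution_le: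
  assumes "finite Y" "T ` X \<subseteq> Y" "\<And>x. x \<in> X \<Longrightarrow> T (T x) = x"
  shows "card X \<le> card Y"
  by (rule card_inj_on_le[of T]) (use assms in \<open>auto intro: inj_on_inverseI\<close>)

text \<open>Both chains allow the same restrictions to the hyperplane, and the product x a sees
  nothing else of x. Exchanging the values on w within a pair of adapted matrices moves the
  hyperplane part of the first matrix to the second component, which gives an injection between the
  two products of sets. The opposite inequality is the same lemma for the toggled chain.\<close>

lemma flag_mats_toggle:
  fixes C :: "'f::{field,finite} vec set set" and a :: "'f mat"
  assumes C: "C \<in> subspace_chains n" and \<phi>: "\<phi> \<in> carrier_vec n" "\<phi> \<noteq> 0\<^sub>v n"
    and a: "a \<in> carrier_mat n n" and \<phi>a: "\<And>v. v \<in> carrier_vec n \<Longrightarrow> \<phi> \<bullet> (a *\<^sub>v v) = 0"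
  defines "C' \<equiv> toggle {v \<in> carrier_vec n. \<phi> \<bullet> v = 0} C"
  shows "flag_mats n C \<noteq> {} \<Longrightarrow> flag_mats n C' \<noteq> {}"
    and "card {x \<in> flag_mats n C. x * a = z} * card (flag_mats n C') \<le>
      card (flag_mats n C) * card {x \<in> flag_mats n C'. x * a = z}"
proof -
  let ?U = "{v \<in> carrier_vec n. \<phi> \<bullet> v = 0}"
  let ?F = "pivot_space ?U C"
  have U: "vec_subspace n ?U" using \<phi> by (auto simp: vec_subspace_def scalar_prod_add_distrib[of _ n])
  obtain i where i: "i < n" "\<phi> $ i \<noteq> 0"
    using \<phi> by (metis carrier_vecD eq_vecI index_zero_vec)
  then have "unit_vec n i \<notin> ?U" using \<phi> by (simp add: scalar_prod_right_unit)
  then have U': "?U \<noteq> carrier_vec n" by (metis unit_vec_carrier)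
  have C': "C' \<in> subspace_chains n" unfolding C'_def by (rule toggle_chain[OF C U U'])
  note F = pivot_space[OF C U U']
  have F': "?F \<subseteq> H" if "H \<in> C'" "\<not> H \<subseteq> ?U" for H
    using pivot_space(3)[OF C' U U' that] by (simp add: C'_def pivot_space_toggle)
  have Fs: "vec_subspace n ?F" using F(1) C by (simp add: subspace_chains_def)
  from F(2) obtain w0 where w0: "w0 \<in> ?F" "w0 \<notin> ?U" by blast
  \<comment> \<open>A vector of the pivot lies in every member not inside the hyperplane, as
    \<open>flag_ok_mix\<close> requires; scaling normalizes its pairing with \<phi> to 1.\<close>
  define w where "w = inverse (\<phi> \<bullet> w0) \<cdot>\<^sub>v w0"
  have w0c: "w0 \<in> carrier_vec n" using w0(1) Fs by (auto simp: vec_subspace_def)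
  have wF: "w \<in> ?F" using w0(1) Fs by (auto simp: w_def vec_subspace_def)
  have w: "w \<in> carrier_vec n" using wF Fs by (auto simp: vec_subspace_def)
  have \<phi>w: "\<phi> \<bullet> w = 1" using w0(2) w0c \<phi> by (simp add: w_def)
  note mix = hmix_flag_mats[OF w \<phi>(1) \<phi>w]
  have wC: "w \<in> H" if "H \<in> C" "\<not> H \<subseteq> ?U" for H using F(3)[OF that] wF by blast
  have wC': "w \<in> H" if "H \<in> C'" "\<not> H \<subseteq> ?U" for H using F'[OF that] wF by blast
  have ok: "flag_ok C' u y \<longleftrightarrow> flag_ok C u y" if "u \<in> carrier_vec n" "\<phi> \<bullet> u = 0" for u y
    unfolding C'_def by (rule flag_ok_toggle'[OF C U U']) (use that in simp)
  have sub: "flag_mats n C \<subseteq> carrier_mat n n" "flag_mats n C' \<subseteq> carrier_mat n n"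
    by (auto simp: flag_mats_def)
  have fin: "finite (flag_mats n C)" "finite (flag_mats n C')"
    using sub finite_carrier_mat finite_subset by metis+
  show "flag_mats n C' \<noteq> {}" if "flag_mats n C \<noteq> {}"
  proof -
    from that obtain x where x: "x \<in> flag_mats n C" by blast
    then have xc: "x \<in> carrier_mat n n" using sub by blast
    \<comment> \<open>Only the value of this matrix on w survives in the mixture, and it is
      admissible for the toggled chain: w itself if w must be fixed, zero otherwise.\<close>
    let ?y = "if w \<in> \<Inter>C' then 1\<^sub>m n else 0\<^sub>m n n"
    have "flag_ok C' w (?y *\<^sub>v w)"
    proof (cases "w \<in> \<Inter>C'")
      case True
      then show ?thesis using flag_ok_ex[OF C' w] w by (simp only: if_True if_P one_mult_mat_vec)
    next
      case False
      moreover have "0\<^sub>m n n *\<^sub>v w = 0\<^sub>v n" using w by (intro eq_vecI) auto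
      ultimately show ?thesis using flag_ok_ex[OF C' w] by (simp only: if_False)
    qed
    moreover have "flag_ok C' u (x *\<^sub>v u)" if "u \<in> carrier_vec n" "\<phi> \<bullet> u = 0" for u
      unfolding ok[OF that] using x that(1) by (simp add: flag_mats_def)
    ultimately have "hmix w \<phi> x ?y \<in> flag_mats n C'"
      by (intro mix[OF C' xc _ wC']) auto
    then show ?thesis by blast
  qed
  let ?T = "\<lambda>(x, x'). (hmix w \<phi> x' x, hmix w \<phi> x x')"
  have T: "hmix w \<phi> x' x \<in> flag_mats n C \<and> hmix w \<phi> x x' \<in> flag_mats n C' \<and>
      hmix w \<phi> x x' * a = x * a \<and> ?T (?T (x, x')) = (x, x')"
    if x: "x \<in> flag_mats n C" and x': "x' \<in> flag_mats n C'" for x x'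
  proof -
    have c: "x \<in> carrier_mat n n" "x' \<in> carrier_mat n n" using x x' sub by auto
    have "flag_ok C u (x' *\<^sub>v u)" "flag_ok C' u (x *\<^sub>v u)" if "u \<in> carrier_vec n" "\<phi> \<bullet> u = 0" for u
      using ok[OF that] x x' that(1) by (auto simp: flag_mats_def)
    moreover have "flag_ok C w (x *\<^sub>v w)" "flag_ok C' w (x' *\<^sub>v w)"
      using x x' w by (auto simp: flag_mats_def)
    ultimately have "hmix w \<phi> x' x \<in> flag_mats n C" "hmix w \<phi> x x' \<in> flag_mats n C'"
      using mix[OF C c(2,1) wC] mix[OF C' c wC'] by blast+
    then show ?thesis
      using hmix_hmix[OF w \<phi>(1) \<phi>w c] hmix_hmix[OF w \<phi>(1) \<phi>w c(2,1)] hmix_mult[OF w \<phi>(1) \<phi>w c a \<phi>a] by simp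
  qed
  have "card ({x \<in> flag_mats n C. x * a = z} \<times> flag_mats n C') \<le>
    card (flag_mats n C \<times> {x \<in> flag_mats n C'. x * a = z})"
    by (rule card_involution_le[of _ ?T]) (use fin T in auto)
  then show "card {x \<in> flag_mats n C. x * a = z} * card (flag_mats n C') \<le>
      card (flag_mats n C) * card {x \<in> flag_mats n C'. x * a = z}"
    by (simp add: card_cartesian_product)
qed

section \<open>The alternating sum over chains\<close>

text \<open>The coefficient of x in the signed sum of the averages over the sets
  \<open>flag_mats n C\<close>. The exponent \<open>Suc (card C)\<close> gives the one-member chain,
  and with it the identity matrix, a positive sign.\<close>

definition kovacs_fun :: "nat \<Rightarrow> 'f::{field,finite} mat \<Rightarrow> 'k::field" where
  "kovacs_fun n x = (\<Sum>C\<in>subspace_chains n.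
    if x \<in> flag_mats n C then (-1) ^ Suc (card C) / of_nat (card (flag_mats n C)) else 0)"

lemma subspace_chain_singleton: "{carrier_vec n} \<in> subspace_chains n"
  by (auto simp: subspace_chains_def vec_subspace_def)

lemma flag_mats_singleton: "flag_mats n {carrier_vec n :: 'f::field vec set} = {1\<^sub>m n}"
proof
  show "flag_mats n {carrier_vec n :: 'f vec set} \<subseteq> {1\<^sub>m n}"
  proof
    fix x :: "'f mat" assume x: "x \<in> flag_mats n {carrier_vec n}"
    then have "x = 1\<^sub>m n"
      by (intro mat_eqI_vec[of _ n n]) (auto simp: flag_mats_def flag_ok_def)
    then show "x \<in> {1\<^sub>m n}" by simp
  qed
qed (auto simp: flag_mats_def flag_ok_def)

text \<open>The image of x lies in the largest proper member of the chain: fixed vectors lie in all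
  members, and every other vector drops into a proper one. A map into a proper subspace is not
  invertible.\<close>

lemma flag_mats_singular:
  fixes C :: "'f::{field,finite} vec set set"
  assumes C: "C \<in> subspace_chains n" "C \<noteq> {carrier_vec n}" and x: "x \<in> flag_mats n C"
  shows "det x = 0"
proof (rule ccontr)
  have xc: "x \<in> carrier_mat n n" using x by (simp add: flag_mats_def)
  assume "det x \<noteq> 0"
  then obtain y where y: "y \<in> carrier_mat n n" "x * y = 1\<^sub>m n"
    using det_non_zero_imp_unit[OF xc, where b = "()"] by (auto simp: Units_def ring_mat_simps)
  let ?D = "C - {carrier_vec n}"
  have ch: "\<forall>S\<in>C. \<forall>T\<in>C. S \<subseteq> T \<or> T \<subseteq> S" and VC: "carrier_vec n \<in> C"
    and sub: "\<And>S. S \<in> C \<Longrightarrow> S \<subseteq> carrier_vec n"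
    using C by (auto simp: subspace_chains_def vec_subspace_def)
  have "?D \<noteq> {}" using C VC by blast
  moreover have "finite ?D" using finite_chain[OF C(1)] by simp
  ultimately obtain M where M: "M \<in> ?D" "\<And>S. S \<in> ?D \<Longrightarrow> M \<subseteq> S \<Longrightarrow> S = M"
    using finite_has_maximal[of ?D] by metis
  then have M': "S \<subseteq> M" if "S \<in> ?D" for S using ch that by blast
  obtain v where v: "v \<in> carrier_vec n" "v \<notin> M" using M sub by blast
  have xM: "x *\<^sub>v u \<in> M" if u: "u \<in> carrier_vec n" for u
  proof -
    have ok: "flag_ok C u (x *\<^sub>v u)" using x u by (simp add: flag_mats_def)
    show ?thesis
    proof (cases "u \<in> \<Inter>C")
      case True
      then show ?thesis using ok M(1) by (simp add: flag_ok_def)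
    next
      case False
      then obtain H where H: "H \<in> C" "u \<notin> H" "x *\<^sub>v u \<in> H"
        using ok unfolding flag_ok_def if_not_P[OF False] by blast
      then have "H \<in> ?D" using u by blast
      then show ?thesis using M' H by blast
    qed
  qed
  have "x *\<^sub>v (y *\<^sub>v v) = v"
    using assoc_mult_mat_vec[OF xc y(1) v(1)] y v by simp
  moreover have "x *\<^sub>v (y *\<^sub>v v) \<in> M" using xM y v by simp
  ultimately show False using v by simp
qed

text \<open>All chains except the one-member chain admit singular matrices only, so a single summand
  is left.\<close>

lemma kovacs_fun_one: "kovacs_fun n (1\<^sub>m n :: 'f::{field,finite} mat) = (1 :: 'k::field)"
proof -
  have "kovacs_fun n (1\<^sub>m n :: 'f mat) = (\<Sum>C\<in>{{carrier_vec n}}. if (1\<^sub>m n :: 'f mat) \<in> flag_mats n C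
    then (-1) ^ Suc (card C) / of_nat (card (flag_mats n C)) else 0 :: 'k)"
    unfolding kovacs_fun_def
  proof (rule sum.mono_neutral_right[OF finite_subspace_chains])
    show "\<forall>C\<in>subspace_chains n - {{carrier_vec n}}. (if (1\<^sub>m n :: 'f mat) \<in> flag_mats n C
      then (-1) ^ Suc (card C) / of_nat (card (flag_mats n C)) else 0 :: 'k) = 0"
    proof
      fix C :: "'f vec set set" assume C: "C \<in> subspace_chains n - {{carrier_vec n}}"
      have "(1\<^sub>m n :: 'f mat) \<notin> flag_mats n C"
        using flag_mats_singular[of C n "1\<^sub>m n"] C by auto
      then show "(if (1\<^sub>m n :: 'f mat) \<in> flag_mats n C
        then (-1) ^ Suc (card C) / of_nat (card (flag_mats n C)) else 0 :: 'k) = 0" by (rule if_not_P)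
    qed
  qed (simp add: subspace_chain_singleton)
  then show ?thesis by (simp add: flag_mats_singleton)
qed

lemma kovacs_fun_support:
  assumes "kovacs_fun n (x :: 'f::{field,finite} mat) \<noteq> (0 :: 'k::field)"
  shows "x \<in> carrier_mat n n" "x = 1\<^sub>m n \<or> det x = 0"
proof -
  have "\<exists>C\<in>subspace_chains n. x \<in> flag_mats n C"
  proof (rule ccontr)
    assume "\<not> ?thesis"
    then have "kovacs_fun n x = (0 :: 'k)" unfolding kovacs_fun_def by (intro sum.neutral) auto
    with assms show False by simp
  qed
  then obtain C where C: "C \<in> subspace_chains n" "x \<in> flag_mats n C" by blast
  then show "x \<in> carrier_mat n n" by (simp add: flag_mats_def)
  show "x = 1\<^sub>m n \<or> det x = 0"
    using flag_mats_singular[OF C(1) _ C(2)] C(2) flag_mats_singleton by blast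
qed

text \<open>Turns the proportion between the counts for a chain and for its toggle into the
  statement that their contributions to the sum are opposite.\<close>

lemma signed_ratio_eq:
  fixes s s' :: "'k::field"
  assumes "N * c' = c * N'" "of_nat c \<noteq> (0 :: 'k)" "of_nat c' \<noteq> (0 :: 'k)" "s' = - s"
  shows "s' * of_nat N' / of_nat c' = - (s * of_nat N / of_nat c)"
proof -
  have "of_nat N * of_nat c' = (of_nat c * of_nat N' :: 'k)"
    using assms(1) by (metis of_nat_mult)
  then have "of_nat N' / of_nat c' = (of_nat N / of_nat c :: 'k)"
    using assms(2,3) by (simp add: field_simps)
  then show ?thesis using assms(4) by (metis minus_mult_left times_divide_eq_right)
qed

text \<open>Reversal of signs alone shows that the sum equals its negative, which says nothing in
  characteristic 2. The predicate P selects one element of each orbit of T, and the two halves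
  cancel term by term.\<close>

lemma sum_sign_reversing:
  fixes h :: "'a \<Rightarrow> 'b::ab_group_add"
  assumes "finite S" and T: "\<And>x. x \<in> S \<Longrightarrow> T x \<in> S" "\<And>x. x \<in> S \<Longrightarrow> T (T x) = x"
    "\<And>x. x \<in> S \<Longrightarrow> P (T x) \<longleftrightarrow> \<not> P x" and h: "\<And>x. x \<in> S \<Longrightarrow> h (T x) = - h x"
  shows "sum h S = 0"
proof -
  define A B where "A = {x \<in> S. P x}" and "B = {x \<in> S. \<not> P x}"
  have "S = A \<union> B" "A \<inter> B = {}" "finite A" "finite B"
    using \<open>finite S\<close> by (auto simp: A_def B_def)
  then have "sum h S = sum h A + sum h B" by (metis sum.union_disjoint)
  moreover have "sum h B = (\<Sum>x\<in>A. - h x)"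
    by (rule sum.reindex_bij_witness[of _ T T]) (auto simp: A_def B_def T h)
  ultimately show ?thesis by (simp add: sum_negf)
qed

lemma kovacs_fun_sum_eq:
  fixes Z :: "'f::{field,finite} mat set"
  assumes Z: "finite Z"
  shows "(\<Sum>x\<in>Z. kovacs_fun n x) = (\<Sum>C\<in>subspace_chains n.
    (-1) ^ Suc (card C) * of_nat (card (Z \<inter> flag_mats n C)) / of_nat (card (flag_mats n C)) :: 'k::field)"
proof -
  have "(\<Sum>x\<in>Z. if x \<in> A then c else 0) = of_nat (card (Z \<inter> A)) * c" for A and c :: 'k
    using sum.inter_restrict[OF Z, of "\<lambda>_. c" A] by simp
  then show ?thesis
    unfolding kovacs_fun_def by (subst sum.swap) (simp add: mult.commute)
qed

text \<open>The left side is the coefficient of z in the product of the alternating sum with a. A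
  nonzero \<phi> in the kernel of the transpose of a defines a hyperplane that contains the image of
  a, and toggling with respect to this hyperplane pairs chains with opposite contributions.\<close>

lemma kovacs_fun_sum:
  fixes a z :: "'f::{field,finite} mat"
  assumes a: "a \<in> carrier_mat n n" "det a = 0" and q: "of_nat CARD('f) \<noteq> (0 :: 'k::field)"
  shows "(\<Sum>x\<in>{x \<in> carrier_mat n n. x * a = z}. kovacs_fun n x) = (0 :: 'k)"
proof -
  have "det (transpose_mat a) = 0" using a det_transpose by metis
  moreover have "transpose_mat a \<in> carrier_mat n n" using a by simp
  ultimately obtain \<phi> where \<phi>: "\<phi> \<in> carrier_vec n" "\<phi> \<noteq> 0\<^sub>v n" "transpose_mat a *\<^sub>v \<phi> = 0\<^sub>v n"
    using det_0_iff_vec_prod_zero by blast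
  have \<phi>a: "\<phi> \<bullet> (a *\<^sub>v v) = 0" if "v \<in> carrier_vec n" for v
    using transpose_vec_mult_scalar[OF a(1) that \<phi>(1)] \<phi>(3) that by simp
  let ?U = "{v \<in> carrier_vec n. \<phi> \<bullet> v = 0}"
  let ?N = "\<lambda>C. card {x \<in> flag_mats n C. x * a = z}"
  let ?g = "\<lambda>C. (-1) ^ Suc (card C) * of_nat (?N C) / of_nat (card (flag_mats n C)) :: 'k"
  have U: "vec_subspace n ?U" using \<phi> by (auto simp: vec_subspace_def scalar_prod_add_distrib[of _ n])
  obtain i where i: "i < n" "\<phi> $ i \<noteq> 0"
    using \<phi> by (metis carrier_vecD eq_vecI index_zero_vec)
  then have "unit_vec n i \<notin> ?U" using \<phi> by (simp add: scalar_prod_right_unit)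
  then have U': "?U \<noteq> carrier_vec n" by (metis unit_vec_carrier)
  have fin: "finite (flag_mats n C :: 'f mat set)" for C
    by (rule finite_subset[OF _ finite_carrier_mat[of n n]]) (auto simp: flag_mats_def)
  \<comment> \<open>The denominators divide a power of q, so they are nonzero in the field.\<close>
  have nz: "of_nat (card (flag_mats n C)) \<noteq> (0 :: 'k)"
    if "C \<in> subspace_chains n" "flag_mats n C \<noteq> {}" for C :: "'f vec set set"
  proof
    assume "of_nat (card (flag_mats n C)) = (0 :: 'k)"
    moreover from card_flag_mats_dvd[OF that] obtain k where
      "CARD('f) ^ (n * n) = card (flag_mats n C) * k" by (elim dvdE)
    ultimately have "of_nat (CARD('f) ^ (n * n)) = (0 :: 'k)" by simp
    then show False using q by simp
  qed
  have tog: "toggle ?U C \<in> subspace_chains n" if "C \<in> subspace_chains n" for C :: "'f vec set set"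
    by (rule toggle_chain[OF that U U'])
  have g: "?g (toggle ?U C) = - ?g C" if C: "C \<in> subspace_chains n" for C
  proof (cases "flag_mats n C = {}")
    case True
    have "flag_mats n (toggle ?U C) = {}"
    proof (rule ccontr)
      assume "flag_mats n (toggle ?U C) \<noteq> {}"
      from flag_mats_toggle(1)[OF tog[OF C] \<phi>(1,2) a(1) \<phi>a this] True
      show False unfolding toggle_toggle by blast
    qed
    then show ?thesis unfolding True by simp
  next
    case False
    then have ne: "flag_mats n (toggle ?U C) \<noteq> {}"
      using flag_mats_toggle(1)[OF C \<phi>(1,2) a(1) \<phi>a] by blast
    show ?thesis
    proof (rule signed_ratio_eq)
      \<comment> \<open>The inequalities for the chain and for its toggle together give equality of
        the proportions.\<close>
      have "?N (toggle ?U C) * card (flag_mats n C) \<le> card (flag_mats n (toggle ?U C)) * ?N C"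
        using flag_mats_toggle(2)[OF tog[OF C] \<phi>(1,2) a(1) \<phi>a, of z] unfolding toggle_toggle .
      with flag_mats_toggle(2)[OF C \<phi>(1,2) a(1) \<phi>a, of z]
      show "?N C * card (flag_mats n (toggle ?U C)) = card (flag_mats n C) * ?N (toggle ?U C)"
        by (intro le_antisym) (simp_all only: mult.commute)
      show "(- 1) ^ Suc (card (toggle ?U C)) = - ((- 1) ^ Suc (card C) :: 'k)"
        unfolding power_Suc card_toggle[OF C] by simp
    qed (rule nz[OF C False], rule nz[OF tog[OF C] ne])
  qed
  \<comment> \<open>This holds when toggling removes a member, hence for exactly one chain of each
    pair.\<close>
  define P where "P C \<longleftrightarrow> pivot_space ?U C \<inter> ?U \<in> C" for C :: "'f vec set set"
  define h where "h = ?g"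
  have h: "h (toggle ?U C) = - h C" if "C \<in> subspace_chains n" for C
    unfolding h_def by (rule g[OF that])
  have P: "P (toggle ?U C) \<longleftrightarrow> \<not> P C" for C
    unfolding P_def pivot_space_toggle by (simp add: toggle_def Let_def)
  let ?Z = "{x \<in> carrier_mat n n. x * a = z}"
  have Z: "finite ?Z" by (rule finite_subset[OF _ finite_carrier_mat[of n n]]) blast
  have sub: "flag_mats n C \<subseteq> carrier_mat n n" for C :: "'f vec set set"
    unfolding flag_mats_def by (rule Collect_restrict)
  have Z': "?Z \<inter> flag_mats n C = {x \<in> flag_mats n C. x * a = z}" for C :: "'f vec set set"
    by (intro equalityI subsetI) (use sub[of C] in auto)
  have "(\<Sum>x\<in>?Z. kovacs_fun n x) = sum h (subspace_chains n)"
    unfolding kovacs_fun_sum_eq[OF Z] Z' h_def by (rule refl)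
  moreover have "sum h (subspace_chains n) = 0"
    by (rule sum_sign_reversing[OF finite_subspace_chains, where T = "toggle ?U" and P = P]) (simp_all add: toggle_toggle tog P h)
  ultimately show ?thesis by simp
qed

section \<open>Monoid algebras\<close>

definition msingle :: "'m \<Rightarrow> 'k::field \<Rightarrow> 'm \<Rightarrow> 'k" where
  "msingle x c = (\<lambda>y. if y = x then c else 0)"

lemma monoid_algebra_carrier:
  "a \<in> carrier (monoid_algebra M) \<longleftrightarrow> finite {x. a x \<noteq> 0} \<and> {x. a x \<noteq> 0} \<subseteq> carrier M"
  by (simp add: monoid_algebra_def)

lemma monoid_algebra_ops:
  "a \<oplus>\<^bsub>monoid_algebra M\<^esub> b = (\<lambda>x. a x + b x)" "\<zero>\<^bsub>monoid_algebra M\<^esub> = (\<lambda>_. 0)"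
  "\<one>\<^bsub>monoid_algebra M\<^esub> = msingle \<one>\<^bsub>M\<^esub> 1" "scalar_embedding M c = msingle \<one>\<^bsub>M\<^esub> c"
  by (simp_all add: monoid_algebra_def msingle_def scalar_embedding_def)

lemma msingle_carrier [simp]: "x \<in> carrier M \<Longrightarrow> msingle x c \<in> carrier (monoid_algebra M)"
proof -
  assume "x \<in> carrier M"
  moreover have "{y. msingle x c y \<noteq> 0} \<subseteq> {x}" by (auto simp: msingle_def)
  ultimately show ?thesis unfolding monoid_algebra_carrier by (metis empty_subsetI finite.emptyI
    finite_insert finite_subset insert_subset subset_trans)
qed

lemma msingle_mult:
  "msingle x c \<otimes>\<^bsub>monoid_algebra M\<^esub> msingle y d = msingle (x \<otimes>\<^bsub>M\<^esub> y) (c * d)"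
proof
  fix z
  have "(msingle x c \<otimes>\<^bsub>monoid_algebra M\<^esub> msingle y d) z =
    (\<Sum>u\<in>{x}. \<Sum>v\<in>{y}. if u \<otimes>\<^bsub>M\<^esub> v = z then msingle x c u * msingle y d v else 0)"
    by (rule monoid_algebra_mult) (auto simp: msingle_def)
  then show "(msingle x c \<otimes>\<^bsub>monoid_algebra M\<^esub> msingle y d) z = msingle (x \<otimes>\<^bsub>M\<^esub> y) (c * d) z"
    by (auto simp: msingle_def)
qed

lemma msingle_add: "msingle x c \<oplus>\<^bsub>monoid_algebra M\<^esub> msingle x d = msingle x (c + d)"
  by (auto simp: monoid_algebra_ops msingle_def)

text \<open>Elements are finite sums of point masses. The premise \<open>a x \<noteq> 0\<close> of
  the last case keeps the point masses inside the support of a, so that the rule also serves for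
  elements supported on singular matrices.\<close>

lemma monoid_algebra_induct [consumes 1, case_names zero add single]:
  fixes a :: "'m \<Rightarrow> 'k::field"
  assumes "a \<in> carrier (monoid_algebra M)"
    and zero: "P \<zero>\<^bsub>monoid_algebra M\<^esub>"
    and add: "\<And>a b. a \<in> carrier (monoid_algebra M) \<Longrightarrow> b \<in> carrier (monoid_algebra M) \<Longrightarrow>
      P a \<Longrightarrow> P b \<Longrightarrow> P (a \<oplus>\<^bsub>monoid_algebra M\<^esub> b)"
    and single: "\<And>x c. x \<in> carrier M \<Longrightarrow> a x \<noteq> 0 \<Longrightarrow> P (msingle x c)"
  shows "P a"
proof -
  have "P b" if "finite S" "S \<subseteq> {x. a x \<noteq> 0}" "{x. b x \<noteq> 0} \<subseteq> S" for S and b :: "'m \<Rightarrow> 'k"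
    using that
  proof (induction S arbitrary: b rule: finite_induct)
    case empty
    then have "b = \<zero>\<^bsub>monoid_algebra M\<^esub>" by (auto simp: monoid_algebra_ops)
    then show ?case using zero by simp
  next
    case (insert x S)
    have xM: "x \<in> carrier M" "a x \<noteq> 0" and SM: "S \<subseteq> carrier M"
      using insert.prems assms(1) by (auto simp: monoid_algebra_carrier)
    let ?b = "b(x := 0)"
    have s: "{y. ?b y \<noteq> 0} \<subseteq> S" using insert.prems by auto
    then have c: "?b \<in> carrier (monoid_algebra M)"
      using SM insert.hyps finite_subset unfolding monoid_algebra_carrier by blast
    have "b = msingle x (b x) \<oplus>\<^bsub>monoid_algebra M\<^esub> ?b" by (auto simp: monoid_algebra_ops msingle_def)
    moreover have "P (msingle x (b x) \<oplus>\<^bsub>monoid_algebra M\<^esub> ?b)"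
      using insert.prems by (intro add single xM c insert.IH s) (auto simp: xM)
    ultimately show ?case by simp
  qed
  from this[of "{x. a x \<noteq> 0}" a] assms(1) show ?thesis by (simp add: monoid_algebra_carrier)
qed

lemma scalar_embedding_central:
  fixes a :: "'m \<Rightarrow> 'k::field"
  assumes "Group.monoid M" "a \<in> carrier (monoid_algebra M)"
  shows "scalar_embedding M c \<otimes>\<^bsub>monoid_algebra M\<^esub> a = a \<otimes>\<^bsub>monoid_algebra M\<^esub> scalar_embedding M c"
  using assms(2)
proof (induction a rule: monoid_algebra_induct)
  interpret M: monoid M by fact
  interpret R: ring "monoid_algebra M :: ('m \<Rightarrow> 'k) ring" by (rule monoid_algebra_ring) fact
  have s: "scalar_embedding M c \<in> carrier (monoid_algebra M)" by (simp add: monoid_algebra_ops)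
  {
    case zero
    then show ?case using s by simp
  next
    case (add a b)
    then show ?case using s by (simp add: R.l_distr R.r_distr)
  next
    case (single x d)
    then show ?case by (simp add: monoid_algebra_ops msingle_mult mult.commute[of c])
  }
qed

section \<open>Maps of monoid algebras induced by monoid homomorphisms\<close>

lemma monoid_algebra_map_superset:
  assumes "finite S" "{x. a x \<noteq> 0} \<subseteq> S"
  shows "monoid_algebra_map \<phi> a y = (\<Sum>x\<in>S. if \<phi> x = y then a x else 0)"
  unfolding monoid_algebra_map_def
  by (rule sum.mono_neutral_cong_left) (use assms in \<open>auto split: if_splits\<close>)

lemma monoid_algebra_map_single: "monoid_algebra_map \<phi> (msingle x c) = msingle (\<phi> x) c"
proof
  fix y
  show "monoid_algebra_map \<phi> (msingle x c) y = msingle (\<phi> x) c y"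
    by (subst monoid_algebra_map_superset[of "{x}"]) (auto simp: msingle_def)
qed

lemma monoid_algebra_map_zero: "monoid_algebra_map \<phi> \<zero>\<^bsub>monoid_algebra M\<^esub> = \<zero>\<^bsub>monoid_algebra N\<^esub>"
  by (auto simp: monoid_algebra_map_def monoid_algebra_ops)

lemma monoid_algebra_map_add:
  assumes "a \<in> carrier (monoid_algebra M)" "b \<in> carrier (monoid_algebra M)"
  shows "monoid_algebra_map \<phi> (a \<oplus>\<^bsub>monoid_algebra M\<^esub> b) =
    monoid_algebra_map \<phi> a \<oplus>\<^bsub>monoid_algebra N\<^esub> monoid_algebra_map \<phi> b"
proof
  fix y
  let ?S = "{x. a x \<noteq> 0} \<union> {x. b x \<noteq> 0}"
  have "finite ?S" using assms by (simp add: monoid_algebra_carrier)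
  note m = monoid_algebra_map_superset[OF this]
  have s: "{x. (a \<oplus>\<^bsub>monoid_algebra M\<^esub> b) x \<noteq> 0} \<subseteq> ?S" by (auto simp: monoid_algebra_ops)
  have "monoid_algebra_map \<phi> (a \<oplus>\<^bsub>monoid_algebra M\<^esub> b) y =
      (\<Sum>x\<in>?S. (if \<phi> x = y then a x else 0) + (if \<phi> x = y then b x else 0))"
    unfolding m[OF s] by (rule sum.cong) (simp_all add: monoid_algebra_ops)
  then show "monoid_algebra_map \<phi> (a \<oplus>\<^bsub>monoid_algebra M\<^esub> b) y =
    (monoid_algebra_map \<phi> a \<oplus>\<^bsub>monoid_algebra N\<^esub> monoid_algebra_map \<phi> b) y"
    unfolding sum.distrib m[of a, OF Un_upper1, symmetric] m[of b, OF Un_upper2, symmetric]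
    by (simp add: monoid_algebra_ops)
qed

lemma monoid_algebra_map_carrier:
  fixes a :: "'m \<Rightarrow> 'k::field"
  assumes "\<phi> \<in> carrier M \<rightarrow> carrier N" "a \<in> carrier (monoid_algebra M)" "Group.monoid N"
  shows "monoid_algebra_map \<phi> a \<in> carrier (monoid_algebra N)"
  using assms(2)
proof (induction a rule: monoid_algebra_induct)
  interpret N: ring "monoid_algebra N :: (_ \<Rightarrow> 'k) ring" by (rule monoid_algebra_ring) fact
  {
    case zero
    then show ?case by (simp add: monoid_algebra_map_zero[where N = N])
  next
    case (add a b)
    then show ?case by (simp add: monoid_algebra_map_add[where N = N])
  next
    case (single x c)
    then show ?case using funcset_mem[OF assms(1)] by (simp add: monoid_algebra_map_single)
  }
qed

lemma monoid_algebra_map_mult: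
  fixes a b :: "'m \<Rightarrow> 'k::field" and \<phi> :: "'m \<Rightarrow> 'n"
  assumes M: "Group.monoid M" and N: "Group.monoid N" and \<phi>: "\<phi> \<in> hom M N"
    and a: "a \<in> carrier (monoid_algebra M)" and b: "b \<in> carrier (monoid_algebra M)"
  shows "monoid_algebra_map \<phi> (a \<otimes>\<^bsub>monoid_algebra M\<^esub> b) =
    monoid_algebra_map \<phi> a \<otimes>\<^bsub>monoid_algebra N\<^esub> monoid_algebra_map \<phi> b"
  using a
proof (induction a rule: monoid_algebra_induct)
  interpret M: ring "monoid_algebra M :: ('m \<Rightarrow> 'k) ring" by (rule monoid_algebra_ring) fact
  interpret N: ring "monoid_algebra N :: ('n \<Rightarrow> 'k) ring" by (rule monoid_algebra_ring) fact
  have \<phi>c: "\<phi> \<in> carrier M \<rightarrow> carrier N" using \<phi> by (simp add: hom_def)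
  have c: "monoid_algebra_map \<phi> a \<in> carrier (monoid_algebra N)"
    if "a \<in> carrier (monoid_algebra M)" for a :: "'m \<Rightarrow> 'k"
    by (rule monoid_algebra_map_carrier[OF \<phi>c that N])
  {
    case zero
    then show ?case using b c[OF b] by (simp add: monoid_algebra_map_zero[where N = N])
  next
    case (add a1 a2)
    then show ?case using b c
      by (simp add: M.l_distr N.l_distr monoid_algebra_map_add[where N = N])
  next
    case (single x d)
    then have x: "x \<in> carrier M" by simp
    have xc: "monoid_algebra_map \<phi> (msingle x d) \<in> carrier (monoid_algebra N)"
      by (rule c) (simp add: x)
    show ?case using b
    proof (induction b rule: monoid_algebra_induct)
      case zero
      then show ?case using x xc by (simp add: monoid_algebra_map_zero[where N = N])
    next
      case (add a1 a2)
      then show ?case using x c xc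
        by (simp add: M.r_distr N.r_distr monoid_algebra_map_add[where N = N])
    next
      case (single y d')
      then show ?case using x \<phi> by (simp add: msingle_mult monoid_algebra_map_single hom_def)
    qed
  }
qed

lemma monoid_algebra_map_inverse:
  fixes a :: "'m \<Rightarrow> 'k::field"
  assumes "\<phi> \<in> carrier M \<rightarrow> carrier N" "Group.monoid N" "\<And>x. x \<in> carrier M \<Longrightarrow> \<psi> (\<phi> x) = x"
    "a \<in> carrier (monoid_algebra M)"
  shows "monoid_algebra_map \<psi> (monoid_algebra_map \<phi> a) = a"
  using assms(4)
proof (induction a rule: monoid_algebra_induct)
  case zero
  show ?case by (simp add: monoid_algebra_map_zero[where N = N] monoid_algebra_map_zero[where N = M])
next
  case (add a b)
  then show ?case
    by (simp add: monoid_algebra_map_carrier[OF assms(1) _ assms(2)] monoid_algebra_map_add[where N = N] monoid_algebra_map_add[where N = M and M = N and \<phi> = \<psi>])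
next
  case (single x c)
  then show ?case using assms(3) by (simp add: monoid_algebra_map_single)
qed

section \<open>Sums over finite sets of monoid elements\<close>

definition msum :: "'m set \<Rightarrow> 'k::field \<Rightarrow> 'm \<Rightarrow> 'k" where
  "msum T c = (\<lambda>x. if x \<in> T then c else 0)"

lemma msum_carrier: "finite T \<Longrightarrow> T \<subseteq> carrier M \<Longrightarrow> msum T c \<in> carrier (monoid_algebra M)"
  unfolding monoid_algebra_carrier msum_def by (auto elim: rev_finite_subset split: if_splits)

text \<open>Right multiplication by the invertible element t permutes T, and the coefficient is
  constant on T. For a group T this is the absorption property of its average.\<close>

lemma msum_mult_single:
  assumes M: "Group.monoid M" and T: "finite T" "T \<subseteq> carrier M"
    and t: "t \<in> T" and closed: "\<And>x. x \<in> T \<Longrightarrow> x \<otimes>\<^bsub>M\<^esub> t \<in> T"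
    and inv: "t' \<in> carrier M" "t \<otimes>\<^bsub>M\<^esub> t' = \<one>\<^bsub>M\<^esub>" "t' \<otimes>\<^bsub>M\<^esub> t = \<one>\<^bsub>M\<^esub>" "\<And>x. x \<in> T \<Longrightarrow> x \<otimes>\<^bsub>M\<^esub> t' \<in> T"
  shows "msum T c \<otimes>\<^bsub>monoid_algebra M\<^esub> msingle t 1 = msum T c"
proof
  fix z
  interpret monoid M by fact
  have tM: "t \<in> carrier M" using t T by blast
  have "(msum T c \<otimes>\<^bsub>monoid_algebra M\<^esub> msingle t 1) z =
      (\<Sum>x\<in>T. \<Sum>y\<in>{t}. if x \<otimes>\<^bsub>M\<^esub> y = z then msum T c x * msingle t 1 y else 0)"
    by (rule monoid_algebra_mult) (use T in \<open>auto simp: msum_def msingle_def\<close>)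
  also have "\<dots> = (\<Sum>x\<in>T. if x = z \<otimes>\<^bsub>M\<^esub> t' \<and> z \<in> T then c else 0)"
  proof (rule sum.cong[OF refl])
    fix x assume x: "x \<in> T"
    then have xM: "x \<in> carrier M" using T by blast
    have "x \<otimes>\<^bsub>M\<^esub> t \<otimes>\<^bsub>M\<^esub> t' = x" using xM tM inv by (simp add: m_assoc)
    moreover have "z \<otimes>\<^bsub>M\<^esub> t' \<otimes>\<^bsub>M\<^esub> t = z" if "z \<in> T"
      using that T tM inv by (simp add: m_assoc subset_iff)
    ultimately have "x \<otimes>\<^bsub>M\<^esub> t = z \<longleftrightarrow> x = z \<otimes>\<^bsub>M\<^esub> t' \<and> z \<in> T" using closed[OF x] by auto
    then show "(\<Sum>y\<in>{t}. if x \<otimes>\<^bsub>M\<^esub> y = z then msum T c x * msingle t 1 y else 0) =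
      (if x = z \<otimes>\<^bsub>M\<^esub> t' \<and> z \<in> T then c else 0)"
      using x by (auto simp: msum_def msingle_def)
  qed
  also have "\<dots> = msum T c z"
    using inv(4)[of z] T by (cases "z \<in> T") (simp_all add: msum_def)
  finally show "(msum T c \<otimes>\<^bsub>monoid_algebra M\<^esub> msingle t 1) z = msum T c z" .
qed

section \<open>Homological algebra over a ring\<close>

abbreviation mhom :: "('r, 'q) ring_scheme \<Rightarrow> ('r, 'a) module \<Rightarrow> ('r, 'b) module \<Rightarrow> ('a \<Rightarrow> 'b) set" where
  "mhom \<equiv> LinearCombinations.module_hom"

lemma mhomI:
  assumes "\<And>x. x \<in> carrier M \<Longrightarrow> f x \<in> carrier N"
    and "\<And>x y. x \<in> carrier M \<Longrightarrow> y \<in> carrier M \<Longrightarrow> f (x \<oplus>\<^bsub>M\<^esub> y) = f x \<oplus>\<^bsub>N\<^esub> f y"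
    and "\<And>r x. r \<in> carrier R \<Longrightarrow> x \<in> carrier M \<Longrightarrow> f (r \<odot>\<^bsub>M\<^esub> x) = r \<odot>\<^bsub>N\<^esub> f x"
  shows "f \<in> mhom R M N"
  using assms by (auto simp: LinearCombinations.module_hom_def)

lemma mhomD:
  assumes "f \<in> mhom R M N"
  shows "x \<in> carrier M \<Longrightarrow> f x \<in> carrier N"
    and "x \<in> carrier M \<Longrightarrow> y \<in> carrier M \<Longrightarrow> f (x \<oplus>\<^bsub>M\<^esub> y) = f x \<oplus>\<^bsub>N\<^esub> f y"
    and "r \<in> carrier R \<Longrightarrow> x \<in> carrier M \<Longrightarrow> f (r \<odot>\<^bsub>M\<^esub> x) = r \<odot>\<^bsub>N\<^esub> f x"
  using assms by (auto simp: LinearCombinations.module_hom_def)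

lemma mhom_comp:
  assumes "f \<in> mhom R M N" "g \<in> mhom R N L"
  shows "(\<lambda>x. g (f x)) \<in> mhom R M L"
  by (rule mhomI) (simp_all add: mhomD[OF assms(1)] mhomD[OF assms(2)])

text \<open>Being a homomorphism depends only on the values on the carrier; this allows passing
  between a map and its extensional restriction.\<close>

lemma mhom_cong:
  assumes "f \<in> mhom R M N" "left_module R M" "\<And>x. x \<in> carrier M \<Longrightarrow> g x = f x"
  shows "g \<in> mhom R M N"
proof -
  interpret left_module R M by fact
  show ?thesis by (rule mhomI) (simp_all add: assms(3) mhomD[OF assms(1)])
qed

context left_module begin

lemma smult_uminus: "r \<in> carrier R \<Longrightarrow> x \<in> carrier M \<Longrightarrow> r \<odot>\<^bsub>M\<^esub> (\<ominus>\<^bsub>M\<^esub> x) = \<ominus>\<^bsub>M\<^esub> (r \<odot>\<^bsub>M\<^esub> x)"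
proof -
  assume a: "r \<in> carrier R" "x \<in> carrier M"
  have "r \<odot>\<^bsub>M\<^esub> (\<ominus>\<^bsub>M\<^esub> x) \<oplus>\<^bsub>M\<^esub> r \<odot>\<^bsub>M\<^esub> x = r \<odot>\<^bsub>M\<^esub> (\<ominus>\<^bsub>M\<^esub> x \<oplus>\<^bsub>M\<^esub> x)" using a by (simp add: smult_r_distr)
  also have "\<dots> = \<zero>\<^bsub>M\<^esub>" using a by (simp add: M.l_neg)
  finally show ?thesis using a by (intro M.minus_equality[symmetric]) auto
qed

lemma neg_one_smult: "x \<in> carrier M \<Longrightarrow> (\<ominus> \<one>) \<odot>\<^bsub>M\<^esub> x = \<ominus>\<^bsub>M\<^esub> x"
proof -
  assume a: "x \<in> carrier M"
  have "(\<ominus> \<one>) \<odot>\<^bsub>M\<^esub> x \<oplus>\<^bsub>M\<^esub> x = (\<ominus> \<one> \<oplus> \<one>) \<odot>\<^bsub>M\<^esub> x" using a by (simp add: smult_l_distr)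
  also have "\<dots> = \<zero>\<^bsub>M\<^esub>" using a by (simp add: R.l_neg)
  finally show ?thesis using a by (intro M.minus_equality[symmetric]) auto
qed

lemma smult_minus: "r \<in> carrier R \<Longrightarrow> x \<in> carrier M \<Longrightarrow> y \<in> carrier M \<Longrightarrow>
    r \<odot>\<^bsub>M\<^esub> (x \<ominus>\<^bsub>M\<^esub> y) = r \<odot>\<^bsub>M\<^esub> x \<ominus>\<^bsub>M\<^esub> r \<odot>\<^bsub>M\<^esub> y"
  by (simp add: a_minus_def smult_r_distr smult_uminus)

lemma minus_self: "x \<in> carrier M \<Longrightarrow> x \<ominus>\<^bsub>M\<^esub> x = \<zero>\<^bsub>M\<^esub>"
  by (simp add: a_minus_def M.r_neg)

lemma minus_eq_zero: "x \<in> carrier M \<Longrightarrow> y \<in> carrier M \<Longrightarrow> x \<ominus>\<^bsub>M\<^esub> y = \<zero>\<^bsub>M\<^esub> \<longleftrightarrow> x = y"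
  by (metis M.minus_equality M.minus_minus M.a_inv_closed M.add.m_comm a_minus_def minus_self)

lemma minus_add_cancel: "x \<in> carrier M \<Longrightarrow> y \<in> carrier M \<Longrightarrow> (x \<ominus>\<^bsub>M\<^esub> y) \<oplus>\<^bsub>M\<^esub> y = x"
  by (simp add: a_minus_def M.a_assoc M.l_neg)

lemma minus_minus_cancel: "x \<in> carrier M \<Longrightarrow> y \<in> carrier M \<Longrightarrow> x \<ominus>\<^bsub>M\<^esub> (x \<ominus>\<^bsub>M\<^esub> y) = y"
  by (simp add: a_minus_def M.minus_add M.minus_minus M.a_assoc[symmetric] M.r_neg)

lemma minus_add_distrib: "\<lbrakk>a \<in> carrier M; b \<in> carrier M; c \<in> carrier M; d \<in> carrier M\<rbrakk> \<Longrightarrow>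
    (a \<oplus>\<^bsub>M\<^esub> b) \<ominus>\<^bsub>M\<^esub> (c \<oplus>\<^bsub>M\<^esub> d) = (a \<ominus>\<^bsub>M\<^esub> c) \<oplus>\<^bsub>M\<^esub> (b \<ominus>\<^bsub>M\<^esub> d)"
  by (simp add: a_minus_def M.minus_add M.a_ac)

lemma hom_uminus:
  assumes N: "left_module R N" and h: "h \<in> mhom R M N" and x: "x \<in> carrier M"
  shows "h (\<ominus>\<^bsub>M\<^esub> x) = \<ominus>\<^bsub>N\<^esub> h x"
proof -
  interpret N: left_module R N by fact
  show ?thesis
    using mhomD(3)[OF h, of "\<ominus> \<one>" x] x mhomD(1)[OF h x]
    by (simp add: neg_one_smult N.neg_one_smult)
qed

lemma hom_minus:
  assumes N: "left_module R N" and h: "h \<in> mhom R M N" and x: "x \<in> carrier M" "y \<in> carrier M"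
  shows "h (x \<ominus>\<^bsub>M\<^esub> y) = h x \<ominus>\<^bsub>N\<^esub> h y"
  using x by (simp add: a_minus_def mhomD[OF h] hom_uminus[OF N h])

lemma mhom_add:
  assumes "f \<in> mhom R L M" "g \<in> mhom R L M"
  shows "(\<lambda>x. f x \<oplus>\<^bsub>M\<^esub> g x) \<in> mhom R L M"
  by (rule mhomI)
    (simp_all add: mhomD[OF assms(1)] mhomD[OF assms(2)] smult_r_distr M.a_ac)

lemma mhom_minus:
  assumes "f \<in> mhom R L M" "g \<in> mhom R L M"
  shows "(\<lambda>x. f x \<ominus>\<^bsub>M\<^esub> g x) \<in> mhom R L M"
  by (rule mhomI)
    (simp_all add: mhomD[OF assms(1)] mhomD[OF assms(2)] smult_minus minus_add_distrib)

end

section \<open>Lifting along free and projective modules\<close>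

lemma free_hom_eqI:
  fixes R :: "('r, 'q) ring_scheme" and B :: "'b set"
  assumes R: "ring R" and N: "left_module R N" and f: "f \<in> mhom R (free_module R B) N"
    and g: "g \<in> mhom R (free_module R B) N"
    and eq: "\<And>b. b \<in> B \<Longrightarrow> f (free_basis R b) = g (free_basis R b)"
    and x: "x \<in> carrier (free_module R B)"
  shows "f x = g x"
proof -
  interpret R: ring R by fact
  interpret N: left_module R N by fact
  let ?F = "free_module R B"
  interpret F: left_module R ?F by (rule free_left_module[OF R])
  have "f y = g y" if "finite S" "S \<subseteq> B" "{b. y b \<noteq> \<zero>\<^bsub>R\<^esub>} \<subseteq> S" "\<And>b. y b \<in> carrier R" for S y
    using that
  proof (induction S arbitrary: y rule: finite_induct)
    case empty
    then have "y = \<zero>\<^bsub>?F\<^esub>" by (auto simp: free_module_def)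
    then show ?case using F.hom_zero[OF N f] F.hom_zero[OF N g] by simp
  next
    case (insert b S)
    let ?y = "y(b := \<zero>\<^bsub>R\<^esub>)"
    have s: "{c. ?y c \<noteq> \<zero>\<^bsub>R\<^esub>} \<subseteq> S" and c: "?y c \<in> carrier R" for c using insert.prems by auto
    have yF: "?y \<in> carrier ?F"
      using c finite_subset[OF s insert.hyps(1)] subset_trans[OF s, of B] insert.prems(1)
      by (simp add: free_module_def image_subset_iff)
    have bF: "free_basis R b \<in> carrier ?F" using insert.prems by (intro free_basis_carrier R) simp
    have yb: "y b \<in> carrier R" using insert.prems by simp
    have e: "y = (y b \<odot>\<^bsub>?F\<^esub> free_basis R b) \<oplus>\<^bsub>?F\<^esub> ?y"
      using insert.prems(3) by (auto simp: free_module_def free_basis_def)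
    have "f ?y = g ?y" by (rule insert.IH) (use insert.prems s c in auto)
    moreover have "f (free_basis R b) = g (free_basis R b)" using eq insert.prems by simp
    ultimately have "f ((y b \<odot>\<^bsub>?F\<^esub> free_basis R b) \<oplus>\<^bsub>?F\<^esub> ?y) = g ((y b \<odot>\<^bsub>?F\<^esub> free_basis R b) \<oplus>\<^bsub>?F\<^esub> ?y)"
      using yF bF yb by (simp add: mhomD(2,3)[OF f] mhomD(2,3)[OF g])
    then show ?case using e by simp
  qed
  from this[of "{b. x b \<noteq> \<zero>\<^bsub>R\<^esub>}" x] x show ?thesis by (auto simp: free_module_def)
qed

text \<open>On the free module of which P is a summand, the images of the basis can be lifted one by
  one; the lift is then composed with the inclusion s. Asking for containment of images instead of
  surjectivity of \<alpha> fits the use in resolutions, where \<alpha> is a differential.\<close>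

lemma projective_lift:
  fixes R :: "('r, 'q) ring_scheme" and P :: "('r, 'p) module"
  assumes P: "projective_module R P" and X: "left_module R X" and Y: "left_module R Y"
    and \<alpha>: "\<alpha> \<in> mhom R X Y" and \<beta>: "\<beta> \<in> mhom R P Y"
    and im: "\<And>x. x \<in> carrier P \<Longrightarrow> \<beta> x \<in> \<alpha> ` carrier X"
  obtains \<gamma> where "\<gamma> \<in> mhom R P X" "\<And>x. x \<in> carrier P \<Longrightarrow> \<alpha> (\<gamma> x) = \<beta> x"
proof -
  from P obtain B :: "'p set" and s r where s: "s \<in> mhom R P (free_module R B)"
    and r: "r \<in> mhom R (free_module R B) P" and rs: "\<And>x. x \<in> carrier P \<Longrightarrow> r (s x) = x"
    unfolding projective_module_def by blast
  interpret X: left_module R X by fact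
  note R = X.R.ring_axioms
  have basis: "free_basis R b \<in> carrier (free_module R B)" if "b \<in> B" for b
    using that by (rule free_basis_carrier[OF R])
  have "\<exists>x\<in>carrier X. \<alpha> x = \<beta> (r (free_basis R b))" if "b \<in> B" for b
    using im[OF mhomD(1)[OF r basis[OF that]]] by (auto simp: image_iff)
  then obtain c where c: "\<And>b. b \<in> B \<Longrightarrow> c b \<in> carrier X \<and> \<alpha> (c b) = \<beta> (r (free_basis R b))"
    by metis
  have cX: "c \<in> B \<rightarrow> carrier X" using c by auto
  let ?l = "lin_ext R X c"
  have l: "?l \<in> mhom R (free_module R B) X" by (rule X.lin_ext_hom[OF cX])
  have eq: "\<alpha> (?l y) = \<beta> (r y)" if "y \<in> carrier (free_module R B)" for y
    by (rule free_hom_eqI[OF R Y mhom_comp[OF l \<alpha>] mhom_comp[OF r \<beta>] _ that])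
      (simp add: X.lin_ext_basis[OF cX] c)
  show ?thesis
    by (rule that[OF mhom_comp[OF s l]]) (simp add: eq mhomD(1)[OF s] rs)
qed

section \<open>Comparison of projective resolutions up to homotopy\<close>

lemma projective_resolutionD:
  assumes "projective_resolution R V P d \<epsilon>"
  shows "projective_module R (P i)" "left_module R (P i)" "d i \<in> mhom R (P (Suc i)) (P i)"
    "\<epsilon> \<in> mhom R (P 0) V" "\<epsilon> ` carrier (P 0) = carrier V"
    "x \<in> carrier (P 0) \<Longrightarrow> \<epsilon> x = \<zero>\<^bsub>V\<^esub> \<longleftrightarrow> x \<in> d 0 ` carrier (P (Suc 0))"
    "y \<in> carrier (P (Suc i)) \<Longrightarrow> d i y = \<zero>\<^bsub>P i\<^esub> \<longleftrightarrow> y \<in> d (Suc i) ` carrier (P (Suc (Suc i)))"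
    "y \<in> carrier (P (Suc (Suc i))) \<Longrightarrow> d i (d (Suc i) y) = \<zero>\<^bsub>P i\<^esub>"
    "y \<in> carrier (P (Suc 0)) \<Longrightarrow> \<epsilon> (d 0 y) = \<zero>\<^bsub>V\<^esub>"
proof -
  note D = assms[unfolded projective_resolution_def]
  show "projective_module R (P i)" using D by blast
  then show "left_module R (P i)" by (simp add: projective_module_def)
  show "d i \<in> mhom R (P (Suc i)) (P i)"
    "\<epsilon> \<in> mhom R (P 0) V" "\<epsilon> ` carrier (P 0) = carrier V" using D by blast+
  show "x \<in> carrier (P 0) \<Longrightarrow> \<epsilon> x = \<zero>\<^bsub>V\<^esub> \<longleftrightarrow> x \<in> d 0 ` carrier (P (Suc 0))" using D by blast
  show "y \<in> carrier (P (Suc i)) \<Longrightarrow> d i y = \<zero>\<^bsub>P i\<^esub> \<longleftrightarrow> y \<in> d (Suc i) ` carrier (P (Suc (Suc i)))"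
    using D by blast
  show "y \<in> carrier (P (Suc (Suc i))) \<Longrightarrow> d i (d (Suc i) y) = \<zero>\<^bsub>P i\<^esub>" using D by blast
  show "y \<in> carrier (P (Suc 0)) \<Longrightarrow> \<epsilon> (d 0 y) = \<zero>\<^bsub>V\<^esub>" using D by blast
qed

text \<open>Recursive lifting through the exact complex Q. The two resolutions may have elements of
  different types, which is essential when resolutions over different rings are involved.\<close>

lemma comparison_map:
  assumes V: "left_module R V" and P: "projective_resolution R V P d \<epsilon>"
    and Q: "projective_resolution R V Q d' \<epsilon>'"
  obtains f where "\<And>i. f i \<in> mhom R (P i) (Q i)" "\<And>x. x \<in> carrier (P 0) \<Longrightarrow> \<epsilon>' (f 0 x) = \<epsilon> x"
    "\<And>i x. x \<in> carrier (P (Suc i)) \<Longrightarrow> d' i (f (Suc i) x) = f i (d i x)"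
proof -
  note p = projective_resolutionD[OF P] and q = projective_resolutionD[OF Q]
  \<comment> \<open>The last clause of the invariant is what the lift to degree n + 1 needs;
    exactness of Q reproduces it for the lifted map.\<close>
  let ?S = "\<lambda>n f. f \<in> mhom R (P n) (Q n) \<and> (n = 0 \<longrightarrow> (\<forall>x\<in>carrier (P 0). \<epsilon>' (f x) = \<epsilon> x)) \<and>
    (\<forall>x\<in>carrier (P (Suc n)). f (d n x) \<in> d' n ` carrier (Q (Suc n)))"
  let ?T = "\<lambda>n f g. \<forall>x\<in>carrier (P (Suc n)). d' n (g x) = f (d n x)"
  have "\<exists>f. \<forall>n. ?S n (f n) \<and> ?T n (f n) (f (Suc n))"
  proof (rule dependent_nat_choice)
    have "\<epsilon> x \<in> \<epsilon>' ` carrier (Q 0)" if "x \<in> carrier (P 0)" for x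
      using mhomD(1)[OF p(4) that] q(5) by simp
    from projective_lift[OF p(1) q(2) V q(4) p(4) this]
    obtain f where f: "f \<in> mhom R (P 0) (Q 0)" "\<And>x. x \<in> carrier (P 0) \<Longrightarrow> \<epsilon>' (f x) = \<epsilon> x" by blast
    have "f (d 0 x) \<in> d' 0 ` carrier (Q (Suc 0))" if "x \<in> carrier (P (Suc 0))" for x
    proof -
      have dx: "d 0 x \<in> carrier (P 0)" by (rule mhomD(1)[OF p(3) that])
      then have "\<epsilon>' (f (d 0 x)) = \<zero>\<^bsub>V\<^esub>" using f(2) p(9)[OF that] by simp
      then show ?thesis using q(6)[OF mhomD(1)[OF f(1) dx]] by simp
    qed
    then show "\<exists>f. ?S 0 f" using f by blast
  next
    fix f n assume f: "?S n f"
    then have fh: "f \<in> mhom R (P n) (Q n)" by blast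
    have "f (d n x) \<in> d' n ` carrier (Q (Suc n))" if "x \<in> carrier (P (Suc n))" for x using f that by blast
    from projective_lift[OF p(1) q(2) q(2) q(3) mhom_comp[OF p(3) fh] this]
    obtain g where g: "g \<in> mhom R (P (Suc n)) (Q (Suc n))"
      "\<And>x. x \<in> carrier (P (Suc n)) \<Longrightarrow> d' n (g x) = f (d n x)" by blast
    have "g (d (Suc n) x) \<in> d' (Suc n) ` carrier (Q (Suc (Suc n)))" if x: "x \<in> carrier (P (Suc (Suc n)))" for x
    proof -
      have dx: "d (Suc n) x \<in> carrier (P (Suc n))" by (rule mhomD(1)[OF p(3) x])
      have "d' n (g (d (Suc n) x)) = \<zero>\<^bsub>Q n\<^esub>"
        using g(2)[OF dx] p(8)[OF x] left_module.hom_zero[OF p(2) q(2) fh] by simp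
      then show ?thesis using q(7)[OF mhomD(1)[OF g(1) dx]] by simp
    qed
    then show "\<exists>g. ?S (Suc n) g \<and> ?T n f g" using g by blast
  qed
  then obtain f where f: "\<And>n. ?S n (f n) \<and> ?T n (f n) (f (Suc n))" by blast
  show ?thesis
  proof (rule that[of f])
    show "f i \<in> mhom R (P i) (Q i)" for i using f by blast
    show "\<epsilon>' (f 0 x) = \<epsilon> x" if "x \<in> carrier (P 0)" for x using f[of 0] that by blast
    show "d' i (f (Suc i) x) = f i (d i x)" if "x \<in> carrier (P (Suc i))" for i x using f[of i] that by blast
  qed
qed

text \<open>Lifting again: once \<open>s n\<close> is found, \<open>h (Suc n)\<close> minus
  \<open>s n\<close> after the differential is a cycle of Q by the identity of the preceding degree.
  Exactness makes it a boundary, and lifting it through the next differential gives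
  \<open>s (Suc n)\<close>.\<close>

lemma null_homotopy:
  assumes V: "left_module R V" and P: "projective_resolution R V P d \<epsilon>"
    and Q: "projective_resolution R V Q d' \<epsilon>'"
    and h: "\<And>i. h i \<in> mhom R (P i) (Q i)" and h0: "\<And>x. x \<in> carrier (P 0) \<Longrightarrow> \<epsilon>' (h 0 x) = \<zero>\<^bsub>V\<^esub>"
    and hd: "\<And>i x. x \<in> carrier (P (Suc i)) \<Longrightarrow> d' i (h (Suc i) x) = h i (d i x)"
  obtains s where "\<And>i. s i \<in> mhom R (P i) (Q (Suc i))"
    "\<And>x. x \<in> carrier (P 0) \<Longrightarrow> h 0 x = d' 0 (s 0 x)"
    "\<And>i x. x \<in> carrier (P (Suc i)) \<Longrightarrow> h (Suc i) x = d' (Suc i) (s (Suc i) x) \<oplus>\<^bsub>Q (Suc i)\<^esub> s i (d i x)"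
proof -
  note p = projective_resolutionD[OF P] and q = projective_resolutionD[OF Q]
  let ?S = "\<lambda>n f. f \<in> mhom R (P n) (Q (Suc n)) \<and> (n = 0 \<longrightarrow> (\<forall>x\<in>carrier (P 0). d' 0 (f x) = h 0 x)) \<and>
    (\<forall>x\<in>carrier (P (Suc n)). h (Suc n) x \<ominus>\<^bsub>Q (Suc n)\<^esub> f (d n x) \<in> d' (Suc n) ` carrier (Q (Suc (Suc n))))"
  let ?T = "\<lambda>n f g. \<forall>x\<in>carrier (P (Suc n)). d' (Suc n) (g x) = h (Suc n) x \<ominus>\<^bsub>Q (Suc n)\<^esub> f (d n x)"
  have "\<exists>f. \<forall>n. ?S n (f n) \<and> ?T n (f n) (f (Suc n))"
  proof (rule dependent_nat_choice)
    have "h 0 x \<in> d' 0 ` carrier (Q (Suc 0))" if "x \<in> carrier (P 0)" for x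
      using q(6)[OF mhomD(1)[OF h that]] h0[OF that] by simp
    from projective_lift[OF p(1) q(2) q(2) q(3) h this]
    obtain f where f: "f \<in> mhom R (P 0) (Q (Suc 0))" "\<And>x. x \<in> carrier (P 0) \<Longrightarrow> d' 0 (f x) = h 0 x" by blast
    have "h (Suc 0) x \<ominus>\<^bsub>Q (Suc 0)\<^esub> f (d 0 x) \<in> d' (Suc 0) ` carrier (Q (Suc (Suc 0)))"
      if x: "x \<in> carrier (P (Suc 0))" for x
    proof -
      interpret Q0: left_module R "Q 0" by (rule q(2))
      interpret Q1: left_module R "Q (Suc 0)" by (rule q(2))
      have dx: "d 0 x \<in> carrier (P 0)" by (rule mhomD(1)[OF p(3) x])
      have c: "h (Suc 0) x \<in> carrier (Q (Suc 0))" "f (d 0 x) \<in> carrier (Q (Suc 0))"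
        by (rule mhomD(1)[OF h x], rule mhomD(1)[OF f(1) dx])
      have "d' 0 (h (Suc 0) x \<ominus>\<^bsub>Q (Suc 0)\<^esub> f (d 0 x)) = \<zero>\<^bsub>Q 0\<^esub>"
        unfolding Q1.hom_minus[OF q(2) q(3) c] hd[OF x] f(2)[OF dx]
        by (rule Q0.minus_self[OF mhomD(1)[OF h dx]])
      then show ?thesis using q(7)[of "h (Suc 0) x \<ominus>\<^bsub>Q (Suc 0)\<^esub> f (d 0 x)" 0] c by simp
    qed
    then show "\<exists>f. ?S 0 f" using f by blast
  next
    fix f n assume f: "?S n f"
    then have fh: "f \<in> mhom R (P n) (Q (Suc n))" by blast
    interpret Q1: left_module R "Q (Suc n)" by (rule q(2))
    interpret Q2: left_module R "Q (Suc (Suc n))" by (rule q(2))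
    have m: "(\<lambda>x. h (Suc n) x \<ominus>\<^bsub>Q (Suc n)\<^esub> f (d n x)) \<in> mhom R (P (Suc n)) (Q (Suc n))"
      by (rule Q1.mhom_minus[OF h mhom_comp[OF p(3) fh]])
    have "h (Suc n) x \<ominus>\<^bsub>Q (Suc n)\<^esub> f (d n x) \<in> d' (Suc n) ` carrier (Q (Suc (Suc n)))"
      if "x \<in> carrier (P (Suc n))" for x using f that by blast
    from projective_lift[OF p(1) q(2) q(2) q(3) m this]
    obtain g where g: "g \<in> mhom R (P (Suc n)) (Q (Suc (Suc n)))"
      "\<And>x. x \<in> carrier (P (Suc n)) \<Longrightarrow> d' (Suc n) (g x) = h (Suc n) x \<ominus>\<^bsub>Q (Suc n)\<^esub> f (d n x)" by blast
    have "h (Suc (Suc n)) x \<ominus>\<^bsub>Q (Suc (Suc n))\<^esub> g (d (Suc n) x) \<in>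
        d' (Suc (Suc n)) ` carrier (Q (Suc (Suc (Suc n))))" if x: "x \<in> carrier (P (Suc (Suc n)))" for x
    proof -
      have dx: "d (Suc n) x \<in> carrier (P (Suc n))" by (rule mhomD(1)[OF p(3) x])
      have c: "h (Suc (Suc n)) x \<in> carrier (Q (Suc (Suc n)))" "g (d (Suc n) x) \<in> carrier (Q (Suc (Suc n)))"
        by (rule mhomD(1)[OF h x], rule mhomD(1)[OF g(1) dx])
      have hc: "h (Suc n) (d (Suc n) x) \<in> carrier (Q (Suc n))" by (rule mhomD(1)[OF h dx])
      have "d' (Suc n) (h (Suc (Suc n)) x \<ominus>\<^bsub>Q (Suc (Suc n))\<^esub> g (d (Suc n) x)) = \<zero>\<^bsub>Q (Suc n)\<^esub>"
        unfolding Q2.hom_minus[OF q(2) q(3) c] hd[OF x] g(2)[OF dx] p(8)[OF x]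
          left_module.hom_zero[OF p(2) q(2) fh] Q1.minus_minus_cancel[OF hc Q1.M.zero_closed] ..
      then show ?thesis using q(7)[of "h (Suc (Suc n)) x \<ominus>\<^bsub>Q (Suc (Suc n))\<^esub> g (d (Suc n) x)" "Suc n"] c by simp
    qed
    then show "\<exists>g. ?S (Suc n) g \<and> ?T n f g" using g by blast
  qed
  then obtain s where s: "\<And>n. ?S n (s n) \<and> ?T n (s n) (s (Suc n))" by blast
  then have sh: "s i \<in> mhom R (P i) (Q (Suc i))" for i by blast
  show ?thesis
  proof (rule that[of s])
    show "s i \<in> mhom R (P i) (Q (Suc i))" for i by (rule sh)
    show "h 0 x = d' 0 (s 0 x)" if "x \<in> carrier (P 0)" for x using s[of 0] that by simp
    show "h (Suc i) x = d' (Suc i) (s (Suc i) x) \<oplus>\<^bsub>Q (Suc i)\<^esub> s i (d i x)" if x: "x \<in> carrier (P (Suc i))" for i x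
    proof -
      have "d' (Suc i) (s (Suc i) x) = h (Suc i) x \<ominus>\<^bsub>Q (Suc i)\<^esub> s i (d i x)" using s[of i] x by blast
      then show ?thesis
        using left_module.minus_add_cancel[OF q(2) mhomD(1)[OF h x] mhomD(1)[OF sh mhomD(1)[OF p(3) x]]] by simp
    qed
  qed
qed

section \<open>Submodules and quotient modules\<close>

definition submodule_of :: "('r, 'q) ring_scheme \<Rightarrow> ('r, 'a) module \<Rightarrow> 'a set \<Rightarrow> bool" where
  "submodule_of R M N \<longleftrightarrow> N \<subseteq> carrier M \<and> \<zero>\<^bsub>M\<^esub> \<in> N \<and> (\<forall>x\<in>N. \<forall>y\<in>N. x \<oplus>\<^bsub>M\<^esub> y \<in> N) \<and>
    (\<forall>r\<in>carrier R. \<forall>x\<in>N. r \<odot>\<^bsub>M\<^esub> x \<in> N)"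

context left_module begin

lemma submodule_uminus: "submodule_of R M N \<Longrightarrow> x \<in> N \<Longrightarrow> \<ominus>\<^bsub>M\<^esub> x \<in> N"
  using neg_one_smult[of x] R.a_inv_closed[OF R.one_closed] unfolding submodule_of_def by (metis subsetD)

lemma submodule_minus: "submodule_of R M N \<Longrightarrow> x \<in> N \<Longrightarrow> y \<in> N \<Longrightarrow> x \<ominus>\<^bsub>M\<^esub> y \<in> N"
  using submodule_uminus unfolding submodule_of_def a_minus_def by blast

lemma submodule_abelian_subgroup:
  assumes "submodule_of R M N" shows "abelian_subgroup N M"
proof (rule abelian_subgroupI3[OF additive_subgroup.intro])
  show "subgroup N (add_monoid M)"
    by (rule M.add.subgroupI)
      (use assms submodule_uminus[OF assms] in \<open>auto simp: submodule_of_def\<close>)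
  show "abelian_group M" ..
qed

lemma coset_eq_iff:
  assumes N: "submodule_of R M N" and x: "x \<in> carrier M" and y: "y \<in> carrier M"
  shows "N +>\<^bsub>M\<^esub> x = N +>\<^bsub>M\<^esub> y \<longleftrightarrow> x \<ominus>\<^bsub>M\<^esub> y \<in> N"
proof -
  interpret N: abelian_subgroup N M by (rule submodule_abelian_subgroup[OF N])
  have "N +>\<^bsub>M\<^esub> x = N +>\<^bsub>M\<^esub> y \<longleftrightarrow> x \<in> N +>\<^bsub>M\<^esub> y"
    using N.a_rcos_self[OF x] N.a_repr_independence'[OF _ y] by metis
  then show ?thesis using N.a_rcos_module[OF y x] by (simp add: a_minus_def)
qed

text \<open>The action on the quotient is a union over all representatives; since N is a submodule,
  all sets in this union are the same coset.\<close>

lemma quotient_smult: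
  assumes N: "submodule_of R M N" and x: "x \<in> carrier M" and r: "r \<in> carrier R"
  shows "r \<odot>\<^bsub>quotient_module M N\<^esub> (N +>\<^bsub>M\<^esub> x) = N +>\<^bsub>M\<^esub> (r \<odot>\<^bsub>M\<^esub> x)"
proof -
  interpret N: abelian_subgroup N M by (rule submodule_abelian_subgroup[OF N])
  have "N +>\<^bsub>M\<^esub> (r \<odot>\<^bsub>M\<^esub> y) = N +>\<^bsub>M\<^esub> (r \<odot>\<^bsub>M\<^esub> x)" if "y \<in> N +>\<^bsub>M\<^esub> x" for y
  proof -
    have y: "y \<in> carrier M" using that M.a_r_coset_subset_G[OF N.a_subset x] by blast
    have "y \<ominus>\<^bsub>M\<^esub> x \<in> N" using N.a_rcos_module_imp[OF x that] by (simp add: a_minus_def)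
    then have "r \<odot>\<^bsub>M\<^esub> y \<ominus>\<^bsub>M\<^esub> r \<odot>\<^bsub>M\<^esub> x \<in> N"
      using smult_minus[OF r y x] N r unfolding submodule_of_def by metis
    then show ?thesis using coset_eq_iff[OF N] x y r by simp
  qed
  moreover have "N +>\<^bsub>M\<^esub> x \<noteq> {}" using N.a_rcos_self[OF x] by blast
  ultimately show ?thesis by (auto simp: quotient_module_def)
qed

end

text \<open>The maps need to be inverse to each other only modulo the submodules, as happens for
  homotopy equivalences acting on cocycles.\<close>

lemma quotient_module_isomorphic:
  assumes Z: "left_module S Z" and Z': "left_module S Z'"
    and N: "submodule_of S Z N" and N': "submodule_of S Z' N'"
    and \<phi>: "\<phi> \<in> mhom S Z Z'" and \<psi>: "\<psi> \<in> mhom S Z' Z"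
    and \<phi>N: "\<And>z. z \<in> N \<Longrightarrow> \<phi> z \<in> N'" and \<psi>N: "\<And>z. z \<in> N' \<Longrightarrow> \<psi> z \<in> N"
    and \<psi>\<phi>: "\<And>z. z \<in> carrier Z \<Longrightarrow> \<psi> (\<phi> z) \<ominus>\<^bsub>Z\<^esub> z \<in> N"
    and \<phi>\<psi>: "\<And>z. z \<in> carrier Z' \<Longrightarrow> \<phi> (\<psi> z) \<ominus>\<^bsub>Z'\<^esub> z \<in> N'"
  shows "module_isomorphic S (quotient_module Z N) (quotient_module Z' N')"
proof -
  interpret Z: left_module S Z by fact
  interpret Z': left_module S Z' by fact
  interpret N: abelian_subgroup N Z by (rule Z.submodule_abelian_subgroup[OF N])
  interpret N': abelian_subgroup N' Z' by (rule Z'.submodule_abelian_subgroup[OF N'])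
  note c = mhomD(1)[OF \<phi>] and c' = mhomD(1)[OF \<psi>]
  \<comment> \<open>All sets in the union are one and the same coset, so no representative has to be
    chosen.\<close>
  define h where "h X = (\<Union>x\<in>X. N' +>\<^bsub>Z'\<^esub> \<phi> x)" for X
  have h: "h (N +>\<^bsub>Z\<^esub> z) = N' +>\<^bsub>Z'\<^esub> \<phi> z" if z: "z \<in> carrier Z" for z
  proof -
    have "N' +>\<^bsub>Z'\<^esub> \<phi> y = N' +>\<^bsub>Z'\<^esub> \<phi> z" if "y \<in> N +>\<^bsub>Z\<^esub> z" for y
    proof -
      have y: "y \<in> carrier Z" using that Z.M.a_r_coset_subset_G[OF N.a_subset z] by blast
      have "y \<ominus>\<^bsub>Z\<^esub> z \<in> N" using N.a_rcos_module_imp[OF z that] by (simp add: a_minus_def)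
      then have "\<phi> y \<ominus>\<^bsub>Z'\<^esub> \<phi> z \<in> N'"
        using \<phi>N Z.hom_minus[OF Z' \<phi> y z, symmetric] by simp
      then show ?thesis using Z'.coset_eq_iff[OF N' c[OF y] c[OF z]] by simp
    qed
    moreover have "N +>\<^bsub>Z\<^esub> z \<noteq> {}" using N.a_rcos_self[OF z] by blast
    ultimately show ?thesis unfolding h_def by blast
  qed
  have car: "carrier (quotient_module Z N) = (\<lambda>z. N +>\<^bsub>Z\<^esub> z) ` carrier Z"
    "carrier (quotient_module Z' N') = (\<lambda>z. N' +>\<^bsub>Z'\<^esub> z) ` carrier Z'"
    by (auto simp: quotient_module_def A_RCOSETS_def')
  have add: "(N +>\<^bsub>Z\<^esub> x) \<oplus>\<^bsub>quotient_module Z N\<^esub> (N +>\<^bsub>Z\<^esub> y) = N +>\<^bsub>Z\<^esub> (x \<oplus>\<^bsub>Z\<^esub> y)"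
    if "x \<in> carrier Z" "y \<in> carrier Z" for x y
    using N.a_rcos_sum[OF that] by (simp add: quotient_module_def)
  have add': "(N' +>\<^bsub>Z'\<^esub> x) \<oplus>\<^bsub>quotient_module Z' N'\<^esub> (N' +>\<^bsub>Z'\<^esub> y) = N' +>\<^bsub>Z'\<^esub> (x \<oplus>\<^bsub>Z'\<^esub> y)"
    if "x \<in> carrier Z'" "y \<in> carrier Z'" for x y
    using N'.a_rcos_sum[OF that] by (simp add: quotient_module_def)
  have "h \<in> mhom S (quotient_module Z N) (quotient_module Z' N')"
  proof (rule mhomI)
    show "h X \<in> carrier (quotient_module Z' N')" if "X \<in> carrier (quotient_module Z N)" for X
      using that c by (auto simp: car h)
    show "h (X \<oplus>\<^bsub>quotient_module Z N\<^esub> Y) = h X \<oplus>\<^bsub>quotient_module Z' N'\<^esub> h Y"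
      if XY: "X \<in> carrier (quotient_module Z N)" "Y \<in> carrier (quotient_module Z N)" for X Y
    proof -
      obtain x y where xy: "x \<in> carrier Z" "X = N +>\<^bsub>Z\<^esub> x" "y \<in> carrier Z" "Y = N +>\<^bsub>Z\<^esub> y"
        using XY by (auto simp: car)
      then show ?thesis by (simp add: add add' h c mhomD(2)[OF \<phi>])
    qed
    show "h (r \<odot>\<^bsub>quotient_module Z N\<^esub> X) = r \<odot>\<^bsub>quotient_module Z' N'\<^esub> h X"
      if r: "r \<in> carrier S" and X: "X \<in> carrier (quotient_module Z N)" for r X
    proof -
      obtain x where x: "x \<in> carrier Z" "X = N +>\<^bsub>Z\<^esub> x" using X by (auto simp: car)
      then show ?thesis using r
        by (simp add: Z.quotient_smult[OF N] Z'.quotient_smult[OF N'] h c mhomD(3)[OF \<phi>])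
    qed
  qed
  moreover have "bij_betw h (carrier (quotient_module Z N)) (carrier (quotient_module Z' N'))"
  proof (rule bij_betwI')
    fix X Y assume XY: "X \<in> carrier (quotient_module Z N)" "Y \<in> carrier (quotient_module Z N)"
    obtain x y where xy: "x \<in> carrier Z" "X = N +>\<^bsub>Z\<^esub> x" "y \<in> carrier Z" "Y = N +>\<^bsub>Z\<^esub> y"
      using XY by (auto simp: car)
    have "X = Y" if "h X = h Y"
    proof -
      have "N' +>\<^bsub>Z'\<^esub> \<phi> x = N' +>\<^bsub>Z'\<^esub> \<phi> y" using that xy h by simp
      then have "\<phi> x \<ominus>\<^bsub>Z'\<^esub> \<phi> y \<in> N'" using Z'.coset_eq_iff[OF N' c[OF xy(1)] c[OF xy(3)]] by simp
      then have "\<psi> (\<phi> x) \<ominus>\<^bsub>Z\<^esub> \<psi> (\<phi> y) \<in> N"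
        using \<psi>N Z'.hom_minus[OF Z \<psi> c[OF xy(1)] c[OF xy(3)], symmetric] by simp
      then have "N +>\<^bsub>Z\<^esub> \<psi> (\<phi> x) = N +>\<^bsub>Z\<^esub> \<psi> (\<phi> y)"
        using Z.coset_eq_iff[OF N c'[OF c[OF xy(1)]] c'[OF c[OF xy(3)]]] by simp
      moreover have "N +>\<^bsub>Z\<^esub> \<psi> (\<phi> z) = N +>\<^bsub>Z\<^esub> z" if "z \<in> carrier Z" for z
        using Z.coset_eq_iff[OF N c'[OF c[OF that]] that] \<psi>\<phi>[OF that] by simp
      ultimately show ?thesis using xy by simp
    qed
    then show "h X = h Y \<longleftrightarrow> X = Y" by blast
  next
    fix X assume "X \<in> carrier (quotient_module Z N)"
    then show "h X \<in> carrier (quotient_module Z' N')" using c by (auto simp: car h)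
  next
    fix Y assume "Y \<in> carrier (quotient_module Z' N')"
    then obtain y where y: "y \<in> carrier Z'" "Y = N' +>\<^bsub>Z'\<^esub> y" by (auto simp: car)
    have "N' +>\<^bsub>Z'\<^esub> \<phi> (\<psi> y) = N' +>\<^bsub>Z'\<^esub> y"
      using Z'.coset_eq_iff[OF N' c[OF c'[OF y(1)]] y(1)] \<phi>\<psi>[OF y(1)] by simp
    then have "Y = h (N +>\<^bsub>Z\<^esub> \<psi> y)" using h[OF c'[OF y(1)]] y by simp
    then show "\<exists>X\<in>carrier (quotient_module Z N). Y = h X" using c'[OF y(1)] by (auto simp: car)
  qed
  ultimately show ?thesis unfolding module_isomorphic_def by blast
qed

lemma module_isomorphic_trans:
  assumes "module_isomorphic S X Y" "module_isomorphic S Y Z"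
  shows "module_isomorphic S X Z"
proof -
  obtain f g where f: "f \<in> mhom S X Y" "bij_betw f (carrier X) (carrier Y)"
    and g: "g \<in> mhom S Y Z" "bij_betw g (carrier Y) (carrier Z)"
    using assms unfolding module_isomorphic_def by blast
  have "bij_betw (\<lambda>x. g (f x)) (carrier X) (carrier Z)"
    using bij_betw_trans[OF f(2) g(2)] by (simp add: comp_def)
  then show ?thesis unfolding module_isomorphic_def by (rule bexI[OF _ mhom_comp[OF f(1) g(1)]])
qed

section \<open>The Hom complex over an algebra\<close>

definition central_embedding :: "('r, 'q) ring_scheme \<Rightarrow> ('k::field \<Rightarrow> 'r) \<Rightarrow> bool" where
  "central_embedding R \<iota> \<longleftrightarrow> (\<forall>c. \<iota> c \<in> carrier R) \<and> (\<forall>c. \<forall>a\<in>carrier R. \<iota> c \<otimes>\<^bsub>R\<^esub> a = a \<otimes>\<^bsub>R\<^esub> \<iota> c) \<and>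
    \<iota> 1 = \<one>\<^bsub>R\<^esub> \<and> (\<forall>c d. \<iota> (c + d) = \<iota> c \<oplus>\<^bsub>R\<^esub> \<iota> d) \<and> (\<forall>c d. \<iota> (c * d) = \<iota> c \<otimes>\<^bsub>R\<^esub> \<iota> d)"

text \<open>Centrality of the embedded field is what makes a scalar multiple of an R-linear map
  R-linear. The remaining laws hold pointwise in W.\<close>

lemma hom_space_left_module:
  fixes \<iota> :: "'k::field \<Rightarrow> 'r"
  assumes \<iota>: "central_embedding R \<iota>" and P: "left_module R P" and W: "left_module R W"
  shows "left_module class_ring (hom_space R \<iota> P W)"
proof -
  interpret P: left_module R P by fact
  interpret W: left_module R W by fact
  let ?H = "hom_space R \<iota> P W"
  have iC: "\<iota> c \<in> carrier R" for c
    using \<iota> unfolding central_embedding_def by blast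
  have icomm: "\<iota> c \<otimes>\<^bsub>R\<^esub> a = a \<otimes>\<^bsub>R\<^esub> \<iota> c" if "a \<in> carrier R" for a c
    using \<iota> that unfolding central_embedding_def by blast
  have iops: "\<iota> 1 = \<one>\<^bsub>R\<^esub>" "\<iota> (c + d) = \<iota> c \<oplus>\<^bsub>R\<^esub> \<iota> d" "\<iota> (c * d) = \<iota> c \<otimes>\<^bsub>R\<^esub> \<iota> d" for c d
    using \<iota> unfolding central_embedding_def by blast+
  have mem: "f \<in> carrier ?H \<longleftrightarrow> f \<in> mhom R P W \<and> f \<in> extensional (carrier P)" for f
    by (simp add: hom_space_def)
  have ops: "\<zero>\<^bsub>?H\<^esub> = (\<lambda>x\<in>carrier P. \<zero>\<^bsub>W\<^esub>)" "f \<oplus>\<^bsub>?H\<^esub> g = (\<lambda>x\<in>carrier P. f x \<oplus>\<^bsub>W\<^esub> g x)"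
    "c \<odot>\<^bsub>?H\<^esub> f = (\<lambda>x\<in>carrier P. \<iota> c \<odot>\<^bsub>W\<^esub> f x)" for f g c by (simp_all add: hom_space_def)
  have res: "restrict f (carrier P) \<in> carrier ?H" if "f \<in> mhom R P W" for f
    unfolding mem using mhom_cong[OF that P, of "restrict f (carrier P)"] by simp
  have z: "(\<lambda>x. \<zero>\<^bsub>W\<^esub>) \<in> mhom R P W" by (rule mhomI) auto
  have add: "f \<oplus>\<^bsub>?H\<^esub> g \<in> carrier ?H" if "f \<in> carrier ?H" "g \<in> carrier ?H" for f g
    unfolding ops by (rule res, rule W.mhom_add) (use that in \<open>simp_all only: mem\<close>)
  have sm: "c \<odot>\<^bsub>?H\<^esub> f \<in> carrier ?H" if "f \<in> carrier ?H" for c f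
    unfolding ops
  proof (rule res, rule mhomI)
    have f: "f \<in> mhom R P W" using that by (simp only: mem)
    fix x assume x: "x \<in> carrier P"
    then show "\<iota> c \<odot>\<^bsub>W\<^esub> f x \<in> carrier W" by (simp add: mhomD[OF f] iC)
    fix y assume "y \<in> carrier P"
    then show "\<iota> c \<odot>\<^bsub>W\<^esub> f (x \<oplus>\<^bsub>P\<^esub> y) = \<iota> c \<odot>\<^bsub>W\<^esub> f x \<oplus>\<^bsub>W\<^esub> \<iota> c \<odot>\<^bsub>W\<^esub> f y"
      using x by (simp add: W.smult_r_distr mhomD[OF f] iC)
  next
    have f: "f \<in> mhom R P W" using that by (simp only: mem)
    fix r x assume rx: "r \<in> carrier R" "x \<in> carrier P"
    have "\<iota> c \<odot>\<^bsub>W\<^esub> f (r \<odot>\<^bsub>P\<^esub> x) = (\<iota> c \<otimes>\<^bsub>R\<^esub> r) \<odot>\<^bsub>W\<^esub> f x"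
      using rx by (simp add: W.smult_assoc mhomD[OF f] iC)
    also have "\<iota> c \<otimes>\<^bsub>R\<^esub> r = r \<otimes>\<^bsub>R\<^esub> \<iota> c" by (rule icomm[OF rx(1)])
    also have "(r \<otimes>\<^bsub>R\<^esub> \<iota> c) \<odot>\<^bsub>W\<^esub> f x = r \<odot>\<^bsub>W\<^esub> (\<iota> c \<odot>\<^bsub>W\<^esub> f x)"
      using rx by (simp add: W.smult_assoc mhomD[OF f] iC)
    finally show "\<iota> c \<odot>\<^bsub>W\<^esub> f (r \<odot>\<^bsub>P\<^esub> x) = r \<odot>\<^bsub>W\<^esub> (\<iota> c \<odot>\<^bsub>W\<^esub> f x)" .
  qed
  have val: "f x \<in> carrier W" if "f \<in> carrier ?H" "x \<in> carrier P" for f x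
    using that(1) mhomD(1)[OF _ that(2), of f R W] by (simp only: mem)
  have fe: "f \<in> extensional (carrier P)" if "f \<in> carrier ?H" for f
    using that by (simp only: mem)
  have zc: "\<zero>\<^bsub>?H\<^esub> \<in> carrier ?H" unfolding ops by (rule res[OF z])
  have "abelian_group ?H"
  proof (rule abelian_groupI)
    fix f assume f: "f \<in> carrier ?H"
    have m: "(\<lambda>x. \<ominus>\<^bsub>W\<^esub> f x) \<in> mhom R P W"
    proof (rule mhom_cong[OF W.mhom_minus[OF z] P])
      show "f \<in> mhom R P W" using f by (simp only: mem)
      show "\<ominus>\<^bsub>W\<^esub> f x = \<zero>\<^bsub>W\<^esub> \<ominus>\<^bsub>W\<^esub> f x" if "x \<in> carrier P" for x
        using val[OF f that] by (simp add: a_minus_def)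
    qed
    then have "restrict (\<lambda>x. \<ominus>\<^bsub>W\<^esub> f x) (carrier P) \<oplus>\<^bsub>?H\<^esub> f = \<zero>\<^bsub>?H\<^esub>"
      using val[OF f] by (auto simp: ops W.M.l_neg)
    then show "\<exists>g\<in>carrier ?H. g \<oplus>\<^bsub>?H\<^esub> f = \<zero>\<^bsub>?H\<^esub>" using res[OF m] by blast
  next
    fix f g k assume fgk: "f \<in> carrier ?H" "g \<in> carrier ?H" "k \<in> carrier ?H"
    show "f \<oplus>\<^bsub>?H\<^esub> g \<oplus>\<^bsub>?H\<^esub> k = f \<oplus>\<^bsub>?H\<^esub> (g \<oplus>\<^bsub>?H\<^esub> k)"
      by (rule extensionalityI[of _ "carrier P"]) (simp_all add: ops W.M.a_assoc val fgk)
  next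
    fix f g assume fg: "f \<in> carrier ?H" "g \<in> carrier ?H"
    show "f \<oplus>\<^bsub>?H\<^esub> g = g \<oplus>\<^bsub>?H\<^esub> f"
      unfolding ops
      by (rule restrict_ext) (rule W.M.a_comm[OF val[OF fg(1)] val[OF fg(2)]])
  next
    fix f assume f: "f \<in> carrier ?H"
    show "\<zero>\<^bsub>?H\<^esub> \<oplus>\<^bsub>?H\<^esub> f = f"
      by (rule extensionalityI[of _ "carrier P"]) (simp_all add: ops val f fe[OF f])
  next
    show "\<zero>\<^bsub>?H\<^esub> \<in> carrier ?H" by (rule zc)
    fix f g assume "f \<in> carrier ?H" "g \<in> carrier ?H"
    then show "f \<oplus>\<^bsub>?H\<^esub> g \<in> carrier ?H" by (rule add)
  qed
  then show ?thesis
  proof (intro left_module.intro left_module_axioms.intro)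
    show "ring (class_ring :: 'k ring)" by (rule class_ring.ring_axioms)
    fix c d :: 'k and f g assume fg: "f \<in> carrier ?H" "g \<in> carrier ?H"
    show "c \<odot>\<^bsub>?H\<^esub> f \<in> carrier ?H" by (rule sm[OF fg(1)])
    show "(c \<oplus>\<^bsub>class_ring\<^esub> d) \<odot>\<^bsub>?H\<^esub> f = c \<odot>\<^bsub>?H\<^esub> f \<oplus>\<^bsub>?H\<^esub> d \<odot>\<^bsub>?H\<^esub> f"
      by (rule extensionalityI[of _ "carrier P"]) (simp_all add: ops W.smult_l_distr val fg iops(2) iC)
    show "c \<odot>\<^bsub>?H\<^esub> (f \<oplus>\<^bsub>?H\<^esub> g) = c \<odot>\<^bsub>?H\<^esub> f \<oplus>\<^bsub>?H\<^esub> c \<odot>\<^bsub>?H\<^esub> g"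
      by (rule extensionalityI[of _ "carrier P"]) (simp_all add: ops W.smult_r_distr val fg iC)
    show "(c \<otimes>\<^bsub>class_ring\<^esub> d) \<odot>\<^bsub>?H\<^esub> f = c \<odot>\<^bsub>?H\<^esub> (d \<odot>\<^bsub>?H\<^esub> f)"
      by (rule extensionalityI[of _ "carrier P"]) (simp_all add: ops W.smult_assoc val fg iops(3) iC)
    show "\<one>\<^bsub>class_ring\<^esub> \<odot>\<^bsub>?H\<^esub> f = f"
      by (rule extensionalityI[of _ "carrier P"]) (simp_all add: ops val fg(1) fe[OF fg(1)] iops(1))
  qed
qed

definition module_complex :: "('r, 'q) ring_scheme \<Rightarrow> (nat \<Rightarrow> ('r, 'p) module) \<Rightarrow> (nat \<Rightarrow> 'p \<Rightarrow> 'p) \<Rightarrow> bool" where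
  "module_complex R P d \<longleftrightarrow> (\<forall>i. left_module R (P i)) \<and> (\<forall>i. d i \<in> mhom R (P (Suc i)) (P i)) \<and>
    (\<forall>i. \<forall>x\<in>carrier (P (Suc (Suc i))). d i (d (Suc i) x) = \<zero>\<^bsub>P i\<^esub>)"

lemma projective_resolution_complex:
  assumes P: "projective_resolution R V P d \<epsilon>" shows "module_complex R P d"
  unfolding module_complex_def
  by (intro conjI allI ballI projective_resolutionD(2,3,8)[OF P])

text \<open>A version free of extensionality, so that composites with chain maps and pointwise
  differences can be formed without restricting them each time. \<open>cocycles_iff\<close> and
  \<open>coboundaries_iff\<close> lead back to the extensional maps of the complex.\<close>

definition is_cocycle :: "('r, 'q) ring_scheme \<Rightarrow> (nat \<Rightarrow> ('r, 'p) module) \<Rightarrow> (nat \<Rightarrow> 'p \<Rightarrow> 'p) \<Rightarrow>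
    ('r, 'w) module \<Rightarrow> nat \<Rightarrow> ('p \<Rightarrow> 'w) \<Rightarrow> bool" where
  "is_cocycle R P d W i z \<longleftrightarrow> z \<in> mhom R (P i) W \<and> (\<forall>x\<in>carrier (P (Suc i)). z (d i x) = \<zero>\<^bsub>W\<^esub>)"

fun is_coboundary :: "('r, 'q) ring_scheme \<Rightarrow> (nat \<Rightarrow> ('r, 'p) module) \<Rightarrow> (nat \<Rightarrow> 'p \<Rightarrow> 'p) \<Rightarrow>
    ('r, 'w) module \<Rightarrow> nat \<Rightarrow> ('p \<Rightarrow> 'w) \<Rightarrow> bool" where
  "is_coboundary R P d W 0 c \<longleftrightarrow> (\<forall>x\<in>carrier (P 0). c x = \<zero>\<^bsub>W\<^esub>)"
| "is_coboundary R P d W (Suc i) c \<longleftrightarrow> (\<exists>u\<in>mhom R (P i) W. \<forall>x\<in>carrier (P (Suc i)). c x = u (d i x))"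

lemma is_coboundary_cong:
  assumes "\<And>x. x \<in> carrier (P i) \<Longrightarrow> c x = c' x" "is_coboundary R P d W i c"
  shows "is_coboundary R P d W i c'"
  using assms by (cases i) auto

lemma hom_space_ops:
  "\<zero>\<^bsub>hom_space R \<iota> P W\<^esub> = (\<lambda>x\<in>carrier P. \<zero>\<^bsub>W\<^esub>)"
  "f \<oplus>\<^bsub>hom_space R \<iota> P W\<^esub> g = (\<lambda>x\<in>carrier P. f x \<oplus>\<^bsub>W\<^esub> g x)"
  "c \<odot>\<^bsub>hom_space R \<iota> P W\<^esub> f = (\<lambda>x\<in>carrier P. \<iota> c \<odot>\<^bsub>W\<^esub> f x)"
  by (simp_all add: hom_space_def)

lemma cocycles_ops:
  "\<zero>\<^bsub>cocycles R \<iota> P d W i\<^esub> = (\<lambda>x\<in>carrier (P i). \<zero>\<^bsub>W\<^esub>)"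
  "f \<oplus>\<^bsub>cocycles R \<iota> P d W i\<^esub> g = (\<lambda>x\<in>carrier (P i). f x \<oplus>\<^bsub>W\<^esub> g x)"
  "c \<odot>\<^bsub>cocycles R \<iota> P d W i\<^esub> f = (\<lambda>x\<in>carrier (P i). \<iota> c \<odot>\<^bsub>W\<^esub> f x)"
  by (simp_all add: cocycles_def hom_space_def)

lemma mhom_zero: "left_module R W \<Longrightarrow> (\<lambda>x. \<zero>\<^bsub>W\<^esub>) \<in> mhom R P W"
proof -
  assume "left_module R W"
  then interpret W: left_module R W .
  show ?thesis by (rule mhomI) auto
qed

context
  fixes R :: "('r, 'q) ring_scheme" and \<iota> :: "'k::field \<Rightarrow> 'r"
    and P :: "nat \<Rightarrow> ('r, 'p) module" and d and W :: "('r, 'w) module"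
  assumes \<iota>: "central_embedding R \<iota>" and P: "module_complex R P d" and W: "left_module R W"
begin

lemma complexD:
  "left_module R (P i)" "d i \<in> mhom R (P (Suc i)) (P i)"
  "x \<in> carrier (P (Suc (Suc i))) \<Longrightarrow> d i (d (Suc i) x) = \<zero>\<^bsub>P i\<^esub>"
  "x \<in> carrier (P (Suc i)) \<Longrightarrow> d i x \<in> carrier (P i)"
proof -
  note D = P[unfolded module_complex_def]
  show "left_module R (P i)" using D by blast
  show d: "d i \<in> mhom R (P (Suc i)) (P i)" using D by blast
  show "x \<in> carrier (P (Suc (Suc i))) \<Longrightarrow> d i (d (Suc i) x) = \<zero>\<^bsub>P i\<^esub>" using D by blast
  show "x \<in> carrier (P (Suc i)) \<Longrightarrow> d i x \<in> carrier (P i)" by (rule mhomD(1)[OF d])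
qed

lemma scalar_mhom: "u \<in> mhom R (P j) W \<Longrightarrow> (\<lambda>x. \<iota> c \<odot>\<^bsub>W\<^esub> u x) \<in> mhom R (P j) W"
proof -
  assume u: "u \<in> mhom R (P j) W"
  interpret W: left_module R W by (rule W)
  have i: "\<iota> c \<in> carrier R" "\<And>a. a \<in> carrier R \<Longrightarrow> \<iota> c \<otimes>\<^bsub>R\<^esub> a = a \<otimes>\<^bsub>R\<^esub> \<iota> c"
    using \<iota> unfolding central_embedding_def by blast+
  show ?thesis
  proof (rule mhomI)
    fix r x assume rx: "r \<in> carrier R" "x \<in> carrier (P j)"
    show "\<iota> c \<odot>\<^bsub>W\<^esub> u (r \<odot>\<^bsub>P j\<^esub> x) = r \<odot>\<^bsub>W\<^esub> (\<iota> c \<odot>\<^bsub>W\<^esub> u x)"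
      unfolding mhomD(3)[OF u rx] using W.smult_assoc[OF i(1) rx(1) mhomD(1)[OF u rx(2)]] W.smult_assoc[OF rx(1) i(1) mhomD(1)[OF u rx(2)]]
        i(2)[OF rx(1)] by metis
  qed (simp_all add: mhomD[OF u] i(1) W.smult_r_distr)
qed

lemma restrict_mhom: "restrict z (carrier (P i)) \<in> mhom R (P i) W \<longleftrightarrow> z \<in> mhom R (P i) W"
  using mhom_cong[OF _ complexD(1), of z i W "restrict z (carrier (P i))"]
    mhom_cong[OF _ complexD(1), of "restrict z (carrier (P i))" i W z] by auto

lemma cocycles_iff:
  "z \<in> carrier (cocycles R \<iota> P d W i) \<longleftrightarrow> z \<in> extensional (carrier (P i)) \<and> is_cocycle R P d W i z"
proof -
  have "compose (carrier (P (Suc i))) z (d i) = (\<lambda>x\<in>carrier (P (Suc i)). \<zero>\<^bsub>W\<^esub>) \<longleftrightarrow>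
    (\<forall>x\<in>carrier (P (Suc i)). z (d i x) = \<zero>\<^bsub>W\<^esub>)"
    unfolding compose_def restrict_def fun_eq_iff by auto
  then show ?thesis by (auto simp: cocycles_def hom_space_def is_cocycle_def)
qed

lemma cocycles_left_module: "left_module class_ring (cocycles R \<iota> P d W i)"
proof -
  interpret H: left_module class_ring "hom_space R \<iota> (P i) W"
    by (rule hom_space_left_module[OF \<iota> complexD(1) W])
  interpret W: left_module R W by (rule W)
  have ic: "\<iota> c \<in> carrier R" for c using \<iota> unfolding central_embedding_def by blast
  let ?K = "carrier (cocycles R \<iota> P d W i)"
  have hs: "z \<in> carrier (hom_space R \<iota> (P i) W)" and zd: "\<And>x. x \<in> carrier (P (Suc i)) \<Longrightarrow> z (d i x) = \<zero>\<^bsub>W\<^esub>"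
    if "z \<in> ?K" for z
    using that unfolding cocycles_iff is_cocycle_def by (auto simp: hom_space_def)
  have mem: "z \<in> ?K" if "z \<in> carrier (hom_space R \<iota> (P i) W)"
    "\<And>x. x \<in> carrier (P (Suc i)) \<Longrightarrow> z (d i x) = \<zero>\<^bsub>W\<^esub>" for z
    using that unfolding cocycles_iff is_cocycle_def by (auto simp: hom_space_def)
  have "left_module class_ring ((hom_space R \<iota> (P i) W)\<lparr>carrier := ?K\<rparr>)"
  proof (rule H.submodule_left_module)
    show "?K \<subseteq> carrier (hom_space R \<iota> (P i) W)" using hs by blast
    show "\<zero>\<^bsub>hom_space R \<iota> (P i) W\<^esub> \<in> ?K"
    proof (rule mem[OF H.M.zero_closed])
      show "\<zero>\<^bsub>hom_space R \<iota> (P i) W\<^esub> (d i x) = \<zero>\<^bsub>W\<^esub>" if "x \<in> carrier (P (Suc i))" for x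
        using complexD(4)[OF that] unfolding hom_space_ops by simp
    qed
    fix z z' assume z: "z \<in> ?K" "z' \<in> ?K"
    show "z \<oplus>\<^bsub>hom_space R \<iota> (P i) W\<^esub> z' \<in> ?K"
    proof (rule mem[OF H.M.a_closed[OF hs[OF z(1)] hs[OF z(2)]]])
      show "(z \<oplus>\<^bsub>hom_space R \<iota> (P i) W\<^esub> z') (d i x) = \<zero>\<^bsub>W\<^esub>" if "x \<in> carrier (P (Suc i))" for x
        using complexD(4)[OF that] zd[OF z(1) that] zd[OF z(2) that] unfolding hom_space_ops by simp
    qed
  next
    fix c :: 'k and z assume z: "z \<in> ?K"
    have "c \<odot>\<^bsub>hom_space R \<iota> (P i) W\<^esub> z \<in> carrier (hom_space R \<iota> (P i) W)"
      by (rule H.smult_closed[OF _ hs[OF z]]) simp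
    then show "c \<odot>\<^bsub>hom_space R \<iota> (P i) W\<^esub> z \<in> ?K"
    proof (rule mem)
      show "(c \<odot>\<^bsub>hom_space R \<iota> (P i) W\<^esub> z) (d i x) = \<zero>\<^bsub>W\<^esub>" if "x \<in> carrier (P (Suc i))" for x
        using complexD(4)[OF that] zd[OF z that] ic[of c] unfolding hom_space_ops by simp
    qed
  qed
  moreover have "(hom_space R \<iota> (P i) W)\<lparr>carrier := ?K\<rparr> = cocycles R \<iota> P d W i"
    by (simp add: cocycles_def)
  ultimately show ?thesis by (simp only:)
qed

text \<open>The negative of a cocycle is given only abstractly by the group structure, so the value
  of a difference is found by adding z back and cancelling in W.\<close>

lemma cocycles_minus:
  assumes y: "y \<in> carrier (cocycles R \<iota> P d W i)" and z: "z \<in> carrier (cocycles R \<iota> P d W i)"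
    and x: "x \<in> carrier (P i)"
  shows "(y \<ominus>\<^bsub>cocycles R \<iota> P d W i\<^esub> z) x = y x \<ominus>\<^bsub>W\<^esub> z x"
proof -
  interpret W: left_module R W by (rule W)
  interpret Z: left_module class_ring "cocycles R \<iota> P d W i" by (rule cocycles_left_module)
  have val: "u x \<in> carrier W" if "u \<in> carrier (cocycles R \<iota> P d W i)" for u
    using that mhomD(1)[OF _ x] unfolding cocycles_iff is_cocycle_def by blast
  let ?m = "y \<ominus>\<^bsub>cocycles R \<iota> P d W i\<^esub> z"
  have m: "?m \<in> carrier (cocycles R \<iota> P d W i)" using y z by (rule Z.M.minus_closed)
  have "(?m \<oplus>\<^bsub>cocycles R \<iota> P d W i\<^esub> z) x = y x" by (simp only: Z.minus_add_cancel[OF y z])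
  then have "?m x \<oplus>\<^bsub>W\<^esub> z x = (y x \<ominus>\<^bsub>W\<^esub> z x) \<oplus>\<^bsub>W\<^esub> z x"
    unfolding cocycles_ops using x W.minus_add_cancel[OF val[OF y] val[OF z]] by simp
  then show ?thesis
    using W.M.add.right_cancel[OF val[OF z] val[OF m] W.M.minus_closed[OF val[OF y] val[OF z]]] by simp
qed

lemma coboundaries_iff:
  "z \<in> coboundaries R \<iota> P d W i \<longleftrightarrow> z \<in> extensional (carrier (P i)) \<and> is_coboundary R P d W i z"
proof (cases i)
  case 0
  have "z = (\<lambda>x\<in>carrier (P 0). \<zero>\<^bsub>W\<^esub>) \<longleftrightarrow>
      z \<in> extensional (carrier (P 0)) \<and> (\<forall>x\<in>carrier (P 0). z x = \<zero>\<^bsub>W\<^esub>)"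
    by (auto simp: extensional_def fun_eq_iff)
  then show ?thesis by (simp add: 0 hom_space_ops)
next
  case (Suc j)
  have "z \<in> extensional (carrier (P (Suc j)))" if "z = compose (carrier (P (Suc j))) u (d j)" for u
    using that by (simp add: compose_def)
  moreover have "\<exists>u'\<in>carrier (hom_space R \<iota> (P j) W). z = compose (carrier (P (Suc j))) u' (d j)"
    if u: "u \<in> mhom R (P j) W" and z: "z \<in> extensional (carrier (P (Suc j)))"
      "\<forall>x\<in>carrier (P (Suc j)). z x = u (d j x)" for u
  proof
    show "restrict u (carrier (P j)) \<in> carrier (hom_space R \<iota> (P j) W)"
      using u by (simp add: hom_space_def restrict_mhom)
    show "z = compose (carrier (P (Suc j))) (restrict u (carrier (P j))) (d j)"
      by (rule extensionalityI[OF z(1)]) (simp_all add: compose_def z(2) complexD(4))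
  qed
  moreover have "u \<in> mhom R (P j) W" if "u \<in> carrier (hom_space R \<iota> (P j) W)" for u
    using that by (simp add: hom_space_def)
  moreover have "compose (carrier (P (Suc j))) u (d j) x = u (d j x)" if "x \<in> carrier (P (Suc j))" for u x
    using that by (simp add: compose_def)
  ultimately show ?thesis unfolding Suc coboundaries.simps is_coboundary.simps by blast
qed

lemma coboundary_cocycle:
  assumes z: "is_coboundary R P d W i z"
  shows "is_cocycle R P d W i z"
proof (cases i)
  case 0
  have "z \<in> mhom R (P 0) W" by (rule mhom_cong[OF mhom_zero[OF W] complexD(1)]) (use z 0 in simp)
  then show ?thesis using z 0 by (simp add: is_cocycle_def complexD(4))
next
  case (Suc j)
  interpret Pj: left_module R "P j" by (rule complexD(1))
  obtain u where u: "u \<in> mhom R (P j) W" "\<And>x. x \<in> carrier (P (Suc j)) \<Longrightarrow> z x = u (d j x)"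
    using z Suc by auto
  have "z \<in> mhom R (P (Suc j)) W" by (rule mhom_cong[OF mhom_comp[OF complexD(2) u(1)] complexD(1) u(2)])
  moreover have "z (d (Suc j) x) = \<zero>\<^bsub>W\<^esub>" if "x \<in> carrier (P (Suc (Suc j)))" for x
    using u(2)[OF complexD(4)[OF that]] complexD(3)[OF that] Pj.hom_zero[OF W u(1)] by simp
  ultimately show ?thesis using Suc by (simp add: is_cocycle_def)
qed

lemma coboundaries_submodule:
  "submodule_of class_ring (cocycles R \<iota> P d W i) (coboundaries R \<iota> P d W i)"
proof -
  interpret W: left_module R W by (rule W)
  have ic: "\<iota> c \<in> carrier R" for c using \<iota> unfolding central_embedding_def by blast
  have zero: "is_coboundary R P d W i (\<lambda>x. \<zero>\<^bsub>W\<^esub>)"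
    using mhom_zero[OF W] by (cases i) (auto intro: bexI[of _ "\<lambda>x. \<zero>\<^bsub>W\<^esub>"])
  have add: "is_coboundary R P d W i (\<lambda>x. z x \<oplus>\<^bsub>W\<^esub> z' x)"
    if z: "is_coboundary R P d W i z" "is_coboundary R P d W i z'" for z z'
  proof (cases i)
    case (Suc j)
    from z obtain u u' where "u \<in> mhom R (P j) W" "u' \<in> mhom R (P j) W"
      "\<And>x. x \<in> carrier (P (Suc j)) \<Longrightarrow> z x = u (d j x) \<and> z' x = u' (d j x)"
      unfolding Suc is_coboundary.simps by blast
    then show ?thesis unfolding Suc is_coboundary.simps
      by (intro bexI[of _ "\<lambda>x. u x \<oplus>\<^bsub>W\<^esub> u' x"] W.mhom_add) auto
  qed (use z in simp)
  have sm: "is_coboundary R P d W i (\<lambda>x. \<iota> c \<odot>\<^bsub>W\<^esub> z x)" if z: "is_coboundary R P d W i z" for z c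
  proof (cases i)
    case (Suc j)
    from z obtain u where "u \<in> mhom R (P j) W" "\<And>x. x \<in> carrier (P (Suc j)) \<Longrightarrow> z x = u (d j x)"
      unfolding Suc is_coboundary.simps by blast
    then show ?thesis unfolding Suc is_coboundary.simps
      by (intro bexI[of _ "\<lambda>x. \<iota> c \<odot>\<^bsub>W\<^esub> u x"] scalar_mhom) auto
  qed (use z ic in simp)
  have res: "restrict z (carrier (P i)) \<in> coboundaries R \<iota> P d W i" if "is_coboundary R P d W i z" for z
    unfolding coboundaries_iff by (simp add: is_coboundary_cong[OF _ that])
  have cob: "is_coboundary R P d W i z" if "z \<in> coboundaries R \<iota> P d W i" for z
    using that unfolding coboundaries_iff by (rule conjunct2)
  show ?thesis unfolding submodule_of_def cocycles_ops
  proof (intro conjI ballI subsetI)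
    show "z \<in> carrier (cocycles R \<iota> P d W i)" if "z \<in> coboundaries R \<iota> P d W i" for z
      using that coboundary_cocycle[OF cob[OF that]] unfolding coboundaries_iff cocycles_iff by simp
    show "(\<lambda>x\<in>carrier (P i). \<zero>\<^bsub>W\<^esub>) \<in> coboundaries R \<iota> P d W i" by (rule res[OF zero])
    show "(\<lambda>x\<in>carrier (P i). z x \<oplus>\<^bsub>W\<^esub> z' x) \<in> coboundaries R \<iota> P d W i"
      if "z \<in> coboundaries R \<iota> P d W i" "z' \<in> coboundaries R \<iota> P d W i" for z z'
      by (rule res[OF add[OF cob[OF that(1)] cob[OF that(2)]]])
    show "(\<lambda>x\<in>carrier (P i). \<iota> c \<odot>\<^bsub>W\<^esub> z x) \<in> coboundaries R \<iota> P d W i"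
      if "z \<in> coboundaries R \<iota> P d W i" for c z
      by (rule res[OF sm[OF cob[OF that]]])
  qed
qed

text \<open>The zero of the quotient is the set of coboundaries itself, recognized here as the coset
  of the zero cocycle.\<close>

lemma hom_cohomology_zero: "\<zero>\<^bsub>hom_cohomology R \<iota> P d W i\<^esub> \<in> carrier (hom_cohomology R \<iota> P d W i)"
proof -
  interpret Z: left_module class_ring "cocycles R \<iota> P d W i" by (rule cocycles_left_module)
  interpret N: abelian_subgroup "coboundaries R \<iota> P d W i" "cocycles R \<iota> P d W i"
    by (rule Z.submodule_abelian_subgroup[OF coboundaries_submodule])
  have "coboundaries R \<iota> P d W i = coboundaries R \<iota> P d W i +>\<^bsub>cocycles R \<iota> P d W i\<^esub> \<zero>\<^bsub>cocycles R \<iota> P d W i\<^esub>"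
    using N.a_rcos_const[OF N.zero_closed] by simp
  then show ?thesis by (auto simp: hom_cohomology_def quotient_module_def A_RCOSETS_def')
qed

lemma hom_cohomology_trivial:
  assumes "\<And>z. is_cocycle R P d W i z \<Longrightarrow> is_coboundary R P d W i z"
  shows "carrier (hom_cohomology R \<iota> P d W i) = {\<zero>\<^bsub>hom_cohomology R \<iota> P d W i\<^esub>}"
proof -
  interpret Z: left_module class_ring "cocycles R \<iota> P d W i" by (rule cocycles_left_module)
  interpret N: abelian_subgroup "coboundaries R \<iota> P d W i" "cocycles R \<iota> P d W i"
    by (rule Z.submodule_abelian_subgroup[OF coboundaries_submodule])
  have "carrier (cocycles R \<iota> P d W i) \<subseteq> coboundaries R \<iota> P d W i"
    using assms unfolding cocycles_iff coboundaries_iff subset_iff by blast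
  then have X: "X = coboundaries R \<iota> P d W i" if "X \<in> carrier (hom_cohomology R \<iota> P d W i)" for X
    using that N.a_rcos_const
    unfolding hom_cohomology_def quotient_module_def partial_object.simps A_RCOSETS_def' by auto
  have "\<zero>\<^bsub>hom_cohomology R \<iota> P d W i\<^esub> = coboundaries R \<iota> P d W i"
    by (simp add: hom_cohomology_def quotient_module_def)
  with X show ?thesis using hom_cohomology_zero by blast
qed

end

section \<open>Isomorphisms between cohomology spaces\<close>

text \<open>The two complexes may live over different rings, so f and g are bare functions in degree
  i, judged only by what composition with them does to cocycles and coboundaries. W and W' share
  their elements, their addition and the action of the field. In this form the lemma covers a change
  of resolution as well as the passage to a corner ring.\<close>

lemma hom_cohomology_isomorphic:
  fixes R :: "('r, 'q) ring_scheme" and \<iota> :: "'k::field \<Rightarrow> 'r" and P :: "nat \<Rightarrow> ('r, 'p) module"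
    and W :: "('r, 'w) module" and R' :: "('s, 't) ring_scheme" and \<iota>' :: "'k \<Rightarrow> 's"
    and Q :: "nat \<Rightarrow> ('s, 'u) module" and W' :: "('s, 'w) module"
  assumes P: "central_embedding R \<iota>" "module_complex R P d" "left_module R W"
    and Q: "central_embedding R' \<iota>'" "module_complex R' Q d'" "left_module R' W'"
    and WW: "zero W' = zero W" "add W' = add W" "\<And>c w. w \<in> carrier W \<Longrightarrow> \<iota>' c \<odot>\<^bsub>W'\<^esub> w = \<iota> c \<odot>\<^bsub>W\<^esub> w"
      "carrier W' = carrier W"
    and f: "\<And>x. x \<in> carrier (Q i) \<Longrightarrow> f x \<in> carrier (P i)"
    and g: "\<And>x. x \<in> carrier (P i) \<Longrightarrow> g x \<in> carrier (Q i)"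
    and fz: "\<And>z. is_cocycle R P d W i z \<Longrightarrow> is_cocycle R' Q d' W' i (\<lambda>x. z (f x))"
    and gz: "\<And>z. is_cocycle R' Q d' W' i z \<Longrightarrow> is_cocycle R P d W i (\<lambda>x. z (g x))"
    and fc: "\<And>c. is_coboundary R P d W i c \<Longrightarrow> is_coboundary R' Q d' W' i (\<lambda>x. c (f x))"
    and gc: "\<And>c. is_coboundary R' Q d' W' i c \<Longrightarrow> is_coboundary R P d W i (\<lambda>x. c (g x))"
    and fg: "\<And>z. is_cocycle R P d W i z \<Longrightarrow> is_coboundary R P d W i (\<lambda>x. z (f (g x)) \<ominus>\<^bsub>W\<^esub> z x)"
    and gf: "\<And>z. is_cocycle R' Q d' W' i z \<Longrightarrow> is_coboundary R' Q d' W' i (\<lambda>x. z (g (f x)) \<ominus>\<^bsub>W'\<^esub> z x)"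
  shows "module_isomorphic class_ring (hom_cohomology R \<iota> P d W i) (hom_cohomology R' \<iota>' Q d' W' i)"
  unfolding hom_cohomology_def
proof (rule quotient_module_isomorphic)
  let ?Z = "cocycles R \<iota> P d W i" and ?Z' = "cocycles R' \<iota>' Q d' W' i"
  let ?f = "\<lambda>z. \<lambda>x\<in>carrier (Q i). z (f x)" and ?g = "\<lambda>z. \<lambda>x\<in>carrier (P i). z (g x)"
  interpret Z: left_module class_ring ?Z by (rule cocycles_left_module[OF P])
  interpret Z': left_module class_ring ?Z' by (rule cocycles_left_module[OF Q])
  interpret W: left_module R W by (rule P)
  interpret W': left_module R' W' by (rule Q)
  show "left_module class_ring ?Z" "left_module class_ring ?Z'" by unfold_locales
  show "submodule_of class_ring ?Z (coboundaries R \<iota> P d W i)" by (rule coboundaries_submodule[OF P])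
  show "submodule_of class_ring ?Z' (coboundaries R' \<iota>' Q d' W' i)" by (rule coboundaries_submodule[OF Q])
  note iff = cocycles_iff[OF P] cocycles_iff[OF Q] coboundaries_iff[OF P] coboundaries_iff[OF Q]
  have Zc: "is_cocycle R P d W i z" if "z \<in> carrier ?Z" for z using that unfolding iff by (rule conjunct2)
  have Z'c: "is_cocycle R' Q d' W' i z" if "z \<in> carrier ?Z'" for z using that unfolding iff by (rule conjunct2)
  have res: "restrict z (carrier (P i)) \<in> carrier ?Z" if "is_cocycle R P d W i z" for z
    using that restrict_mhom[OF P] complexD(4)[OF P] unfolding iff is_cocycle_def by simp
  have res': "restrict z (carrier (Q i)) \<in> carrier ?Z'" if "is_cocycle R' Q d' W' i z" for z
    using that restrict_mhom[OF Q] complexD(4)[OF Q] unfolding iff is_cocycle_def by simp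
  have val: "z x \<in> carrier W" if "z \<in> carrier ?Z" "x \<in> carrier (P i)" for z x
    using Zc[OF that(1)] mhomD(1)[OF _ that(2)] unfolding is_cocycle_def by blast
  have val': "z x \<in> carrier W'" if "z \<in> carrier ?Z'" "x \<in> carrier (Q i)" for z x
    using Z'c[OF that(1)] mhomD(1)[OF _ that(2)] unfolding is_cocycle_def by blast
  show F: "?f \<in> mhom class_ring ?Z ?Z'"
  proof (rule mhomI)
    show "?f z \<in> carrier ?Z'" if "z \<in> carrier ?Z" for z by (rule res'[OF fz[OF Zc[OF that]]])
    show "?f (y \<oplus>\<^bsub>?Z\<^esub> z) = ?f y \<oplus>\<^bsub>?Z'\<^esub> ?f z" for y z
      unfolding cocycles_ops by (rule restrict_ext) (simp add: f WW)
    show "?f (c \<odot>\<^bsub>?Z\<^esub> z) = c \<odot>\<^bsub>?Z'\<^esub> ?f z" if z: "z \<in> carrier ?Z" for c z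
      unfolding cocycles_ops by (rule restrict_ext) (simp add: f WW val[OF z])
  qed
  show G: "?g \<in> mhom class_ring ?Z' ?Z"
  proof (rule mhomI)
    show "?g z \<in> carrier ?Z" if "z \<in> carrier ?Z'" for z by (rule res[OF gz[OF Z'c[OF that]]])
    show "?g (y \<oplus>\<^bsub>?Z'\<^esub> z) = ?g y \<oplus>\<^bsub>?Z\<^esub> ?g z" for y z
      unfolding cocycles_ops by (rule restrict_ext) (simp add: g WW)
    show "?g (c \<odot>\<^bsub>?Z'\<^esub> z) = c \<odot>\<^bsub>?Z\<^esub> ?g z" if z: "z \<in> carrier ?Z'" for c z
      unfolding cocycles_ops using val'[OF z g] by (intro restrict_ext) (simp add: g WW)
  qed
  show "?f z \<in> coboundaries R' \<iota>' Q d' W' i" if "z \<in> coboundaries R \<iota> P d W i" for z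
    unfolding iff
  proof
    have "is_coboundary R P d W i z" using that unfolding iff by (rule conjunct2)
    from fc[OF this] show "is_coboundary R' Q d' W' i (?f z)" by (rule is_coboundary_cong[rotated]) simp
  qed simp
  show "?g z \<in> coboundaries R \<iota> P d W i" if "z \<in> coboundaries R' \<iota>' Q d' W' i" for z
    unfolding iff
  proof
    have "is_coboundary R' Q d' W' i z" using that unfolding iff by (rule conjunct2)
    from gc[OF this] show "is_coboundary R P d W i (?g z)" by (rule is_coboundary_cong[rotated]) simp
  qed simp
  note mval = cocycles_minus[OF P] and mval' = cocycles_minus[OF Q]
  show "?g (?f z) \<ominus>\<^bsub>?Z\<^esub> z \<in> coboundaries R \<iota> P d W i" if z: "z \<in> carrier ?Z" for z
  proof -
    have c: "?g (?f z) \<in> carrier ?Z"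
      by (rule mhomD(1)[OF G mhomD(1)[OF F z]])
    then have "?g (?f z) \<ominus>\<^bsub>?Z\<^esub> z \<in> carrier ?Z" using z by simp
    moreover have "is_coboundary R P d W i (\<lambda>x. z (f (g x)) \<ominus>\<^bsub>W\<^esub> z x)" by (rule fg[OF Zc[OF z]])
    then have "is_coboundary R P d W i (?g (?f z) \<ominus>\<^bsub>?Z\<^esub> z)"
      by (rule is_coboundary_cong[rotated]) (subst mval[OF c z], assumption, simp add: g)
    ultimately show ?thesis unfolding iff by simp
  qed
  show "?f (?g z) \<ominus>\<^bsub>?Z'\<^esub> z \<in> coboundaries R' \<iota>' Q d' W' i" if z: "z \<in> carrier ?Z'" for z
  proof -
    have c: "?f (?g z) \<in> carrier ?Z'"
      by (rule mhomD(1)[OF F mhomD(1)[OF G z]])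
    then have "?f (?g z) \<ominus>\<^bsub>?Z'\<^esub> z \<in> carrier ?Z'" using z by simp
    moreover have "is_coboundary R' Q d' W' i (\<lambda>x. z (g (f x)) \<ominus>\<^bsub>W'\<^esub> z x)" by (rule gf[OF Z'c[OF z]])
    then have "is_coboundary R' Q d' W' i (?f (?g z) \<ominus>\<^bsub>?Z'\<^esub> z)"
      by (rule is_coboundary_cong[rotated]) (subst mval'[OF c z], assumption, simp add: f)
    ultimately show ?thesis unfolding iff by simp
  qed
qed

lemma cocycle_pullback:
  assumes P: "module_complex R P e" and Q: "module_complex R Q e'" and W: "left_module R W"
    and h: "\<And>i. h i \<in> mhom R (Q i) (P i)" "\<And>i x. x \<in> carrier (Q (Suc i)) \<Longrightarrow> e i (h (Suc i) x) = h i (e' i x)"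
    and z: "is_cocycle R P e W i z"
  shows "is_cocycle R Q e' W i (\<lambda>x. z (h i x))"
proof -
  have zh: "z \<in> mhom R (P i) W" "\<And>x. x \<in> carrier (P (Suc i)) \<Longrightarrow> z (e i x) = \<zero>\<^bsub>W\<^esub>"
    using z by (auto simp: is_cocycle_def)
  have "z (h i (e' i x)) = \<zero>\<^bsub>W\<^esub>" if "x \<in> carrier (Q (Suc i))" for x
    using zh(2)[OF mhomD(1)[OF h(1) that]] h(2)[OF that] by simp
  then show ?thesis using mhom_comp[OF h(1) zh(1)] by (simp add: is_cocycle_def)
qed

lemma coboundary_pullback:
  assumes h: "\<And>i. h i \<in> mhom R (Q i) (P i)" "\<And>i x. x \<in> carrier (Q (Suc i)) \<Longrightarrow> e i (h (Suc i) x) = h i (e' i x)"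
    and z: "is_coboundary R P e W i z"
  shows "is_coboundary R Q e' W i (\<lambda>x. z (h i x))"
proof (cases i)
  case 0
  show ?thesis unfolding 0 is_coboundary.simps
  proof
    fix x assume "x \<in> carrier (Q 0)"
    from mhomD(1)[OF h(1) this] show "z (h 0 x) = \<zero>\<^bsub>W\<^esub>" using z unfolding 0 is_coboundary.simps by blast
  qed
next
  case (Suc j)
  from z obtain u where u: "u \<in> mhom R (P j) W" "\<forall>x\<in>carrier (P (Suc j)). z x = u (e j x)"
    unfolding Suc is_coboundary.simps by (rule bexE)
  show ?thesis unfolding Suc is_coboundary.simps
  proof (rule bexI[OF _ mhom_comp[OF h(1) u(1)]], rule ballI)
    fix x assume x: "x \<in> carrier (Q (Suc j))"
    show "z (h (Suc j) x) = u (h j (e' j x))"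
      using bspec[OF u(2) mhomD(1)[OF h(1) x]] unfolding h(2)[OF x] .
  qed
qed

text \<open>The difference of h and the identity lies over zero, hence has a null homotopy s. A
  cocycle z kills the part of the homotopy formula that ends with a differential, and z after s
  bounds what is left; in degree zero nothing is left.\<close>

lemma cocycle_endomorphism:
  assumes V: "left_module R V" and W: "left_module R W" and P: "projective_resolution R V P e \<delta>"
    and h: "\<And>i. h i \<in> mhom R (P i) (P i)" "\<And>x. x \<in> carrier (P 0) \<Longrightarrow> \<delta> (h 0 x) = \<delta> x"
      "\<And>i x. x \<in> carrier (P (Suc i)) \<Longrightarrow> e i (h (Suc i) x) = h i (e i x)"
    and z: "is_cocycle R P e W i z"
  shows "is_coboundary R P e W i (\<lambda>x. z (h i x) \<ominus>\<^bsub>W\<^esub> z x)"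
proof -
  interpret W: left_module R W by fact
  interpret V: left_module R V by fact
  note p = projective_resolutionD[OF P]
  have zh: "z \<in> mhom R (P i) W" "\<And>x. x \<in> carrier (P (Suc i)) \<Longrightarrow> z (e i x) = \<zero>\<^bsub>W\<^esub>"
    using z unfolding is_cocycle_def by blast+
  let ?k = "\<lambda>i x. h i x \<ominus>\<^bsub>P i\<^esub> x"
  have id: "(\<lambda>x. x) \<in> mhom R (P i) (P i)" for i by (rule mhomI) simp_all
  have k: "?k i \<in> mhom R (P i) (P i)" for i by (rule left_module.mhom_minus[OF p(2) h(1) id])
  have k0: "\<delta> (?k 0 x) = \<zero>\<^bsub>V\<^esub>" if x: "x \<in> carrier (P 0)" for x
    unfolding left_module.hom_minus[OF p(2) V p(4) mhomD(1)[OF h(1) x] x] h(2)[OF x]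
    by (rule V.minus_self[OF mhomD(1)[OF p(4) x]])
  have kd: "e j (?k (Suc j) x) = ?k j (e j x)" if x: "x \<in> carrier (P (Suc j))" for j x
    unfolding left_module.hom_minus[OF p(2) p(2) p(3) mhomD(1)[OF h(1) x] x] h(3)[OF x] ..
  have zk: "z (?k i x) = z (h i x) \<ominus>\<^bsub>W\<^esub> z x" if x: "x \<in> carrier (P i)" for x
    by (rule left_module.hom_minus[OF p(2) W zh(1) mhomD(1)[OF h(1) x] x])
  obtain s where s: "\<And>i. s i \<in> mhom R (P i) (P (Suc i))"
    "\<And>x. x \<in> carrier (P 0) \<Longrightarrow> ?k 0 x = e 0 (s 0 x)"
    "\<And>i x. x \<in> carrier (P (Suc i)) \<Longrightarrow> ?k (Suc i) x = e (Suc i) (s (Suc i) x) \<oplus>\<^bsub>P (Suc i)\<^esub> s i (e i x)"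
  proof (rule null_homotopy[where h = ?k, OF V P P k k0 kd])
    fix s assume "\<And>i. s i \<in> mhom R (P i) (P (Suc i))"
      "\<And>x. x \<in> carrier (P 0) \<Longrightarrow> ?k 0 x = e 0 (s 0 x)"
      "\<And>i x. x \<in> carrier (P (Suc i)) \<Longrightarrow> ?k (Suc i) x = e (Suc i) (s (Suc i) x) \<oplus>\<^bsub>P (Suc i)\<^esub> s i (e i x)"
    then show thesis by (rule that[of s])
  qed
  show ?thesis
  proof (cases i)
    case 0
    note zk = zk[unfolded 0] and zh = zh[unfolded 0]
    show ?thesis unfolding 0 is_coboundary.simps
    proof
      fix x assume x: "x \<in> carrier (P 0)"
      show "z (h 0 x) \<ominus>\<^bsub>W\<^esub> z x = \<zero>\<^bsub>W\<^esub>"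
        unfolding zk[OF x, symmetric] s(2)[OF x] by (rule zh(2)[OF mhomD(1)[OF s(1) x]])
    qed
  next
    case (Suc j)
    note zk = zk[unfolded Suc] and zh = zh[unfolded Suc]
    show ?thesis unfolding Suc is_coboundary.simps
    proof (rule bexI[OF _ mhom_comp[OF s(1) zh(1)]], rule ballI)
      fix x assume x: "x \<in> carrier (P (Suc j))"
      have c: "e (Suc j) (s (Suc j) x) \<in> carrier (P (Suc j))" "s j (e j x) \<in> carrier (P (Suc j))"
        by (rule mhomD(1)[OF p(3) mhomD(1)[OF s(1) x]], rule mhomD(1)[OF s(1) mhomD(1)[OF p(3) x]])
      show "z (h (Suc j) x) \<ominus>\<^bsub>W\<^esub> z x = z (s j (e j x))"
        unfolding zk[OF x, symmetric] s(3)[OF x] mhomD(2)[OF zh(1) c] zh(2)[OF mhomD(1)[OF s(1) x]]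
        by (rule W.M.l_zero[OF mhomD(1)[OF zh(1) c(2)]])
    qed
  qed
qed

text \<open>Comparison maps in both directions compose to chain endomorphisms over the identity of
  V, and these act trivially on cohomology.\<close>

lemma hom_cohomology_resolution_independent:
  fixes \<iota> :: "'k::field \<Rightarrow> 'r"
  assumes \<iota>: "central_embedding R \<iota>" and V: "left_module R V" and W: "left_module R W"
    and P: "projective_resolution R V P d \<epsilon>" and Q: "projective_resolution R V Q d' \<epsilon>'"
  shows "module_isomorphic class_ring (hom_cohomology R \<iota> P d W i) (hom_cohomology R \<iota> Q d' W i)"
proof -
  note Pc = projective_resolution_complex[OF P] and Qc = projective_resolution_complex[OF Q]
  obtain g where g: "\<And>i. g i \<in> mhom R (P i) (Q i)" "\<And>x. x \<in> carrier (P 0) \<Longrightarrow> \<epsilon>' (g 0 x) = \<epsilon> x"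
    "\<And>i x. x \<in> carrier (P (Suc i)) \<Longrightarrow> d' i (g (Suc i) x) = g i (d i x)"
    using comparison_map[OF V P Q] by metis
  obtain f where f: "\<And>i. f i \<in> mhom R (Q i) (P i)" "\<And>x. x \<in> carrier (Q 0) \<Longrightarrow> \<epsilon> (f 0 x) = \<epsilon>' x"
    "\<And>i x. x \<in> carrier (Q (Suc i)) \<Longrightarrow> d i (f (Suc i) x) = f i (d' i x)"
    using comparison_map[OF V Q P] by metis
  show ?thesis
  proof (rule hom_cohomology_isomorphic[OF \<iota> Pc W \<iota> Qc W, where f = "f i" and g = "g i"])
    show "\<And>x. x \<in> carrier (Q i) \<Longrightarrow> f i x \<in> carrier (P i)" by (rule mhomD(1)[OF f(1)])
    show "\<And>x. x \<in> carrier (P i) \<Longrightarrow> g i x \<in> carrier (Q i)" by (rule mhomD(1)[OF g(1)])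
    show "is_cocycle R Q d' W i (\<lambda>x. z (f i x))" if "is_cocycle R P d W i z" for z
      by (rule cocycle_pullback[OF Pc Qc W f(1,3) that])
    show "is_cocycle R P d W i (\<lambda>x. z (g i x))" if "is_cocycle R Q d' W i z" for z
      by (rule cocycle_pullback[OF Qc Pc W g(1,3) that])
    show "is_coboundary R Q d' W i (\<lambda>x. z (f i x))" if "is_coboundary R P d W i z" for z
      by (rule coboundary_pullback[OF f(1,3) that])
    show "is_coboundary R P d W i (\<lambda>x. z (g i x))" if "is_coboundary R Q d' W i z" for z
      by (rule coboundary_pullback[OF g(1,3) that])
    show "is_coboundary R P d W i (\<lambda>x. z (f i (g i x)) \<ominus>\<^bsub>W\<^esub> z x)" if "is_cocycle R P d W i z" for z
    proof (rule cocycle_endomorphism[OF V W P _ _ _ that, where h = "\<lambda>i x. f i (g i x)"])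
      show "(\<lambda>x. f i (g i x)) \<in> mhom R (P i) (P i)" for i by (rule mhom_comp[OF g(1) f(1)])
      show "\<epsilon> (f 0 (g 0 x)) = \<epsilon> x" if "x \<in> carrier (P 0)" for x
        using f(2)[OF mhomD(1)[OF g(1) that]] g(2)[OF that] by simp
      show "d i (f (Suc i) (g (Suc i) x)) = f i (g i (d i x))" if "x \<in> carrier (P (Suc i))" for i x
        using f(3)[OF mhomD(1)[OF g(1) that]] g(3)[OF that] by simp
    qed
    show "is_coboundary R Q d' W i (\<lambda>x. z (g i (f i x)) \<ominus>\<^bsub>W\<^esub> z x)" if "is_cocycle R Q d' W i z" for z
    proof (rule cocycle_endomorphism[OF V W Q _ _ _ that, where h = "\<lambda>i x. g i (f i x)"])
      show "(\<lambda>x. g i (f i x)) \<in> mhom R (Q i) (Q i)" for i by (rule mhom_comp[OF f(1) g(1)])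
      show "\<epsilon>' (g 0 (f 0 x)) = \<epsilon>' x" if "x \<in> carrier (Q 0)" for x
        using g(2)[OF mhomD(1)[OF f(1) that]] f(2)[OF that] by simp
      show "d' i (g (Suc i) (f (Suc i) x)) = g i (f i (d' i x))" if "x \<in> carrier (Q (Suc i))" for i x
        using g(3)[OF mhomD(1)[OF f(1) that]] f(3)[OF that] by simp
    qed
  qed simp_all
qed

text \<open>Every submodule being a direct summand makes all modules injective.\<close>

lemma hom_cohomology_split:
  fixes \<iota> :: "'k::field \<Rightarrow> 'r" and P :: "nat \<Rightarrow> ('r, 'p) module"
  assumes \<iota>: "central_embedding R \<iota>" and W: "left_module R W"
    and P: "projective_resolution R V P d \<epsilon>"
    and split: "\<And>(M :: ('r, 'p) module) N. left_module R M \<Longrightarrow> submodule_of R M N \<Longrightarrow>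
      \<exists>\<rho>\<in>mhom R M M. (\<forall>x\<in>carrier M. \<rho> x \<in> N) \<and> (\<forall>x\<in>N. \<rho> x = x)"
  shows "carrier (hom_cohomology R \<iota> P d W (Suc j)) = {\<zero>\<^bsub>hom_cohomology R \<iota> P d W (Suc j)\<^esub>}"
proof (rule hom_cohomology_trivial[OF \<iota> projective_resolution_complex[OF P] W])
  note p = projective_resolutionD[OF P]
  interpret Pj: left_module R "P j" by (rule p(2))
  interpret S: left_module R "P (Suc j)" by (rule p(2))
  interpret W: left_module R W by (rule W)
  fix z assume "is_cocycle R P d W (Suc j) z"
  then have z: "z \<in> mhom R (P (Suc j)) W" and zd: "\<And>x. x \<in> carrier (P (Suc (Suc j))) \<Longrightarrow> z (d (Suc j) x) = \<zero>\<^bsub>W\<^esub>"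
    by (auto simp: is_cocycle_def)
  \<comment> \<open>The cocycle z vanishes on the image of the next differential, which by exactness
    is the kernel of \<open>d j\<close>; so z depends only on the image under
    \<open>d j\<close>.\<close>
  have zeq: "z x = z y" if xy: "x \<in> carrier (P (Suc j))" "y \<in> carrier (P (Suc j))" "d j x = d j y" for x y
  proof -
    have m: "x \<ominus>\<^bsub>P (Suc j)\<^esub> y \<in> carrier (P (Suc j))" using xy by simp
    have "d j (x \<ominus>\<^bsub>P (Suc j)\<^esub> y) = \<zero>\<^bsub>P j\<^esub>"
      unfolding S.hom_minus[OF p(2) p(3) xy(1,2)] xy(3) by (rule Pj.minus_self[OF mhomD(1)[OF p(3) xy(2)]])
    then obtain v where "v \<in> carrier (P (Suc (Suc j)))" "x \<ominus>\<^bsub>P (Suc j)\<^esub> y = d (Suc j) v"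
      unfolding p(7)[OF m] by (rule imageE)
    then have "z (x \<ominus>\<^bsub>P (Suc j)\<^esub> y) = \<zero>\<^bsub>W\<^esub>" using zd by simp
    then show ?thesis
      using S.hom_minus[OF W z xy(1,2)] W.minus_eq_zero[OF mhomD(1)[OF z xy(1)] mhomD(1)[OF z xy(2)]] by simp
  qed
  let ?N = "d j ` carrier (P (Suc j))"
  have "submodule_of R (P j) ?N"
    unfolding submodule_of_def
  proof (intro conjI ballI)
    show "?N \<subseteq> carrier (P j)" using mhomD(1)[OF p(3)] by blast
    show "\<zero>\<^bsub>P j\<^esub> \<in> ?N" 
      by (rule image_eqI[OF _ S.M.zero_closed]) (rule S.hom_zero[OF p(2) p(3), symmetric])
    show "a \<oplus>\<^bsub>P j\<^esub> b \<in> ?N" if ab: "a \<in> ?N" "b \<in> ?N" for a b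
    proof -
      obtain x y where xy: "x \<in> carrier (P (Suc j))" "y \<in> carrier (P (Suc j))" and e: "a = d j x" "b = d j y"
        using ab by blast
      show ?thesis unfolding e mhomD(2)[OF p(3) xy, symmetric] by (rule imageI[OF S.M.a_closed[OF xy]])
    qed
    show "r \<odot>\<^bsub>P j\<^esub> a \<in> ?N" if ra: "r \<in> carrier R" "a \<in> ?N" for r a
    proof -
      obtain x where x: "x \<in> carrier (P (Suc j))" and e: "a = d j x" using ra by blast
      show ?thesis unfolding e mhomD(3)[OF p(3) ra(1) x, symmetric]
        by (rule imageI[OF S.smult_closed[OF ra(1) x]])
    qed
  qed
  from split[OF p(2) this] obtain \<rho> where \<rho>: "\<rho> \<in> mhom R (P j) (P j)"
    "\<And>x. x \<in> carrier (P j) \<Longrightarrow> \<rho> x \<in> ?N" "\<And>x. x \<in> ?N \<Longrightarrow> \<rho> x = x" by blast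
  \<comment> \<open>A choice of preimages, in general not linear. The composite of z with it is
    linear all the same, because z depends only on the image under \<open>d j\<close>.\<close>
  define t where "t y = (SOME x. x \<in> carrier (P (Suc j)) \<and> d j x = \<rho> y)" for y
  have t: "t y \<in> carrier (P (Suc j))" "d j (t y) = \<rho> y" if y: "y \<in> carrier (P j)" for y
  proof -
    from \<rho>(2)[OF y] obtain x where "\<rho> y = d j x" "x \<in> carrier (P (Suc j))" by (rule imageE)
    then have "\<exists>x. x \<in> carrier (P (Suc j)) \<and> d j x = \<rho> y" by (intro exI[of _ x]) simp
    from someI_ex[OF this] show "t y \<in> carrier (P (Suc j))" "d j (t y) = \<rho> y"
      unfolding t_def by (rule conjunct1, rule conjunct2)
  qed
  have "(\<lambda>y. z (t y)) \<in> mhom R (P j) W"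
  proof (rule mhomI)
    show "z (t x) \<in> carrier W" if "x \<in> carrier (P j)" for x by (rule mhomD(1)[OF z t(1)[OF that]])
    show "z (t (x \<oplus>\<^bsub>P j\<^esub> y)) = z (t x) \<oplus>\<^bsub>W\<^esub> z (t y)" if xy: "x \<in> carrier (P j)" "y \<in> carrier (P j)" for x y
    proof -
      have "z (t (x \<oplus>\<^bsub>P j\<^esub> y)) = z (t x \<oplus>\<^bsub>P (Suc j)\<^esub> t y)"
      proof (rule zeq)
        show "d j (t (x \<oplus>\<^bsub>P j\<^esub> y)) = d j (t x \<oplus>\<^bsub>P (Suc j)\<^esub> t y)"
          unfolding t(2)[OF Pj.M.a_closed[OF xy]] mhomD(2)[OF \<rho>(1) xy]
            mhomD(2)[OF p(3) t(1)[OF xy(1)] t(1)[OF xy(2)]] t(2)[OF xy(1)] t(2)[OF xy(2)] ..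
      qed (rule t(1)[OF Pj.M.a_closed[OF xy]], rule S.M.a_closed[OF t(1)[OF xy(1)] t(1)[OF xy(2)]])
      then show ?thesis using mhomD(2)[OF z t(1)[OF xy(1)] t(1)[OF xy(2)]] by simp
    qed
    show "z (t (r \<odot>\<^bsub>P j\<^esub> x)) = r \<odot>\<^bsub>W\<^esub> z (t x)" if rx: "r \<in> carrier R" "x \<in> carrier (P j)" for r x
    proof -
      have "z (t (r \<odot>\<^bsub>P j\<^esub> x)) = z (r \<odot>\<^bsub>P (Suc j)\<^esub> t x)"
      proof (rule zeq)
        show "d j (t (r \<odot>\<^bsub>P j\<^esub> x)) = d j (r \<odot>\<^bsub>P (Suc j)\<^esub> t x)"
          unfolding t(2)[OF Pj.smult_closed[OF rx]] mhomD(3)[OF \<rho>(1) rx]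
            mhomD(3)[OF p(3) rx(1) t(1)[OF rx(2)]] t(2)[OF rx(2)] ..
      qed (rule t(1)[OF Pj.smult_closed[OF rx]], rule S.smult_closed[OF rx(1) t(1)[OF rx(2)]])
      then show ?thesis using mhomD(3)[OF z rx(1) t(1)[OF rx(2)]] by simp
    qed
  qed
  moreover have "z x = z (t (d j x))" if x: "x \<in> carrier (P (Suc j))" for x
  proof (rule zeq[OF x])
    have dx: "d j x \<in> carrier (P j)" by (rule mhomD(1)[OF p(3) x])
    show "t (d j x) \<in> carrier (P (Suc j))" by (rule t(1)[OF dx])
    show "d j x = d j (t (d j x))" unfolding t(2)[OF dx] \<rho>(3)[OF imageI[OF x]] ..
  qed
  ultimately show "is_coboundary R P d W (Suc j) z" unfolding is_coboundary.simps by (intro bexI ballI)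
qed

section \<open>Corner rings\<close>

lemma is_coboundary_zeroI:
  assumes W: "left_module R W" and c: "\<And>x. x \<in> carrier (P i) \<Longrightarrow> c x = \<zero>\<^bsub>W\<^esub>"
  shows "is_coboundary R P d W i c"
proof (cases i)
  case (Suc j)
  show ?thesis unfolding Suc is_coboundary.simps
    by (rule bexI[OF _ mhom_zero[OF W]]) (use c Suc in simp)
qed (use c in simp)

text \<open>A ring surjection \<open>\<pi> : A \<rightarrow> B\<close> with a multiplicative section \<open>s\<close> such that left
  multiplication by some \<open>e\<close> over \<open>1\<close> factors through \<open>\<pi>\<close>. Then \<open>B = e A e = e A\<close>, and
  \<open>P \<mapsto> e P\<close> is an exact left adjoint of restriction along \<open>\<pi>\<close>.\<close>

locale ring_retract = A: ring A + B: ring B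
  for A :: "('a, 'c) ring_scheme" and B :: "('b, 'd) ring_scheme" +
  fixes \<pi> :: "'a \<Rightarrow> 'b" and s :: "'b \<Rightarrow> 'a" and e :: 'a
  assumes \<pi>: "\<pi> \<in> Ring.ring_hom A B" and s: "s \<in> Ring.ring_hom B A"
    and \<pi>s: "b \<in> carrier B \<Longrightarrow> \<pi> (s b) = b"
    and e: "e \<in> carrier A" and \<pi>e: "\<pi> e = \<one>\<^bsub>B\<^esub>"
    and es\<pi>: "a \<in> carrier A \<Longrightarrow> e \<otimes>\<^bsub>A\<^esub> s (\<pi> a) = e \<otimes>\<^bsub>A\<^esub> a"
begin

lemmas \<pi>_simps [simp] = Ring.ring_hom_closed[OF \<pi>] Ring.ring_hom_mult[OF \<pi>] Ring.ring_hom_add[OF \<pi>] Ring.ring_hom_one[OF \<pi>] \<pi>e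
lemmas s_simps [simp] = Ring.ring_hom_closed[OF s] Ring.ring_hom_mult[OF s] Ring.ring_hom_add[OF s] Ring.ring_hom_one[OF s] \<pi>s

text \<open>The elements a e and a have the same image under \<pi>, and left multiplication by e
  depends on this image only.\<close>

lemma e_absorb: "a \<in> carrier A \<Longrightarrow> e \<otimes>\<^bsub>A\<^esub> (a \<otimes>\<^bsub>A\<^esub> e) = e \<otimes>\<^bsub>A\<^esub> a"
  using es\<pi>[of "a \<otimes>\<^bsub>A\<^esub> e"] es\<pi>[of a] e by simp

lemma e_idem: "e \<otimes>\<^bsub>A\<^esub> e = e"
  using e_absorb[of "\<one>\<^bsub>A\<^esub>"] e by simp

section \<open>The functor from P to e P\<close>

text \<open>The section s lifts scalars of B to A, and the additional factor e returns the result to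
  e P. It also makes the action independent of the chosen lift.\<close>

definition corner :: "('a, 'p) module \<Rightarrow> ('b, 'p) module" where
  "corner P = \<lparr>carrier = {x \<in> carrier P. e \<odot>\<^bsub>P\<^esub> x = x}, mult = undefined, one = undefined,
    zero = zero P, add = add P, smult = (\<lambda>r x. e \<odot>\<^bsub>P\<^esub> (s r \<odot>\<^bsub>P\<^esub> x))\<rparr>"

lemma corner_simps:
  "x \<in> carrier (corner P) \<longleftrightarrow> x \<in> carrier P \<and> e \<odot>\<^bsub>P\<^esub> x = x"
  "zero (corner P) = zero P" "add (corner P) = add P" "r \<odot>\<^bsub>corner P\<^esub> x = e \<odot>\<^bsub>P\<^esub> (s r \<odot>\<^bsub>P\<^esub> x)"
  by (simp_all add: corner_def)

lemma restrict_scalars_simps: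
  "carrier (restrict_scalars \<pi> W) = carrier W" "zero (restrict_scalars \<pi> W) = zero W"
  "add (restrict_scalars \<pi> W) = add W" "a \<odot>\<^bsub>restrict_scalars \<pi> W\<^esub> w = \<pi> a \<odot>\<^bsub>W\<^esub> w"
  by (simp_all add: restrict_scalars_def)

lemma restrict_scalars_left_module:
  assumes "left_module B W" shows "left_module A (restrict_scalars \<pi> W)"
proof -
  interpret W: left_module B W by fact
  have "abelian_group (restrict_scalars \<pi> W)"
  proof (rule abelian_groupI)
    show "\<exists>y\<in>carrier (restrict_scalars \<pi> W). y \<oplus>\<^bsub>restrict_scalars \<pi> W\<^esub> x = \<zero>\<^bsub>restrict_scalars \<pi> W\<^esub>"
      if "x \<in> carrier (restrict_scalars \<pi> W)" for x
      using that W.M.l_neg W.M.a_inv_closed unfolding restrict_scalars_simps by blast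
  qed (simp_all add: restrict_scalars_simps W.M.a_ac)
  then show ?thesis
    by (intro left_module.intro left_module_axioms.intro)
      (simp_all add: restrict_scalars_simps A.ring_axioms W.smult_l_distr W.smult_r_distr W.smult_assoc)
qed

context
  fixes P :: "('a, 'p) module"
  assumes P: "left_module A P"
begin

interpretation P: left_module A P by (rule P)

lemma e_smult: "x \<in> carrier P \<Longrightarrow> e \<odot>\<^bsub>P\<^esub> x \<in> carrier (corner P)"
  using P.smult_assoc[OF e e, of x] e by (simp add: corner_simps e_idem)

lemma e_smult_absorb: "a \<in> carrier A \<Longrightarrow> x \<in> carrier P \<Longrightarrow>
    e \<odot>\<^bsub>P\<^esub> (a \<odot>\<^bsub>P\<^esub> (e \<odot>\<^bsub>P\<^esub> x)) = e \<odot>\<^bsub>P\<^esub> (a \<odot>\<^bsub>P\<^esub> x)"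
  using e_absorb[of a] e by (simp add: P.smult_assoc[symmetric] A.m_assoc)

lemma e_smult_section: "a \<in> carrier A \<Longrightarrow> x \<in> carrier P \<Longrightarrow>
    e \<odot>\<^bsub>P\<^esub> (s (\<pi> a) \<odot>\<^bsub>P\<^esub> x) = e \<odot>\<^bsub>P\<^esub> (a \<odot>\<^bsub>P\<^esub> x)"
  using es\<pi>[of a] e by (simp add: P.smult_assoc[symmetric])

lemma corner_left_module: "left_module B (corner P)"
proof -
  have "abelian_group (corner P)"
  proof (rule abelian_groupI)
    show "\<exists>y\<in>carrier (corner P). y \<oplus>\<^bsub>corner P\<^esub> x = \<zero>\<^bsub>corner P\<^esub>" if x: "x \<in> carrier (corner P)" for x
    proof
      show "\<ominus>\<^bsub>P\<^esub> x \<in> carrier (corner P)" using x P.smult_uminus[OF e, of x] by (simp add: corner_simps)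
      show "\<ominus>\<^bsub>P\<^esub> x \<oplus>\<^bsub>corner P\<^esub> x = \<zero>\<^bsub>corner P\<^esub>" using x by (simp add: corner_simps P.M.l_neg)
    qed
  qed (use e in \<open>simp_all add: corner_simps P.M.a_ac P.smult_r_distr\<close>)
  then show ?thesis
  proof (intro left_module.intro left_module_axioms.intro B.ring_axioms)
    fix r r' x y assume r: "r \<in> carrier B" "r' \<in> carrier B" and xy: "x \<in> carrier (corner P)" "y \<in> carrier (corner P)"
    then have x: "x \<in> carrier P" "e \<odot>\<^bsub>P\<^esub> x = x" "y \<in> carrier P" by (simp_all add: corner_simps)
    show "r \<odot>\<^bsub>corner P\<^esub> x \<in> carrier (corner P)"
      using e_smult[of "s r \<odot>\<^bsub>P\<^esub> x"] r x by (simp add: corner_simps(4))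
    show "(r \<oplus>\<^bsub>B\<^esub> r') \<odot>\<^bsub>corner P\<^esub> x = r \<odot>\<^bsub>corner P\<^esub> x \<oplus>\<^bsub>corner P\<^esub> r' \<odot>\<^bsub>corner P\<^esub> x"
      using r x e by (simp add: corner_simps P.smult_l_distr P.smult_r_distr)
    show "r \<odot>\<^bsub>corner P\<^esub> (x \<oplus>\<^bsub>corner P\<^esub> y) = r \<odot>\<^bsub>corner P\<^esub> x \<oplus>\<^bsub>corner P\<^esub> r \<odot>\<^bsub>corner P\<^esub> y"
      using r x e by (simp add: corner_simps P.smult_r_distr)
    show "(r \<otimes>\<^bsub>B\<^esub> r') \<odot>\<^bsub>corner P\<^esub> x = r \<odot>\<^bsub>corner P\<^esub> (r' \<odot>\<^bsub>corner P\<^esub> x)"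
      using r x e by (simp add: corner_simps e_smult_absorb P.smult_assoc)
  next
    fix x assume "x \<in> carrier (corner P)"
    then show "\<one>\<^bsub>B\<^esub> \<odot>\<^bsub>corner P\<^esub> x = x" by (simp add: corner_simps)
  qed
qed

lemma corner_mhom:
  assumes f: "f \<in> mhom A P Q" shows "f \<in> mhom B (corner P) (corner Q)"
proof (rule mhomI)
  fix x assume "x \<in> carrier (corner P)"
  then have x: "x \<in> carrier P" "e \<odot>\<^bsub>P\<^esub> x = x" by (simp_all add: corner_simps)
  then show "f x \<in> carrier (corner Q)"
    using mhomD(3)[OF f e x(1)] mhomD(1)[OF f x(1)] by (simp add: corner_simps)
  show "f (r \<odot>\<^bsub>corner P\<^esub> x) = r \<odot>\<^bsub>corner Q\<^esub> f x" if "r \<in> carrier B" for r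
    using that x e by (simp add: corner_simps mhomD[OF f])
qed (simp add: corner_simps mhomD[OF f])

lemma mhom_restrict_corner:
  assumes z: "z \<in> mhom A P (restrict_scalars \<pi> W)" and W: "left_module B W"
  shows "z \<in> mhom B (corner P) W"
proof (rule mhomI)
  interpret W: left_module B W by (rule W)
  note zD = mhomD[OF z, unfolded restrict_scalars_simps]
  fix r x assume "r \<in> carrier B" "x \<in> carrier (corner P)"
  then show "z (r \<odot>\<^bsub>corner P\<^esub> x) = r \<odot>\<^bsub>W\<^esub> z x" using e by (simp add: corner_simps zD)
qed (simp_all add: corner_simps mhomD[OF z, unfolded restrict_scalars_simps])

text \<open>The inverse of restriction to e P in the adjunction: multiplication by e carries the
  action of a on P to that of \<pi> a on e P.\<close>

lemma mhom_extend_corner: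
  assumes w: "w \<in> mhom B (corner P) W"
  shows "(\<lambda>x. w (e \<odot>\<^bsub>P\<^esub> x)) \<in> mhom A P (restrict_scalars \<pi> W)"
proof (rule mhomI)
  fix x y assume xy: "x \<in> carrier P" "y \<in> carrier P"
  show "w (e \<odot>\<^bsub>P\<^esub> x) \<in> carrier (restrict_scalars \<pi> W)"
    using mhomD(1)[OF w e_smult[OF xy(1)]] by (simp add: restrict_scalars_simps)
  show "w (e \<odot>\<^bsub>P\<^esub> (x \<oplus>\<^bsub>P\<^esub> y)) = w (e \<odot>\<^bsub>P\<^esub> x) \<oplus>\<^bsub>restrict_scalars \<pi> W\<^esub> w (e \<odot>\<^bsub>P\<^esub> y)"
    using mhomD(2)[OF w e_smult[OF xy(1)] e_smult[OF xy(2)]] xy e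
    by (simp add: restrict_scalars_simps corner_simps P.smult_r_distr)
next
  fix a x assume ax: "a \<in> carrier A" "x \<in> carrier P"
  have "\<pi> a \<odot>\<^bsub>corner P\<^esub> (e \<odot>\<^bsub>P\<^esub> x) = e \<odot>\<^bsub>P\<^esub> (a \<odot>\<^bsub>P\<^esub> x)"
    using ax e by (simp add: corner_simps e_smult_absorb e_smult_section)
  then show "w (e \<odot>\<^bsub>P\<^esub> (a \<odot>\<^bsub>P\<^esub> x)) = a \<odot>\<^bsub>restrict_scalars \<pi> W\<^esub> w (e \<odot>\<^bsub>P\<^esub> x)"
    using mhomD(3)[OF w Ring.ring_hom_closed[OF \<pi> ax(1)] e_smult[OF ax(2)]] by (simp add: restrict_scalars_simps)
qed

end

lemma free_module_map:
  assumes f: "f \<in> carrier (free_module A C)"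
  shows "(\<lambda>b. \<pi> (f b)) \<in> carrier (free_module B C)"
proof -
  have z: "\<pi> \<zero>\<^bsub>A\<^esub> = \<zero>\<^bsub>B\<^esub>" by (rule ring_hom_zero[OF \<pi> A.ring_axioms B.ring_axioms])
  have "{b. \<pi> (f b) \<noteq> \<zero>\<^bsub>B\<^esub>} \<subseteq> {b. f b \<noteq> \<zero>\<^bsub>A\<^esub>}" using z by auto
  then show ?thesis using f finite_subset by (auto simp: free_module_def)
qed

lemma free_module_map_section:
  assumes f: "f \<in> carrier (free_module B C)"
  shows "(\<lambda>b. s (f b)) \<in> carrier (free_module A C)"
proof -
  have z: "s \<zero>\<^bsub>B\<^esub> = \<zero>\<^bsub>A\<^esub>" by (rule ring_hom_zero[OF s B.ring_axioms A.ring_axioms])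
  have "{b. s (f b) \<noteq> \<zero>\<^bsub>A\<^esub>} \<subseteq> {b. f b \<noteq> \<zero>\<^bsub>B\<^esub>}" using z by auto
  then show ?thesis using f finite_subset by (auto simp: free_module_def)
qed

text \<open>For a free A-module F the B-module e F is free on the same basis, since e A is a copy of
  B. For a summand P of F this amounts to applying \<pi> to coordinates on the way in, and s
  followed by e on the way out; the composite is the identity by e s(\<pi> a) = e a.\<close>

lemma corner_projective:
  fixes P :: "('a, 'p) module"
  assumes proj: "projective_module A P" shows "projective_module B (corner P)"
proof -
  have P: "left_module A P" using proj by (simp add: projective_module_def)
  interpret P: left_module A P by (rule P)
  obtain C :: "'p set" and i r where i: "i \<in> mhom A P (free_module A C)"
    and r: "r \<in> mhom A (free_module A C) P" and ri: "\<And>x. x \<in> carrier P \<Longrightarrow> r (i x) = x"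
    using proj unfolding projective_module_def by blast
  let ?F = "free_module A C" and ?G = "free_module B C"
  interpret F: left_module A ?F by (rule free_left_module[OF A.ring_axioms])
  have Fops: "f \<oplus>\<^bsub>?F\<^esub> g = (\<lambda>b. f b \<oplus>\<^bsub>A\<^esub> g b)" "a \<odot>\<^bsub>?F\<^esub> f = (\<lambda>b. a \<otimes>\<^bsub>A\<^esub> f b)" for f g a
    by (simp_all add: free_module_def)
  have Gops: "f \<oplus>\<^bsub>?G\<^esub> g = (\<lambda>b. f b \<oplus>\<^bsub>B\<^esub> g b)" "a \<odot>\<^bsub>?G\<^esub> f = (\<lambda>b. a \<otimes>\<^bsub>B\<^esub> f b)" for f g a
    by (simp_all add: free_module_def)
  have Fv: "f b \<in> carrier A" if "f \<in> carrier ?F" for f b using that by (auto simp: free_module_def)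
  have Gv: "f b \<in> carrier B" if "f \<in> carrier ?G" for f b using that by (auto simp: free_module_def)
  let ?i = "\<lambda>x b. \<pi> (i x b)" and ?r = "\<lambda>g. e \<odot>\<^bsub>P\<^esub> r (\<lambda>b. s (g b))"
  have i': "?i \<in> mhom B (corner P) ?G"
  proof (rule mhomI)
    fix x y assume "x \<in> carrier (corner P)" "y \<in> carrier (corner P)"
    then have xy: "x \<in> carrier P" "y \<in> carrier P" by (simp_all add: corner_simps)
    note ix = mhomD(1)[OF i xy(1)] and iy = mhomD(1)[OF i xy(2)]
    show "?i x \<in> carrier ?G" by (rule free_module_map[OF ix])
    show "?i (x \<oplus>\<^bsub>corner P\<^esub> y) = ?i x \<oplus>\<^bsub>?G\<^esub> ?i y"
      unfolding corner_simps mhomD(2)[OF i xy] Fops Gops using Fv[OF ix] Fv[OF iy] by simp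
    fix c assume c: "c \<in> carrier B"
    have "i (c \<odot>\<^bsub>corner P\<^esub> x) = e \<odot>\<^bsub>?F\<^esub> (s c \<odot>\<^bsub>?F\<^esub> i x)"
      using c e xy by (simp add: corner_simps mhomD[OF i])
    then show "?i (c \<odot>\<^bsub>corner P\<^esub> x) = c \<odot>\<^bsub>?G\<^esub> ?i x"
      unfolding Fops Gops using Fv[OF ix] c e by simp
  qed
  have r': "?r \<in> mhom B ?G (corner P)"
  proof (rule mhomI)
    fix f g assume fg: "f \<in> carrier ?G" "g \<in> carrier ?G"
    note sf = free_module_map_section[OF fg(1)] and sg = free_module_map_section[OF fg(2)]
    show "?r f \<in> carrier (corner P)" by (rule e_smult[OF P mhomD(1)[OF r sf]])
    have "(\<lambda>b. s ((f \<oplus>\<^bsub>?G\<^esub> g) b)) = (\<lambda>b. s (f b)) \<oplus>\<^bsub>?F\<^esub> (\<lambda>b. s (g b))"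
      unfolding Fops Gops using Gv[OF fg(1)] Gv[OF fg(2)] by simp
    then show "?r (f \<oplus>\<^bsub>?G\<^esub> g) = ?r f \<oplus>\<^bsub>corner P\<^esub> ?r g"
      using mhomD(1,2)[OF r sf] mhomD(1)[OF r sg] sg e by (simp add: corner_simps P.smult_r_distr)
    fix c assume c: "c \<in> carrier B"
    have "(\<lambda>b. s ((c \<odot>\<^bsub>?G\<^esub> f) b)) = s c \<odot>\<^bsub>?F\<^esub> (\<lambda>b. s (f b))"
      unfolding Fops Gops using Gv[OF fg(1)] c by simp
    then have "?r (c \<odot>\<^bsub>?G\<^esub> f) = e \<odot>\<^bsub>P\<^esub> (s c \<odot>\<^bsub>P\<^esub> r (\<lambda>b. s (f b)))"
      using mhomD(3)[OF r _ sf, of "s c"] c by simp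
    also have "\<dots> = c \<odot>\<^bsub>corner P\<^esub> ?r f"
      using e_smult_absorb[OF P _ mhomD(1)[OF r sf], of "s c"] c by (simp add: corner_simps)
    finally show "?r (c \<odot>\<^bsub>?G\<^esub> f) = c \<odot>\<^bsub>corner P\<^esub> ?r f" .
  qed
  have "?r (?i x) = x" if "x \<in> carrier (corner P)" for x
  proof -
    have x: "x \<in> carrier P" "e \<odot>\<^bsub>P\<^esub> x = x" using that by (simp_all add: corner_simps)
    note ix = mhomD(1)[OF i x(1)]
    note six = free_module_map_section[OF free_module_map[OF ix]]
    have "e \<odot>\<^bsub>?F\<^esub> (\<lambda>b. s (\<pi> (i x b))) = e \<odot>\<^bsub>?F\<^esub> i x"
      unfolding Fops using es\<pi> Fv[OF ix] by simp
    then have "r (e \<odot>\<^bsub>?F\<^esub> (\<lambda>b. s (\<pi> (i x b)))) = r (e \<odot>\<^bsub>?F\<^esub> i x)" by simp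
    then show ?thesis unfolding mhomD(3)[OF r e six] mhomD(3)[OF r e ix] ri[OF x(1)] x(2) .
  qed
  then show ?thesis
    unfolding projective_module_def
    using corner_left_module[OF P] i' r' by (intro conjI exI[of _ C] bexI[of _ ?i] bexI[of _ ?r]) auto
qed

text \<open>A preimage y of an element fixed by e can be replaced by e y, because the differentials
  are A-linear; so exactness survives. The augmentation stays surjective because e acts on V as
  \<pi> e, that is, as one.\<close>

lemma corner_resolution:
  assumes V: "left_module B V" and P: "projective_resolution A (restrict_scalars \<pi> V) P d \<epsilon>"
  shows "projective_resolution B V (\<lambda>i. corner (P i)) d \<epsilon>"
  unfolding projective_resolution_def
proof (intro conjI allI)
  note p = projective_resolutionD[OF P]
  interpret V: left_module B V by fact
  have eP: "e \<odot>\<^bsub>P i\<^esub> x \<in> carrier (corner (P i))" if "x \<in> carrier (P i)" for i x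
    by (rule e_smult[OF p(2) that])
  have sub: "x \<in> carrier (P i)" "e \<odot>\<^bsub>P i\<^esub> x = x" if "x \<in> carrier (corner (P i))" for i x
    using that by (simp_all add: corner_simps)
  have img: "x \<in> d i ` carrier (corner (P (Suc i)))" if x: "x \<in> carrier (corner (P i))"
    and im: "x \<in> d i ` carrier (P (Suc i))" for i x
  proof -
    obtain y where y: "y \<in> carrier (P (Suc i))" "x = d i y" using im by blast
    have "d i (e \<odot>\<^bsub>P (Suc i)\<^esub> y) = x" using mhomD(3)[OF p(3) e y(1)] sub(2)[OF x] y(2) by simp
    then show ?thesis using eP[OF y(1)] by blast
  qed
  have dc: "d i \<in> mhom B (corner (P (Suc i))) (corner (P i))" for i by (rule corner_mhom[OF p(2) p(3)])
  show "projective_module B (corner (P i))" for i by (rule corner_projective[OF p(1)])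
  show "d i \<in> mhom B (corner (P (Suc i))) (corner (P i))" for i by (rule dc)
  show \<epsilon>: "\<epsilon> \<in> mhom B (corner (P 0)) V" by (rule mhom_restrict_corner[OF p(2) p(4) V])
  show "\<epsilon> ` carrier (corner (P 0)) = carrier V"
  proof (intro equalityI subsetI)
    show "v \<in> carrier V" if "v \<in> \<epsilon> ` carrier (corner (P 0))" for v using that mhomD(1)[OF \<epsilon>] by blast
    fix v assume v: "v \<in> carrier V"
    then have "v \<in> \<epsilon> ` carrier (P 0)" using p(5) by (simp add: restrict_scalars_simps)
    then obtain x where x: "x \<in> carrier (P 0)" "\<epsilon> x = v" by blast
    have "\<epsilon> (e \<odot>\<^bsub>P 0\<^esub> x) = v" using mhomD(3)[OF p(4) e x(1)] x(2) v by (simp add: restrict_scalars_simps)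
    then show "v \<in> \<epsilon> ` carrier (corner (P 0))" using eP[OF x(1)] by blast
  qed
  show "{x \<in> carrier (corner (P 0)). \<epsilon> x = \<zero>\<^bsub>V\<^esub>} = d 0 ` carrier (corner (P (Suc 0)))"
  proof (intro equalityI subsetI)
    fix x assume "x \<in> {x \<in> carrier (corner (P 0)). \<epsilon> x = \<zero>\<^bsub>V\<^esub>}"
    then have x: "x \<in> carrier (corner (P 0))" "\<epsilon> x = \<zero>\<^bsub>V\<^esub>" by simp_all
    then show "x \<in> d 0 ` carrier (corner (P (Suc 0)))"
      using p(6)[OF sub(1)[OF x(1)]] img[OF x(1)] by (simp add: restrict_scalars_simps)
  next
    fix x assume "x \<in> d 0 ` carrier (corner (P (Suc 0)))"
    then obtain y where y: "y \<in> carrier (corner (P (Suc 0)))" "x = d 0 y" by blast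
    then show "x \<in> {x \<in> carrier (corner (P 0)). \<epsilon> x = \<zero>\<^bsub>V\<^esub>}"
      using p(9)[OF sub(1)[OF y(1)]] mhomD(1)[OF dc y(1)] by (simp add: restrict_scalars_simps)
  qed
  show "{x \<in> carrier (corner (P (Suc i))). d i x = \<zero>\<^bsub>corner (P i)\<^esub>} = d (Suc i) ` carrier (corner (P (Suc (Suc i))))" for i
  proof (intro equalityI subsetI)
    fix x assume "x \<in> {x \<in> carrier (corner (P (Suc i))). d i x = \<zero>\<^bsub>corner (P i)\<^esub>}"
    then have x: "x \<in> carrier (corner (P (Suc i)))" "d i x = \<zero>\<^bsub>P i\<^esub>" by (simp_all add: corner_simps(2))
    then show "x \<in> d (Suc i) ` carrier (corner (P (Suc (Suc i))))"
      using p(7)[OF sub(1)[OF x(1)]] img[OF x(1)] by simp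
  next
    fix x assume "x \<in> d (Suc i) ` carrier (corner (P (Suc (Suc i))))"
    then obtain y where y: "y \<in> carrier (corner (P (Suc (Suc i))))" "x = d (Suc i) y" by blast
    then show "x \<in> {x \<in> carrier (corner (P (Suc i))). d i x = \<zero>\<^bsub>corner (P i)\<^esub>}"
      using p(8)[OF sub(1)[OF y(1)]] mhomD(1)[OF dc y(1)] by (simp add: corner_simps(2))
  qed
qed

text \<open>On W the element e acts as one, so z (e x) = z x for every A-linear z. Hence restriction
  of cochains to e P and composition with multiplication by e are inverse to each other already
  before passing to cohomology, and all correction terms are zero.\<close>

lemma corner_cohomology:
  fixes \<iota> :: "'k::field \<Rightarrow> 'a" and W :: "('b, 'w) module"
  assumes \<iota>: "central_embedding A \<iota>" and \<iota>': "central_embedding B \<iota>'" and \<pi>\<iota>: "\<And>c. \<pi> (\<iota> c) = \<iota>' c"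
    and V: "left_module B V" and W: "left_module B W"
    and P: "projective_resolution A (restrict_scalars \<pi> V) P d \<epsilon>"
  shows "module_isomorphic class_ring (hom_cohomology A \<iota> P d (restrict_scalars \<pi> W) i)
    (hom_cohomology B \<iota>' (\<lambda>i. corner (P i)) d W i)"
proof -
  note p = projective_resolutionD[OF P]
  let ?Q = "\<lambda>i. corner (P i)" and ?W = "restrict_scalars \<pi> W"
  interpret W: left_module B W by fact
  have W': "left_module A ?W" by (rule restrict_scalars_left_module[OF W])
  interpret W': left_module A ?W by (rule W')
  have sub: "x \<in> carrier (P i)" "e \<odot>\<^bsub>P i\<^esub> x = x" if "x \<in> carrier (?Q i)" for i x
    using that by (simp_all add: corner_simps)
  have ed: "e \<odot>\<^bsub>P j\<^esub> d j x = d j (e \<odot>\<^bsub>P (Suc j)\<^esub> x)" if "x \<in> carrier (P (Suc j))" for j x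
    using mhomD(3)[OF p(3) e that] by simp
  have ez: "z (e \<odot>\<^bsub>P j\<^esub> x) = z x" if z: "z \<in> mhom A (P j) ?W" and x: "x \<in> carrier (P j)" for z j x
    using mhomD(3)[OF z e x] mhomD(1)[OF z x] by (simp add: restrict_scalars_simps)
  have zeroA: "is_coboundary A P d ?W i c" if "\<And>x. x \<in> carrier (P i) \<Longrightarrow> c x = \<zero>\<^bsub>?W\<^esub>" for c
    by (rule is_coboundary_zeroI[OF W' that])
  have zeroB: "is_coboundary B ?Q d W i c" if "\<And>x. x \<in> carrier (?Q i) \<Longrightarrow> c x = \<zero>\<^bsub>W\<^esub>" for c
    by (rule is_coboundary_zeroI[OF W that])
  show ?thesis
  proof (rule hom_cohomology_isomorphic[OF \<iota> projective_resolution_complex[OF P] W' \<iota>'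
        projective_resolution_complex[OF corner_resolution[OF V P]] W,
        where f = "\<lambda>x. x" and g = "\<lambda>x. e \<odot>\<^bsub>P i\<^esub> x"])
    show "zero W = zero ?W" "add W = add ?W" "carrier W = carrier ?W"
      "\<And>c w. w \<in> carrier ?W \<Longrightarrow> \<iota>' c \<odot>\<^bsub>W\<^esub> w = \<iota> c \<odot>\<^bsub>?W\<^esub> w" by (simp_all add: restrict_scalars_simps \<pi>\<iota>)
    show "x \<in> carrier (P i)" if "x \<in> carrier (?Q i)" for x by (rule sub(1)[OF that])
    show "e \<odot>\<^bsub>P i\<^esub> x \<in> carrier (?Q i)" if "x \<in> carrier (P i)" for x by (rule e_smult[OF p(2) that])
    show "is_cocycle B ?Q d W i z" if "is_cocycle A P d ?W i z" for z
      using that mhom_restrict_corner[OF p(2) _ W] sub(1) unfolding is_cocycle_def restrict_scalars_simps by blast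
    show "is_cocycle A P d ?W i (\<lambda>x. z (e \<odot>\<^bsub>P i\<^esub> x))" if z: "is_cocycle B ?Q d W i z" for z
      unfolding is_cocycle_def
    proof (intro conjI ballI)
      show "(\<lambda>x. z (e \<odot>\<^bsub>P i\<^esub> x)) \<in> mhom A (P i) ?W"
        by (rule mhom_extend_corner[OF p(2)]) (use z in \<open>simp add: is_cocycle_def\<close>)
      show "z (e \<odot>\<^bsub>P i\<^esub> d i x) = \<zero>\<^bsub>?W\<^esub>" if "x \<in> carrier (P (Suc i))" for x
        using ed[OF that] z e_smult[OF p(2) that] by (simp add: is_cocycle_def restrict_scalars_simps)
    qed
    show "is_coboundary B ?Q d W i c" if c: "is_coboundary A P d ?W i c" for c
    proof (cases i)
      case 0
      then show ?thesis using c sub(1)[of _ 0] by (simp add: restrict_scalars_simps)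
    next
      case (Suc j)
      then obtain u where u: "u \<in> mhom A (P j) ?W" "\<forall>x\<in>carrier (P (Suc j)). c x = u (d j x)" using c by auto
      show ?thesis unfolding Suc is_coboundary.simps
        by (rule bexI[OF _ mhom_restrict_corner[OF p(2) u(1) W]]) (use u(2) sub(1) in blast)
    qed
    show "is_coboundary A P d ?W i (\<lambda>x. c (e \<odot>\<^bsub>P i\<^esub> x))" if c: "is_coboundary B ?Q d W i c" for c
    proof (cases i)
      case 0
      then show ?thesis using c e_smult[OF p(2)] by (simp add: restrict_scalars_simps)
    next
      case (Suc j)
      then obtain u where u: "u \<in> mhom B (?Q j) W" "\<forall>x\<in>carrier (?Q (Suc j)). c x = u (d j x)" using c by auto
      show ?thesis unfolding Suc is_coboundary.simps
      proof (rule bexI[OF _ mhom_extend_corner[OF p(2) u(1)]], rule ballI)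
        fix x assume x: "x \<in> carrier (P (Suc j))"
        show "c (e \<odot>\<^bsub>P (Suc j)\<^esub> x) = u (e \<odot>\<^bsub>P j\<^esub> d j x)"
          unfolding ed[OF x] using u(2) e_smult[OF p(2) x] by blast
      qed
    qed
    show "is_coboundary A P d ?W i (\<lambda>x. z (e \<odot>\<^bsub>P i\<^esub> x) \<ominus>\<^bsub>?W\<^esub> z x)" if z: "is_cocycle A P d ?W i z" for z
    proof (rule zeroA)
      fix x assume x: "x \<in> carrier (P i)"
      have zh: "z \<in> mhom A (P i) ?W" using z by (simp add: is_cocycle_def)
      show "z (e \<odot>\<^bsub>P i\<^esub> x) \<ominus>\<^bsub>?W\<^esub> z x = \<zero>\<^bsub>?W\<^esub>"
        unfolding ez[OF zh x] by (rule W'.minus_self[OF mhomD(1)[OF zh x]])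
    qed
    show "is_coboundary B ?Q d W i (\<lambda>x. z (e \<odot>\<^bsub>P i\<^esub> x) \<ominus>\<^bsub>W\<^esub> z x)" if z: "is_cocycle B ?Q d W i z" for z
    proof (rule zeroB)
      fix x assume x: "x \<in> carrier (?Q i)"
      have zh: "z \<in> mhom B (?Q i) W" using z by (simp add: is_cocycle_def)
      show "z (e \<odot>\<^bsub>P i\<^esub> x) \<ominus>\<^bsub>W\<^esub> z x = \<zero>\<^bsub>W\<^esub>"
        unfolding sub(2)[OF x] by (rule W.minus_self[OF mhomD(1)[OF zh x]])
    qed
  qed
qed

end

section \<open>The affine monoid\<close>

lemma central_embedding_scalar_embedding:
  assumes M: "Group.monoid M"
  shows "central_embedding (monoid_algebra M :: ('m \<Rightarrow> 'k::field) ring) (scalar_embedding M)"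
proof -
  interpret M: monoid M by fact
  show ?thesis
    unfolding central_embedding_def
  proof (intro conjI allI ballI)
    fix c d :: 'k
    show "scalar_embedding M c \<in> carrier (monoid_algebra M)" by (simp add: monoid_algebra_ops)
    show "scalar_embedding M c \<otimes>\<^bsub>monoid_algebra M\<^esub> a = a \<otimes>\<^bsub>monoid_algebra M\<^esub> scalar_embedding M c"
      if "a \<in> carrier (monoid_algebra M)" for a by (rule scalar_embedding_central[OF M that])
    show "scalar_embedding M 1 = \<one>\<^bsub>monoid_algebra M\<^esub>" unfolding monoid_algebra_ops ..
    show "scalar_embedding M (c + d) = scalar_embedding M c \<oplus>\<^bsub>monoid_algebra M\<^esub> scalar_embedding M d"
      unfolding monoid_algebra_ops(4) msingle_add ..
    show "scalar_embedding M (c * d) = scalar_embedding M c \<otimes>\<^bsub>monoid_algebra M\<^esub> scalar_embedding M d"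
      unfolding monoid_algebra_ops(4) msingle_mult by simp
  qed
qed

lemma monoid_algebra_map_ring_hom:
  assumes "Group.monoid M" "Group.monoid N" "\<phi> \<in> hom M N" "\<phi> \<one>\<^bsub>M\<^esub> = \<one>\<^bsub>N\<^esub>"
  shows "(monoid_algebra_map \<phi> :: ('m \<Rightarrow> 'k::field) \<Rightarrow> _) \<in> Ring.ring_hom (monoid_algebra M) (monoid_algebra N)"
proof (rule ring_hom_memI)
  fix a b :: "'m \<Rightarrow> 'k" assume a: "a \<in> carrier (monoid_algebra M)" and b: "b \<in> carrier (monoid_algebra M)"
  show "monoid_algebra_map \<phi> a \<in> carrier (monoid_algebra N)"
    by (rule monoid_algebra_map_carrier[OF _ a assms(2)]) (use assms(3) in \<open>simp add: hom_def\<close>)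
  show "monoid_algebra_map \<phi> (a \<otimes>\<^bsub>monoid_algebra M\<^esub> b) =
    monoid_algebra_map \<phi> a \<otimes>\<^bsub>monoid_algebra N\<^esub> monoid_algebra_map \<phi> b"
    by (rule monoid_algebra_map_mult[OF assms(1-3) a b])
  show "monoid_algebra_map \<phi> (a \<oplus>\<^bsub>monoid_algebra M\<^esub> b) =
    monoid_algebra_map \<phi> a \<oplus>\<^bsub>monoid_algebra N\<^esub> monoid_algebra_map \<phi> b"
    by (rule monoid_algebra_map_add[OF a b])
next
  show "monoid_algebra_map \<phi> \<one>\<^bsub>monoid_algebra M :: ('m \<Rightarrow> 'k) ring\<^esub> = \<one>\<^bsub>monoid_algebra N\<^esub>"
    unfolding monoid_algebra_ops monoid_algebra_map_single assms(4) ..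
qed

section \<open>Affine maps and translations\<close>

lemma card_carrier_vec: "card (carrier_vec n :: 'f::finite vec set) = CARD('f) ^ n"
proof -
  have "bij_betw vec_of_list {xs :: 'f list. set xs \<subseteq> UNIV \<and> length xs = n} (carrier_vec n)"
    by (rule bij_betwI[where g = list_of_vec]) (auto simp: list_vec vec_list intro!: carrier_vecI)
  from bij_betw_same_card[OF this] show ?thesis using card_lists_length_eq[of "UNIV :: 'f set" n] by simp
qed

lemma affine_transformation_inj:
  fixes A A' :: "'f::field mat"
  assumes "A \<in> carrier_mat n n" "b \<in> carrier_vec n" "A' \<in> carrier_mat n n" "b' \<in> carrier_vec n"
    "affine_transformation n A b = affine_transformation n A' b'"
  shows "b = b'"
proof -
  have "A *\<^sub>v 0\<^sub>v n + b = A' *\<^sub>v 0\<^sub>v n + b'"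
    using fun_cong[OF assms(5), of "0\<^sub>v n"] by (simp add: affine_transformation_def)
  moreover have "A *\<^sub>v 0\<^sub>v n = 0\<^sub>v n" "A' *\<^sub>v 0\<^sub>v n = 0\<^sub>v n" using assms(1,3) by auto
  ultimately show ?thesis using assms(2,4) by simp
qed

definition translation_set :: "nat \<Rightarrow> ('f::field vec \<Rightarrow> 'f vec) set" where
  "translation_set n = affine_transformation n (1\<^sub>m n) ` carrier_vec n"

lemma card_translation_set: "card (translation_set n :: ('f::{field,finite} vec \<Rightarrow> _) set) = CARD('f) ^ n"
proof -
  have "inj_on (affine_transformation n (1\<^sub>m n :: 'f mat)) (carrier_vec n)"
    by (rule inj_onI) (rule affine_transformation_inj[of "1\<^sub>m n" n _ "1\<^sub>m n"], auto)
  then show ?thesis unfolding translation_set_def by (simp add: card_image card_carrier_vec)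
qed

lemma affine_monoid_carrier:
  "f \<in> carrier (affine_monoid n) \<longleftrightarrow> (\<exists>A\<in>carrier_mat n n. \<exists>b\<in>carrier_vec n. f = affine_transformation n A b)"
  by (auto simp: affine_monoid_def)

lemma affine_mult:
  assumes "A \<in> carrier_mat n n" "A' \<in> carrier_mat n n" "b \<in> carrier_vec n" "b' \<in> carrier_vec n"
  shows "affine_transformation n A b \<otimes>\<^bsub>affine_monoid n\<^esub> affine_transformation n A' b' =
    affine_transformation n (A * A') (A *\<^sub>v b' + b)"
  using compose_affine_transformation[OF assms] by (simp add: affine_monoid_def)

lemma affine_one: "\<one>\<^bsub>affine_monoid n\<^esub> = affine_transformation n (1\<^sub>m n) (0\<^sub>v n :: 'f::field vec)"
  by (simp add: affine_monoid_def affine_transformation_one)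

text \<open>An affine map is a translation after its linear part, and e absorbs a translation on its
  right; on basis elements this is the equation e s(\<pi> a) = e a. The coefficient is the inverse
  of the number of translations, which makes \<pi> e equal to one.\<close>

lemma affine_retract:
  fixes K :: "'k::field itself"
  assumes q: "of_nat CARD('f::{field,finite}) \<noteq> (0 :: 'k)"
  shows "ring_retract (monoid_algebra (affine_monoid n) :: (('f vec \<Rightarrow> 'f vec) \<Rightarrow> 'k) ring)
    (monoid_algebra (matrix_monoid n)) (monoid_algebra_map (linear_part n))
    (monoid_algebra_map (\<lambda>A. affine_transformation n A (0\<^sub>v n)))
    (msum (translation_set n) (1 / of_nat (CARD('f) ^ n)))"
proof -
  let ?A = "affine_monoid n :: ('f vec \<Rightarrow> 'f vec) monoid" and ?M = "matrix_monoid n :: 'f mat ring"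
  let ?KA = "monoid_algebra ?A :: (_ \<Rightarrow> 'k) ring" and ?KM = "monoid_algebra ?M :: (_ \<Rightarrow> 'k) ring"
  let ?s = "\<lambda>A :: 'f mat. affine_transformation n A (0\<^sub>v n)"
  let ?T = "translation_set n :: ('f vec \<Rightarrow> 'f vec) set" and ?c = "1 / of_nat (CARD('f) ^ n) :: 'k"
  let ?e = "msum ?T ?c"
  interpret A: monoid ?A by (rule affine_monoid)
  interpret M: monoid ?M by (rule matrix_monoid)
  interpret KA: ring ?KA by (rule monoid_algebra_ring[OF affine_monoid])
  interpret KM: ring ?KM by (rule monoid_algebra_ring[OF matrix_monoid])
  have lp1: "linear_part n \<one>\<^bsub>?A\<^esub> = \<one>\<^bsub>?M\<^esub>" by (simp add: linear_part_hom ring_mat_simps)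
  have z: "A *\<^sub>v 0\<^sub>v n = 0\<^sub>v n" if "A \<in> carrier_mat n n" for A :: "'f mat" using that by auto
  have s: "?s \<in> hom ?M ?A"
    by (rule homI)
      (auto simp: ring_mat_simps affine_monoid_carrier affine_mult z intro!: bexI[of _ "0\<^sub>v n"])
  have s1: "?s \<one>\<^bsub>?M\<^esub> = \<one>\<^bsub>?A\<^esub>" by (simp add: affine_one ring_mat_simps)
  have fT: "finite ?T" unfolding translation_set_def by (intro finite_imageI finite_carrier_vec)
  have T: "?T \<subseteq> carrier ?A"
    by (auto simp: translation_set_def affine_monoid_carrier intro!: bexI[of _ "1\<^sub>m n"])
  have e: "?e \<in> carrier ?KA" by (rule msum_carrier[OF fT T])
  have Tmult: "affine_transformation n (1\<^sub>m n) a \<otimes>\<^bsub>?A\<^esub> affine_transformation n (1\<^sub>m n) b =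
      affine_transformation n (1\<^sub>m n) (b + a)"
    if "a \<in> carrier_vec n" "b \<in> carrier_vec n" for a b :: "'f vec"
    using that by (simp add: affine_mult)
  have et: "?e \<otimes>\<^bsub>?KA\<^esub> msingle (affine_transformation n (1\<^sub>m n) b) 1 = ?e" if b: "b \<in> carrier_vec n" for b
  proof (rule msum_mult_single[OF affine_monoid fT T])
    let ?t = "affine_transformation n (1\<^sub>m n) b" and ?t' = "affine_transformation n (1\<^sub>m n) (- b)"
    show "?t \<in> ?T" unfolding translation_set_def using b by blast
    show "?t' \<in> carrier ?A" using T b unfolding translation_set_def by auto
    show "x \<otimes>\<^bsub>?A\<^esub> ?t \<in> ?T" "x \<otimes>\<^bsub>?A\<^esub> ?t' \<in> ?T" if "x \<in> ?T" for x
      using that b Tmult unfolding translation_set_def by auto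
    show "?t \<otimes>\<^bsub>?A\<^esub> ?t' = \<one>\<^bsub>?A\<^esub>" "?t' \<otimes>\<^bsub>?A\<^esub> ?t = \<one>\<^bsub>?A\<^esub>"
      using b by (simp_all add: Tmult affine_one)
  qed
  have \<pi>: "monoid_algebra_map (linear_part n) \<in> Ring.ring_hom ?KA ?KM"
    by (rule monoid_algebra_map_ring_hom) (rule affine_monoid matrix_monoid linear_part_hom(1) lp1)+
  have sh: "monoid_algebra_map ?s \<in> Ring.ring_hom ?KM ?KA"
    by (rule monoid_algebra_map_ring_hom[OF matrix_monoid affine_monoid s s1])
  show ?thesis
  proof (intro ring_retract.intro ring_retract_axioms.intro KA.ring_axioms KM.ring_axioms \<pi> sh e)
    fix b assume b: "b \<in> carrier ?KM"
    show "monoid_algebra_map (linear_part n) (monoid_algebra_map ?s b) = b"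
      by (rule monoid_algebra_map_inverse[OF _ affine_monoid _ b])
        (use s in \<open>auto simp: hom_def linear_part_affine_transformation ring_mat_simps\<close>)
  next
    show "monoid_algebra_map (linear_part n) ?e = \<one>\<^bsub>?KM\<^esub>"
    proof
      fix y
      have "linear_part n x = 1\<^sub>m n" if "x \<in> ?T" for x
        using that by (auto simp: translation_set_def linear_part_affine_transformation)
      then have "monoid_algebra_map (linear_part n) ?e y = (\<Sum>x\<in>?T. if y = 1\<^sub>m n then ?c else 0)"
        by (subst monoid_algebra_map_superset[OF fT]) (auto simp: msum_def intro!: sum.cong)
      also have "\<dots> = (if y = 1\<^sub>m n then 1 else 0)"
        using q by (simp add: card_translation_set)
      finally show "monoid_algebra_map (linear_part n) ?e y = \<one>\<^bsub>?KM\<^esub> y"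
        by (simp add: monoid_algebra_ops msingle_def ring_mat_simps)
    qed
  next
    fix a assume "a \<in> carrier ?KA"
    then show "?e \<otimes>\<^bsub>?KA\<^esub> monoid_algebra_map ?s (monoid_algebra_map (linear_part n) a) = ?e \<otimes>\<^bsub>?KA\<^esub> a"
    proof (induction a rule: monoid_algebra_induct)
      case zero
      then show ?case by (simp add: monoid_algebra_map_zero[where N = ?M] monoid_algebra_map_zero[where N = ?A])
    next
      case (add a b)
      then show ?case using e
        by (simp add: ring_hom_add[OF \<pi>] ring_hom_add[OF sh] ring_hom_closed[OF \<pi>] ring_hom_closed[OF sh] KA.r_distr)
    next
      case (single f c)
      then obtain A b where Ab: "A \<in> carrier_mat n n" "b \<in> carrier_vec n" "f = affine_transformation n A b"
        by (auto simp: affine_monoid_carrier)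
      let ?t = "affine_transformation n (1\<^sub>m n) b"
      have t: "?t \<in> carrier ?A" and sA: "?s A \<in> carrier ?A" using T Ab s
        by (auto simp: translation_set_def hom_def ring_mat_simps)
      have "f = ?t \<otimes>\<^bsub>?A\<^esub> ?s A" using Ab by (simp add: affine_mult)
      then have "msingle f c = msingle ?t 1 \<otimes>\<^bsub>?KA\<^esub> msingle (?s A) c" by (simp add: msingle_mult)
      then have "?e \<otimes>\<^bsub>?KA\<^esub> msingle f c = ?e \<otimes>\<^bsub>?KA\<^esub> msingle ?t 1 \<otimes>\<^bsub>?KA\<^esub> msingle (?s A) c"
        using e t sA by (simp add: KA.m_assoc)
      also have "\<dots> = ?e \<otimes>\<^bsub>?KA\<^esub> msingle (?s A) c" unfolding et[OF Ab(2)] ..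
      finally show ?case
        using Ab by (simp add: monoid_algebra_map_single linear_part_affine_transformation)
    qed
  qed
qed

section \<open>From an arbitrary resolution to Ext\<close>

lemma hom_cohomology_Ext:
  assumes \<iota>: "central_embedding R \<iota>" and V: "left_module R V" and W: "left_module R W"
    and P: "projective_resolution R V P d \<epsilon>"
  shows "module_isomorphic class_ring (hom_cohomology R \<iota> P d W i) (Ext R \<iota> i V W)"
proof -
  obtain Q d' where Q: "chosen_resolution R V = (Q, d')" by (cases "chosen_resolution R V")
  then obtain \<epsilon>' where "projective_resolution R V Q d' \<epsilon>'" using chosen_resolution[OF V Q] by blast
  from hom_cohomology_resolution_independent[OF \<iota> V W P this]
  show ?thesis by (simp add: Ext_def Q)
qed

text \<open>The corner of the chosen resolution over A is a resolution over B, but its elements have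
  another type than those of the resolution chosen over B. Independence of the resolution bridges
  the two.\<close>

lemma (in ring_retract) Ext_restrict_scalars:
  fixes \<iota> :: "'k::field \<Rightarrow> 'a"
  assumes \<iota>: "central_embedding A \<iota>" and \<iota>': "central_embedding B \<iota>'" and \<pi>\<iota>: "\<And>c. \<pi> (\<iota> c) = \<iota>' c"
    and V: "left_module B V" and W: "left_module B W"
  shows "module_isomorphic class_ring (Ext A \<iota> i (restrict_scalars \<pi> V) (restrict_scalars \<pi> W)) (Ext B \<iota>' i V W)"
proof -
  have V': "left_module A (restrict_scalars \<pi> V)" by (rule restrict_scalars_left_module[OF V])
  obtain P d where Q: "chosen_resolution A (restrict_scalars \<pi> V) = (P, d)"
    by (cases "chosen_resolution A (restrict_scalars \<pi> V)")
  then obtain \<epsilon> where P: "projective_resolution A (restrict_scalars \<pi> V) P d \<epsilon>"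
    using chosen_resolution[OF V' Q] by blast
  have "module_isomorphic class_ring (Ext A \<iota> i (restrict_scalars \<pi> V) (restrict_scalars \<pi> W))
      (hom_cohomology B \<iota>' (\<lambda>i. corner (P i)) d W i)"
    using corner_cohomology[OF \<iota> \<iota>' \<pi>\<iota> V W P] by (simp add: Ext_def Q)
  then show ?thesis
    by (rule module_isomorphic_trans) (rule hom_cohomology_Ext[OF \<iota>' V W corner_resolution[OF V P]])
qed

section \<open>Splitting of modules over the matrix monoid algebra\<close>

context left_module begin

lemma finsum_smult:
  assumes "finite S" "x \<in> S \<rightarrow> carrier R" "m \<in> carrier M"
  shows "(\<Oplus>k\<in>S. x k) \<odot>\<^bsub>M\<^esub> m = (\<Oplus>\<^bsub>M\<^esub>k\<in>S. x k \<odot>\<^bsub>M\<^esub> m)"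
  using assms(1,2)
proof (induction S rule: finite_induct)
  case (insert k S)
  then have x: "x \<in> S \<rightarrow> carrier R" "x k \<in> carrier R" by auto
  then have y: "(\<lambda>k. x k \<odot>\<^bsub>M\<^esub> m) \<in> S \<rightarrow> carrier M" "x k \<odot>\<^bsub>M\<^esub> m \<in> carrier M" using assms(3) by auto
  show ?case
    unfolding R.finsum_insert[OF insert.hyps x] M.finsum_insert[OF insert.hyps y] insert.IH[OF x(1), symmetric]
    by (rule smult_l_distr[OF x(2) R.finsum_closed[OF x(1)] assms(3)])
qed (simp add: assms(3))

text \<open>Formulated for additive maps between modules over possibly different rings: it is used
  for the inclusion of a corner into the whole module and for maps that are additive but linear over
  neither ring in the form at hand.\<close>

lemma hom_finsum:
  assumes N: "left_module R' N" and h0: "h \<zero>\<^bsub>M\<^esub> = \<zero>\<^bsub>N\<^esub>" and hc: "\<And>x. x \<in> carrier M \<Longrightarrow> h x \<in> carrier N"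
    and ha: "\<And>x y. x \<in> carrier M \<Longrightarrow> y \<in> carrier M \<Longrightarrow> h (x \<oplus>\<^bsub>M\<^esub> y) = h x \<oplus>\<^bsub>N\<^esub> h y"
    and "finite S" "g \<in> S \<rightarrow> carrier M"
  shows "h (\<Oplus>\<^bsub>M\<^esub>k\<in>S. g k) = (\<Oplus>\<^bsub>N\<^esub>k\<in>S. h (g k))"
  using assms(5,6)
proof (induction S rule: finite_induct)
  interpret N: left_module R' N by fact
  {
    case empty
    then show ?case by (simp add: h0)
  next
    case (insert k S)
    then have x: "g \<in> S \<rightarrow> carrier M" "g k \<in> carrier M" by auto
    then have y: "(\<lambda>k. h (g k)) \<in> S \<rightarrow> carrier N" "h (g k) \<in> carrier N" using hc by auto
    show ?case
      unfolding M.finsum_insert[OF insert.hyps x] N.M.finsum_insert[OF insert.hyps y] insert.IH[OF x(1), symmetric]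
      by (rule ha[OF x(2) M.finsum_closed[OF x(1)]])
  }
qed

lemma submodule_finsum:
  assumes N: "submodule_of R M N" and "finite S" "\<And>k. k \<in> S \<Longrightarrow> g k \<in> N"
  shows "(\<Oplus>\<^bsub>M\<^esub>k\<in>S. g k) \<in> N"
  using assms(2,3)
proof (induction S rule: finite_induct)
  case (insert k S)
  have sub: "N \<subseteq> carrier M" using N by (simp add: submodule_of_def)
  have x: "g \<in> S \<rightarrow> carrier M" "g k \<in> carrier M" using insert.prems sub by auto
  have "(\<Oplus>\<^bsub>M\<^esub>k\<in>S. g k) \<in> N" using insert by simp
  then show ?case unfolding M.finsum_insert[OF insert.hyps x]
    using N insert.prems unfolding submodule_of_def by blast
qed (use N in \<open>simp add: submodule_of_def\<close>)

end

section \<open>Complements of subspaces\<close>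

text \<open>Dimensions may be infinite, so a complement is obtained from Zorn's lemma as a maximal
  subspace meeting N in zero. The projection is taken along this complement.\<close>

lemma vector_space_projection:
  fixes M :: "('k::field, 'a) module"
  assumes M: "left_module class_ring M" and N: "submodule_of class_ring M N"
  obtains \<rho> where "\<rho> \<in> mhom class_ring M M" "\<And>x. x \<in> carrier M \<Longrightarrow> \<rho> x \<in> N" "\<And>x. x \<in> N \<Longrightarrow> \<rho> x = x"
proof -
  interpret M: left_module "class_ring :: 'k ring" M by fact
  note ND = N[unfolded submodule_of_def]
  have Nc: "x \<in> carrier M" if "x \<in> N" for x using ND that by blast
  define \<C> where "\<C> = {C. submodule_of class_ring M C \<and> C \<inter> N = {\<zero>\<^bsub>M\<^esub>}}"
  have "{\<zero>\<^bsub>M\<^esub>} \<in> \<C>" using ND by (auto simp: \<C>_def submodule_of_def)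
  then have ne: "\<C> \<noteq> {}" by blast
  have un: "\<Union>\<D> \<in> \<C>" if \<D>: "\<D> \<noteq> {}" "subset.chain \<C> \<D>" for \<D>
  proof -
    have sub: "\<D> \<subseteq> \<C>" and ch: "\<And>X Y. X \<in> \<D> \<Longrightarrow> Y \<in> \<D> \<Longrightarrow> X \<subseteq> Y \<or> Y \<subseteq> X"
      using \<D>(2) by (auto simp: subset_chain_def)
    have D: "submodule_of class_ring M X" "X \<inter> N = {\<zero>\<^bsub>M\<^esub>}" if "X \<in> \<D>" for X
      using sub that by (auto simp: \<C>_def)
    have "submodule_of class_ring M (\<Union>\<D>)"
      unfolding submodule_of_def
    proof (intro conjI ballI)
      show "\<Union>\<D> \<subseteq> carrier M" using D(1) unfolding submodule_of_def by blast
      show "\<zero>\<^bsub>M\<^esub> \<in> \<Union>\<D>" using D(1) \<D>(1) unfolding submodule_of_def by blast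
      fix x assume x: "x \<in> \<Union>\<D>"
      then obtain X where X: "X \<in> \<D>" "x \<in> X" by blast
      have "c \<odot>\<^bsub>M\<^esub> x \<in> X" for c using D(1)[OF X(1)] X(2) unfolding submodule_of_def by simp
      then show "c \<odot>\<^bsub>M\<^esub> x \<in> \<Union>\<D>" for c using X(1) by blast
      fix y assume "y \<in> \<Union>\<D>"
      then obtain Y where Y: "Y \<in> \<D>" "y \<in> Y" by blast
      from ch[OF X(1) Y(1)] obtain Z where "Z \<in> \<D>" "x \<in> Z" "y \<in> Z" using X Y by blast
      then show "x \<oplus>\<^bsub>M\<^esub> y \<in> \<Union>\<D>" using D(1)[of Z] unfolding submodule_of_def by blast
    qed
    moreover have "\<Union>\<D> \<inter> N = {\<zero>\<^bsub>M\<^esub>}" using D(2) \<D>(1) by blast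
    ultimately show ?thesis by (simp add: \<C>_def)
  qed
  from subset_Zorn_nonempty[OF ne un] obtain C where C: "C \<in> \<C>" "\<And>X. X \<in> \<C> \<Longrightarrow> C \<subseteq> X \<Longrightarrow> X = C" by blast
  have Cs: "submodule_of class_ring M C" and CN: "C \<inter> N = {\<zero>\<^bsub>M\<^esub>}" using C(1) by (simp_all add: \<C>_def)
  note CD = Cs[unfolded submodule_of_def]
  have Cc: "x \<in> carrier M" if "x \<in> C" for x using CD that by blast
  have sC: "k \<odot>\<^bsub>M\<^esub> x \<in> C" if "x \<in> C" for k x using CD that by simp
  have sN: "k \<odot>\<^bsub>M\<^esub> x \<in> N" if "x \<in> N" for k x using ND that by simp
  have aC: "x \<oplus>\<^bsub>M\<^esub> y \<in> C" if "x \<in> C" "y \<in> C" for x y using CD that by blast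
  have aN: "x \<oplus>\<^bsub>M\<^esub> y \<in> N" if "x \<in> N" "y \<in> N" for x y using ND that by blast
  have mC: "x \<ominus>\<^bsub>M\<^esub> y \<in> C" if "x \<in> C" "y \<in> C" for x y by (rule M.submodule_minus[OF Cs that])
  have mN: "x \<ominus>\<^bsub>M\<^esub> y \<in> N" if "x \<in> N" "y \<in> N" for x y by (rule M.submodule_minus[OF N that])
  have sc: "k \<odot>\<^bsub>M\<^esub> x \<in> carrier M" if "x \<in> carrier M" for k x using that by simp
  have sa: "k \<odot>\<^bsub>M\<^esub> (l \<odot>\<^bsub>M\<^esub> x) = (k * l) \<odot>\<^bsub>M\<^esub> x" if "x \<in> carrier M" for k l x
    using M.smult_assoc[of k l x] that by simp
  have ex: "\<exists>n\<in>N. m \<ominus>\<^bsub>M\<^esub> n \<in> C" if m: "m \<in> carrier M" for m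
  proof (rule ccontr)
    assume no: "\<not> (\<exists>n\<in>N. m \<ominus>\<^bsub>M\<^esub> n \<in> C)"
    \<comment> \<open>If m is outside N + C, the span of C and m still meets N in zero, against the
      maximality of C.\<close>
    define D where "D = {c \<oplus>\<^bsub>M\<^esub> k \<odot>\<^bsub>M\<^esub> m | c k. c \<in> C}"
    have DI: "c \<oplus>\<^bsub>M\<^esub> k \<odot>\<^bsub>M\<^esub> m \<in> D" if "c \<in> C" for c k using that by (auto simp: D_def)
    have zC: "\<zero>\<^bsub>M\<^esub> \<in> C" using CD by blast
    have z1: "x \<oplus>\<^bsub>M\<^esub> 0 \<odot>\<^bsub>M\<^esub> m = x" if "x \<in> carrier M" for x
      using that M.smult_l_null[OF m] by simp
    have CsubD: "C \<subseteq> D"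
    proof
      fix c assume c: "c \<in> C"
      show "c \<in> D" using DI[OF c, of 0] unfolding z1[OF Cc[OF c]] .
    qed
    have mD: "m \<in> D" using DI[OF zC, of 1] m M.smult_one[OF m] by simp
    have "submodule_of class_ring M D"
      unfolding submodule_of_def
    proof (intro conjI ballI)
      show "D \<subseteq> carrier M" using Cc m by (auto simp: D_def)
      show "\<zero>\<^bsub>M\<^esub> \<in> D" using CsubD zC by blast
      fix x assume "x \<in> D"
      then obtain c k where x: "x = c \<oplus>\<^bsub>M\<^esub> k \<odot>\<^bsub>M\<^esub> m" "c \<in> C" by (auto simp: D_def)
      show "l \<odot>\<^bsub>M\<^esub> x \<in> D" for l
      proof -
        have "l \<odot>\<^bsub>M\<^esub> x = l \<odot>\<^bsub>M\<^esub> c \<oplus>\<^bsub>M\<^esub> (l * k) \<odot>\<^bsub>M\<^esub> m"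
          unfolding x using M.smult_r_distr[of l c "k \<odot>\<^bsub>M\<^esub> m"] Cc[OF x(2)] sc[OF m] sa[OF m] by simp
        then show ?thesis using DI[OF sC[OF x(2)]] by simp
      qed
      fix y assume "y \<in> D"
      then obtain d l where y: "y = d \<oplus>\<^bsub>M\<^esub> l \<odot>\<^bsub>M\<^esub> m" "d \<in> C" by (auto simp: D_def)
      have "x \<oplus>\<^bsub>M\<^esub> y = (c \<oplus>\<^bsub>M\<^esub> d) \<oplus>\<^bsub>M\<^esub> (k \<odot>\<^bsub>M\<^esub> m \<oplus>\<^bsub>M\<^esub> l \<odot>\<^bsub>M\<^esub> m)"
        unfolding x y using Cc[OF x(2)] Cc[OF y(2)] sc[OF m] by (simp add: M.M.a_ac)
      also have "k \<odot>\<^bsub>M\<^esub> m \<oplus>\<^bsub>M\<^esub> l \<odot>\<^bsub>M\<^esub> m = (k + l) \<odot>\<^bsub>M\<^esub> m"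
        using M.smult_l_distr[of k l m] m by simp
      finally show "x \<oplus>\<^bsub>M\<^esub> y \<in> D" using DI[OF aC[OF x(2) y(2)]] by simp
    qed
    moreover have "D \<inter> N = {\<zero>\<^bsub>M\<^esub>}"
    proof (intro equalityI subsetI)
      fix x assume x: "x \<in> D \<inter> N"
      then obtain c k where ck: "x = c \<oplus>\<^bsub>M\<^esub> k \<odot>\<^bsub>M\<^esub> m" "c \<in> C" by (auto simp: D_def)
      show "x \<in> {\<zero>\<^bsub>M\<^esub>}"
      proof (cases "k = 0")
        case True
        then have "x = c" using ck z1[OF Cc[OF ck(2)]] by simp
        then show ?thesis using x ck(2) CN by blast
      next
        case False
        have xN: "x \<in> N" using x by simp
        let ?i = "inverse k"
        \<comment> \<open>Dividing by k and solving for m would put m into N + C, which was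
          excluded.\<close>
        have "?i \<odot>\<^bsub>M\<^esub> x = ?i \<odot>\<^bsub>M\<^esub> c \<oplus>\<^bsub>M\<^esub> (?i * k) \<odot>\<^bsub>M\<^esub> m"
          unfolding ck(1) using M.smult_r_distr[of ?i c "k \<odot>\<^bsub>M\<^esub> m"] Cc[OF ck(2)] sc[OF m] sa[OF m] by simp
        also have "(?i * k) \<odot>\<^bsub>M\<^esub> m = m" using False M.smult_one[OF m] by simp
        finally have e: "?i \<odot>\<^bsub>M\<^esub> x = ?i \<odot>\<^bsub>M\<^esub> c \<oplus>\<^bsub>M\<^esub> m" .
        have ic: "?i \<odot>\<^bsub>M\<^esub> c \<in> carrier M" using sc[OF Cc[OF ck(2)]] .
        have "m \<ominus>\<^bsub>M\<^esub> (?i \<odot>\<^bsub>M\<^esub> x) = \<ominus>\<^bsub>M\<^esub> (?i \<odot>\<^bsub>M\<^esub> c)"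
          unfolding e a_minus_def M.M.minus_add[OF ic m]
            M.M.a_lcomm[OF m M.M.a_inv_closed[OF ic] M.M.a_inv_closed[OF m]] M.M.r_neg[OF m]
          by (rule M.M.r_zero[OF M.M.a_inv_closed[OF ic]])
        moreover have "\<ominus>\<^bsub>M\<^esub> (?i \<odot>\<^bsub>M\<^esub> c) \<in> C" by (rule M.submodule_uminus[OF Cs sC[OF ck(2)]])
        ultimately show ?thesis using no sN[OF xN, of ?i] by auto
      qed
    qed (use ND CsubD zC in auto)
    ultimately have "D \<in> \<C>" by (simp add: \<C>_def)
    then have "m \<in> C" using C(2) CsubD mD by blast
    moreover have "m \<ominus>\<^bsub>M\<^esub> \<zero>\<^bsub>M\<^esub> = m" using m by (simp add: a_minus_def)
    ultimately show False using no ND by auto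
  qed
  have uniq: "n = n'" if "n \<in> N" "n' \<in> N" "m \<ominus>\<^bsub>M\<^esub> n \<in> C" "m \<ominus>\<^bsub>M\<^esub> n' \<in> C" "m \<in> carrier M" for n n' m
  proof -
    have c: "n \<in> carrier M" "n' \<in> carrier M" using Nc that by auto
    have "(m \<ominus>\<^bsub>M\<^esub> n') \<ominus>\<^bsub>M\<^esub> (m \<ominus>\<^bsub>M\<^esub> n) = n \<ominus>\<^bsub>M\<^esub> n'"
      using c that(5) by (simp add: a_minus_def M.M.minus_add M.M.a_ac M.M.r_neg1 M.M.r_neg M.M.r_neg2)
    then have "n \<ominus>\<^bsub>M\<^esub> n' \<in> C \<inter> N" using mC[OF that(4,3)] mN[OF that(1,2)] by simp
    then show ?thesis using CN M.minus_eq_zero[OF c] by auto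
  qed
  define \<rho> where "\<rho> m = (SOME n. n \<in> N \<and> m \<ominus>\<^bsub>M\<^esub> n \<in> C)" for m
  have \<rho>: "\<rho> m \<in> N" "m \<ominus>\<^bsub>M\<^esub> \<rho> m \<in> C" if m: "m \<in> carrier M" for m
  proof -
    have "\<exists>n. n \<in> N \<and> m \<ominus>\<^bsub>M\<^esub> n \<in> C" using ex[OF m] by blast
    from someI_ex[OF this] show "\<rho> m \<in> N" "m \<ominus>\<^bsub>M\<^esub> \<rho> m \<in> C" unfolding \<rho>_def by (rule conjunct1, rule conjunct2)
  qed
  have \<rho>c: "\<rho> m \<in> carrier M" if "m \<in> carrier M" for m by (rule Nc[OF \<rho>(1)[OF that]])
  show ?thesis
  proof (rule that[of \<rho>])
    show "\<rho> \<in> mhom class_ring M M"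
    proof (rule mhomI)
      show "\<rho> x \<in> carrier M" if "x \<in> carrier M" for x by (rule \<rho>c[OF that])
      show "\<rho> (x \<oplus>\<^bsub>M\<^esub> y) = \<rho> x \<oplus>\<^bsub>M\<^esub> \<rho> y" if xy: "x \<in> carrier M" "y \<in> carrier M" for x y
      proof (rule uniq[OF \<rho>(1) aN[OF \<rho>(1) \<rho>(1)] \<rho>(2)])
        show "(x \<oplus>\<^bsub>M\<^esub> y) \<ominus>\<^bsub>M\<^esub> (\<rho> x \<oplus>\<^bsub>M\<^esub> \<rho> y) \<in> C"
          unfolding M.minus_add_distrib[OF xy \<rho>c[OF xy(1)] \<rho>c[OF xy(2)]]
          by (rule aC[OF \<rho>(2)[OF xy(1)] \<rho>(2)[OF xy(2)]])
      qed (simp_all add: xy)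
      show "\<rho> (k \<odot>\<^bsub>M\<^esub> x) = k \<odot>\<^bsub>M\<^esub> \<rho> x" if x: "x \<in> carrier M" for k x
      proof (rule uniq[OF \<rho>(1) sN[OF \<rho>(1)] \<rho>(2)])
        have "k \<odot>\<^bsub>M\<^esub> (x \<ominus>\<^bsub>M\<^esub> \<rho> x) \<in> C" by (rule sC[OF \<rho>(2)[OF x]])
        then show "k \<odot>\<^bsub>M\<^esub> x \<ominus>\<^bsub>M\<^esub> k \<odot>\<^bsub>M\<^esub> \<rho> x \<in> C"
          using M.smult_minus[of k x "\<rho> x"] x \<rho>c[OF x] by simp
      qed (simp_all add: x)
    qed
    show "\<rho> x \<in> N" if "x \<in> carrier M" for x by (rule \<rho>(1)[OF that])
    show "\<rho> x = x" if x: "x \<in> N" for x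
    proof (rule uniq[OF \<rho>(1) x \<rho>(2)])
      show "x \<ominus>\<^bsub>M\<^esub> x \<in> C" unfolding M.minus_self[OF Nc[OF x]] using CD by blast
    qed (rule Nc[OF x])+
  qed
qed

lemma left_module_scalars:
  assumes \<iota>: "central_embedding R \<iota>" and M: "left_module R M"
  shows "left_module class_ring (restrict_scalars \<iota> M)"
proof -
  interpret M: left_module R M by fact
  have iC: "\<iota> c \<in> carrier R" and iops: "\<iota> 1 = \<one>\<^bsub>R\<^esub>" "\<iota> (c + d) = \<iota> c \<oplus>\<^bsub>R\<^esub> \<iota> d" "\<iota> (c * d) = \<iota> c \<otimes>\<^bsub>R\<^esub> \<iota> d" for c d
    using \<iota> unfolding central_embedding_def by blast+
  have simps: "carrier (restrict_scalars \<iota> M) = carrier M" "zero (restrict_scalars \<iota> M) = zero M"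
    "add (restrict_scalars \<iota> M) = add M" "c \<odot>\<^bsub>restrict_scalars \<iota> M\<^esub> w = \<iota> c \<odot>\<^bsub>M\<^esub> w" for c w
    by (simp_all add: restrict_scalars_def)
  have "abelian_group (restrict_scalars \<iota> M)"
  proof (rule abelian_groupI)
    show "\<exists>y\<in>carrier (restrict_scalars \<iota> M). y \<oplus>\<^bsub>restrict_scalars \<iota> M\<^esub> x = \<zero>\<^bsub>restrict_scalars \<iota> M\<^esub>"
      if "x \<in> carrier (restrict_scalars \<iota> M)" for x
      using that M.M.l_neg M.M.a_inv_closed unfolding simps by blast
  qed (simp_all add: simps M.M.a_ac)
  then show ?thesis
    by (intro left_module.intro left_module_axioms.intro class_ring.ring_axioms)
      (simp_all add: simps iops iC M.smult_l_distr M.smult_r_distr M.smult_assoc)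
qed

section \<open>Averaging over a finite group of units\<close>

lemma (in left_module) finsum_const:
  assumes \<iota>: "central_embedding R (\<iota> :: 'k::field \<Rightarrow> _)" and "finite S" and y: "y \<in> carrier M"
  shows "(\<Oplus>\<^bsub>M\<^esub>k\<in>S. y) = \<iota> (of_nat (card S)) \<odot>\<^bsub>M\<^esub> y"
  using assms(2)
proof (induction S rule: finite_induct)
  have iC: "\<iota> c \<in> carrier R" and iops: "\<iota> 1 = \<one>" "\<iota> (c + d) = \<iota> c \<oplus> \<iota> d" for c d
    using \<iota> unfolding central_embedding_def by blast+
  have "\<iota> 0 \<oplus> \<iota> 0 = \<zero> \<oplus> \<iota> 0" using iops(2)[of 0 0] iC[of 0] by simp
  then have i0: "\<iota> 0 = \<zero>" using R.add.right_cancel[OF iC iC R.zero_closed] by blast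
  {
    case empty
    then show ?case by (simp add: i0 y)
  next
    case (insert k S)
    have c: "(\<lambda>k. y) \<in> S \<rightarrow> carrier M" using y by simp
    have e: "of_nat (card (insert k S)) = 1 + (of_nat (card S) :: 'k)" using insert.hyps by simp
    show ?case
      unfolding M.finsum_insert[OF insert.hyps c y] insert.IH e iops(2) iops(1)
        smult_l_distr[OF R.one_closed iC y] smult_one[OF y] ..
  }
qed

text \<open>Maschke's argument for a finite group \<open>G\<close> of units, cut down by an idempotent \<open>\<tau>\<close> commuting
  with \<open>G\<close>.\<close>

lemma maschke_projection:
  fixes \<iota> :: "'k::field \<Rightarrow> 'r" and M :: "('r, 'a) module"
  assumes \<iota>: "central_embedding R \<iota>" and M: "left_module R M" and N: "submodule_of R M N"
    and G: "finite G" "G \<subseteq> carrier R" "\<And>g h. g \<in> G \<Longrightarrow> h \<in> G \<Longrightarrow> g \<otimes>\<^bsub>R\<^esub> h \<in> G"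
    and inv: "\<And>g. g \<in> G \<Longrightarrow> i g \<in> G" "\<And>g. g \<in> G \<Longrightarrow> i g \<otimes>\<^bsub>R\<^esub> g = \<one>\<^bsub>R\<^esub>"
      "\<And>g. g \<in> G \<Longrightarrow> g \<otimes>\<^bsub>R\<^esub> i g = \<one>\<^bsub>R\<^esub>"
    and cardG: "of_nat (card G) \<noteq> (0 :: 'k)"
    and \<tau>: "\<tau> \<in> carrier R" "\<tau> \<otimes>\<^bsub>R\<^esub> \<tau> = \<tau>" "\<And>g. g \<in> G \<Longrightarrow> g \<otimes>\<^bsub>R\<^esub> \<tau> = \<tau> \<otimes>\<^bsub>R\<^esub> g"
  obtains \<rho> where "\<And>x. x \<in> carrier M \<Longrightarrow> \<rho> x \<in> N" "\<And>x. x \<in> N \<Longrightarrow> \<rho> x = \<tau> \<odot>\<^bsub>M\<^esub> x"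
    "\<And>x y. x \<in> carrier M \<Longrightarrow> y \<in> carrier M \<Longrightarrow> \<rho> (x \<oplus>\<^bsub>M\<^esub> y) = \<rho> x \<oplus>\<^bsub>M\<^esub> \<rho> y"
    "\<And>c x. x \<in> carrier M \<Longrightarrow> \<rho> (\<iota> c \<odot>\<^bsub>M\<^esub> x) = \<iota> c \<odot>\<^bsub>M\<^esub> \<rho> x"
    "\<And>g x. g \<in> G \<Longrightarrow> x \<in> carrier M \<Longrightarrow> \<rho> (g \<odot>\<^bsub>M\<^esub> x) = g \<odot>\<^bsub>M\<^esub> \<rho> x"
    "\<And>a x. a \<in> carrier R \<Longrightarrow> a \<otimes>\<^bsub>R\<^esub> \<tau> = \<zero>\<^bsub>R\<^esub> \<Longrightarrow> \<tau> \<otimes>\<^bsub>R\<^esub> a = \<zero>\<^bsub>R\<^esub> \<Longrightarrow> x \<in> carrier M \<Longrightarrow> \<rho> (a \<odot>\<^bsub>M\<^esub> x) = a \<odot>\<^bsub>M\<^esub> \<rho> x"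
proof -
  interpret M: left_module R M by fact
  note ND = N[unfolded submodule_of_def]
  have Nc: "x \<in> carrier M" if "x \<in> N" for x using ND that by blast
  have sN: "r \<odot>\<^bsub>M\<^esub> x \<in> N" if "r \<in> carrier R" "x \<in> N" for r x using ND that by blast
  have iC: "\<iota> c \<in> carrier R" and icomm: "a \<in> carrier R \<Longrightarrow> \<iota> c \<otimes>\<^bsub>R\<^esub> a = a \<otimes>\<^bsub>R\<^esub> \<iota> c"
    and i1: "\<iota> 1 = \<one>\<^bsub>R\<^esub>" and im: "\<iota> (c * d) = \<iota> c \<otimes>\<^bsub>R\<^esub> \<iota> d" for c d a
    using \<iota> unfolding central_embedding_def by blast+
  have gC: "g \<in> carrier R" if "g \<in> G" for g using G(2) that by blast
  have comm: "\<iota> c \<odot>\<^bsub>M\<^esub> (a \<odot>\<^bsub>M\<^esub> x) = a \<odot>\<^bsub>M\<^esub> (\<iota> c \<odot>\<^bsub>M\<^esub> x)" if "a \<in> carrier R" "x \<in> carrier M" for c a x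
    unfolding M.smult_assoc[OF iC that, symmetric] M.smult_assoc[OF that(1) iC that(2), symmetric] icomm[OF that(1)] ..
  have \<tau>comm: "g \<odot>\<^bsub>M\<^esub> (\<tau> \<odot>\<^bsub>M\<^esub> x) = \<tau> \<odot>\<^bsub>M\<^esub> (g \<odot>\<^bsub>M\<^esub> x)" if "g \<in> G" "x \<in> carrier M" for g x
    unfolding M.smult_assoc[OF gC[OF that(1)] \<tau>(1) that(2), symmetric] \<tau>(3)[OF that(1)]
      M.smult_assoc[OF \<tau>(1) gC[OF that(1)] that(2)] ..
  have canc: "g \<odot>\<^bsub>M\<^esub> (i g \<odot>\<^bsub>M\<^esub> x) = x" if "g \<in> G" "x \<in> carrier M" for g x
    unfolding M.smult_assoc[OF gC[OF that(1)] gC[OF inv(1)[OF that(1)]] that(2), symmetric] inv(3)[OF that(1)]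
    by (rule M.smult_one[OF that(2)])
  let ?M = "restrict_scalars \<iota> M"
  have rs: "carrier ?M = carrier M" "zero ?M = zero M" "add ?M = add M" "c \<odot>\<^bsub>?M\<^esub> w = \<iota> c \<odot>\<^bsub>M\<^esub> w" for c w
    by (simp_all add: restrict_scalars_def)
  have "submodule_of class_ring ?M N" using ND iC unfolding submodule_of_def rs by simp
  from vector_space_projection[OF left_module_scalars[OF \<iota> M] this]
  obtain \<rho>0 where \<rho>0: "\<rho>0 \<in> mhom class_ring ?M ?M" "\<And>x. x \<in> carrier M \<Longrightarrow> \<rho>0 x \<in> N" "\<And>x. x \<in> N \<Longrightarrow> \<rho>0 x = x"
    unfolding rs by metis
  have \<rho>a: "\<rho>0 (x \<oplus>\<^bsub>M\<^esub> y) = \<rho>0 x \<oplus>\<^bsub>M\<^esub> \<rho>0 y" if "x \<in> carrier M" "y \<in> carrier M" for x y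
    using mhomD(2)[OF \<rho>0(1), unfolded rs, OF that] .
  have \<rho>s: "\<rho>0 (\<iota> c \<odot>\<^bsub>M\<^esub> x) = \<iota> c \<odot>\<^bsub>M\<^esub> \<rho>0 x" if "x \<in> carrier M" for c x
    using mhomD(3)[OF \<rho>0(1), unfolded rs, of c x] that by simp
  have \<rho>c: "\<rho>0 x \<in> carrier M" if "x \<in> carrier M" for x by (rule Nc[OF \<rho>0(2)[OF that]])
  \<comment> \<open>The linear projection conjugated by g. The inner factor \<tau> annihilates
    arguments a x with \<tau> a = 0; the outer factor \<tau> in the definition of \<rho> makes a
    annihilate the result when a \<tau> = 0.\<close>
  define t where "t x g = g \<odot>\<^bsub>M\<^esub> \<rho>0 (i g \<odot>\<^bsub>M\<^esub> (\<tau> \<odot>\<^bsub>M\<^esub> x))" for x g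
  define u where "u x = (\<Oplus>\<^bsub>M\<^esub>g\<in>G. t x g)" for x
  let ?c = "1 / of_nat (card G) :: 'k"
  define \<rho> where "\<rho> x = \<tau> \<odot>\<^bsub>M\<^esub> (\<iota> ?c \<odot>\<^bsub>M\<^esub> u x)" for x
  have arg: "i g \<odot>\<^bsub>M\<^esub> (\<tau> \<odot>\<^bsub>M\<^esub> x) \<in> carrier M" if "g \<in> G" "x \<in> carrier M" for g x
    using gC[OF inv(1)[OF that(1)]] \<tau>(1) that(2) by simp
  have tN: "t x g \<in> N" if "g \<in> G" "x \<in> carrier M" for g x
    unfolding t_def by (rule sN[OF gC[OF that(1)] \<rho>0(2)[OF arg[OF that]]])
  have tC: "t x \<in> G \<rightarrow> carrier M" if "x \<in> carrier M" for x using Nc[OF tN[OF _ that]] by blast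
  have uN: "u x \<in> N" if "x \<in> carrier M" for x
    unfolding u_def by (rule M.submodule_finsum[OF N G(1) tN[OF _ that]])
  have uC: "u x \<in> carrier M" if "x \<in> carrier M" for x by (rule Nc[OF uN[OF that]])
  \<comment> \<open>Reindexing by p and pulling f out of the sum treats two cases at once: scalars
    of the field, where p is the identity, and elements h of G, where p is left multiplication by
    h.\<close>
  have u_hom: "u y = f (u x)" if x: "x \<in> carrier M" "y \<in> carrier M"
    and f: "\<And>z. z \<in> carrier M \<Longrightarrow> f z \<in> carrier M" "f \<zero>\<^bsub>M\<^esub> = \<zero>\<^bsub>M\<^esub>"
      "\<And>z w. z \<in> carrier M \<Longrightarrow> w \<in> carrier M \<Longrightarrow> f (z \<oplus>\<^bsub>M\<^esub> w) = f z \<oplus>\<^bsub>M\<^esub> f w"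
    and t: "\<And>g. g \<in> G \<Longrightarrow> t y (p g) = f (t x g)" and p: "bij_betw p G G" for x y f p
  proof -
    have "u y = (\<Oplus>\<^bsub>M\<^esub>g\<in>p ` G. t y g)" unfolding u_def bij_betw_imp_surj_on[OF p] ..
    also have "\<dots> = (\<Oplus>\<^bsub>M\<^esub>g\<in>G. t y (p g))"
      by (rule M.M.finsum_reindex) (use tC[OF x(2)] p in \<open>simp_all add: bij_betw_def\<close>)
    also have "\<dots> = (\<Oplus>\<^bsub>M\<^esub>g\<in>G. f (t x g))"
      by (rule M.M.finsum_cong') (use t f(1) tC[OF x(1)] in auto)
    also have "\<dots> = f (u x)"
      unfolding u_def by (rule M.hom_finsum[OF M f(2,1,3) G(1) tC[OF x(1)], symmetric])
    finally show ?thesis .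
  qed
  have tadd: "t (x \<oplus>\<^bsub>M\<^esub> y) g = t x g \<oplus>\<^bsub>M\<^esub> t y g" if "x \<in> carrier M" "y \<in> carrier M" "g \<in> G" for x y g
  proof -
    note ig = gC[OF inv(1)[OF that(3)]]
    have "i g \<odot>\<^bsub>M\<^esub> (\<tau> \<odot>\<^bsub>M\<^esub> (x \<oplus>\<^bsub>M\<^esub> y)) = i g \<odot>\<^bsub>M\<^esub> (\<tau> \<odot>\<^bsub>M\<^esub> x) \<oplus>\<^bsub>M\<^esub> i g \<odot>\<^bsub>M\<^esub> (\<tau> \<odot>\<^bsub>M\<^esub> y)"
      using that(1,2) \<tau>(1) ig by (simp add: M.smult_r_distr)
    then show ?thesis
      unfolding t_def using \<rho>a[OF arg[OF that(3,1)] arg[OF that(3,2)]]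
        M.smult_r_distr[OF gC[OF that(3)] \<rho>c[OF arg[OF that(3,1)]] \<rho>c[OF arg[OF that(3,2)]]] by simp
  qed
  show ?thesis
  proof (rule that[of \<rho>])
    show "\<rho> x \<in> N" if "x \<in> carrier M" for x
      unfolding \<rho>_def by (rule sN[OF \<tau>(1) sN[OF iC uN[OF that]]])
    show "\<rho> x = \<tau> \<odot>\<^bsub>M\<^esub> x" if x: "x \<in> N" for x
    proof -
      have \<tau>x: "\<tau> \<odot>\<^bsub>M\<^esub> x \<in> carrier M" using \<tau>(1) Nc[OF x] by simp
      have "t x g = \<tau> \<odot>\<^bsub>M\<^esub> x" if g: "g \<in> G" for g
        unfolding t_def \<rho>0(3)[OF sN[OF gC[OF inv(1)[OF g]] sN[OF \<tau>(1) x]]] by (rule canc[OF g \<tau>x])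
      then have "u x = (\<Oplus>\<^bsub>M\<^esub>g\<in>G. \<tau> \<odot>\<^bsub>M\<^esub> x)"
        unfolding u_def using \<tau>x by (intro M.M.finsum_cong') auto
      then have "\<iota> ?c \<odot>\<^bsub>M\<^esub> u x = (\<iota> ?c \<otimes>\<^bsub>R\<^esub> \<iota> (of_nat (card G))) \<odot>\<^bsub>M\<^esub> (\<tau> \<odot>\<^bsub>M\<^esub> x)"
        unfolding M.finsum_const[OF \<iota> G(1) \<tau>x] M.smult_assoc[OF iC iC \<tau>x] by simp
      also have "\<iota> ?c \<otimes>\<^bsub>R\<^esub> \<iota> (of_nat (card G)) = \<one>\<^bsub>R\<^esub>"
        unfolding im[symmetric] using cardG i1 by simp
      finally show ?thesis
        unfolding \<rho>_def M.smult_one[OF \<tau>x] using M.smult_assoc[OF \<tau>(1) \<tau>(1) Nc[OF x]] \<tau>(2) by simp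
    qed
    show "\<rho> (x \<oplus>\<^bsub>M\<^esub> y) = \<rho> x \<oplus>\<^bsub>M\<^esub> \<rho> y" if xy: "x \<in> carrier M" "y \<in> carrier M" for x y
    proof -
      have "u (x \<oplus>\<^bsub>M\<^esub> y) = (\<Oplus>\<^bsub>M\<^esub>g\<in>G. t x g \<oplus>\<^bsub>M\<^esub> t y g)"
        unfolding u_def by (rule M.M.finsum_cong') (use tadd[OF xy] tC[OF xy(1)] tC[OF xy(2)] in auto)
      also have "\<dots> = u x \<oplus>\<^bsub>M\<^esub> u y" unfolding u_def by (rule M.M.finsum_addf[OF tC[OF xy(1)] tC[OF xy(2)]])
      finally show ?thesis
        unfolding \<rho>_def using uC[OF xy(1)] uC[OF xy(2)] iC \<tau>(1) by (simp add: M.smult_r_distr)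
    qed
    show "\<rho> (\<iota> c \<odot>\<^bsub>M\<^esub> x) = \<iota> c \<odot>\<^bsub>M\<^esub> \<rho> x" if x: "x \<in> carrier M" for c x
    proof -
      have cx: "\<iota> c \<odot>\<^bsub>M\<^esub> x \<in> carrier M" using iC x by simp
      have p: "bij_betw (\<lambda>g. g) G G" by (simp add: bij_betw_def)
      have "u (\<iota> c \<odot>\<^bsub>M\<^esub> x) = \<iota> c \<odot>\<^bsub>M\<^esub> u x"
      proof (rule u_hom[OF x cx _ _ _ _ p])
        fix g assume g: "g \<in> G"
        note ig = gC[OF inv(1)[OF g]]
        have "i g \<odot>\<^bsub>M\<^esub> (\<tau> \<odot>\<^bsub>M\<^esub> (\<iota> c \<odot>\<^bsub>M\<^esub> x)) = \<iota> c \<odot>\<^bsub>M\<^esub> (i g \<odot>\<^bsub>M\<^esub> (\<tau> \<odot>\<^bsub>M\<^esub> x))"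
          unfolding comm[OF \<tau>(1) x, symmetric] comm[OF ig M.smult_closed[OF \<tau>(1) x]] ..
        then show "t (\<iota> c \<odot>\<^bsub>M\<^esub> x) g = \<iota> c \<odot>\<^bsub>M\<^esub> t x g"
          unfolding t_def using \<rho>s[OF arg[OF g x]] comm[OF gC[OF g] \<rho>c[OF arg[OF g x]]] by simp
      qed (use iC in \<open>simp_all add: M.smult_r_distr\<close>)
      then show ?thesis
        unfolding \<rho>_def using comm[OF iC uC[OF x]] comm[OF \<tau>(1) M.smult_closed[OF iC uC[OF x]]] by simp
    qed
    show "\<rho> (h \<odot>\<^bsub>M\<^esub> x) = h \<odot>\<^bsub>M\<^esub> \<rho> x" if h: "h \<in> G" and x: "x \<in> carrier M" for h x
    proof -
      note hC = gC[OF h]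
      have hx: "h \<odot>\<^bsub>M\<^esub> x \<in> carrier M" using hC x by simp
      have p: "bij_betw (\<lambda>g. h \<otimes>\<^bsub>R\<^esub> g) G G"
      proof (rule bij_betw_byWitness[where f' = "\<lambda>g. i h \<otimes>\<^bsub>R\<^esub> g"])
        note ih = gC[OF inv(1)[OF h]]
        show "\<forall>g\<in>G. i h \<otimes>\<^bsub>R\<^esub> (h \<otimes>\<^bsub>R\<^esub> g) = g" "\<forall>g\<in>G. h \<otimes>\<^bsub>R\<^esub> (i h \<otimes>\<^bsub>R\<^esub> g) = g"
          using M.R.m_assoc[OF ih hC gC, symmetric] M.R.m_assoc[OF hC ih gC, symmetric] inv(2,3)[OF h] gC by simp_all
      qed (use G(3) h inv(1) in auto)
      have "u (h \<odot>\<^bsub>M\<^esub> x) = h \<odot>\<^bsub>M\<^esub> u x"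
      proof (rule u_hom[OF x hx _ _ _ _ p])
        fix g assume g: "g \<in> G"
        let ?k = "i (h \<otimes>\<^bsub>R\<^esub> g)"
        have hg: "h \<otimes>\<^bsub>R\<^esub> g \<in> G" by (rule G(3)[OF h g])
        note kC = gC[OF inv(1)[OF hg]] and ig = gC[OF inv(1)[OF g]]
        have "?k \<otimes>\<^bsub>R\<^esub> h = ?k \<otimes>\<^bsub>R\<^esub> h \<otimes>\<^bsub>R\<^esub> (g \<otimes>\<^bsub>R\<^esub> i g)"
          using inv(3)[OF g] kC hC by simp
        also have "\<dots> = (?k \<otimes>\<^bsub>R\<^esub> (h \<otimes>\<^bsub>R\<^esub> g)) \<otimes>\<^bsub>R\<^esub> i g"
          using kC hC gC[OF g] ig by (simp add: M.R.m_assoc)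
        also have "\<dots> = i g" using inv(2)[OF hg] ig by simp
        finally have kh: "?k \<otimes>\<^bsub>R\<^esub> h = i g" .
        have "?k \<odot>\<^bsub>M\<^esub> (\<tau> \<odot>\<^bsub>M\<^esub> (h \<odot>\<^bsub>M\<^esub> x)) = i g \<odot>\<^bsub>M\<^esub> (\<tau> \<odot>\<^bsub>M\<^esub> x)"
          unfolding \<tau>comm[OF h x, symmetric] M.smult_assoc[OF kC hC M.smult_closed[OF \<tau>(1) x], symmetric] kh ..
        then show "t (h \<odot>\<^bsub>M\<^esub> x) (h \<otimes>\<^bsub>R\<^esub> g) = h \<odot>\<^bsub>M\<^esub> t x g"
          unfolding t_def using M.smult_assoc[OF hC gC[OF g] \<rho>c[OF arg[OF g x]]] by simp
      qed (use hC in \<open>simp_all add: M.smult_r_distr\<close>)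
      then show ?thesis
        unfolding \<rho>_def using comm[OF hC uC[OF x]] \<tau>comm[OF h M.smult_closed[OF iC uC[OF x]]] by simp
    qed
    show "\<rho> (a \<odot>\<^bsub>M\<^esub> x) = a \<odot>\<^bsub>M\<^esub> \<rho> x" if a: "a \<in> carrier R" "a \<otimes>\<^bsub>R\<^esub> \<tau> = \<zero>\<^bsub>R\<^esub>" "\<tau> \<otimes>\<^bsub>R\<^esub> a = \<zero>\<^bsub>R\<^esub>"
      and x: "x \<in> carrier M" for a x
    proof -
      have "\<tau> \<odot>\<^bsub>M\<^esub> (a \<odot>\<^bsub>M\<^esub> x) = \<zero>\<^bsub>M\<^esub>" using M.smult_assoc[OF \<tau>(1) a(1) x] a(3) M.smult_l_null[OF x] by simp
      moreover have "\<rho>0 \<zero>\<^bsub>M\<^esub> = \<zero>\<^bsub>M\<^esub>" using \<rho>0(3) ND by blast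
      ultimately have "t (a \<odot>\<^bsub>M\<^esub> x) g = \<zero>\<^bsub>M\<^esub>" if "g \<in> G" for g
        unfolding t_def using gC[OF that] gC[OF inv(1)[OF that]] by simp
      then have "u (a \<odot>\<^bsub>M\<^esub> x) = (\<Oplus>\<^bsub>M\<^esub>g\<in>G. \<zero>\<^bsub>M\<^esub>)" unfolding u_def by (intro M.M.finsum_cong') auto
      then have "\<rho> (a \<odot>\<^bsub>M\<^esub> x) = \<zero>\<^bsub>M\<^esub>" unfolding \<rho>_def using iC \<tau>(1) by simp
      moreover have "a \<odot>\<^bsub>M\<^esub> \<rho> x = \<zero>\<^bsub>M\<^esub>"
        unfolding \<rho>_def M.smult_assoc[OF a(1) \<tau>(1) M.smult_closed[OF iC uC[OF x]], symmetric] a(2)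
        by (rule M.smult_l_null[OF M.smult_closed[OF iC uC[OF x]]])
      ultimately show ?thesis by simp
    qed
  qed
qed

text \<open>Here \<open>\<epsilon> = \<Sum>\<^sub>k X\<^sub>k Y\<^sub>k\<close> lies in \<open>R f R\<close>, and \<open>f R f\<close> is the image of \<open>J\<close>: a splitting
  over \<open>f R f\<close> is transported to \<open>\<epsilon> R \<epsilon>\<close> as in Morita theory.\<close>

lemma morita_projection:
  fixes R :: "('r, 'q) ring_scheme" and R' :: "('s, 't) ring_scheme" and M :: "('r, 'a) module"
  assumes M: "left_module R M" and N: "submodule_of R M N" and R': "ring R'"
    and J: "\<And>b. b \<in> carrier R' \<Longrightarrow> J b \<in> carrier R"
      "\<And>b c. b \<in> carrier R' \<Longrightarrow> c \<in> carrier R' \<Longrightarrow> J (b \<oplus>\<^bsub>R'\<^esub> c) = J b \<oplus>\<^bsub>R\<^esub> J c"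
      "\<And>b c. b \<in> carrier R' \<Longrightarrow> c \<in> carrier R' \<Longrightarrow> J (b \<otimes>\<^bsub>R'\<^esub> c) = J b \<otimes>\<^bsub>R\<^esub> J c"
    and S: "finite S" "\<And>k. k \<in> S \<Longrightarrow> X k \<in> carrier R" "\<And>k. k \<in> S \<Longrightarrow> Y k \<in> carrier R"
    and fY: "\<And>k. k \<in> S \<Longrightarrow> J \<one>\<^bsub>R'\<^esub> \<otimes>\<^bsub>R\<^esub> Y k = Y k"
    and YaX: "\<And>k l a. k \<in> S \<Longrightarrow> l \<in> S \<Longrightarrow> a \<in> carrier R \<Longrightarrow> Y k \<otimes>\<^bsub>R\<^esub> a \<otimes>\<^bsub>R\<^esub> X l \<in> J ` carrier R'"
    and Ya\<epsilon>: "\<And>k a. k \<in> S \<Longrightarrow> a \<in> carrier R \<Longrightarrow> Y k \<otimes>\<^bsub>R\<^esub> a \<otimes>\<^bsub>R\<^esub> (\<Oplus>\<^bsub>R\<^esub>k\<in>S. X k \<otimes>\<^bsub>R\<^esub> Y k) = Y k \<otimes>\<^bsub>R\<^esub> a"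
    and \<epsilon>aX: "\<And>k a. k \<in> S \<Longrightarrow> a \<in> carrier R \<Longrightarrow> (\<Oplus>\<^bsub>R\<^esub>k\<in>S. X k \<otimes>\<^bsub>R\<^esub> Y k) \<otimes>\<^bsub>R\<^esub> (a \<otimes>\<^bsub>R\<^esub> X k) = a \<otimes>\<^bsub>R\<^esub> X k"
    and split: "\<And>(M' :: ('s, 'a) module) N'. left_module R' M' \<Longrightarrow> submodule_of R' M' N' \<Longrightarrow>
      \<exists>\<rho>\<in>mhom R' M' M'. (\<forall>x\<in>carrier M'. \<rho> x \<in> N') \<and> (\<forall>x\<in>N'. \<rho> x = x)"
  obtains \<rho> where "\<rho> \<in> mhom R M M" "\<And>x. x \<in> carrier M \<Longrightarrow> \<rho> x \<in> N"
    "\<And>x. x \<in> N \<Longrightarrow> \<rho> x = (\<Oplus>\<^bsub>R\<^esub>k\<in>S. X k \<otimes>\<^bsub>R\<^esub> Y k) \<odot>\<^bsub>M\<^esub> x"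
proof -
  interpret M: left_module R M by fact
  interpret R': ring R' by fact
  note ND = N[unfolded submodule_of_def]
  have Nc: "x \<in> carrier M" if "x \<in> N" for x using ND that by blast
  have sN: "r \<odot>\<^bsub>M\<^esub> x \<in> N" if "r \<in> carrier R" "x \<in> N" for r x using ND that by blast
  let ?f = "J \<one>\<^bsub>R'\<^esub>" and ?\<epsilon> = "\<Oplus>\<^bsub>R\<^esub>k\<in>S. X k \<otimes>\<^bsub>R\<^esub> Y k"
  have XYc: "(\<lambda>k. X k \<otimes>\<^bsub>R\<^esub> Y k) \<in> S \<rightarrow> carrier R" using S by simp
  have \<epsilon>: "?\<epsilon> \<in> carrier R" by (rule M.R.finsum_closed[OF XYc])
  have f: "?f \<in> carrier R" by (rule J(1)[OF R'.one_closed])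
  \<comment> \<open>The corner f M, on which R' acts through J with its identity acting as f. Its
    elements have the type of those of M, so the splitting hypothesis applies.\<close>
  define M' :: "('s, 'a) module" where "M' = \<lparr>carrier = {x \<in> carrier M. ?f \<odot>\<^bsub>M\<^esub> x = x}, mult = undefined, one = undefined,
    zero = zero M, add = add M, smult = (\<lambda>r x. J r \<odot>\<^bsub>M\<^esub> x)\<rparr>"
  have M's: "x \<in> carrier M' \<longleftrightarrow> x \<in> carrier M \<and> ?f \<odot>\<^bsub>M\<^esub> x = x"
    "zero M' = zero M" "add M' = add M" "b \<odot>\<^bsub>M'\<^esub> x = J b \<odot>\<^bsub>M\<^esub> x" for x b by (simp_all add: M'_def)
  have fJ: "?f \<odot>\<^bsub>M\<^esub> (J b \<odot>\<^bsub>M\<^esub> x) = J b \<odot>\<^bsub>M\<^esub> x" if "b \<in> carrier R'" "x \<in> carrier M" for b x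
    using J(3)[OF R'.one_closed that(1)] that(1) M.smult_assoc[OF f J(1)[OF that(1)] that(2)] by simp
  have M': "left_module R' M'"
  proof -
    have "abelian_group M'"
    proof (rule abelian_groupI)
      show "\<exists>y\<in>carrier M'. y \<oplus>\<^bsub>M'\<^esub> x = \<zero>\<^bsub>M'\<^esub>" if x: "x \<in> carrier M'" for x
      proof
        show "\<ominus>\<^bsub>M\<^esub> x \<in> carrier M'" using x M.smult_uminus[OF f, of x] by (simp add: M's)
        show "\<ominus>\<^bsub>M\<^esub> x \<oplus>\<^bsub>M'\<^esub> x = \<zero>\<^bsub>M'\<^esub>" using x by (simp add: M's M.M.l_neg)
      qed
    qed (use f in \<open>simp_all add: M's M.M.a_ac M.smult_r_distr\<close>)
    then show ?thesis
    proof (intro left_module.intro left_module_axioms.intro R')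
      fix b c x y assume b: "b \<in> carrier R'" "c \<in> carrier R'" and xy: "x \<in> carrier M'" "y \<in> carrier M'"
      then have x: "x \<in> carrier M" "y \<in> carrier M" by (simp_all add: M's)
      show "b \<odot>\<^bsub>M'\<^esub> x \<in> carrier M'" using fJ[OF b(1) x(1)] J(1)[OF b(1)] x(1) by (simp add: M's)
      show "(b \<oplus>\<^bsub>R'\<^esub> c) \<odot>\<^bsub>M'\<^esub> x = b \<odot>\<^bsub>M'\<^esub> x \<oplus>\<^bsub>M'\<^esub> c \<odot>\<^bsub>M'\<^esub> x"
        using J(1)[OF b(1)] J(1)[OF b(2)] J(2)[OF b] x by (simp add: M's M.smult_l_distr)
      show "b \<odot>\<^bsub>M'\<^esub> (x \<oplus>\<^bsub>M'\<^esub> y) = b \<odot>\<^bsub>M'\<^esub> x \<oplus>\<^bsub>M'\<^esub> b \<odot>\<^bsub>M'\<^esub> y"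
        using J(1)[OF b(1)] x by (simp add: M's M.smult_r_distr)
      show "(b \<otimes>\<^bsub>R'\<^esub> c) \<odot>\<^bsub>M'\<^esub> x = b \<odot>\<^bsub>M'\<^esub> (c \<odot>\<^bsub>M'\<^esub> x)"
        using J(1)[OF b(1)] J(1)[OF b(2)] J(3)[OF b] x by (simp add: M's M.smult_assoc)
    next
      fix x assume "x \<in> carrier M'"
      then show "\<one>\<^bsub>R'\<^esub> \<odot>\<^bsub>M'\<^esub> x = x" by (simp add: M's)
    qed
  qed
  interpret M': left_module R' M' by (rule M')
  have "submodule_of R' M' (N \<inter> carrier M')"
    unfolding submodule_of_def
  proof (intro conjI ballI)
    show "\<zero>\<^bsub>M'\<^esub> \<in> N \<inter> carrier M'" using ND M'.M.zero_closed by (simp add: M's(2))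
    show "x \<oplus>\<^bsub>M'\<^esub> y \<in> N \<inter> carrier M'" if "x \<in> N \<inter> carrier M'" "y \<in> N \<inter> carrier M'" for x y
      using ND that M'.M.a_closed[of x y] by (simp add: M's(3))
    show "b \<odot>\<^bsub>M'\<^esub> x \<in> N \<inter> carrier M'" if "b \<in> carrier R'" "x \<in> N \<inter> carrier M'" for b x
      using sN[OF J(1)[OF that(1)], of x] that M'.smult_closed[of b x] by (simp add: M's(4))
  qed simp
  from split[OF M' this] obtain \<sigma> where \<sigma>: "\<sigma> \<in> mhom R' M' M'"
    "\<And>x. x \<in> carrier M' \<Longrightarrow> \<sigma> x \<in> N \<inter> carrier M'" "\<And>x. x \<in> N \<inter> carrier M' \<Longrightarrow> \<sigma> x = x" by blast
  have Yc: "Y k \<odot>\<^bsub>M\<^esub> x \<in> carrier M'" if "k \<in> S" "x \<in> carrier M" for k x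
    using M.smult_assoc[OF f S(3)[OF that(1)] that(2)] fY[OF that(1)] S(3)[OF that(1)] that(2) by (simp add: M's)
  have \<sigma>N: "\<sigma> (Y k \<odot>\<^bsub>M\<^esub> x) \<in> N" if "k \<in> S" "x \<in> carrier M" for k x using \<sigma>(2)[OF Yc[OF that]] by simp
  have \<sigma>c: "\<sigma> (Y k \<odot>\<^bsub>M\<^esub> x) \<in> carrier M" if "k \<in> S" "x \<in> carrier M" for k x by (rule Nc[OF \<sigma>N[OF that]])
  \<comment> \<open>The transport of \<sigma>: the \<open>Y k\<close> map into f M, \<sigma>
    projects there, and the \<open>X k\<close> lead back.\<close>
  define \<rho> where "\<rho> x = (\<Oplus>\<^bsub>M\<^esub>k\<in>S. X k \<odot>\<^bsub>M\<^esub> \<sigma> (Y k \<odot>\<^bsub>M\<^esub> x))" for x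
  have summand: "(\<lambda>k. X k \<odot>\<^bsub>M\<^esub> \<sigma> (Y k \<odot>\<^bsub>M\<^esub> x)) \<in> S \<rightarrow> carrier M" if "x \<in> carrier M" for x
    using S(2) \<sigma>c[OF _ that] by simp
  have \<rho>N: "\<rho> x \<in> N" if "x \<in> carrier M" for x
    unfolding \<rho>_def by (rule M.submodule_finsum[OF N S(1) sN[OF S(2) \<sigma>N[OF _ that]]])
  have \<rho>c: "\<rho> x \<in> carrier M" if "x \<in> carrier M" for x by (rule Nc[OF \<rho>N[OF that]])
  have \<epsilon>sum: "?\<epsilon> \<odot>\<^bsub>M\<^esub> x = (\<Oplus>\<^bsub>M\<^esub>k\<in>S. X k \<odot>\<^bsub>M\<^esub> (Y k \<odot>\<^bsub>M\<^esub> x))" if x: "x \<in> carrier M" for x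
    unfolding M.finsum_smult[OF S(1) XYc x]
    by (rule M.M.finsum_cong') (use S(2,3) x in \<open>auto simp: M.smult_assoc\<close>)
  \<comment> \<open>As Y a = Y a \<epsilon>, inserting the sum for \<epsilon> writes Y a x as a sum
    of terms (Y a X) (Y x). The first factors lie in the image of J and commute with \<sigma>, so
    applying \<sigma> reassembles Y a \<rho>(x).\<close>
  have key: "\<sigma> (Y k \<odot>\<^bsub>M\<^esub> (a \<odot>\<^bsub>M\<^esub> x)) = Y k \<odot>\<^bsub>M\<^esub> (a \<odot>\<^bsub>M\<^esub> \<rho> x)"
    if k: "k \<in> S" and a: "a \<in> carrier R" and x: "x \<in> carrier M" for k a x
  proof -
    note Yk = S(3)[OF k]
    have Ya: "Y k \<otimes>\<^bsub>R\<^esub> a \<in> carrier R" using Yk a by simp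
    let ?g = "\<lambda>l. (Y k \<otimes>\<^bsub>R\<^esub> a \<otimes>\<^bsub>R\<^esub> X l) \<odot>\<^bsub>M\<^esub> (Y l \<odot>\<^bsub>M\<^esub> x)"
    have lin: "?g l \<in> carrier M'" "\<sigma> (?g l) = (Y k \<otimes>\<^bsub>R\<^esub> a) \<odot>\<^bsub>M\<^esub> (X l \<odot>\<^bsub>M\<^esub> \<sigma> (Y l \<odot>\<^bsub>M\<^esub> x))" if l: "l \<in> S" for l
    proof -
      obtain b where b: "Y k \<otimes>\<^bsub>R\<^esub> a \<otimes>\<^bsub>R\<^esub> X l = J b" "b \<in> carrier R'" using YaX[OF k l a] by (rule imageE)
      show "?g l \<in> carrier M'"
        unfolding b(1) M's(4)[symmetric] by (rule M'.smult_closed[OF b(2) Yc[OF l x]])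
      show "\<sigma> (?g l) = (Y k \<otimes>\<^bsub>R\<^esub> a) \<odot>\<^bsub>M\<^esub> (X l \<odot>\<^bsub>M\<^esub> \<sigma> (Y l \<odot>\<^bsub>M\<^esub> x))"
        unfolding M.smult_assoc[OF Ya S(2)[OF l] \<sigma>c[OF l x], symmetric] unfolding b(1) M's(4)[symmetric]
        by (rule mhomD(3)[OF \<sigma>(1) b(2) Yc[OF l x]])
    qed
    have "Y k \<odot>\<^bsub>M\<^esub> (a \<odot>\<^bsub>M\<^esub> x) = (Y k \<otimes>\<^bsub>R\<^esub> a \<otimes>\<^bsub>R\<^esub> ?\<epsilon>) \<odot>\<^bsub>M\<^esub> x"
      unfolding Ya\<epsilon>[OF k a] M.smult_assoc[OF Yk a x] ..
    also have "\<dots> = (Y k \<otimes>\<^bsub>R\<^esub> a) \<odot>\<^bsub>M\<^esub> (\<Oplus>\<^bsub>M\<^esub>l\<in>S. X l \<odot>\<^bsub>M\<^esub> (Y l \<odot>\<^bsub>M\<^esub> x))"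
      unfolding M.smult_assoc[OF Ya \<epsilon> x] \<epsilon>sum[OF x] ..
    also have "\<dots> = (\<Oplus>\<^bsub>M\<^esub>l\<in>S. (Y k \<otimes>\<^bsub>R\<^esub> a) \<odot>\<^bsub>M\<^esub> (X l \<odot>\<^bsub>M\<^esub> (Y l \<odot>\<^bsub>M\<^esub> x)))"
      by (rule M.smult_finsum[OF S(1) Ya]) (use S(2,3) x in simp)
    also have "\<dots> = (\<Oplus>\<^bsub>M\<^esub>l\<in>S. ?g l)"
      by (rule M.M.finsum_cong') (use S(2,3) x Ya in \<open>auto simp: M.smult_assoc\<close>)
    also have "\<dots> = (\<Oplus>\<^bsub>M'\<^esub>l\<in>S. ?g l)"
      by (rule M'.hom_finsum[where h = "\<lambda>y. y", OF M, symmetric]) (use S(1) lin(1) in \<open>simp_all add: M's\<close>)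
    finally have "\<sigma> (Y k \<odot>\<^bsub>M\<^esub> (a \<odot>\<^bsub>M\<^esub> x)) = \<sigma> (\<Oplus>\<^bsub>M'\<^esub>l\<in>S. ?g l)" by simp
    also have "\<dots> = (\<Oplus>\<^bsub>M\<^esub>l\<in>S. \<sigma> (?g l))"
    proof (rule M'.hom_finsum[OF M _ _ _ S(1)])
      show "\<sigma> \<zero>\<^bsub>M'\<^esub> = \<zero>\<^bsub>M\<^esub>" using M'.hom_zero[OF M' \<sigma>(1)] by (simp add: M's)
      show "\<sigma> y \<in> carrier M" if "y \<in> carrier M'" for y using mhomD(1)[OF \<sigma>(1) that] by (simp add: M's)
      show "\<sigma> (y \<oplus>\<^bsub>M'\<^esub> z) = \<sigma> y \<oplus>\<^bsub>M\<^esub> \<sigma> z" if "y \<in> carrier M'" "z \<in> carrier M'" for y z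
        using mhomD(2)[OF \<sigma>(1) that] by (simp add: M's(3))
    qed (use lin(1) in simp)
    also have "\<dots> = (\<Oplus>\<^bsub>M\<^esub>l\<in>S. (Y k \<otimes>\<^bsub>R\<^esub> a) \<odot>\<^bsub>M\<^esub> (X l \<odot>\<^bsub>M\<^esub> \<sigma> (Y l \<odot>\<^bsub>M\<^esub> x)))"
      by (rule M.M.finsum_cong') (use lin(2) summand[OF x] Ya in auto)
    also have "\<dots> = (Y k \<otimes>\<^bsub>R\<^esub> a) \<odot>\<^bsub>M\<^esub> \<rho> x"
      unfolding \<rho>_def by (rule M.smult_finsum[OF S(1) Ya summand[OF x], symmetric])
    finally show ?thesis unfolding M.smult_assoc[OF Yk a \<rho>c[OF x]] .
  qed
  show ?thesis
  proof (rule that[of \<rho>])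
    show "\<rho> \<in> mhom R M M"
    proof (rule mhomI)
      show "\<rho> x \<in> carrier M" if "x \<in> carrier M" for x by (rule \<rho>c[OF that])
      show "\<rho> (x \<oplus>\<^bsub>M\<^esub> y) = \<rho> x \<oplus>\<^bsub>M\<^esub> \<rho> y" if x: "x \<in> carrier M" and y: "y \<in> carrier M" for x y
      proof -
        have "X k \<odot>\<^bsub>M\<^esub> \<sigma> (Y k \<odot>\<^bsub>M\<^esub> (x \<oplus>\<^bsub>M\<^esub> y)) = X k \<odot>\<^bsub>M\<^esub> \<sigma> (Y k \<odot>\<^bsub>M\<^esub> x) \<oplus>\<^bsub>M\<^esub> X k \<odot>\<^bsub>M\<^esub> \<sigma> (Y k \<odot>\<^bsub>M\<^esub> y)"
          if k: "k \<in> S" for k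
          unfolding M.smult_r_distr[OF S(3)[OF k] x y] mhomD(2)[OF \<sigma>(1) Yc[OF k x] Yc[OF k y], unfolded M's(3)]
          by (rule M.smult_r_distr[OF S(2)[OF k] \<sigma>c[OF k x] \<sigma>c[OF k y]])
        then have "\<rho> (x \<oplus>\<^bsub>M\<^esub> y) = (\<Oplus>\<^bsub>M\<^esub>k\<in>S. X k \<odot>\<^bsub>M\<^esub> \<sigma> (Y k \<odot>\<^bsub>M\<^esub> x) \<oplus>\<^bsub>M\<^esub> X k \<odot>\<^bsub>M\<^esub> \<sigma> (Y k \<odot>\<^bsub>M\<^esub> y))"
          unfolding \<rho>_def by (intro M.M.finsum_cong') (use summand[OF x] summand[OF y] in auto)
        then show ?thesis unfolding \<rho>_def M.M.finsum_addf[OF summand[OF x] summand[OF y]] .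
      qed
      show "\<rho> (a \<odot>\<^bsub>M\<^esub> x) = a \<odot>\<^bsub>M\<^esub> \<rho> x" if a: "a \<in> carrier R" and x: "x \<in> carrier M" for a x
      proof -
        have aw: "a \<odot>\<^bsub>M\<^esub> \<rho> x \<in> carrier M" using a \<rho>c[OF x] by simp
        \<comment> \<open>By \<open>key\<close> the left side is \<epsilon> a \<rho>(x). The factor
          \<epsilon> then disappears, because \<rho>(x) is a sum of elements X w and \<epsilon>
          fixes a X from the left.\<close>
        have "\<rho> (a \<odot>\<^bsub>M\<^esub> x) = (\<Oplus>\<^bsub>M\<^esub>k\<in>S. X k \<odot>\<^bsub>M\<^esub> (Y k \<odot>\<^bsub>M\<^esub> (a \<odot>\<^bsub>M\<^esub> \<rho> x)))"
          unfolding \<rho>_def[of "a \<odot>\<^bsub>M\<^esub> x"]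
          by (rule M.M.finsum_cong') (use key[OF _ a x] S(2,3) aw in auto)
        also have "\<dots> = ?\<epsilon> \<odot>\<^bsub>M\<^esub> (a \<odot>\<^bsub>M\<^esub> \<rho> x)" by (rule \<epsilon>sum[OF aw, symmetric])
        also have "\<dots> = (?\<epsilon> \<otimes>\<^bsub>R\<^esub> a) \<odot>\<^bsub>M\<^esub> \<rho> x" by (rule M.smult_assoc[OF \<epsilon> a \<rho>c[OF x], symmetric])
        also have "\<dots> = (\<Oplus>\<^bsub>M\<^esub>k\<in>S. (?\<epsilon> \<otimes>\<^bsub>R\<^esub> a) \<odot>\<^bsub>M\<^esub> (X k \<odot>\<^bsub>M\<^esub> \<sigma> (Y k \<odot>\<^bsub>M\<^esub> x)))"
          unfolding \<rho>_def by (rule M.smult_finsum[OF S(1) _ summand[OF x]]) (use \<epsilon> a in simp)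
        also have "\<dots> = (\<Oplus>\<^bsub>M\<^esub>k\<in>S. a \<odot>\<^bsub>M\<^esub> (X k \<odot>\<^bsub>M\<^esub> \<sigma> (Y k \<odot>\<^bsub>M\<^esub> x)))"
        proof (rule M.M.finsum_cong')
          fix k assume k: "k \<in> S"
          note c = \<sigma>c[OF k x] and Xk = S(2)[OF k]
          show "(?\<epsilon> \<otimes>\<^bsub>R\<^esub> a) \<odot>\<^bsub>M\<^esub> (X k \<odot>\<^bsub>M\<^esub> \<sigma> (Y k \<odot>\<^bsub>M\<^esub> x)) = a \<odot>\<^bsub>M\<^esub> (X k \<odot>\<^bsub>M\<^esub> \<sigma> (Y k \<odot>\<^bsub>M\<^esub> x))"
            unfolding M.smult_assoc[OF M.R.m_closed[OF \<epsilon> a] Xk c, symmetric] M.R.m_assoc[OF \<epsilon> a Xk] \<epsilon>aX[OF k a]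
            by (rule M.smult_assoc[OF a Xk c])
        qed (use a summand[OF x] in auto)
        also have "\<dots> = a \<odot>\<^bsub>M\<^esub> \<rho> x" unfolding \<rho>_def by (rule M.smult_finsum[OF S(1) a summand[OF x], symmetric])
        finally show ?thesis .
      qed
    qed
    show "\<rho> x \<in> N" if "x \<in> carrier M" for x by (rule \<rho>N[OF that])
    show "\<rho> x = ?\<epsilon> \<odot>\<^bsub>M\<^esub> x" if x: "x \<in> N" for x
      unfolding \<rho>_def \<epsilon>sum[OF Nc[OF x]]
    proof (rule M.M.finsum_cong')
      fix k assume k: "k \<in> S"
      have "Y k \<odot>\<^bsub>M\<^esub> x \<in> N \<inter> carrier M'" using sN[OF S(3)[OF k] x] Yc[OF k Nc[OF x]] by simp
      then show "X k \<odot>\<^bsub>M\<^esub> \<sigma> (Y k \<odot>\<^bsub>M\<^esub> x) = X k \<odot>\<^bsub>M\<^esub> (Y k \<odot>\<^bsub>M\<^esub> x)" using \<sigma>(3) by simp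
    qed (use S(2,3) Nc[OF x] in auto)
  qed
qed

section \<open>The ideal spanned by the singular matrices and its identity\<close>

definition singular_support :: "nat \<Rightarrow> ('f::field mat \<Rightarrow> 'k::field) set" where
  "singular_support n = {u \<in> carrier (monoid_algebra (matrix_monoid n)). \<forall>x. u x \<noteq> 0 \<longrightarrow> det x = 0}"

lemma msingle_singular_support:
  "a \<in> carrier_mat n n \<Longrightarrow> det a = 0 \<Longrightarrow> msingle a c \<in> singular_support n"
  unfolding singular_support_def by (auto simp: ring_mat_simps intro!: msingle_carrier) (auto simp: msingle_def split: if_splits)

text \<open>A matrix in the support of a product is a product of matrices from the two supports, one
  of which is singular, and determinants multiply.\<close>

lemma singular_support_mult:
  fixes u a :: "'f::field mat \<Rightarrow> 'k::field"
  assumes u: "u \<in> singular_support n" and a: "a \<in> carrier (monoid_algebra (matrix_monoid n))"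
  shows "u \<otimes>\<^bsub>monoid_algebra (matrix_monoid n)\<^esub> a \<in> singular_support n"
    and "a \<otimes>\<^bsub>monoid_algebra (matrix_monoid n)\<^esub> u \<in> singular_support n"
proof -
  interpret A: ring "monoid_algebra (matrix_monoid n) :: ('f mat \<Rightarrow> 'k) ring"
    by (rule monoid_algebra_ring[OF matrix_monoid])
  have uc: "u \<in> carrier (monoid_algebra (matrix_monoid n))" using u by (simp add: singular_support_def)
  have supp: "\<exists>x y. v x \<noteq> 0 \<and> w y \<noteq> 0 \<and> x * y = z"
    if "(v \<otimes>\<^bsub>monoid_algebra (matrix_monoid n)\<^esub> w) z \<noteq> 0" for v w :: "'f mat \<Rightarrow> 'k" and z
  proof (rule ccontr)
    assume "\<not> ?thesis"
    then have "{(x, y). v x \<noteq> 0 \<and> w y \<noteq> 0 \<and> x * y = z} = {}" by blast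
    with that show False by (simp add: monoid_algebra_def ring_mat_simps)
  qed
  have d: "det (x * y) = det x * det y"
    if "v x \<noteq> 0" "w y \<noteq> 0" "v \<in> carrier (monoid_algebra (matrix_monoid n))"
      "w \<in> carrier (monoid_algebra (matrix_monoid n))" for v w :: "'f mat \<Rightarrow> 'k" and x y
    by (rule det_mult[of _ n]) (use that in \<open>auto simp: monoid_algebra_carrier ring_mat_simps\<close>)
  show "u \<otimes>\<^bsub>monoid_algebra (matrix_monoid n)\<^esub> a \<in> singular_support n"
    using supp[of u a] d[of u _ a, OF _ _ uc a] u A.m_closed[OF uc a] unfolding singular_support_def by fastforce
  show "a \<otimes>\<^bsub>monoid_algebra (matrix_monoid n)\<^esub> u \<in> singular_support n"
    using supp[of a u] d[of a _ u, OF _ _ a uc] u A.m_closed[OF a uc] unfolding singular_support_def by fastforce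
qed

text \<open>The coefficients of the first product are multiples of the sums in
  \<open>kovacs_fun_sum\<close>. Transposition reverses products and preserves determinants, which
  yields the second product.\<close>

lemma kovacs_mult_single:
  fixes a :: "'f::{field,finite} mat"
  assumes a: "a \<in> carrier_mat n n" "det a = 0" and q: "of_nat CARD('f) \<noteq> (0 :: 'k::field)"
  shows "kovacs_fun n \<otimes>\<^bsub>monoid_algebra (matrix_monoid n)\<^esub> msingle a (c :: 'k) = (\<lambda>_. 0)"
    and "msingle a c \<otimes>\<^bsub>monoid_algebra (matrix_monoid n)\<^esub> (\<lambda>x. kovacs_fun n (transpose_mat x)) = (\<lambda>_. 0)"
proof -
  let ?C = "carrier_mat n n :: 'f mat set"
  have s: "{x. msingle a c x \<noteq> 0} \<subseteq> {a}" by (auto simp: msingle_def)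
  have k: "{x. kovacs_fun n x \<noteq> (0 :: 'k)} \<subseteq> ?C" using kovacs_fun_support(1) by blast
  have k': "{x. kovacs_fun n (transpose_mat x) \<noteq> (0 :: 'k)} \<subseteq> ?C"
    using kovacs_fun_support(1)[of n "transpose_mat _", where 'k = 'k] by auto
  have ms: "msingle a c a = c" by (simp add: msingle_def)
  show "kovacs_fun n \<otimes>\<^bsub>monoid_algebra (matrix_monoid n)\<^esub> msingle a c = (\<lambda>_. 0)"
  proof
    fix z
    have "(kovacs_fun n \<otimes>\<^bsub>monoid_algebra (matrix_monoid n)\<^esub> msingle a c) z =
        (\<Sum>x\<in>?C. \<Sum>y\<in>{a}. if x \<otimes>\<^bsub>matrix_monoid n\<^esub> y = z then kovacs_fun n x * msingle a c y else 0)"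
      by (rule monoid_algebra_mult[OF finite_carrier_mat _ k s]) simp
    also have "\<dots> = (\<Sum>x\<in>?C. if x * a = z then kovacs_fun n x else 0) * c"
      unfolding sum_distrib_right by (rule sum.cong) (simp_all add: ring_mat_simps ms)
    also have "\<dots> = 0"
      unfolding sum.inter_filter[OF finite_carrier_mat, symmetric] kovacs_fun_sum[OF a q] by simp
    finally show "(kovacs_fun n \<otimes>\<^bsub>monoid_algebra (matrix_monoid n)\<^esub> msingle a c) z = 0" .
  qed
  show "msingle a c \<otimes>\<^bsub>monoid_algebra (matrix_monoid n)\<^esub> (\<lambda>x. kovacs_fun n (transpose_mat x)) = (\<lambda>_. 0)"
  proof
    fix z
    have at: "transpose_mat a \<in> ?C" "det (transpose_mat a) = 0" using a det_transpose[OF a(1)] by simp_all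
    have tt: "a * x = z \<longleftrightarrow> transpose_mat x * transpose_mat a = transpose_mat z" if "x \<in> ?C" for x
      unfolding transpose_mult[OF a(1) that, symmetric] by simp
    have "(msingle a c \<otimes>\<^bsub>monoid_algebra (matrix_monoid n)\<^esub> (\<lambda>x. kovacs_fun n (transpose_mat x))) z =
        (\<Sum>x\<in>{a}. \<Sum>y\<in>?C. if x \<otimes>\<^bsub>matrix_monoid n\<^esub> y = z then msingle a c x * kovacs_fun n (transpose_mat y) else 0)"
      by (rule monoid_algebra_mult[OF _ finite_carrier_mat s k']) simp
    also have "\<dots> = c * (\<Sum>y\<in>?C. if transpose_mat y * transpose_mat a = transpose_mat z then kovacs_fun n (transpose_mat y) else 0)"
      unfolding sum_distrib_left by (simp, rule sum.cong) (simp_all add: ring_mat_simps ms tt)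
    also have "(\<Sum>y\<in>?C. if transpose_mat y * transpose_mat a = transpose_mat z then kovacs_fun n (transpose_mat y) else 0)
        = (\<Sum>x\<in>?C. if x * transpose_mat a = transpose_mat z then kovacs_fun n x else (0 :: 'k))"
      by (rule sum.reindex_bij_witness[of _ transpose_mat transpose_mat]) simp_all
    also have "\<dots> = 0"
      unfolding sum.inter_filter[OF finite_carrier_mat, symmetric] kovacs_fun_sum[OF at q] by simp
    finally show "(msingle a c \<otimes>\<^bsub>monoid_algebra (matrix_monoid n)\<^esub> (\<lambda>x. kovacs_fun n (transpose_mat x))) z = 0" by simp
  qed
qed

text \<open>The alternating sum \<tau> is annihilated by singular matrices on its right, its
  transpose \<tau>' by those on its left, and both differ from one by elements of the ideal. Hence
  \<tau> = \<tau> \<tau>' = \<tau>', and one element serves on both sides.\<close>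

lemma kovacs_idempotent:
  assumes q: "of_nat CARD('f::{field,finite}) \<noteq> (0 :: 'k::field)"
  obtains \<epsilon> \<tau> :: "'f::{field,finite} mat \<Rightarrow> 'k::field" where "\<epsilon> \<in> singular_support n" "\<tau> \<in> carrier (monoid_algebra (matrix_monoid n))"
    "\<epsilon> \<oplus>\<^bsub>monoid_algebra (matrix_monoid n)\<^esub> \<tau> = \<one>\<^bsub>monoid_algebra (matrix_monoid n)\<^esub>"
    "\<And>u. u \<in> singular_support n \<Longrightarrow> \<tau> \<otimes>\<^bsub>monoid_algebra (matrix_monoid n)\<^esub> u = \<zero>\<^bsub>monoid_algebra (matrix_monoid n)\<^esub>"
    "\<And>u. u \<in> singular_support n \<Longrightarrow> u \<otimes>\<^bsub>monoid_algebra (matrix_monoid n)\<^esub> \<tau> = \<zero>\<^bsub>monoid_algebra (matrix_monoid n)\<^esub>"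
proof -
  let ?A = "monoid_algebra (matrix_monoid n) :: ('f mat \<Rightarrow> 'k) ring"
  interpret A: ring ?A by (rule monoid_algebra_ring[OF matrix_monoid])
  define \<tau> :: "'f mat \<Rightarrow> 'k" where "\<tau> = kovacs_fun n"
  define \<tau>' :: "'f mat \<Rightarrow> 'k" where "\<tau>' x = kovacs_fun n (transpose_mat x)" for x
  define \<epsilon> where "\<epsilon> x = (\<one>\<^bsub>?A\<^esub>) x - \<tau> x" for x
  define \<epsilon>' where "\<epsilon>' x = (\<one>\<^bsub>?A\<^esub>) x - \<tau>' x" for x
  have \<tau>s: "x \<in> carrier_mat n n" "x = 1\<^sub>m n \<or> det x = 0" if "\<tau> x \<noteq> 0" for x
    using kovacs_fun_support[of n x, where 'k = 'k] that by (auto simp: \<tau>_def)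
  have \<tau>'s: "x \<in> carrier_mat n n" "x = 1\<^sub>m n \<or> det x = 0" if "\<tau>' x \<noteq> 0" for x
  proof -
    have *: "transpose_mat x \<in> carrier_mat n n" "transpose_mat x = 1\<^sub>m n \<or> det (transpose_mat x) = 0"
      using kovacs_fun_support[of n "transpose_mat x", where 'k = 'k] that by (auto simp: \<tau>'_def)
    show x: "x \<in> carrier_mat n n" using *(1) by simp
    show "x = 1\<^sub>m n \<or> det x = 0" using *(2) det_transpose[OF x] by (metis transpose_one transpose_transpose)
  qed
  have fin: "finite X" if "X \<subseteq> carrier_mat n n" for X :: "'f mat set"
    by (rule finite_subset[OF that finite_carrier_mat])
  have \<tau>c: "\<tau> \<in> carrier ?A" "\<tau>' \<in> carrier ?A"
    unfolding monoid_algebra_carrier using \<tau>s(1) \<tau>'s(1) by (auto simp: ring_mat_simps intro!: fin)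
  have one: "(\<one>\<^bsub>?A\<^esub>) x = (if x = 1\<^sub>m n then 1 else 0)" for x by (simp add: monoid_algebra_ops msingle_def ring_mat_simps)
  have k1: "\<tau> (1\<^sub>m n) = 1" "\<tau>' (1\<^sub>m n) = 1" by (simp_all add: \<tau>_def \<tau>'_def kovacs_fun_one)
  \<comment> \<open>The coefficients at the identity matrix cancel, which leaves singular matrices
    only.\<close>
  have es: "x \<in> carrier_mat n n \<and> det x = 0" if "\<epsilon> x \<noteq> 0" for x
    using that \<tau>s[of x] k1 unfolding \<epsilon>_def one by (cases "x = 1\<^sub>m n") auto
  have es': "x \<in> carrier_mat n n \<and> det x = 0" if "\<epsilon>' x \<noteq> 0" for x
    using that \<tau>'s[of x] k1 unfolding \<epsilon>'_def one by (cases "x = 1\<^sub>m n") auto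
  have \<epsilon>: "\<epsilon> \<in> singular_support n" "\<epsilon>' \<in> singular_support n"
    unfolding singular_support_def monoid_algebra_carrier using es es' by (auto simp: ring_mat_simps intro!: fin)
  then have \<epsilon>c: "\<epsilon> \<in> carrier ?A" "\<epsilon>' \<in> carrier ?A" by (simp_all add: singular_support_def)
  have sum: "\<epsilon> \<oplus>\<^bsub>?A\<^esub> \<tau> = \<one>\<^bsub>?A\<^esub>" "\<epsilon>' \<oplus>\<^bsub>?A\<^esub> \<tau>' = \<one>\<^bsub>?A\<^esub>"
    by (auto simp: monoid_algebra_ops(1) \<epsilon>_def \<epsilon>'_def)
  have "\<tau> \<otimes>\<^bsub>?A\<^esub> u = \<zero>\<^bsub>?A\<^esub> \<and> u \<otimes>\<^bsub>?A\<^esub> \<tau>' = \<zero>\<^bsub>?A\<^esub>" if u: "u \<in> singular_support n" for u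
  proof -
    have uc: "u \<in> carrier ?A" and us: "\<And>x. u x \<noteq> 0 \<Longrightarrow> det x = 0" using u by (simp_all add: singular_support_def)
    from uc show ?thesis
    proof (induction u rule: monoid_algebra_induct)
      case zero
      then show ?case using \<tau>c by simp
    next
      case (add a b)
      then show ?case using \<tau>c by (simp add: A.l_distr A.r_distr)
    next
      case (single x c)
      then have x: "x \<in> carrier_mat n n" "det x = 0" using us by (simp_all add: ring_mat_simps)
      show ?case
        using kovacs_mult_single[OF x q, of c] unfolding \<tau>_def \<tau>'_def by (simp add: monoid_algebra_ops(2))
    qed
  qed
  then have ann: "\<tau> \<otimes>\<^bsub>?A\<^esub> u = \<zero>\<^bsub>?A\<^esub>" "u \<otimes>\<^bsub>?A\<^esub> \<tau>' = \<zero>\<^bsub>?A\<^esub>" if "u \<in> singular_support n" for u using that by blast+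
  have "\<tau> = \<tau> \<otimes>\<^bsub>?A\<^esub> (\<epsilon>' \<oplus>\<^bsub>?A\<^esub> \<tau>')" unfolding sum using \<tau>c by simp
  also have "\<dots> = \<tau> \<otimes>\<^bsub>?A\<^esub> \<tau>'" using \<tau>c \<epsilon>c ann(1)[OF \<epsilon>(2)] by (simp add: A.r_distr)
  also have "\<dots> = (\<epsilon> \<oplus>\<^bsub>?A\<^esub> \<tau>) \<otimes>\<^bsub>?A\<^esub> \<tau>'" using \<tau>c \<epsilon>c ann(2)[OF \<epsilon>(1)] by (simp add: A.l_distr)
  also have "\<dots> = \<tau>'" unfolding sum using \<tau>c by simp
  finally have eq: "\<tau>' = \<tau>" by simp
  show thesis by (rule that[OF \<epsilon>(1) \<tau>c(1) sum(1) ann(1) ann(2)[unfolded eq]])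
qed

section \<open>The corner embedding and factorization of singular matrices\<close>

lemma mult_four_block_last:
  assumes "A1 \<in> carrier_mat m m" "B1 \<in> carrier_mat m 1" "C1 \<in> carrier_mat 1 m" "D1 \<in> carrier_mat 1 1"
    and "A2 \<in> carrier_mat m m" "B2 \<in> carrier_mat m 1" "C2 \<in> carrier_mat 1 m" "D2 \<in> carrier_mat 1 1"
  shows "four_block_mat A1 B1 C1 D1 * four_block_mat A2 B2 C2 D2
    = four_block_mat (A1 * A2 + B1 * C2) (A1 * B2 + B1 * D2) (C1 * A2 + D1 * C2) (C1 * B2 + D1 * D2)"
  by (rule mult_four_block_mat[OF assms])

text \<open>This embedding is multiplicative but not unital.\<close>

definition corner_mat :: "nat \<Rightarrow> 'f::field mat \<Rightarrow> 'f mat" where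
  "corner_mat m x = four_block_mat x (0\<^sub>m m 1) (0\<^sub>m 1 m) (0\<^sub>m 1 1)"

lemma corner_mat_carrier: "x \<in> carrier_mat m m \<Longrightarrow> corner_mat m x \<in> carrier_mat (Suc m) (Suc m)"
  unfolding corner_mat_def using four_block_carrier_mat[of x m m "0\<^sub>m 1 1" 1 1] by simp

lemma corner_mat_mult:
  assumes "x \<in> carrier_mat m m" "y \<in> carrier_mat m m"
  shows "corner_mat m (x * y) = corner_mat m x * corner_mat m y"
  unfolding corner_mat_def
  by (subst mult_four_block_last[where m = m]) (use assms in simp_all)

lemma split_last:
  assumes y: "y \<in> carrier_mat (Suc m) (Suc m)"
  obtains a b c d where "a \<in> carrier_mat m m" "b \<in> carrier_mat m 1" "c \<in> carrier_mat 1 m" "d \<in> carrier_mat 1 1"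
    "y = four_block_mat a b c d"
proof -
  obtain a b c d where s: "split_block y m m = (a, b, c, d)" by (metis prod_cases4)
  have "dim_row y = m + 1" "dim_col y = m + 1" using y by auto
  from split_block[OF s this] that show thesis by blast
qed

text \<open>With f the diagonal idempotent of rank m, multiplication by f on both sides erases the
  last row and the last column; what remains is an embedded smaller matrix.\<close>

lemma corner_mat_sandwich:
  assumes y: "y \<in> carrier_mat (Suc m) (Suc m)"
  obtains a where "a \<in> carrier_mat m m" "corner_mat m (1\<^sub>m m) * y * corner_mat m (1\<^sub>m m) = corner_mat m a"
proof -
  obtain a b c d where s: "a \<in> carrier_mat m m" "b \<in> carrier_mat m 1" "c \<in> carrier_mat 1 m" "d \<in> carrier_mat 1 1"
    "y = four_block_mat a b c d" by (rule split_last[OF y])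
  have "corner_mat m (1\<^sub>m m) * y = four_block_mat a b (0\<^sub>m 1 m) (0\<^sub>m 1 1)"
    unfolding corner_mat_def s(5)
    by (subst mult_four_block_last[where m = m]) (use s in simp_all)
  also have "\<dots> * corner_mat m (1\<^sub>m m) = corner_mat m a"
    unfolding corner_mat_def
    by (subst mult_four_block_last[where m = m]) (use s in simp_all)
  finally show thesis by (rule that[OF s(1)])
qed

text \<open>The last column is zero, so the last unit vector lies in the kernel.\<close>

lemma det_corner_mat: "det (corner_mat m (1\<^sub>m m :: 'f::field mat)) = 0"
proof -
  have c: "corner_mat m (1\<^sub>m m :: 'f mat) \<in> carrier_mat (Suc m) (Suc m)" by (rule corner_mat_carrier) simp
  have "row (corner_mat m (1\<^sub>m m :: 'f mat)) m = 0\<^sub>v (Suc m)"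
    by (rule eq_vecI) (auto simp: corner_mat_def)
  then have "corner_mat m (1\<^sub>m m) *\<^sub>v unit_vec (Suc m) m = (0\<^sub>v (Suc m) :: 'f vec)"
    by (intro eq_vecI) (auto simp: corner_mat_def scalar_prod_def unit_vec_def less_Suc_eq)
  then show ?thesis unfolding det_0_iff_vec_prod_zero[OF c] by (intro exI[of _ "unit_vec (Suc m) m"]) auto
qed

text \<open>The row echelon form r of a singular matrix has last row zero, so the idempotent f fixes
  it from the left, and l undoes the row operations. Thus a = l f r, which shows that f generates
  the ideal of singular matrices.\<close>

lemma singular_factorization:
  fixes a :: "'f::field mat"
  assumes a: "a \<in> carrier_mat (Suc m) (Suc m)" "det a = 0"
  obtains l r where "l \<in> carrier_mat (Suc m) (Suc m)" "r \<in> carrier_mat (Suc m) (Suc m)" "l * r = a"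
    "corner_mat m (1\<^sub>m m) * r = r"
proof -
  note g = gauss_jordan_single[OF a(1) refl]
  let ?r = "gauss_jordan_single a"
  obtain P Q where PQ: "?r = P * a" "P \<in> carrier_mat (Suc m) (Suc m)" "Q \<in> carrier_mat (Suc m) (Suc m)"
    "Q * P = 1\<^sub>m (Suc m)" using g(4) by blast
  have "det ?r = 0" unfolding PQ(1) det_mult[OF PQ(2) a(1)] a(2) by simp
  then have "?r \<noteq> 1\<^sub>m (Suc m)" by auto
  then have row: "row ?r m = 0\<^sub>v (Suc m)" using row_echelon_form_imp_1_or_0_row[OF g(2,3)] by simp
  obtain b c d e where s: "b \<in> carrier_mat m m" "c \<in> carrier_mat m 1" "d \<in> carrier_mat 1 m" "e \<in> carrier_mat 1 1"
    "?r = four_block_mat b c d e" by (rule split_last[OF g(2)])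
  have ix: "?r $$ (m, j) = 0" if "j < Suc m" for j
    using arg_cong[OF row, of "\<lambda>v. v $ j"] that g(2) by auto
  have d: "d = 0\<^sub>m 1 m"
  proof (rule eq_matI)
    fix i j assume "i < dim_row (0\<^sub>m 1 m :: 'f mat)" "j < dim_col (0\<^sub>m 1 m :: 'f mat)"
    then show "d $$ (i, j) = 0\<^sub>m 1 m $$ (i, j)" using ix[of j] s(1-4) unfolding s(5) by auto
  qed (use s in auto)
  have e: "e = 0\<^sub>m 1 1"
  proof (rule eq_matI)
    fix i j assume "i < dim_row (0\<^sub>m 1 1 :: 'f mat)" "j < dim_col (0\<^sub>m 1 1 :: 'f mat)"
    then show "e $$ (i, j) = 0\<^sub>m 1 1 $$ (i, j)" using ix[of m] s(1-4) unfolding s(5) by auto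
  qed (use s in auto)
  have "corner_mat m (1\<^sub>m m) * ?r = ?r"
    unfolding corner_mat_def s(5)
    by (subst mult_four_block_last[where m = m]) (use s d e in simp_all)
  moreover have "Q * ?r = a" unfolding PQ(1) assoc_mult_mat[OF PQ(3,2) a(1), symmetric] PQ(4) using a by simp
  ultimately show thesis using that[OF PQ(3) g(2)] by blast
qed

text \<open>Lagrange's theorem for the smaller group embedded with last diagonal entry 1. It hands
  the hypothesis on the group order down to smaller dimensions in the induction.\<close>

lemma card_GL_dvd: "card (GL m :: 'f::{field,finite} mat set) dvd card (GL (Suc m) :: 'f mat set)"
proof -
  let ?M = "matrix_monoid m :: 'f mat ring" and ?N = "matrix_monoid (Suc m) :: 'f mat ring"
  interpret M: monoid ?M by (rule matrix_monoid)
  interpret N: monoid ?N by (rule matrix_monoid)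
  interpret G: group "units_of ?N" by (rule N.units_group)
  let ?h = "\<lambda>g :: 'f mat. four_block_mat g (0\<^sub>m m 1) (0\<^sub>m 1 m) (1\<^sub>m 1)"
  have hc: "?h g \<in> carrier_mat (Suc m) (Suc m)" if "g \<in> carrier_mat m m" for g
    using four_block_carrier_mat[OF that, of "1\<^sub>m 1" 1 1] by simp
  have hm: "?h g * ?h k = ?h (g * k)" if "g \<in> carrier_mat m m" "k \<in> carrier_mat m m" for g k
    by (subst mult_four_block_last[where m = m]) (use that in simp_all)
  have h1: "?h (1\<^sub>m m) = 1\<^sub>m (Suc m)" by (rule eq_matI) auto
  have hinj: "g = k" if "g \<in> carrier_mat m m" "k \<in> carrier_mat m m" "?h g = ?h k" for g k
  proof (rule eq_matI)
    fix i j assume "i < dim_row k" "j < dim_col k"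
    then have ij: "i < dim_row g" "j < dim_col g" "i < dim_row k" "j < dim_col k" using that(1,2) by auto
    have "?h x $$ (i, j) = x $$ (i, j)" if "i < dim_row x" "j < dim_col x" for x using that by simp
    from this[OF ij(1,2)] this[OF ij(3,4)] show "g $$ (i, j) = k $$ (i, j)" unfolding that(3) by (rule trans[OF sym])
  qed (use that(1,2) in auto)
  have GLc: "g \<in> carrier_mat m m" if "g \<in> GL m" for g :: "'f mat"
    using that by (auto simp: Units_def ring_mat_simps)
  have unit: "?h g \<in> GL (Suc m)" if "g \<in> GL m" for g
  proof -
    note inv = M.Units_inv_Units[OF that] M.Units_l_inv[OF that] M.Units_r_inv[OF that]
    let ?k = "inv\<^bsub>?M\<^esub> g"
    have k: "?k \<in> carrier_mat m m" by (rule GLc[OF inv(1)])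
    have "?h g \<in> carrier ?N" "?h ?k \<in> carrier ?N"
      unfolding ring_mat_simps by (rule hc[OF GLc[OF that]], rule hc[OF k])
    moreover have "?h ?k \<otimes>\<^bsub>?N\<^esub> ?h g = \<one>\<^bsub>?N\<^esub>"
      using inv(2) hm[OF k GLc[OF that]] h1 unfolding ring_mat_simps by presburger
    moreover have "?h g \<otimes>\<^bsub>?N\<^esub> ?h ?k = \<one>\<^bsub>?N\<^esub>"
      using inv(3) hm[OF GLc[OF that] k] h1 unfolding ring_mat_simps by presburger
    ultimately show ?thesis unfolding Units_def by (intro CollectI conjI bexI[of _ "?h ?k"])
  qed
  have "subgroup (?h ` GL m) (units_of ?N)"
  proof (rule G.subgroupI)
    show "?h ` GL m \<subseteq> carrier (units_of ?N)" using unit by (auto simp: units_of_carrier)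
    show "?h ` GL m \<noteq> {}" using M.Units_one_closed by blast
    show "x \<otimes>\<^bsub>units_of ?N\<^esub> y \<in> ?h ` GL m" if xy: "x \<in> ?h ` GL m" "y \<in> ?h ` GL m" for x y
    proof -
      obtain g k where gk: "g \<in> GL m" "k \<in> GL m" "x = ?h g" "y = ?h k" using xy by blast
      have "x \<otimes>\<^bsub>units_of ?N\<^esub> y = ?h (g * k)"
        unfolding gk units_of_mult ring_mat_simps by (rule hm[OF GLc GLc]) (rule gk)+
      moreover have "g * k \<in> GL m" using M.Units_m_closed[OF gk(1,2)] by (simp add: ring_mat_simps)
      ultimately show ?thesis by blast
    qed
    show "inv\<^bsub>units_of ?N\<^esub> x \<in> ?h ` GL m" if x: "x \<in> ?h ` GL m" for x
    proof -
      obtain g where g: "g \<in> GL m" "x = ?h g" using x by blast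
      let ?k = "inv\<^bsub>?M\<^esub> g"
      have k: "?k \<in> GL m" "?k * g = 1\<^sub>m m"
        using M.Units_inv_Units[OF g(1)] M.Units_l_inv[OF g(1)] by (simp_all add: ring_mat_simps)
      have "?h ?k \<otimes>\<^bsub>units_of ?N\<^esub> x = \<one>\<^bsub>units_of ?N\<^esub>"
        unfolding g(2) units_of_mult units_of_one ring_mat_simps hm[OF GLc[OF k(1)] GLc[OF g(1)]] k(2) h1 ..
      then have "inv\<^bsub>units_of ?N\<^esub> x = ?h ?k"
        by (rule G.inv_equality) (use unit g k in \<open>auto simp: units_of_carrier\<close>)
      then show ?thesis using k by blast
    qed
  qed
  from G.lagrange[OF this] have "card (?h ` GL m) dvd card (GL (Suc m) :: 'f mat set)"
    unfolding Coset.order_def units_of_carrier by (intro dvdI[where k = "card (rcosets\<^bsub>units_of ?N\<^esub> (?h ` GL m))"]) (simp add: mult.commute)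
  moreover have "card (?h ` GL m) = card (GL m :: 'f mat set)"
    by (rule card_image[OF inj_onI]) (rule hinj[OF GLc GLc])
  ultimately show ?thesis by simp
qed

section \<open>Splitting by induction on the dimension\<close>

text \<open>The map \<rho>1 takes care of \<epsilon> M. On \<tau> M the singular matrices act as
  zero, so averaging over the invertible matrices gives a second map \<rho>2. On N the sum of the
  two acts as \<epsilon> + \<tau> = 1.\<close>

lemma singular_splitting_extends:
  fixes M :: "('f::{field,finite} mat \<Rightarrow> 'k::field, 'a) module"
  assumes G: "of_nat (card (GL n :: 'f mat set)) \<noteq> (0 :: 'k)"
    and M: "left_module (monoid_algebra (matrix_monoid n)) M" and N: "submodule_of (monoid_algebra (matrix_monoid n)) M N"
    and \<epsilon>: "\<epsilon> \<in> singular_support n" and \<tau>: "\<tau> \<in> carrier (monoid_algebra (matrix_monoid n))"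
    and sum: "\<epsilon> \<oplus>\<^bsub>monoid_algebra (matrix_monoid n)\<^esub> \<tau> = \<one>\<^bsub>monoid_algebra (matrix_monoid n)\<^esub>"
    and ann: "\<And>u. u \<in> singular_support n \<Longrightarrow> \<tau> \<otimes>\<^bsub>monoid_algebra (matrix_monoid n)\<^esub> u = \<zero>\<^bsub>monoid_algebra (matrix_monoid n)\<^esub>"
      "\<And>u. u \<in> singular_support n \<Longrightarrow> u \<otimes>\<^bsub>monoid_algebra (matrix_monoid n)\<^esub> \<tau> = \<zero>\<^bsub>monoid_algebra (matrix_monoid n)\<^esub>"
    and \<rho>1: "\<rho>1 \<in> mhom (monoid_algebra (matrix_monoid n)) M M" "\<And>x. x \<in> carrier M \<Longrightarrow> \<rho>1 x \<in> N"
      "\<And>x. x \<in> N \<Longrightarrow> \<rho>1 x = \<epsilon> \<odot>\<^bsub>M\<^esub> x"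
  shows "\<exists>\<rho>\<in>mhom (monoid_algebra (matrix_monoid n)) M M. (\<forall>x\<in>carrier M. \<rho> x \<in> N) \<and> (\<forall>x\<in>N. \<rho> x = x)"
proof -
  let ?M = "matrix_monoid n :: 'f mat ring"
  let ?A = "monoid_algebra ?M :: ('f mat \<Rightarrow> 'k) ring"
  interpret M: left_module ?A M by fact
  interpret U: monoid ?M by (rule matrix_monoid)
  have \<iota>: "central_embedding ?A (scalar_embedding ?M)" by (rule central_embedding_scalar_embedding[OF matrix_monoid])
  have \<iota>C: "scalar_embedding ?M c \<in> carrier ?A" for c using \<iota> unfolding central_embedding_def by blast
  have \<epsilon>c: "\<epsilon> \<in> carrier ?A" using \<epsilon> by (simp add: singular_support_def)
  have GLc: "g \<in> carrier ?M" if "g \<in> GL n" for g by (rule U.Units_closed[OF that])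
  define s where "s g = (msingle g 1 :: 'f mat \<Rightarrow> 'k)" for g
  have sc: "s g \<in> carrier ?A" if "g \<in> carrier ?M" for g unfolding s_def by (rule msingle_carrier[OF that])
  have sm: "s g \<otimes>\<^bsub>?A\<^esub> s h = s (g \<otimes>\<^bsub>?M\<^esub> h)" for g h by (simp add: s_def msingle_mult)
  have s1: "s \<one>\<^bsub>?M\<^esub> = \<one>\<^bsub>?A\<^esub>" by (simp add: s_def monoid_algebra_ops)
  have s_inj: "g = h" if "s g = s h" for g h
    using fun_cong[OF that, of g] by (simp add: s_def msingle_def split: if_splits)
  have inj: "inj_on s (GL n)" by (rule inj_onI) (rule s_inj)
  \<comment> \<open>The averaging takes a group of units inside the algebra, so inversion is
    transported along the injection s.\<close>
  define i where "i u = s (inv\<^bsub>?M\<^esub> (the_inv_into (GL n) s u))" for u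
  have i_s: "i (s g) = s (inv\<^bsub>?M\<^esub> g)" if "g \<in> GL n" for g by (simp add: i_def the_inv_into_f_f[OF inj that])
  have fin: "finite (GL n :: 'f mat set)"
    by (rule finite_subset[OF _ finite_carrier_mat[of n n]]) (use GLc in \<open>auto simp: ring_mat_simps\<close>)
  have \<tau>\<tau>: "\<tau> \<otimes>\<^bsub>?A\<^esub> \<tau> = \<tau>"
  proof -
    have "\<tau> = \<tau> \<otimes>\<^bsub>?A\<^esub> (\<epsilon> \<oplus>\<^bsub>?A\<^esub> \<tau>)" unfolding sum using \<tau> by simp
    also have "\<dots> = \<tau> \<otimes>\<^bsub>?A\<^esub> \<tau>" unfolding M.R.r_distr[OF \<epsilon>c \<tau> \<tau>] ann(1)[OF \<epsilon>] using \<tau> by simp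
    finally show ?thesis by (rule sym)
  qed
  \<comment> \<open>Centrality of \<tau>: both \<epsilon> a and a \<epsilon> are in the ideal and
    are annihilated by \<tau>, so a \<tau> = \<tau> a \<tau> = \<tau> a.\<close>
  have comm: "a \<otimes>\<^bsub>?A\<^esub> \<tau> = \<tau> \<otimes>\<^bsub>?A\<^esub> a" if a: "a \<in> carrier ?A" for a
  proof -
    have 1: "(a \<otimes>\<^bsub>?A\<^esub> \<epsilon>) \<otimes>\<^bsub>?A\<^esub> \<tau> = \<zero>\<^bsub>?A\<^esub>" "(\<epsilon> \<otimes>\<^bsub>?A\<^esub> a) \<otimes>\<^bsub>?A\<^esub> \<tau> = \<zero>\<^bsub>?A\<^esub>" "\<tau> \<otimes>\<^bsub>?A\<^esub> (a \<otimes>\<^bsub>?A\<^esub> \<epsilon>) = \<zero>\<^bsub>?A\<^esub>"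
      by (rule ann singular_support_mult[OF \<epsilon> a])+
    note cl = a \<tau> \<epsilon>c M.R.m_closed
    have "a \<otimes>\<^bsub>?A\<^esub> \<tau> = (\<epsilon> \<oplus>\<^bsub>?A\<^esub> \<tau>) \<otimes>\<^bsub>?A\<^esub> (a \<otimes>\<^bsub>?A\<^esub> \<tau>)" unfolding sum using cl by simp
    also have "\<dots> = \<epsilon> \<otimes>\<^bsub>?A\<^esub> (a \<otimes>\<^bsub>?A\<^esub> \<tau>) \<oplus>\<^bsub>?A\<^esub> \<tau> \<otimes>\<^bsub>?A\<^esub> (a \<otimes>\<^bsub>?A\<^esub> \<tau>)" by (rule M.R.l_distr) (use cl in simp_all)
    also have "\<epsilon> \<otimes>\<^bsub>?A\<^esub> (a \<otimes>\<^bsub>?A\<^esub> \<tau>) = \<zero>\<^bsub>?A\<^esub>" unfolding M.R.m_assoc[OF \<epsilon>c a \<tau>, symmetric] by (rule 1)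
    also have "\<zero>\<^bsub>?A\<^esub> \<oplus>\<^bsub>?A\<^esub> \<tau> \<otimes>\<^bsub>?A\<^esub> (a \<otimes>\<^bsub>?A\<^esub> \<tau>) = \<tau> \<otimes>\<^bsub>?A\<^esub> (a \<otimes>\<^bsub>?A\<^esub> \<epsilon>) \<oplus>\<^bsub>?A\<^esub> \<tau> \<otimes>\<^bsub>?A\<^esub> (a \<otimes>\<^bsub>?A\<^esub> \<tau>)" unfolding 1(3) ..
    also have "\<dots> = \<tau> \<otimes>\<^bsub>?A\<^esub> (a \<otimes>\<^bsub>?A\<^esub> \<epsilon> \<oplus>\<^bsub>?A\<^esub> a \<otimes>\<^bsub>?A\<^esub> \<tau>)" by (rule M.R.r_distr[symmetric]) (use cl in simp_all)
    also have "a \<otimes>\<^bsub>?A\<^esub> \<epsilon> \<oplus>\<^bsub>?A\<^esub> a \<otimes>\<^bsub>?A\<^esub> \<tau> = a \<otimes>\<^bsub>?A\<^esub> (\<epsilon> \<oplus>\<^bsub>?A\<^esub> \<tau>)" by (rule M.R.r_distr[symmetric]) (use cl in simp_all)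
    also have "\<dots> = a" unfolding sum using cl by simp
    finally show ?thesis .
  qed
  have g1: "finite (s ` GL n)" using fin by (rule finite_imageI)
  have g2: "s ` GL n \<subseteq> carrier ?A" using sc[OF GLc] by (rule image_subsetI)
  have g3: "g \<otimes>\<^bsub>?A\<^esub> h \<in> s ` GL n" if g: "g \<in> s ` GL n" and h: "h \<in> s ` GL n" for g h
    proof -
      obtain x where x: "g = s x" "x \<in> GL n" using g by (rule imageE)
      obtain y where y: "h = s y" "y \<in> GL n" using h by (rule imageE)
      show ?thesis unfolding x(1) y(1) sm by (rule imageI) (rule U.Units_m_closed[OF x(2) y(2)])
    qed
  have g4: "of_nat (card (s ` GL n)) \<noteq> (0 :: 'k)" unfolding card_image[OF inj] by (rule G)
  have g5: "i g \<in> s ` GL n" "i g \<otimes>\<^bsub>?A\<^esub> g = \<one>\<^bsub>?A\<^esub>" "g \<otimes>\<^bsub>?A\<^esub> i g = \<one>\<^bsub>?A\<^esub>" "g \<otimes>\<^bsub>?A\<^esub> \<tau> = \<tau> \<otimes>\<^bsub>?A\<^esub> g"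
      if g: "g \<in> s ` GL n" for g
    proof -
      obtain x where x: "g = s x" "x \<in> GL n" using g by (rule imageE)
      show "i g \<in> s ` GL n" unfolding x(1) i_s[OF x(2)] by (rule imageI) (rule U.Units_inv_Units[OF x(2)])
      show "i g \<otimes>\<^bsub>?A\<^esub> g = \<one>\<^bsub>?A\<^esub>" unfolding x(1) i_s[OF x(2)] sm U.Units_l_inv[OF x(2)] by (rule s1)
      show "g \<otimes>\<^bsub>?A\<^esub> i g = \<one>\<^bsub>?A\<^esub>" unfolding x(1) i_s[OF x(2)] sm U.Units_r_inv[OF x(2)] by (rule s1)
      show "g \<otimes>\<^bsub>?A\<^esub> \<tau> = \<tau> \<otimes>\<^bsub>?A\<^esub> g" unfolding x(1) by (rule comm[OF sc[OF GLc[OF x(2)]]])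
    qed
  obtain \<rho>2 where \<rho>2: "\<And>x. x \<in> carrier M \<Longrightarrow> \<rho>2 x \<in> N" "\<And>x. x \<in> N \<Longrightarrow> \<rho>2 x = \<tau> \<odot>\<^bsub>M\<^esub> x"
    "\<And>x y. x \<in> carrier M \<Longrightarrow> y \<in> carrier M \<Longrightarrow> \<rho>2 (x \<oplus>\<^bsub>M\<^esub> y) = \<rho>2 x \<oplus>\<^bsub>M\<^esub> \<rho>2 y"
    "\<And>c x. x \<in> carrier M \<Longrightarrow> \<rho>2 (scalar_embedding ?M c \<odot>\<^bsub>M\<^esub> x) = scalar_embedding ?M c \<odot>\<^bsub>M\<^esub> \<rho>2 x"
    "\<And>g x. g \<in> s ` GL n \<Longrightarrow> x \<in> carrier M \<Longrightarrow> \<rho>2 (g \<odot>\<^bsub>M\<^esub> x) = g \<odot>\<^bsub>M\<^esub> \<rho>2 x"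
    "\<And>a x. a \<in> carrier ?A \<Longrightarrow> a \<otimes>\<^bsub>?A\<^esub> \<tau> = \<zero>\<^bsub>?A\<^esub> \<Longrightarrow> \<tau> \<otimes>\<^bsub>?A\<^esub> a = \<zero>\<^bsub>?A\<^esub> \<Longrightarrow> x \<in> carrier M \<Longrightarrow> \<rho>2 (a \<odot>\<^bsub>M\<^esub> x) = a \<odot>\<^bsub>M\<^esub> \<rho>2 x"
    apply (rule maschke_projection[where i = i and G = "s ` GL n", OF \<iota> M N _ _ _ _ _ _ _ \<tau> \<tau>\<tau>])
    subgoal by (rule g1)
    subgoal by (rule g2)
    subgoal by (rule g3)
    subgoal by (rule g5(1))
    subgoal by (rule g5(2))
    subgoal by (rule g5(3))
    subgoal by (rule g4)
    subgoal by (rule g5(4))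
    subgoal premises p for \<rho> by (rule p(1)[of \<rho>, OF p(2-7)])
    done
  note ND = N[unfolded submodule_of_def]
  have Nc: "x \<in> carrier M" if "x \<in> N" for x using ND that by blast
  have \<rho>2c: "\<rho>2 x \<in> carrier M" if "x \<in> carrier M" for x by (rule Nc[OF \<rho>2(1)[OF that]])
  have "\<rho>2 \<in> mhom ?A M M"
  proof (rule mhomI)
    fix a x assume a: "a \<in> carrier ?A" and x: "x \<in> carrier M"
    note rx = \<rho>2c[OF x]
    \<comment> \<open>The algebra is spanned by singular matrices, for which both sides are zero,
      and by scalar multiples of invertible ones, with which \<rho>2 commutes by the
      averaging.\<close>
    from a show "\<rho>2 (a \<odot>\<^bsub>M\<^esub> x) = a \<odot>\<^bsub>M\<^esub> \<rho>2 x"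
    proof (induction a rule: monoid_algebra_induct)
      case zero
      have z: "\<zero>\<^bsub>?A\<^esub> \<in> singular_support n" by (simp add: singular_support_def) (simp add: monoid_algebra_ops(2))
      show ?case by (rule \<rho>2(6)[OF M.R.zero_closed ann(2)[OF z] ann(1)[OF z] x])
    next
      case (add a b)
      show ?case
        unfolding M.smult_l_distr[OF add(1,2) x] M.smult_l_distr[OF add(1,2) rx]
          \<rho>2(3)[OF M.smult_closed[OF add(1) x] M.smult_closed[OF add(2) x]] add(3,4) ..
    next
      case (single y c)
      then have y: "y \<in> carrier_mat n n" by (simp add: ring_mat_simps)
      show ?case
      proof (cases "det y = 0")
        case True
        note z = msingle_singular_support[OF y True, of c]
        show ?thesis by (rule \<rho>2(6)[OF _ ann(2)[OF z] ann(1)[OF z] x]) (use z in \<open>simp add: singular_support_def\<close>)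
      next
        case False
        have g: "y \<in> GL n" by (rule det_non_zero_imp_unit[OF y False])
        have yC: "s y \<in> carrier ?A" by (rule sc[OF GLc[OF g]])
        have e: "msingle y c = scalar_embedding ?M c \<otimes>\<^bsub>?A\<^esub> s y"
          unfolding monoid_algebra_ops(4) s_def msingle_mult using y by (simp add: ring_mat_simps)
        have "\<rho>2 (s y \<odot>\<^bsub>M\<^esub> x) = s y \<odot>\<^bsub>M\<^esub> \<rho>2 x" by (rule \<rho>2(5)[OF imageI[OF g] x])
        then show ?thesis
          unfolding e M.smult_assoc[OF \<iota>C yC x] M.smult_assoc[OF \<iota>C yC rx] \<rho>2(4)[OF M.smult_closed[OF yC x]] by (rule arg_cong)
      qed
    qed
  qed (rule \<rho>2c \<rho>2(3); assumption)+
  then have "(\<lambda>x. \<rho>1 x \<oplus>\<^bsub>M\<^esub> \<rho>2 x) \<in> mhom ?A M M" by (rule M.mhom_add[OF \<rho>1(1)])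
  moreover have "\<rho>1 x \<oplus>\<^bsub>M\<^esub> \<rho>2 x \<in> N" if "x \<in> carrier M" for x using ND \<rho>1(2)[OF that] \<rho>2(1)[OF that] by blast
  moreover have "\<rho>1 x \<oplus>\<^bsub>M\<^esub> \<rho>2 x = x" if "x \<in> N" for x
    unfolding \<rho>1(3)[OF that] \<rho>2(2)[OF that] M.smult_l_distr[OF \<epsilon>c \<tau> Nc[OF that], symmetric] sum
    by (rule M.smult_one[OF Nc[OF that]])
  ultimately show ?thesis by (intro bexI[of _ "\<lambda>x. \<rho>1 x \<oplus>\<^bsub>M\<^esub> \<rho>2 x"] conjI ballI)
qed

lemma finsum_msingle:
  fixes a :: "'m \<Rightarrow> 'k::field"
  assumes M: "Group.monoid M" and S: "finite S" "S \<subseteq> carrier M"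
  shows "(\<Oplus>\<^bsub>monoid_algebra M\<^esub>x\<in>S. msingle x (a x)) = (\<lambda>x. if x \<in> S then a x else 0)"
  using S
proof (induction S rule: finite_induct)
  interpret A: ring "monoid_algebra M :: ('m \<Rightarrow> 'k) ring" by (rule monoid_algebra_ring[OF M])
  {
    case empty
    show ?case unfolding A.finsum_empty by (simp add: monoid_algebra_ops(2))
  next
    case (insert x S)
    have c: "(\<lambda>x. msingle x (a x)) \<in> S \<rightarrow> carrier (monoid_algebra M)" "msingle x (a x) \<in> carrier (monoid_algebra M)"
      using insert.prems by auto
    have IH: "(\<Oplus>\<^bsub>monoid_algebra M\<^esub>x\<in>S. msingle x (a x)) = (\<lambda>x. if x \<in> S then a x else 0)"
      by (rule insert.IH) (use insert.prems in simp)
    show ?case unfolding A.finsum_insert[OF insert.hyps c] IH monoid_algebra_ops(1)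
      using insert.hyps(2) by (auto simp: msingle_def)
  }
qed

text \<open>The Morita data come from factoring each matrix in the support of \<epsilon> through f.
  The module varies in the induction, because the induction hypothesis is applied to f M over the
  smaller matrix algebra.\<close>

lemma matrix_algebra_split:
  fixes M :: "('f::{field,finite} mat \<Rightarrow> 'k::field, 'a) module"
  assumes q: "of_nat CARD('f) \<noteq> (0 :: 'k)" and G: "of_nat (card (GL n :: 'f mat set)) \<noteq> (0 :: 'k)"
    and M: "left_module (monoid_algebra (matrix_monoid n)) M" and N: "submodule_of (monoid_algebra (matrix_monoid n)) M N"
  shows "\<exists>\<rho>\<in>mhom (monoid_algebra (matrix_monoid n)) M M. (\<forall>x\<in>carrier M. \<rho> x \<in> N) \<and> (\<forall>x\<in>N. \<rho> x = x)"
  using G M N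
proof (induction n arbitrary: M N)
  case 0
  let ?A = "monoid_algebra (matrix_monoid 0) :: ('f mat \<Rightarrow> 'k) ring"
  interpret M: left_module ?A M by (rule 0(2))
  obtain \<epsilon> \<tau> where k: "\<epsilon> \<in> singular_support 0" "\<tau> \<in> carrier ?A" "\<epsilon> \<oplus>\<^bsub>?A\<^esub> \<tau> = \<one>\<^bsub>?A\<^esub>"
    "\<And>u. u \<in> singular_support 0 \<Longrightarrow> \<tau> \<otimes>\<^bsub>?A\<^esub> u = \<zero>\<^bsub>?A\<^esub>"
    "\<And>u. u \<in> singular_support 0 \<Longrightarrow> u \<otimes>\<^bsub>?A\<^esub> \<tau> = \<zero>\<^bsub>?A\<^esub>"
    apply (rule kovacs_idempotent[OF q, where n = 0])
    subgoal premises p for \<epsilon> \<tau> by (rule p(1)[of \<epsilon> \<tau>, OF p(2-6)])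
    done
  \<comment> \<open>The determinant of the empty matrix is 1, so no matrix is singular; \<epsilon>
    is zero and the zero map serves as \<rho>1.\<close>
  have "\<epsilon> x = 0" for x
  proof (rule ccontr)
    assume "\<epsilon> x \<noteq> 0"
    then have "det x = 0" "x \<in> carrier_mat 0 0"
      using k(1) by (auto simp: singular_support_def monoid_algebra_carrier ring_mat_simps)
    then show False by simp
  qed
  then have \<epsilon>: "\<epsilon> = \<zero>\<^bsub>?A\<^esub>" by (auto simp: monoid_algebra_ops(2))
  have N0: "\<zero>\<^bsub>M\<^esub> \<in> N" "N \<subseteq> carrier M" using 0(3) by (simp_all add: submodule_of_def)
  have \<epsilon>0: "\<zero>\<^bsub>M\<^esub> = \<epsilon> \<odot>\<^bsub>M\<^esub> x" if "x \<in> N" for x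
    unfolding \<epsilon> using M.smult_l_null[of x] N0(2) that by auto
  show ?case
  proof (rule singular_splitting_extends[OF 0(1-3) k(1-3) _ _ mhom_zero[OF 0(2)]])
  qed (rule k(4,5) N0(1) \<epsilon>0; assumption?)+
next
  case (Suc m)
  let ?M = "matrix_monoid (Suc m) :: 'f mat ring" and ?M' = "matrix_monoid m :: 'f mat ring"
  let ?A = "monoid_algebra ?M :: ('f mat \<Rightarrow> 'k) ring" and ?B = "monoid_algebra ?M' :: ('f mat \<Rightarrow> 'k) ring"
  interpret M: left_module ?A M by (rule Suc.prems(2))
  interpret B: ring ?B by (rule monoid_algebra_ring[OF matrix_monoid])
  have Gm: "of_nat (card (GL m :: 'f mat set)) \<noteq> (0 :: 'k)"
    using card_GL_dvd[of m, where 'f = 'f] Suc.prems(1) by (auto elim!: dvdE)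
  obtain \<epsilon> \<tau> where k: "\<epsilon> \<in> singular_support (Suc m)" "\<tau> \<in> carrier ?A" "\<epsilon> \<oplus>\<^bsub>?A\<^esub> \<tau> = \<one>\<^bsub>?A\<^esub>"
    "\<And>u. u \<in> singular_support (Suc m) \<Longrightarrow> \<tau> \<otimes>\<^bsub>?A\<^esub> u = \<zero>\<^bsub>?A\<^esub>"
    "\<And>u. u \<in> singular_support (Suc m) \<Longrightarrow> u \<otimes>\<^bsub>?A\<^esub> \<tau> = \<zero>\<^bsub>?A\<^esub>"
    apply (rule kovacs_idempotent[OF q, where n = "Suc m"])
    subgoal premises p for \<epsilon> \<tau> by (rule p(1)[of \<epsilon> \<tau>, OF p(2-6)])
    done
  have \<epsilon>c: "\<epsilon> \<in> carrier ?A" using k(1) by (simp add: singular_support_def)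
  \<comment> \<open>As \<tau> annihilates the ideal and \<epsilon> + \<tau> = 1, the element
    \<epsilon> is an identity of the ideal.\<close>
  have \<epsilon>l: "\<epsilon> \<otimes>\<^bsub>?A\<^esub> u = u" if u: "u \<in> singular_support (Suc m)" for u
  proof -
    have uc: "u \<in> carrier ?A" using u by (simp add: singular_support_def)
    have "u = (\<epsilon> \<oplus>\<^bsub>?A\<^esub> \<tau>) \<otimes>\<^bsub>?A\<^esub> u" unfolding k(3) using uc by simp
    also have "\<dots> = \<epsilon> \<otimes>\<^bsub>?A\<^esub> u" unfolding M.R.l_distr[OF \<epsilon>c k(2) uc] k(4)[OF u] using \<epsilon>c uc by simp
    finally show ?thesis by (rule sym)
  qed
  have \<epsilon>r: "u \<otimes>\<^bsub>?A\<^esub> \<epsilon> = u" if u: "u \<in> singular_support (Suc m)" for u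
  proof -
    have uc: "u \<in> carrier ?A" using u by (simp add: singular_support_def)
    have "u = u \<otimes>\<^bsub>?A\<^esub> (\<epsilon> \<oplus>\<^bsub>?A\<^esub> \<tau>)" unfolding k(3) using uc by simp
    also have "\<dots> = u \<otimes>\<^bsub>?A\<^esub> \<epsilon>" unfolding M.R.r_distr[OF \<epsilon>c k(2) uc] k(5)[OF u] using \<epsilon>c uc by simp
    finally show ?thesis by (rule sym)
  qed
  let ?f = "corner_mat m (1\<^sub>m m) :: 'f mat"
  have f: "?f \<in> carrier_mat (Suc m) (Suc m)" by (rule corner_mat_carrier) simp
  define S where "S = {a. \<epsilon> a \<noteq> 0}"
  have S: "finite S" "S \<subseteq> carrier ?M" using \<epsilon>c by (simp_all add: S_def monoid_algebra_carrier)
  have "\<exists>l r. l \<in> carrier_mat (Suc m) (Suc m) \<and> r \<in> carrier_mat (Suc m) (Suc m) \<and> l * r = a \<and> ?f * r = r" if "a \<in> S" for a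
  proof -
    have "a \<in> carrier_mat (Suc m) (Suc m)" "det a = 0"
      using that S(2) k(1) by (auto simp: S_def ring_mat_simps singular_support_def)
    then show ?thesis by (rule singular_factorization) blast
  qed
  then obtain l r where lr: "\<And>a. a \<in> S \<Longrightarrow> l a \<in> carrier_mat (Suc m) (Suc m)"
    "\<And>a. a \<in> S \<Longrightarrow> r a \<in> carrier_mat (Suc m) (Suc m)" "\<And>a. a \<in> S \<Longrightarrow> l a * r a = a" "\<And>a. a \<in> S \<Longrightarrow> ?f * r a = r a"
    by metis
  \<comment> \<open>The coefficient of a in \<epsilon> is placed in the left factor. Since l f r = l
    r = a, the products X a Y a add up to \<epsilon>.\<close>
  define X where "X a = msingle (l a * ?f) (\<epsilon> a)" for a
  define Y where "Y a = (msingle (r a) 1 :: 'f mat \<Rightarrow> 'k)" for a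
  have lf: "l a * ?f \<in> carrier_mat (Suc m) (Suc m)" "det (l a * ?f) = 0" if "a \<in> S" for a
    using lr(1)[OF that] f det_mult[OF lr(1)[OF that] f] by (simp_all add: det_corner_mat)
  have rd: "det (r a) = 0" if "a \<in> S" for a
    using det_mult[OF f lr(2)[OF that]] unfolding lr(4)[OF that] by (simp add: det_corner_mat)
  have Xs: "X a \<in> singular_support (Suc m)" if "a \<in> S" for a
    unfolding X_def by (rule msingle_singular_support[OF lf[OF that]])
  have Ys: "Y a \<in> singular_support (Suc m)" if "a \<in> S" for a
    unfolding Y_def by (rule msingle_singular_support[OF lr(2)[OF that] rd[OF that]])
  have XYc: "X a \<in> carrier ?A" "Y a \<in> carrier ?A" if "a \<in> S" for a
    using Xs[OF that] Ys[OF that] by (simp_all add: singular_support_def)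
  have XY: "X a \<otimes>\<^bsub>?A\<^esub> Y a = msingle a (\<epsilon> a)" if "a \<in> S" for a
    unfolding X_def Y_def msingle_mult ring_mat_simps assoc_mult_mat[OF lr(1)[OF that] f lr(2)[OF that]] lr(3,4)[OF that] by simp
  have "(\<Oplus>\<^bsub>?A\<^esub>a\<in>S. X a \<otimes>\<^bsub>?A\<^esub> Y a) = (\<Oplus>\<^bsub>?A\<^esub>a\<in>S. msingle a (\<epsilon> a))"
    by (rule M.R.finsum_cong') (use XY S(2) in auto)
  also have "\<dots> = \<epsilon>" unfolding finsum_msingle[OF matrix_monoid S] by (auto simp: S_def)
  finally have \<epsilon>_sum: "(\<Oplus>\<^bsub>?A\<^esub>a\<in>S. X a \<otimes>\<^bsub>?A\<^esub> Y a) = \<epsilon>" .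
  let ?J = "monoid_algebra_map (corner_mat m) :: ('f mat \<Rightarrow> 'k) \<Rightarrow> _"
  have hom: "corner_mat m \<in> hom ?M' ?M"
    by (rule homI) (simp_all add: ring_mat_simps corner_mat_carrier corner_mat_mult)
  have Jc: "?J b \<in> carrier ?A" if "b \<in> carrier ?B" for b
    by (rule monoid_algebra_map_carrier[OF _ that matrix_monoid]) (use hom in \<open>simp add: hom_def\<close>)
  have J1: "?J \<one>\<^bsub>?B\<^esub> = msingle ?f 1" by (simp add: monoid_algebra_ops(3) monoid_algebra_map_single ring_mat_simps)
  \<comment> \<open>Y a starts with f and X b ends with f, so everything between them lands in f A
    f, the image of the smaller algebra.\<close>
  have YaX: "Y a \<otimes>\<^bsub>?A\<^esub> u \<otimes>\<^bsub>?A\<^esub> X b \<in> ?J ` carrier ?B" if ab: "a \<in> S" "b \<in> S" and u: "u \<in> carrier ?A" for a b u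
    using u
  proof (induction u rule: monoid_algebra_induct)
    case zero
    have "Y a \<otimes>\<^bsub>?A\<^esub> \<zero>\<^bsub>?A\<^esub> \<otimes>\<^bsub>?A\<^esub> X b = ?J \<zero>\<^bsub>?B\<^esub>"
      unfolding monoid_algebra_map_zero[where M = ?M' and N = ?M] using XYc ab by simp
    moreover have "\<zero>\<^bsub>?B\<^esub> \<in> carrier ?B" by simp
    ultimately show ?case by (metis imageI)
  next
    case (add u v)
    obtain x y where xy: "x \<in> carrier ?B" "y \<in> carrier ?B" "Y a \<otimes>\<^bsub>?A\<^esub> u \<otimes>\<^bsub>?A\<^esub> X b = ?J x" "Y a \<otimes>\<^bsub>?A\<^esub> v \<otimes>\<^bsub>?A\<^esub> X b = ?J y"
      using add(3,4) by blast
    have "Y a \<otimes>\<^bsub>?A\<^esub> (u \<oplus>\<^bsub>?A\<^esub> v) \<otimes>\<^bsub>?A\<^esub> X b = ?J (x \<oplus>\<^bsub>?B\<^esub> y)"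
      unfolding monoid_algebra_map_add[OF xy(1,2), where N = ?M] xy(3,4)[symmetric]
      using XYc(2)[OF ab(1)] XYc(1)[OF ab(2)] add(1,2) by (simp add: M.R.l_distr M.R.r_distr)
    then show ?case using B.a_closed[OF xy(1,2)] by (metis imageI)
  next
    case (single x c)
    have x: "x \<in> carrier_mat (Suc m) (Suc m)" using single by (simp add: ring_mat_simps)
    note ra = lr(2)[OF ab(1)] and lb = lr(1)[OF ab(2)]
    have rxl: "r a * (x * l b) \<in> carrier_mat (Suc m) (Suc m)" using ra x lb by simp
    obtain y where y: "y \<in> carrier_mat m m" "?f * (r a * (x * l b)) * ?f = corner_mat m y"
      by (rule corner_mat_sandwich[OF rxl])
    have "?f * (r a * (x * l b)) = r a * (x * l b)"
      using assoc_mult_mat[OF f ra mult_carrier_mat[OF x lb]] lr(4)[OF ab(1)] by simp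
    then have "r a * x * (l b * ?f) = corner_mat m y"
      using y(2) assoc_mult_mat[OF ra x mult_carrier_mat[OF lb f]] assoc_mult_mat[OF x lb f]
        assoc_mult_mat[OF ra mult_carrier_mat[OF x lb] f] by simp
    then have "Y a \<otimes>\<^bsub>?A\<^esub> msingle x c \<otimes>\<^bsub>?A\<^esub> X b = ?J (msingle y (c * \<epsilon> b))"
      unfolding X_def Y_def msingle_mult monoid_algebra_map_single ring_mat_simps by simp
    moreover have "msingle y (c * \<epsilon> b) \<in> carrier ?B" using y(1) by (simp add: ring_mat_simps)
    ultimately show ?case by (metis imageI)
  qed
  have h1: "?J (b \<oplus>\<^bsub>?B\<^esub> c) = ?J b \<oplus>\<^bsub>?A\<^esub> ?J c" if "b \<in> carrier ?B" "c \<in> carrier ?B" for b c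
      by (rule monoid_algebra_map_add[OF that])
  have h2: "?J (b \<otimes>\<^bsub>?B\<^esub> c) = ?J b \<otimes>\<^bsub>?A\<^esub> ?J c" if "b \<in> carrier ?B" "c \<in> carrier ?B" for b c
      by (rule monoid_algebra_map_mult[OF matrix_monoid matrix_monoid hom that])
  have h3: "?J \<one>\<^bsub>?B\<^esub> \<otimes>\<^bsub>?A\<^esub> Y a = Y a" if "a \<in> S" for a
      unfolding J1 Y_def msingle_mult ring_mat_simps lr(4)[OF that] by simp
  have h4: "Y a \<otimes>\<^bsub>?A\<^esub> u \<otimes>\<^bsub>?A\<^esub> (\<Oplus>\<^bsub>?A\<^esub>a\<in>S. X a \<otimes>\<^bsub>?A\<^esub> Y a) = Y a \<otimes>\<^bsub>?A\<^esub> u" if "a \<in> S" "u \<in> carrier ?A" for a u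
      unfolding \<epsilon>_sum by (rule \<epsilon>r[OF singular_support_mult(1)[OF Ys[OF that(1)] that(2)]])
  have h5: "(\<Oplus>\<^bsub>?A\<^esub>a\<in>S. X a \<otimes>\<^bsub>?A\<^esub> Y a) \<otimes>\<^bsub>?A\<^esub> (u \<otimes>\<^bsub>?A\<^esub> X a) = u \<otimes>\<^bsub>?A\<^esub> X a" if "a \<in> S" "u \<in> carrier ?A" for a u
      unfolding \<epsilon>_sum by (rule \<epsilon>l[OF singular_support_mult(2)[OF Xs[OF that(1)] that(2)]])
  have h6: "\<exists>\<rho>\<in>mhom ?B M' M'. (\<forall>x\<in>carrier M'. \<rho> x \<in> N') \<and> (\<forall>x\<in>N'. \<rho> x = x)"
      if "left_module ?B M'" "submodule_of ?B M' N'" for M' :: "('f mat \<Rightarrow> 'k, 'a) module" and N'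
      by (rule Suc.IH[OF Gm that])
  obtain \<rho>1 where \<rho>1: "\<rho>1 \<in> mhom ?A M M" "\<And>x. x \<in> carrier M \<Longrightarrow> \<rho>1 x \<in> N"
    "\<And>x. x \<in> N \<Longrightarrow> \<rho>1 x = (\<Oplus>\<^bsub>?A\<^esub>a\<in>S. X a \<otimes>\<^bsub>?A\<^esub> Y a) \<odot>\<^bsub>M\<^esub> x"
    apply (rule morita_projection[where R = ?A and R' = ?B and M = M and N = N and J = ?J and S = S and X = X and Y = Y,
          OF Suc.prems(2,3) B.ring_axioms _ _ _ S(1)])
    subgoal by (rule Jc)
    subgoal by (rule h1)
    subgoal by (rule h2)
    subgoal by (rule XYc(1))
    subgoal by (rule XYc(2))
    subgoal by (rule h3)
    subgoal by (rule YaX)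
    subgoal by (rule h4)
    subgoal by (rule h5)
    subgoal by (rule h6)
    subgoal premises p for \<rho> by (rule p(1)[of \<rho>, OF p(2-4)])
    done
  show ?case
  proof (rule singular_splitting_extends[OF Suc.prems k(1-3) _ _ \<rho>1(1)])
  qed (rule k(4,5) \<rho>1(2) \<rho>1(3)[unfolded \<epsilon>_sum]; assumption)+
qed

section \<open>Ext over the affine monoid\<close>

text \<open>Otherwise the characteristic divides the prime p without being p, so it would be 1,
  which is impossible in a field.\<close>

lemma of_nat_prime_neq_zero:
  assumes "prime p" "CHAR('k::field) \<noteq> p"
  shows "of_nat p \<noteq> (0 :: 'k)"
proof
  assume "of_nat p = (0 :: 'k)"
  then have "CHAR('k) dvd p" by (simp add: of_nat_eq_0_iff_char_dvd)
  then have "CHAR('k) = 1" using assms prime_nat_iff by blast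
  then show False by (simp add: CHAR_not_1)
qed

theorem corollary5p10:
  fixes V :: "('f::{field,finite} mat \<Rightarrow> 'k::field, 'v) module"
    and W :: "('f mat \<Rightarrow> 'k, 'w) module"
    and n p m :: nat
  assumes "prime p" and "m \<ge> 1" and "CARD('f) = p ^ m"
    and "CHAR('k) \<noteq> p"
    and "left_module (monoid_algebra (matrix_monoid n)) V"
    and "left_module (monoid_algebra (matrix_monoid n)) W"
  shows "(\<forall>i. module_isomorphic class_ring
            (Ext_monoid (affine_monoid n) i
              (inflate (linear_part n) V) (inflate (linear_part n) W))
            (Ext_monoid (matrix_monoid n) i V W)) \<and>
         (\<not> CHAR('k) dvd card (GL n :: 'f mat set) \<longrightarrow>
           (\<forall>i\<ge>1. carrier (Ext_monoid (affine_monoid n) i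
              (inflate (linear_part n) V) (inflate (linear_part n) W)) =
            {\<zero>\<^bsub>Ext_monoid (affine_monoid n) i
              (inflate (linear_part n) V) (inflate (linear_part n) W)\<^esub>}))"
proof -
  let ?A = "monoid_algebra (affine_monoid n) :: (('f vec \<Rightarrow> 'f vec) \<Rightarrow> 'k) ring"
  let ?B = "monoid_algebra (matrix_monoid n) :: ('f mat \<Rightarrow> 'k) ring"
  let ?V = "inflate (linear_part n) V" and ?W = "inflate (linear_part n) W"
  let ?E = "\<lambda>i. Ext_monoid (affine_monoid n) i ?V ?W"
  have q: "of_nat CARD('f) \<noteq> (0 :: 'k)"
    using of_nat_prime_neq_zero[OF assms(1,4)] by (simp add: assms(3))
  interpret ring_retract ?A ?B "monoid_algebra_map (linear_part n)"
    "monoid_algebra_map (\<lambda>A. affine_transformation n A (0\<^sub>v n))"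
    "msum (translation_set n) (1 / of_nat (CARD('f) ^ n))"
    by (rule affine_retract[OF q])
  have \<iota>: "central_embedding ?A (scalar_embedding (affine_monoid n))"
    by (rule central_embedding_scalar_embedding[OF affine_monoid])
  have \<iota>': "central_embedding ?B (scalar_embedding (matrix_monoid n))"
    by (rule central_embedding_scalar_embedding[OF matrix_monoid])
  have "linear_part n \<one>\<^bsub>affine_monoid n\<^esub> = \<one>\<^bsub>matrix_monoid n :: 'f mat ring\<^esub>"
    by (simp add: linear_part_hom ring_mat_simps)
  then have \<pi>\<iota>: "monoid_algebra_map (linear_part n) (scalar_embedding (affine_monoid n) c)
      = (scalar_embedding (matrix_monoid n) c :: 'f mat \<Rightarrow> 'k)" for c
    by (simp add: monoid_algebra_ops(4) monoid_algebra_map_single)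
  have iso: "module_isomorphic class_ring (?E i) (Ext_monoid (matrix_monoid n) i V W)" for i
    by (rule Ext_restrict_scalars[OF \<iota> \<iota>' \<pi>\<iota> assms(5,6)])
  have "carrier (?E i) = {\<zero>\<^bsub>?E i\<^esub>}" if G: "\<not> CHAR('k) dvd card (GL n :: 'f mat set)" and i: "i \<ge> 1" for i
  proof -
    obtain j where j: "i = Suc j" using i by (cases i) auto
    have "of_nat (card (GL n :: 'f mat set)) \<noteq> (0 :: 'k)" using G by (simp add: of_nat_eq_0_iff_char_dvd)
    note split = matrix_algebra_split[OF q this]
    obtain P d where Q: "chosen_resolution ?B V = (P, d)" by (cases "chosen_resolution ?B V")
    then obtain \<epsilon> where P: "projective_resolution ?B V P d \<epsilon>" using chosen_resolution[OF assms(5) Q] by blast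
    \<comment> \<open>Degrees from 1 on have the form \<open>Suc j\<close>, where splitting makes
      every cocycle a coboundary over the matrix algebra; the isomorphism then carries the vanishing
      over.\<close>
    have E: "carrier (Ext_monoid (matrix_monoid n) i V W) = {\<zero>\<^bsub>Ext_monoid (matrix_monoid n) i V W\<^esub>}"
      unfolding Ext_def Q j prod.case by (rule hom_cohomology_split[OF \<iota>' assms(6) P split])
    obtain P' d' where Q': "chosen_resolution ?A ?V = (P', d')" by (cases "chosen_resolution ?A ?V")
    have V': "left_module ?A ?V" and W': "left_module ?A ?W"
      by (rule restrict_scalars_left_module[OF assms(5)], rule restrict_scalars_left_module[OF assms(6)])
    obtain \<epsilon>' where P': "projective_resolution ?A ?V P' d' \<epsilon>'" using chosen_resolution[OF V' Q'] by blast
    \<comment> \<open>A bijection with a singleton shows only that there is one element; that this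
      element is the zero needs the zero to lie in the carrier.\<close>
    have zero: "\<zero>\<^bsub>?E i\<^esub> \<in> carrier (?E i)"
      unfolding Ext_def Q' prod.case by (rule hom_cohomology_zero[OF \<iota> projective_resolution_complex[OF P'] W'])
    obtain h where "bij_betw h (carrier (?E i)) (carrier (Ext_monoid (matrix_monoid n) i V W))"
      using iso[of i] unfolding module_isomorphic_def by (rule bexE)
    then have "card (carrier (?E i)) = 1" unfolding E by (simp add: bij_betw_same_card)
    with zero show ?thesis by (metis card_1_singletonE singletonD)
  qed
  with iso show ?thesis by blast
qed

end
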